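(* Let $\nu>0$, $f\in L^{2^\#}(\Omega)$, $\varphi\in L^\infty_\nu(\mathbb{R}^N)$ and $$G[u](x)=\varphi(x)\Gamma(u),\qquad x\in\mathbb{R}^N,$$ where $\Gamma:H^\sigma_0(\Omega)\to\mathbb{R}^+$ is a functional satisfying (i) $0<\eta(R)\le\Gamma(u)\le E(R)$ for all $u\in B_R$, (ii) $|\Gamma(u_1)-\Gamma(u_2)|\le\gamma(R)\|u_1-u_2\|_{H^\sigma_0(\Omega)}$ for all $u_1,u_2\in B_R$, for sufficiently large $R\in\mathbb{R}^+$, with $\eta$, $E$ and $\gamma$ being monotone increasing positive functions of $R$. Then the quasi-variational inequality $$u\in\mathbb{K}^\sigma_{G[u]}:\qquad\int_{\mathbb{R}^N}AD^\sigma u\cdot D^\sigma(v-u)\,dx\ge\int_\Omega f(v-u)\,dx\qquad\text{for all }v\in\mathbb{K}^\sigma_{G[u]}$$ has a unique solution, provided $$2C_\#\,\frac{\gamma(R_f)}{\eta(R_f)}\,\|f\|_{L^{2^\#}(\Omega)}<1,$$ where $R_f=C_\#\|f\|_{L^{2^\#}(\Omega)}$, $C_\#=C_*/a_*$ and $C_*$ is the constant of the Sobolev embedding $H^\sigma_0(\Omega)\hookrightarrow L^{2^*}(\Omega)$.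
   Context: Let $0<\sigma<1$ and let $\Omega\subset\mathbb{R}^N$ be a bounded domain with Lipschitz boundary. Functions on $\Omega$ are extended by zero outside $\Omega$, with the same notation. The $\sigma$-gradient (distributional Riesz fractional gradient) of $u\in L^p(\mathbb{R}^N)$, $1<p<\infty$, is $D^\sigma u=D(I_{1-\sigma}u)$, i.e. $(D^\sigma u)_j=\frac{\partial}{\partial x_j}I_{1-\sigma}u$ in the sense of distributions, where for $0<\alpha<1$, $I_\alpha u(x)=\gamma_{N,\alpha}\int_{\mathbb{R}^N}\frac{u(y)}{|x-y|^{N-\alpha}}dy$ and $\gamma_{N,\alpha}=\frac{\Gamma(\frac{N-\alpha}{2})}{\pi^{N/2}2^\alpha\Gamma(\frac\alpha2)}$ (here $\Gamma(\cdot)$ is the Euler Gamma function, unrelated to the functional $\Gamma$ of the claim). $H^\sigma_0(\Omega)$ is the closure of $C^\infty_0(\Omega)$ in $H^\sigma(\mathbb{R}^N)$, with the (equivalent) norm $\|u\|_{H^\sigma_0(\Omega)}=\|D^\sigma u\|_{L^2(\mathbb{R}^N)^N}$. For $R>0$, $B_R=\{v\in H^\sigma_0(\Omega):\|v\|_{H^\sigma_0(\Omega)}\le R\}$. For $\nu>0$, $L^\infty_\nu(\mathbb{R}^N)=\{v\in L^\infty(\mathbb{R}^N):v(x)\ge\nu\text{ for a.e. }x\in\mathbb{R}^N\}$, and $\mathbb{K}^\sigma_{G[u]}=\{v\in H^\sigma_0(\Omega):|D^\sigma v|\le G[u]\text{ a.e. in }\mathbb{R}^N\}$. The matrix $A:\mathbb{R}^N\to\mathbb{R}^{N\times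 N}$ is bounded and measurable, not necessarily symmetric, and for some $a_*,a^*>0$, for a.e. $x\in\mathbb{R}^N$ and all $\xi,\eta\in\mathbb{R}^N$: $a_*|\xi|^2\le A(x)\xi\cdot\xi$ and $A(x)\xi\cdot\eta\le a^*|\xi||\eta|$. $2^*=\frac{2N}{N-2\sigma}$ and $2^\#=\frac{2N}{N+2\sigma}$ when $\sigma<\frac N2$; if $N=1$ and $\sigma=\frac12$, $2^*=q$ and $2^\#=q'=\frac q{q-1}$ for an arbitrary fixed $q\in(1,\infty)$; if $N=1$ and $\sigma>\frac12$, $2^*=\infty$ and $2^\#=1$. $C_*$ is such that $\|v\|_{L^{2^*}(\Omega)}\le C_*\|v\|_{H^\sigma_0(\Omega)}$ for all $v\in H^\sigma_0(\Omega)$.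
   Formalization: "For sufficiently large R" is made precise: (i) and (ii) are required for all R ≥ R₀ with R₀ ≤ R_f whenever R_f > 0, since otherwise γ(R_f) and η(R_f) would say nothing about Γ and uniqueness can fail. *)

theory Defs
  imports "HOL-Analysis.Analysis" "HOL-Probability.Essential_Supremum"
begin

text \<open>Elements of function spaces are represented by functions, not by equivalence classes;
  equality in a space of measurable functions is therefore equality almost everywhere.\<close>

section \<open>Lebesgue spaces\<close>

definition Lp :: "ereal \<Rightarrow> 'a measure \<Rightarrow> ('a \<Rightarrow> real) set" where
  "Lp p M = {u \<in> borel_measurable M.
     if p = \<infinity> then \<exists>C. AE x in M. \<bar>u x\<bar> \<le> C
     else integrable M (\<lambda>x. \<bar>u x\<bar> powr real_of_ereal p)}"

text \<open>Only meaningful on \<^term>\<open>Lp p M\<close>.\<close>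

definition Lp_norm :: "ereal \<Rightarrow> 'a measure \<Rightarrow> ('a \<Rightarrow> real) \<Rightarrow> real" where
  "Lp_norm p M u =
     (if p = \<infinity> then real_of_ereal (esssup M (\<lambda>x. ereal \<bar>u x\<bar>))
      else (LINT x|M. \<bar>u x\<bar> powr real_of_ereal p) powr (1 / real_of_ereal p))"

definition Linf_ge :: "real \<Rightarrow> (real^'n \<Rightarrow> real) set" where
  "Linf_ge \<nu> = {v \<in> Lp \<infinity> lebesgue. AE x in lebesgue. \<nu> \<le> v x}"

section \<open>Domains and test functions\<close>

text \<open>Near each boundary point, \<open>\<Omega>\<close> is, in suitable orthonormal coordinates with last axis \<open>e\<close>,
  the strict epigraph of a Lipschitz function \<open>\<zeta>\<close> of the other coordinates, that is,
  of the component orthogonal to \<open>e\<close>.\<close>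

definition lipschitz_boundary :: "(real^'n) set \<Rightarrow> bool" where
  "lipschitz_boundary \<Omega> \<longleftrightarrow>
     (\<forall>p\<in>frontier \<Omega>. \<exists>r>0. \<exists>e L \<zeta>. norm e = 1 \<and> L-lipschitz_on {y. y \<bullet> e = 0} \<zeta> \<and>
        \<Omega> \<inter> ball p r = {x \<in> ball p r. \<zeta> (x - (x \<bullet> e) *\<^sub>R e) < x \<bullet> e})"

definition partial_deriv :: "'n \<Rightarrow> (real^'n \<Rightarrow> real) \<Rightarrow> real^'n \<Rightarrow> real" where
  "partial_deriv j \<phi> x = frechet_derivative \<phi> (at x) (axis j 1)"

fun Ck :: "nat \<Rightarrow> (real^'n \<Rightarrow> real) \<Rightarrow> bool" where
  "Ck 0 \<phi> \<longleftrightarrow> continuous_on UNIV \<phi>"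
| "Ck (Suc k) \<phi> \<longleftrightarrow> \<phi> differentiable_on UNIV \<and> (\<forall>j. Ck k (partial_deriv j \<phi>))"

definition test_fun :: "(real^'n) set \<Rightarrow> (real^'n \<Rightarrow> real) set" where
  "test_fun \<Omega> = {\<phi>. (\<forall>k. Ck k \<phi>) \<and> compact (closure {x. \<phi> x \<noteq> 0}) \<and> closure {x. \<phi> x \<noteq> 0} \<subseteq> \<Omega>}"

section \<open>The distributional Riesz fractional gradient\<close>

definition riesz_const :: "nat \<Rightarrow> real \<Rightarrow> real" where
  "riesz_const N \<alpha> =
     Gamma ((real N - \<alpha>) / 2) / (pi powr (real N / 2) * 2 powr \<alpha> * Gamma (\<alpha> / 2))"

definition riesz_potential :: "real \<Rightarrow> (real^'n \<Rightarrow> real) \<Rightarrow> real^'n \<Rightarrow> real" where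
  "riesz_potential \<alpha> u x =
     riesz_const CARD('n) \<alpha> * (LINT y|lebesgue. u y / norm (x - y) powr (real CARD('n) - \<alpha>))"

definition locally_integrable :: "(real^'n \<Rightarrow> 'b::{banach, second_countable_topology}) \<Rightarrow> bool" where
  "locally_integrable w \<longleftrightarrow> (\<forall>K. compact K \<longrightarrow> set_integrable lebesgue K w)"

definition has_distr_gradient :: "(real^'n \<Rightarrow> real) \<Rightarrow> (real^'n \<Rightarrow> real^'n) \<Rightarrow> bool" where
  "has_distr_gradient w g \<longleftrightarrow> locally_integrable w \<and> locally_integrable g \<and>
     (\<forall>\<phi>\<in>test_fun UNIV. \<forall>j.
        (LINT x|lebesgue. w x * partial_deriv j \<phi> x) = - (LINT x|lebesgue. g x $ j * \<phi> x))"

text \<open>A representative of the distributional gradient of the Riesz potential, which is determined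
  up to a null set whenever that distribution is a locally integrable function.\<close>

definition frac_grad :: "real \<Rightarrow> (real^'n \<Rightarrow> real) \<Rightarrow> real^'n \<Rightarrow> real^'n" where
  "frac_grad \<sigma> u = (SOME g. has_distr_gradient (riesz_potential (1 - \<sigma>) u) g)"

section \<open>Fractional Sobolev spaces\<close>

definition gagliardo :: "real \<Rightarrow> (real^'n \<Rightarrow> real) \<Rightarrow> ennreal" where
  "gagliardo \<sigma> u = (\<integral>\<^sup>+x. \<integral>\<^sup>+y.
     ennreal ((u x - u y)\<^sup>2 / norm (x - y) powr (real CARD('n) + 2 * \<sigma>)) \<partial>lebesgue \<partial>lebesgue)"

definition Hs :: "real \<Rightarrow> (real^'n \<Rightarrow> real) set" where
  "Hs \<sigma> = {u \<in> Lp 2 lebesgue. gagliardo \<sigma> u < \<infinity>}"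

definition Hs_norm :: "real \<Rightarrow> (real^'n \<Rightarrow> real) \<Rightarrow> real" where
  "Hs_norm \<sigma> u = sqrt ((Lp_norm 2 lebesgue u)\<^sup>2 + enn2real (gagliardo \<sigma> u))"

definition Hs0 :: "real \<Rightarrow> (real^'n) set \<Rightarrow> (real^'n \<Rightarrow> real) set" where
  "Hs0 \<sigma> \<Omega> = {u \<in> Hs \<sigma>. \<forall>\<epsilon>>0. \<exists>\<phi>\<in>test_fun \<Omega>. Hs_norm \<sigma> (\<lambda>x. u x - \<phi> x) < \<epsilon>}"

definition Hs0_norm :: "real \<Rightarrow> (real^'n \<Rightarrow> real) \<Rightarrow> real" where
  "Hs0_norm \<sigma> u = Lp_norm 2 lebesgue (\<lambda>x. norm (frac_grad \<sigma> u x))"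

definition Hs0_ball :: "real \<Rightarrow> (real^'n) set \<Rightarrow> real \<Rightarrow> (real^'n \<Rightarrow> real) set" where
  "Hs0_ball \<sigma> \<Omega> R = {v \<in> Hs0 \<sigma> \<Omega>. Hs0_norm \<sigma> v \<le> R}"

text \<open>The exponents \<open>2\<^sup>*\<close> and \<open>2\<^sup>#\<close> in dimension \<open>N\<close>. For \<open>0 < \<sigma> < 1\<close> the case \<open>\<sigma> = N / 2\<close> is
  \<open>N = 1\<close>, \<open>\<sigma> = 1/2\<close>, and \<open>\<sigma> > N / 2\<close> occurs only for \<open>N = 1\<close>; the parameter \<open>q\<close> matters only in
  the former.\<close>

definition two_star :: "nat \<Rightarrow> real \<Rightarrow> real \<Rightarrow> ereal" where
  "two_star N \<sigma> q =
     (if \<sigma> < real N / 2 then ereal (2 * real N / (real N - 2 * \<sigma>))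
      else if \<sigma> = real N / 2 then ereal q else \<infinity>)"

definition two_sharp :: "nat \<Rightarrow> real \<Rightarrow> real \<Rightarrow> ereal" where
  "two_sharp N \<sigma> q =
     (if \<sigma> < real N / 2 then ereal (2 * real N / (real N + 2 * \<sigma>))
      else if \<sigma> = real N / 2 then ereal (q / (q - 1)) else 1)"

definition sobolev_const :: "real \<Rightarrow> real \<Rightarrow> (real^'n) set \<Rightarrow> real \<Rightarrow> bool" where
  "sobolev_const \<sigma> q \<Omega> C \<longleftrightarrow>
     (\<forall>v\<in>Hs0 \<sigma> \<Omega>. v \<in> Lp (two_star CARD('n) \<sigma> q) (lebesgue_on \<Omega>) \<and>
        Lp_norm (two_star CARD('n) \<sigma> q) (lebesgue_on \<Omega>) v \<le> C * Hs0_norm \<sigma> v)"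

section \<open>The quasi-variational inequality\<close>

definition elliptic_matrix :: "real \<Rightarrow> real \<Rightarrow> (real^'n \<Rightarrow> real^'n^'n) \<Rightarrow> bool" where
  "elliptic_matrix a b A \<longleftrightarrow> A \<in> borel_measurable lebesgue \<and>
     (\<exists>C. AE x in lebesgue. norm (A x) \<le> C) \<and>
     (AE x in lebesgue. \<forall>\<xi> \<zeta>. a * (norm \<xi>)\<^sup>2 \<le> (A x *v \<xi>) \<bullet> \<xi> \<and>
                               (A x *v \<xi>) \<bullet> \<zeta> \<le> b * norm \<xi> * norm \<zeta>)"

definition constraint_set :: "real \<Rightarrow> (real^'n) set \<Rightarrow> (real^'n \<Rightarrow> real) \<Rightarrow> (real^'n \<Rightarrow> real) set" where
  "constraint_set \<sigma> \<Omega> g = {v \<in> Hs0 \<sigma> \<Omega>. AE x in lebesgue. norm (frac_grad \<sigma> v x) \<le> g x}"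

definition qvi_solution :: "real \<Rightarrow> (real^'n) set \<Rightarrow> (real^'n \<Rightarrow> real^'n^'n) \<Rightarrow> (real^'n \<Rightarrow> real) \<Rightarrow>
    ((real^'n \<Rightarrow> real) \<Rightarrow> real^'n \<Rightarrow> real) \<Rightarrow> (real^'n \<Rightarrow> real) \<Rightarrow> bool" where
  "qvi_solution \<sigma> \<Omega> A f G u \<longleftrightarrow> u \<in> constraint_set \<sigma> \<Omega> (G u) \<and>
     (\<forall>v\<in>constraint_set \<sigma> \<Omega> (G u).
        (LINT x|lebesgue. (A x *v frac_grad \<sigma> u x) \<bullet> frac_grad \<sigma> (\<lambda>y. v y - u y) x)
          \<ge> (LINT x|lebesgue_on \<Omega>. f x * (v x - u x)))"

end

theory Submission
  imports Defs "HOL-Probability.Probability" "HOL-Real_Asymp.Real_Asymp"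
begin


text \<open>
  Write \<open>X = H\<^sup>\<sigma>\<^sub>0(\<Omega>)\<close>. The map \<open>u \<mapsto> D\<^sup>\<sigma> u\<close> identifies \<open>X\<close>, modulo equality almost everywhere,
  with a closed subspace of \<open>L\<^sup>2(\<real>\<^sup>N)\<^sup>N\<close>, and under this identification the quasi-variational
  inequality becomes a statement about an abstract Hilbert space: \<open>K\<close> is a closed convex set that
  contains 0, \<open>T\<close> is a bounded coercive operator, \<open>L\<close> is a bounded linear functional, and one looks
  for \<open>u\<close> that solves the variational inequality of \<open>T\<close> and \<open>L\<close> on the dilate \<open>\<Gamma>(u) K\<close>.

  The abstract statement is a contraction argument on the real line. For each \<open>s > 0\<close> the
  variational inequality on \<open>s K\<close> has exactly one solution \<open>u\<^sub>s\<close> (Lions and Stampacchia), and testing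
  it with 0 gives \<open>\<parallel>u\<^sub>s\<parallel> \<le> R\<^sub>f\<close>. If \<open>s \<le> t\<close> then \<open>(t/s) u\<^sub>s\<close> is admissible for \<open>t\<close> and solves the
  inequality there with load \<open>(t/s) L\<close>; comparing it with \<open>u\<^sub>t\<close> by coercivity yields
  \<open>\<parallel>u\<^sub>s - u\<^sub>t\<parallel> \<le> 2 R\<^sub>f (t - s) / s\<close>. Hence \<open>s \<mapsto> \<Gamma>(u\<^sub>s)\<close> maps \<open>[\<eta>(R\<^sub>f), E(R\<^sub>f)]\<close> into itself and is
  Lipschitz there with constant \<open>2 R\<^sub>f \<gamma>(R\<^sub>f) / \<eta>(R\<^sub>f) < 1\<close>. Its fixed points correspond exactly to the
  solutions of the quasi-variational inequality. This is \<open>unique_quasi_solution\<close>.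

  The work lies in the identification. The space is defined by the Gagliardo seminorm, while the
  inequality involves the distributional gradient of a Riesz potential, so one needs: every function
  of \<open>X\<close> has a square integrable fractional gradient, whose norm is equivalent to the Gagliardo
  seminorm, and the gradients form a closed set. Equivalence for smooth functions
  (\<open>energy_identity\<close>) is proved without the Fourier transform, by writing both sides as integrals
  over the heat semigroup. With \<open>p\<^sub>t\<close> the Gaussian density of covariance \<open>t I\<close>, the kernels
  \<open>|z| powr (1 - \<sigma> - N)\<close> and \<open>|z| powr (- 2 \<sigma> - N)\<close> are, up to constants, the integrals of
  \<open>t powr (a - 1) p\<^sub>t(z)\<close> over \<open>t > 0\<close> with \<open>a = (1 - \<sigma>) / 2\<close> and \<open>a = - \<sigma>\<close> respectively. Because
  \<open>p\<^sub>s\<close> and \<open>p\<^sub>t\<close> convolve to \<open>p\<^sub>s\<^sub>+\<^sub>t\<close> and \<open>p\<close> solves the heat equation, both energies reduce to multiples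
  of the integral of \<open>r powr (- \<sigma>)\<close> against the Dirichlet energy at time \<open>r\<close>, the inner product of
  the gradient of the function with its evolution by the heat semigroup.
  The general case follows by density. The gradient of \<open>u \<in> X\<close> is obtained as
  an \<open>L\<^sup>2\<close> limit of gradients of test functions, and it satisfies the distributional identity because
  the derivative and the Riesz kernel can be moved onto the test function (\<open>weak_frac_grad\<close>). A
  Poincare inequality for the Gagliardo seminorm shows that the gradient determines the function, and
  with Fatou's lemma it gives completeness.
\<close>


section \<open>Gaussian densities and powers of the distance\<close>

text \<open>A product of one-dimensional densities, so that integrals over the whole space reduce to the known
  one-dimensional ones. The parameter is the variance.\<close>

definition gauss :: "real \<Rightarrow> 'a::euclidean_space \<Rightarrow> real" where
  "gauss t z = (\<Prod>b\<in>Basis. normal_density 0 (sqrt t) (z \<bullet> b))"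

lemma gauss_nonneg [simp]: "0 \<le> gauss t z"
  unfolding gauss_def by (intro prod_nonneg) auto

lemma gauss_eq:
  fixes z :: "'a::euclidean_space"
  assumes "0 < t"
  shows "gauss t z = (2 * pi * t) powr (- real DIM('a) / 2) * exp (- (norm z)\<^sup>2 / (2 * t))"
proof -
  have "gauss t z = (\<Prod>b\<in>(Basis::'a set). 1 / sqrt (2 * pi * t)) *
      (\<Prod>b\<in>Basis. exp (- (z \<bullet> b)\<^sup>2 / (2 * t)))"
    unfolding gauss_def normal_density_def using assms by (subst prod.distrib[symmetric]) simp
  also have "(\<Prod>b\<in>Basis. exp (- (z \<bullet> b)\<^sup>2 / (2 * t))) = exp (- (norm z)\<^sup>2 / (2 * t))"
  proof -
    have "(norm z)\<^sup>2 = (\<Sum>b\<in>Basis. (z \<bullet> b)\<^sup>2)"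
      unfolding power2_norm_eq_inner by (subst euclidean_inner) (simp add: power2_eq_square)
    then show ?thesis
      by (simp add: exp_sum[symmetric] sum_divide_distrib[symmetric] sum_negf)
  qed
  also have "(\<Prod>b\<in>(Basis::'a set). 1 / sqrt (2 * pi * t)) = (2 * pi * t) powr (- real DIM('a) / 2)"
  proof -
    have "1 / sqrt (2 * pi * t) = (2 * pi * t) powr (- 1 / 2)"
      using assms by (simp add: powr_minus_divide powr_half_sqrt)
    then have "(\<Prod>b\<in>(Basis::'a set). 1 / sqrt (2 * pi * t)) = ((2 * pi * t) powr (- 1 / 2)) powr DIM('a)"
      using assms by (simp add: powr_realpow)
    also have "\<dots> = (2 * pi * t) powr (- real DIM('a) / 2)"
      by (simp add: powr_powr)
    finally show ?thesis .
  qed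
  finally show ?thesis .
qed

lemma gauss_measurable [measurable]:
  assumes [measurable]: "f \<in> borel_measurable M" "g \<in> borel_measurable M"
  shows "(\<lambda>x. gauss (f x) (g x)) \<in> borel_measurable M"
  unfolding gauss_def normal_density_def by measurable

lemma gauss_minus: "gauss t (- z) = gauss t z"
  unfolding gauss_def normal_density_def by simp

lemma gauss_commute: "gauss t (x - y) = gauss t (y - x)"
  using gauss_minus[of t "x - y"] by simp

lemma gauss_le:
  fixes z :: "'a::euclidean_space"
  assumes "0 < t" shows "gauss t z \<le> (2 * pi * t) powr (- real DIM('a) / 2)"
  unfolding gauss_eq[OF assms]
  using assms by (intro mult_left_le) auto

lemma nn_integral_gauss:
  assumes "0 < t" shows "(\<integral>\<^sup>+z. ennreal (gauss t (z::'a::euclidean_space)) \<partial>lborel) = 1"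
proof -
  have 1: "(\<integral>\<^sup>+x. ennreal (normal_density 0 (sqrt t) x) \<partial>lborel) = 1"
    using assms by (subst nn_integral_eq_integral) (auto simp: integrable_normal_density integral_normal_density)
  have "(\<integral>\<^sup>+z. ennreal (gauss t (z::'a)) \<partial>lborel)
      = (\<integral>\<^sup>+z. (\<Prod>b\<in>Basis. ennreal (normal_density 0 (sqrt t) ((z::'a) \<bullet> b))) \<partial>lborel)"
    unfolding gauss_def by (subst prod_ennreal) auto
  also have "\<dots> = (\<Prod>b\<in>(Basis::'a set). (\<integral>\<^sup>+x. ennreal (normal_density 0 (sqrt t) x) \<partial>lborel))"
    by (rule nn_integral_lborel_prod) auto
  finally show ?thesis by (simp add: 1)
qed

lemma nn_integral_gauss_shift:
  assumes "0 < t" shows "(\<integral>\<^sup>+z. ennreal (gauss t (z - (y::'a::euclidean_space))) \<partial>lborel) = 1"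
    "(\<integral>\<^sup>+z. ennreal (gauss t (y - (z::'a::euclidean_space))) \<partial>lborel) = 1"
proof -
  have "(\<integral>\<^sup>+z. ennreal (gauss t (z - y)) \<partial>lborel) = (\<integral>\<^sup>+z. ennreal (gauss t z) \<partial>distr lborel borel ((+) (-y)))"
    by (subst nn_integral_distr) (auto simp: algebra_simps)
  then show *: "(\<integral>\<^sup>+z. ennreal (gauss t (z - y)) \<partial>lborel) = 1"
    by (simp add: lborel_distr_plus nn_integral_gauss[OF assms])
  show "(\<integral>\<^sup>+z. ennreal (gauss t (y - z)) \<partial>lborel) = 1"
    by (subst gauss_commute) (rule *)
qed

text \<open>Sums of independent Gaussians are Gaussian with added variances; in each coordinate this is the
  known convolution of normal densities.\<close>

lemma nn_integral_gauss_conv: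
  fixes x :: "'a::euclidean_space"
  assumes "0 < s" "0 < t"
  shows "(\<integral>\<^sup>+y. ennreal (gauss s (x - y) * gauss t y) \<partial>lborel) = ennreal (gauss (s + t) x)"
proof -
  have 1: "(\<integral>\<^sup>+y. ennreal (normal_density 0 (sqrt s) (c - y) * normal_density 0 (sqrt t) y) \<partial>lborel)
     = ennreal (normal_density 0 (sqrt (s + t)) c)" for c
    using fun_cong[OF conv_normal_density_zero_mean[of "sqrt s" "sqrt t"], of c] assms by simp
  have "(\<integral>\<^sup>+y. ennreal (gauss s (x - y) * gauss t y) \<partial>lborel)
      = (\<integral>\<^sup>+y. (\<Prod>b\<in>Basis. (\<lambda>v. ennreal (normal_density 0 (sqrt s) (x \<bullet> b - v) * normal_density 0 (sqrt t) v)) (y \<bullet> b)) \<partial>lborel)"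
    unfolding gauss_def
    by (subst prod_ennreal) (auto simp: prod.distrib inner_diff_left)
  also have "\<dots> = (\<Prod>b\<in>(Basis::'a set). (\<integral>\<^sup>+v. ennreal (normal_density 0 (sqrt s) (x \<bullet> b - v) * normal_density 0 (sqrt t) v) \<partial>lborel))"
    by (rule nn_integral_lborel_prod) auto
  also have "\<dots> = ennreal (gauss (s + t) x)"
    unfolding gauss_def by (simp add: 1 prod_ennreal)
  finally show ?thesis .
qed

lemma powr_le_exp:
  assumes "0 < m" "0 < x"
  shows "x powr m \<le> m powr m * exp (x::real)"
proof -
  have "ln (x / m) \<le> x / m - 1" using assms by (intro ln_le_minus_one) auto
  then have "m * (ln x - ln m) \<le> x - m" using assms by (simp add: ln_div field_simps)
  then have "m * ln x \<le> m * ln m + x" using assms by (simp add: algebra_simps)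
  then have "exp (m * ln x) \<le> exp (m * ln m + x)" by simp
  then show ?thesis using assms by (simp add: powr_def exp_add mult.commute)
qed


lemma nn_integral_powr_from_1:
  assumes "p < - 1"
  shows "(\<integral>\<^sup>+t. ennreal (t powr p) * indicator {1::real..} t \<partial>lborel) = ennreal (- 1 / (p + 1))"
  using nn_integral_has_integral_lebesgue'[OF _ has_integral_powr_to_inf[of p 1]] assms by simp

lemma nn_integral_powr_to:
  assumes "- 1 < p" "0 \<le> c"
  shows "(\<integral>\<^sup>+t. ennreal (t powr p) * indicator {0..c::real} t \<partial>lborel) = ennreal (c powr (p + 1) / (p + 1))"
  using nn_integral_has_integral_lebesgue'[OF _ has_integral_powr_from_0[of p c]] assms by simp

text \<open>The integrand is \<open>t powr (\<beta> - 1)\<close> times the Gaussian density of variance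
  \<open>t\<close> in dimension \<open>n\<close>, at distance 1 from its centre. This constant is
  \<open>2 powr (- \<beta>) * pi powr (- n / 2) * Gamma (n / 2 - \<beta>)\<close>; only its
  positivity and finiteness matter below.\<close>

definition gauss_mix :: "nat \<Rightarrow> real \<Rightarrow> ennreal" where
  "gauss_mix n \<beta> = (\<integral>\<^sup>+t. ennreal (t powr (\<beta> - 1) *
      ((2 * pi * t) powr (- real n / 2) * exp (- 1 / (2 * t)))) * indicator {0<..} t \<partial>lborel)"

text \<open>Near 0 the exponential beats every power of \<open>t\<close>, and at infinity the exponent
  \<open>\<beta> - 1 - n / 2\<close> is below \<open>-1\<close>.\<close>

lemma gauss_mix_finite:
  assumes "\<beta> < real n / 2"
  shows "gauss_mix n \<beta> < \<infinity>"
proof -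
  \<comment> \<open>The powers of t combine to t powr (- m).\<close>
  define m where "m = real n / 2 - \<beta> + 1"
  have m: "0 < m" using assms by (simp add: m_def)
  define K where "K = (2 * pi) powr (- real n / 2) * (m powr m * 2 powr m + 1)"
  have K: "0 \<le> K" by (auto simp: K_def)
  have b: "t powr (\<beta> - 1) * ((2 * pi * t) powr (- real n / 2) * exp (- 1 / (2 * t)))
      \<le> K * (indicator {0..1} t + t powr (- m) * indicator {1..} t)" if t: "0 < t" for t :: real
  proof -
    have e: "t powr (\<beta> - 1) * (2 * pi * t) powr (- real n / 2) = (2 * pi) powr (- real n / 2) * t powr (- m)"
      using t by (simp add: m_def powr_mult powr_add[symmetric] algebra_simps)
    show ?thesis
    proof (cases "t \<le> 1")
      case True
      have "(1 / (2 * t)) powr m \<le> m powr m * exp (1 / (2 * t))"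
        using powr_le_exp[of m "1 / (2 * t)"] m t by simp
      then have "(1 / (2 * t)) powr m * exp (- (1 / (2 * t))) \<le> m powr m"
        by (simp add: exp_minus field_simps)
      moreover from t have "(1 / (2 * t)) powr m = t powr (- m) / 2 powr m"
        by (simp add: powr_divide powr_mult powr_minus field_simps)
      then have "t powr (- m) * exp (- (1 / (2 * t))) = 2 powr m * ((1 / (2 * t)) powr m * exp (- (1 / (2 * t))))"
        by simp
      ultimately have "t powr (- m) * exp (- (1 / (2 * t))) \<le> m powr m * 2 powr m"
        using mult_left_mono[of "(1 / (2 * t)) powr m * exp (- (1 / (2 * t)))" "m powr m" "2 powr m"] by (simp only: mult.commute powr_ge_zero)
      also have "\<dots> \<le> m powr m * 2 powr m + 1" by simp
      finally have "(2 * pi) powr (- real n / 2) * (t powr (- m) * exp (- (1 / (2 * t)))) \<le> K"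
        unfolding K_def by (intro mult_left_mono) auto
      also have "K \<le> K * (indicator {0..1} t + t powr (- m) * indicator {1..} t)"
        using True t K by (auto simp: indicator_def algebra_simps)
      finally show ?thesis using e by (simp add: mult.assoc[symmetric])
    next
      case False
      have "(2 * pi) powr (- real n / 2) * t powr (- m) * exp (- (1 / (2 * t)))
          \<le> (2 * pi) powr (- real n / 2) * t powr (- m)"
        using t by (intro mult_left_le) auto
      also have "\<dots> \<le> K * t powr (- m)"
        unfolding K_def by (intro mult_right_mono) (auto simp: algebra_simps)
      finally show ?thesis using False t e by (simp add: mult.assoc[symmetric])
    qed
  qed
  have "gauss_mix n \<beta> \<le> (\<integral>\<^sup>+t. ennreal K * (indicator {0..1} t + ennreal (t powr (- m)) * indicator {1..} t) \<partial>lborel)"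
    unfolding gauss_mix_def
  proof (intro nn_integral_mono)
    fix t :: real
    show "ennreal (t powr (\<beta> - 1) * ((2 * pi * t) powr (- real n / 2) * exp (- 1 / (2 * t)))) * indicator {0<..} t
        \<le> ennreal K * (indicator {0..1} t + ennreal (t powr (- m)) * indicator {1..} t)"
    proof (cases "0 < t")
      case True
      have "ennreal (K * (indicator {0..1} t + t powr (- m) * indicator {1..} t)) =
         ennreal K * (indicator {0..1} t + ennreal (t powr (- m)) * indicator {1..} t)"
        using K by (subst ennreal_mult) (auto simp: indicator_def)
      then show ?thesis using True ennreal_leI[OF b[OF True]] by simp
    qed auto
  qed
  also have "\<dots> = ennreal K * (1 + ennreal (- 1 / (- m + 1)))"
    using assms
    by (simp add: nn_integral_cmult nn_integral_add nn_integral_powr_from_1 m_def)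
  also have "\<dots> < \<infinity>" by (simp add: ennreal_mult_less_top)
  finally show ?thesis .
qed

lemma gauss_mix_pos: "0 < gauss_mix n \<beta>"
proof (rule ccontr)
  assume "\<not> ?thesis"
  then have "gauss_mix n \<beta> = 0" by (simp add: not_gr_zero)
  then have "AE t in lborel. ennreal (t powr (\<beta> - 1) *
      ((2 * pi * t) powr (- real n / 2) * exp (- 1 / (2 * t)))) * indicator {0<..} t = 0"
    unfolding gauss_mix_def by (subst (asm) nn_integral_0_iff_AE) auto
  then have "AE t::real in lborel. t \<notin> {0<..<1}"
    by eventually_elim (auto simp: indicator_def)
  then have "{0<..<1::real} \<in> null_sets lborel"
    by (subst AE_iff_null_sets) auto
  then show False by (simp add: null_sets_def)
qed

text \<open>Powers of the distance are superpositions of Gaussians: rescale time by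
  \<open>\<bar>z\<bar>\<^sup>2\<close>.\<close>

lemma nn_integral_gauss_mix:
  fixes z :: "'a::euclidean_space"
  assumes "z \<noteq> 0"
  shows "(\<integral>\<^sup>+t. ennreal (t powr (\<beta> - 1) * gauss t z) * indicator {0<..} t \<partial>lborel) =
     gauss_mix DIM('a) \<beta> * ennreal (norm z powr (2 * \<beta> - DIM('a)))"
proof -
  define c where "c = (norm z)\<^sup>2"
  have c: "0 < c" using assms by (simp add: c_def)
  have "(\<integral>\<^sup>+t. ennreal (t powr (\<beta> - 1) * gauss t z) * indicator {0<..} t \<partial>lborel)
      = (\<integral>\<^sup>+t. ennreal (t powr (\<beta> - 1) * ((2 * pi * t) powr (- real DIM('a) / 2) * exp (- c / (2 * t)))) * indicator {0<..} t \<partial>lborel)"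
    by (intro nn_integral_cong) (auto simp: indicator_def gauss_eq c_def)
  also have "\<dots> = ennreal c * (\<integral>\<^sup>+t. ennreal ((c * t) powr (\<beta> - 1) * ((2 * pi * (c * t)) powr (- real DIM('a) / 2) * exp (- c / (2 * (c * t))))) * indicator {0<..} (c * t) \<partial>lborel)"
    using c by (subst nn_integral_real_affine[where c=c and t=0]) auto
  also have "\<dots> = ennreal c * (\<integral>\<^sup>+t. ennreal (c powr (\<beta> - 1 - real DIM('a) / 2)) * (ennreal (t powr (\<beta> - 1) * ((2 * pi * t) powr (- real DIM('a) / 2) * exp (- 1 / (2 * t)))) * indicator {0<..} t) \<partial>lborel)"
  proof (rule arg_cong[where f="\<lambda>v. ennreal c * v"], rule nn_integral_cong)
    fix t :: real
    show "ennreal ((c * t) powr (\<beta> - 1) * ((2 * pi * (c * t)) powr (- real DIM('a) / 2) * exp (- c / (2 * (c * t))))) * indicator {0<..} (c * t)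
      = ennreal (c powr (\<beta> - 1 - real DIM('a) / 2)) * (ennreal (t powr (\<beta> - 1) * ((2 * pi * t) powr (- real DIM('a) / 2) * exp (- 1 / (2 * t)))) * indicator {0<..} t)"
    proof (cases "0 < t")
      case True
      have "c powr (\<beta> - 1 - real DIM('a) / 2) = c powr (\<beta> - 1) * c powr (- real DIM('a) / 2)"
        by (simp add: powr_add[symmetric])
      then show ?thesis using True c
        by (simp add: ennreal_mult[symmetric] powr_mult mult_ac)
    qed (use c in \<open>auto simp: indicator_def zero_less_mult_iff\<close>)
  qed
  also have "\<dots> = gauss_mix DIM('a) \<beta> * (ennreal c * ennreal (c powr (\<beta> - 1 - real DIM('a) / 2)))"
    unfolding gauss_mix_def by (subst nn_integral_cmult) (auto simp: mult_ac)
  also have "ennreal c * ennreal (c powr (\<beta> - 1 - real DIM('a) / 2)) = ennreal (norm z powr (2 * \<beta> - DIM('a)))"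
  proof -
    have "c * c powr (\<beta> - 1 - real DIM('a) / 2) = c powr (\<beta> - real DIM('a) / 2)"
      using c powr_add[of c 1 "\<beta> - 1 - real DIM('a) / 2"] by simp
    also have "\<dots> = (norm z powr 2) powr (\<beta> - real DIM('a) / 2)"
      using assms by (simp add: c_def)
    also have "\<dots> = norm z powr (2 * \<beta> - DIM('a))"
      unfolding powr_powr by (simp add: algebra_simps)
    finally show ?thesis using c by (simp add: ennreal_mult[symmetric])
  qed
  finally show ?thesis .
qed

section \<open>The heat semigroup\<close>

definition heat :: "('a::euclidean_space \<Rightarrow> real) \<Rightarrow> real \<Rightarrow> 'a \<Rightarrow> real" where
  "heat f t x = (\<integral>y. f y * gauss t (x - y) \<partial>lborel)"

lemma integrable_gauss [simp]:
  assumes "0 < t"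
  shows "integrable lborel (\<lambda>x. gauss t (x - (y::'a::euclidean_space)))" "integrable lborel (\<lambda>x. gauss t (y - (x::'a)))"
  using nn_integral_gauss_shift[OF assms, of y]
  by (auto intro!: integrableI_bounded simp: less_top[symmetric])

lemma integral_gauss [simp]:
  assumes "0 < t"
  shows "(\<integral>x. gauss t (x - (y::'a::euclidean_space)) \<partial>lborel) = 1" "(\<integral>x. gauss t (y - (x::'a)) \<partial>lborel) = 1"
  using nn_integral_gauss_shift[OF assms, of y]
  by (auto simp: integral_eq_nn_integral)

lemma heat_measurable [measurable]:
  fixes f :: "'a::euclidean_space \<Rightarrow> real"
  assumes [measurable]: "f \<in> borel_measurable borel" "a \<in> borel_measurable M" "b \<in> borel_measurable M"
  shows "(\<lambda>p. heat f (a p) (b p)) \<in> borel_measurable M"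
  unfolding heat_def by measurable

lemma abs_heat_le:
  assumes "0 < t" and [measurable]: "f \<in> borel_measurable borel" and b: "\<And>x. \<bar>f x\<bar> \<le> M"
  shows "\<bar>heat f t x\<bar> \<le> M"
proof -
  have M: "0 \<le> M" using b[of undefined] by linarith
  have "\<bar>heat f t x\<bar> \<le> (\<integral>y. \<bar>f y * gauss t (x - y)\<bar> \<partial>lborel)"
    unfolding heat_def by (rule integral_abs_bound)
  also have "\<dots> \<le> (\<integral>y. M * gauss t (x - y) \<partial>lborel)"
  proof (rule integral_mono_AE')
    show "integrable lborel (\<lambda>y. M * gauss t (x - y))"
      using assms(1) by (intro integrable_mult_right) auto
  qed (auto simp: abs_mult M intro!: mult_right_mono b)
  finally show ?thesis using assms(1) by simp
qed

lemma heat_Fubini: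
  fixes f g :: "'a::euclidean_space \<Rightarrow> real"
  assumes "0 < t" and f: "integrable lborel f"
    and [measurable]: "g \<in> borel_measurable borel" and b: "\<And>x. \<bar>g x\<bar> \<le> M"
  shows "integrable (lborel \<Otimes>\<^sub>M lborel) (\<lambda>(x, y). f x * gauss t (x - y) * g y)"
proof -
  have [measurable]: "f \<in> borel_measurable borel" using f by simp
  have M: "0 \<le> M" using b[of undefined] by linarith
  have "(\<integral>\<^sup>+p. ennreal (norm (case p of (x, y) \<Rightarrow> f x * gauss t (x - y) * g y)) \<partial>(lborel \<Otimes>\<^sub>M lborel))
     = (\<integral>\<^sup>+x. \<integral>\<^sup>+y. ennreal (norm (f x * gauss t (x - y) * g y)) \<partial>lborel \<partial>lborel)"
    by (subst lborel.nn_integral_fst[symmetric]) auto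
  also have "\<dots> \<le> (\<integral>\<^sup>+x. \<integral>\<^sup>+y. ennreal (M * \<bar>f x\<bar>) * ennreal (gauss t (x - y)) \<partial>lborel \<partial>lborel)"
  proof (intro nn_integral_mono)
    fix x y :: 'a
    have "norm (f x * gauss t (x - y) * g y) \<le> \<bar>f x\<bar> * gauss t (x - y) * M"
      unfolding real_norm_def abs_mult by (intro mult_mono b) (auto simp: M)
    then show "ennreal (norm (f x * gauss t (x - y) * g y)) \<le> ennreal (M * \<bar>f x\<bar>) * ennreal (gauss t (x - y))"
      using M by (simp add: ennreal_mult[symmetric] mult_ac ennreal_leI)
  qed
  also have "\<dots> = (\<integral>\<^sup>+x. ennreal (M * \<bar>f x\<bar>) \<partial>lborel)"
    using assms(1) by (simp add: nn_integral_cmult nn_integral_gauss_shift)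
  also have "\<dots> < \<infinity>"
    using integrable_mult_right[OF integrable_abs[OF f], of M] M
    by (subst nn_integral_eq_integral) auto
  finally show ?thesis by (intro integrableI_bounded) auto
qed

text \<open>The Gaussian kernel is symmetric in its two arguments.\<close>

lemma heat_symmetric:
  fixes f g :: "'a::euclidean_space \<Rightarrow> real"
  assumes "0 < t" and f: "integrable lborel f"
    and [measurable]: "g \<in> borel_measurable borel" and b: "\<And>x. \<bar>g x\<bar> \<le> M"
  shows "(\<integral>x. f x * heat g t x \<partial>lborel) = (\<integral>x. g x * heat f t x \<partial>lborel)"
proof -
  have "(\<integral>x. f x * heat g t x \<partial>lborel) = (\<integral>x. \<integral>y. f x * gauss t (x - y) * g y \<partial>lborel \<partial>lborel)"
    unfolding heat_def integral_mult_right_zero[symmetric] by (simp add: mult_ac)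
  also have "\<dots> = (\<integral>y. \<integral>x. f x * gauss t (x - y) * g y \<partial>lborel \<partial>lborel)"
    using lborel_pair.Fubini_integral[OF heat_Fubini[OF assms]] by simp
  also have "\<dots> = (\<integral>x. g x * heat f t x \<partial>lborel)"
    unfolding heat_def integral_mult_right_zero[symmetric] by (simp add: mult_ac gauss_commute)
  finally show ?thesis .
qed

lemma integrable_heat:
  fixes f g :: "'a::euclidean_space \<Rightarrow> real"
  assumes "0 < t" and f: "integrable lborel f"
    and g [measurable]: "g \<in> borel_measurable borel" and b: "\<And>x. \<bar>g x\<bar> \<le> M"
  shows "integrable lborel (\<lambda>x. g x * heat f t x)"
proof -
  have "integrable lborel (\<lambda>y. \<integral>x. f x * gauss t (x - y) * g y \<partial>lborel)"
    using lborel_pair.integrable_snd[OF heat_Fubini[OF assms]] by simp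
  then show ?thesis
    unfolding heat_def integral_mult_right_zero[symmetric] by (simp add: mult_ac gauss_commute)
qed

lemma heat_semigroup:
  fixes f :: "'a::euclidean_space \<Rightarrow> real"
  assumes "0 < s" "0 < t"
    and [measurable]: "f \<in> borel_measurable borel" and b: "\<And>x. \<bar>f x\<bar> \<le> M"
  shows "heat (heat f t) s x = heat f (s + t) x"
proof -
  have g: "heat (\<lambda>y. gauss s (y - x)) t z = gauss (s + t) (x - z)" for z
  proof -
    have "(\<integral>\<^sup>+y. ennreal (gauss s (y - x) * gauss t (z - y)) \<partial>lborel)
        = (\<integral>\<^sup>+y. ennreal (gauss s (x - y) * gauss t (y - z)) \<partial>distr lborel borel ((+) 0))"
      by (subst nn_integral_distr) (auto simp: gauss_commute[of s x] gauss_commute[of t z])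
    also have "distr lborel borel ((+) 0) = distr lborel borel ((+) (z::'a))"
      by (simp only: lborel_distr_plus)
    also have "(\<integral>\<^sup>+y. ennreal (gauss s (x - y) * gauss t (y - z)) \<partial>distr lborel borel ((+) z))
        = (\<integral>\<^sup>+y. ennreal (gauss s ((x - z) - y) * gauss t y) \<partial>lborel)"
      by (subst nn_integral_distr) (auto simp: algebra_simps)
    also have "\<dots> = ennreal (gauss (s + t) (x - z))"
      by (rule nn_integral_gauss_conv[OF assms(1,2)])
    finally show ?thesis
      unfolding heat_def by (subst integral_eq_nn_integral) auto
  qed
  have "heat (heat f t) s x = (\<integral>y. gauss s (y - x) * heat f t y \<partial>lborel)"
    unfolding heat_def[of "heat f t"] by (simp add: mult.commute gauss_commute)
  also have "\<dots> = (\<integral>z. f z * heat (\<lambda>y. gauss s (y - x)) t z \<partial>lborel)"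
    using assms by (intro heat_symmetric[where M=M]) auto
  also have "\<dots> = heat f (s + t) x"
    by (simp only: g) (simp only: heat_def)
  finally show ?thesis .
qed

definition heat_energy :: "('a::euclidean_space \<Rightarrow> real) \<Rightarrow> real \<Rightarrow> real" where
  "heat_energy f t = (\<integral>x. f x * heat f t x \<partial>lborel)"

lemma heat_energy_measurable [measurable]:
  assumes [measurable]: "f \<in> borel_measurable borel" "a \<in> borel_measurable M"
  shows "(\<lambda>p. heat_energy f (a p)) \<in> borel_measurable M"
  unfolding heat_energy_def by measurable

text \<open>Self-adjointness and the semigroup law give \<open>\<langle>P\<^sub>s f, P\<^sub>t f\<rangle> =
  \<langle>f, P\<^sub>s\<^sub>+\<^sub>t f\<rangle>\<close>.\<close>

lemma inner_heat:
  fixes f :: "'a::euclidean_space \<Rightarrow> real"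
  assumes "0 < s" "0 < t" and f: "integrable lborel f" and b: "\<And>x. \<bar>f x\<bar> \<le> M"
  shows "integrable lborel (\<lambda>x. heat f s x * heat f t x)"
    and "(\<integral>x. heat f s x * heat f t x \<partial>lborel) = heat_energy f (s + t)"
proof -
  have [measurable]: "f \<in> borel_measurable borel" using f by simp
  show "integrable lborel (\<lambda>x. heat f s x * heat f t x)"
    by (rule integrable_heat[where M=M]) (use assms abs_heat_le[of s f M] in auto)
  have "(\<integral>x. heat f s x * heat f t x \<partial>lborel) = (\<integral>x. f x * heat (heat f s) t x \<partial>lborel)"
    by (rule heat_symmetric[where M=M, symmetric]) (use assms abs_heat_le[of s f M] in auto)
  also have "\<dots> = heat_energy f (s + t)"
    unfolding heat_energy_def using assms
    by (subst heat_semigroup[where M=M]) (auto simp: add.commute)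
  finally show "(\<integral>x. heat f s x * heat f t x \<partial>lborel) = heat_energy f (s + t)" .
qed

text \<open>The energy at time \<open>t\<close> is the squared \<open>L\<^sup>2\<close> norm at time \<open>t
  / 2\<close>.\<close>

lemma heat_energy_nonneg:
  fixes f :: "'a::euclidean_space \<Rightarrow> real"
  assumes "0 < t" and f: "integrable lborel f" and b: "\<And>x. \<bar>f x\<bar> \<le> M"
  shows "0 \<le> heat_energy f t"
proof -
  have "0 \<le> (\<integral>x. heat f (t / 2) x * heat f (t / 2) x \<partial>lborel)" by simp
  then show ?thesis using inner_heat(2)[of "t/2" "t/2" f M] assms by simp
qed
 
lemma nn_integral_heat_square:
  fixes f :: "'a::euclidean_space \<Rightarrow> real"
  assumes "0 < t" and f: "integrable lborel f" and b: "\<And>x. \<bar>f x\<bar> \<le> M"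
  shows "(\<integral>\<^sup>+x. ennreal ((heat f t x)\<^sup>2) \<partial>lborel) = ennreal (heat_energy f (2 * t))"
  using inner_heat[of t t f M] assms
  by (subst nn_integral_eq_integral) (auto simp: power2_eq_square)

section \<open>Squaring an integral that depends on a parameter\<close>

lemma nn_integral_mult_le_sqrt:
  fixes f g :: "'a \<Rightarrow> real"
  assumes [measurable]: "f \<in> borel_measurable X" "g \<in> borel_measurable X"
    and f: "(\<integral>\<^sup>+x. ennreal ((f x)\<^sup>2) \<partial>X) \<le> ennreal (a\<^sup>2)" and g: "(\<integral>\<^sup>+x. ennreal ((g x)\<^sup>2) \<partial>X) \<le> ennreal (b\<^sup>2)"
    and a: "0 < a" and b: "0 < b"
  shows "(\<integral>\<^sup>+x. ennreal \<bar>f x * g x\<bar> \<partial>X) \<le> ennreal (a * b)"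
proof -
  have *: "\<bar>f x * g x\<bar> \<le> b / (2 * a) * (f x)\<^sup>2 + a / (2 * b) * (g x)\<^sup>2" for x
  proof -
    have "0 \<le> (b * \<bar>f x\<bar> - a * \<bar>g x\<bar>)\<^sup>2" by simp
    then have "2 * a * b * \<bar>f x * g x\<bar> \<le> b\<^sup>2 * (f x)\<^sup>2 + a\<^sup>2 * (g x)\<^sup>2"
      by (simp add: power2_diff power_mult_distrib abs_mult algebra_simps)
    then show ?thesis using a b by (simp add: field_simps power2_eq_square)
  qed
  have "(\<integral>\<^sup>+x. ennreal \<bar>f x * g x\<bar> \<partial>X) \<le> (\<integral>\<^sup>+x. ennreal (b / (2 * a)) * ennreal ((f x)\<^sup>2) + ennreal (a / (2 * b)) * ennreal ((g x)\<^sup>2) \<partial>X)"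
  proof (intro nn_integral_mono)
    fix x
    have "ennreal \<bar>f x * g x\<bar> \<le> ennreal (b / (2 * a) * (f x)\<^sup>2 + a / (2 * b) * (g x)\<^sup>2)"
      by (rule ennreal_leI[OF *])
    also have "\<dots> = ennreal (b / (2 * a)) * ennreal ((f x)\<^sup>2) + ennreal (a / (2 * b)) * ennreal ((g x)\<^sup>2)"
      using a b by (subst ennreal_plus) (auto simp: ennreal_mult[symmetric])
    finally show "ennreal \<bar>f x * g x\<bar> \<le> \<dots>" .
  qed
  also have "\<dots> \<le> ennreal (b / (2 * a)) * ennreal (a\<^sup>2) + ennreal (a / (2 * b)) * ennreal (b\<^sup>2)"
    by (subst nn_integral_add) (auto simp: nn_integral_cmult intro!: add_mono mult_left_mono f g)
  also have "\<dots> = ennreal (b / (2 * a) * a\<^sup>2 + a / (2 * b) * b\<^sup>2)"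
    using a b by (simp add: ennreal_mult[symmetric] ennreal_plus[symmetric] del: ennreal_plus)
  also have "b / (2 * a) * a\<^sup>2 + a / (2 * b) * b\<^sup>2 = a * b"
    using a b by (simp add: power2_eq_square)
  finally show ?thesis .
qed

text \<open>If the \<open>L\<^sup>2\<close> norms of the slices \<open>F t\<close> are dominated by an
  integrable function of \<open>t\<close>, then the \<open>t\<close>-integral of \<open>F\<close> is
  in \<open>L\<^sup>2\<close>, and its square may be expanded as a double integral and Fubini
  applied. The Cauchy--Schwarz inequality for pairs of slices provides the absolute convergence.\<close>

lemma square_integral_Fubini:
  fixes F :: "'t \<Rightarrow> 'x \<Rightarrow> real"
  assumes T: "sigma_finite_measure T" and X: "sigma_finite_measure X"
    and F [measurable]: "case_prod F \<in> borel_measurable (T \<Otimes>\<^sub>M X)"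
    and n [measurable]: "n \<in> borel_measurable T" and n_pos: "\<And>t. 0 < n t" and n_int: "(\<integral>\<^sup>+t. ennreal (n t) \<partial>T) < \<infinity>"
    and F_le: "\<And>t. t \<in> space T \<Longrightarrow> (\<integral>\<^sup>+x. ennreal ((F t x)\<^sup>2) \<partial>X) \<le> ennreal ((n t)\<^sup>2)"
  shows "integrable X (\<lambda>x. (\<integral>t. F t x \<partial>T)\<^sup>2)"
    and "integrable (T \<Otimes>\<^sub>M T) (\<lambda>(t, s). \<integral>x. F t x * F s x \<partial>X)"
    and "(\<integral>x. (\<integral>t. F t x \<partial>T)\<^sup>2 \<partial>X) = (\<integral>p. (case p of (t, s) \<Rightarrow> \<integral>x. F t x * F s x \<partial>X) \<partial>(T \<Otimes>\<^sub>M T))"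
proof -
  interpret T: sigma_finite_measure T by fact
  interpret X: sigma_finite_measure X by fact
  interpret TT: pair_sigma_finite T T ..
  interpret TTX: pair_sigma_finite "T \<Otimes>\<^sub>M T" X ..
  have F1 [measurable]: "(\<lambda>x. F t x) \<in> borel_measurable X" if "t \<in> space T" for t
    using that by measurable
  have F2 [measurable]: "(\<lambda>q. F (fst (fst q)) (snd q)) \<in> borel_measurable ((T \<Otimes>\<^sub>M T) \<Otimes>\<^sub>M X)"
      "(\<lambda>q. F (snd (fst q)) (snd q)) \<in> borel_measurable ((T \<Otimes>\<^sub>M T) \<Otimes>\<^sub>M X)"
    by measurable
  define Q where "Q = (\<lambda>(p, x). F (fst p) x * F (snd p) x)"
  have [measurable]: "Q \<in> borel_measurable ((T \<Otimes>\<^sub>M T) \<Otimes>\<^sub>M X)"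
    unfolding Q_def by measurable
  have "(\<integral>\<^sup>+q. ennreal (norm (Q q)) \<partial>((T \<Otimes>\<^sub>M T) \<Otimes>\<^sub>M X))
      = (\<integral>\<^sup>+p. \<integral>\<^sup>+x. ennreal (norm (Q (p, x))) \<partial>X \<partial>(T \<Otimes>\<^sub>M T))"
    by (subst X.nn_integral_fst[symmetric]) auto
  also have "\<dots> = (\<integral>\<^sup>+t. \<integral>\<^sup>+s. \<integral>\<^sup>+x. ennreal (norm (Q ((t, s), x))) \<partial>X \<partial>T \<partial>T)"
    by (subst T.nn_integral_fst[symmetric]) auto
  also have "\<dots> \<le> (\<integral>\<^sup>+t. \<integral>\<^sup>+s. ennreal (n t) * ennreal (n s) \<partial>T \<partial>T)"
  proof (intro nn_integral_mono)
    fix t s assume "t \<in> space T" "s \<in> space T"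
    then show "(\<integral>\<^sup>+x. ennreal (norm (Q ((t, s), x))) \<partial>X) \<le> ennreal (n t) * ennreal (n s)"
      using nn_integral_mult_le_sqrt[OF F1 F1 F_le F_le n_pos n_pos, of t s] n_pos[of t] n_pos[of s]
      by (simp add: Q_def ennreal_mult)
  qed
  also have "\<dots> = (\<integral>\<^sup>+t. ennreal (n t) \<partial>T) * (\<integral>\<^sup>+t. ennreal (n t) \<partial>T)"
    by (simp add: nn_integral_cmult nn_integral_multc)
  also have "\<dots> < \<infinity>" using n_int by (simp add: ennreal_mult_less_top)
  finally have Q: "integrable ((T \<Otimes>\<^sub>M T) \<Otimes>\<^sub>M X) Q"
    by (intro integrableI_bounded) auto
  have Q': "AE x in X. (\<integral>p. Q (p, x) \<partial>(T \<Otimes>\<^sub>M T)) = (\<integral>t. F t x \<partial>T)\<^sup>2"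
  proof -
    have "AE x in X. integrable (T \<Otimes>\<^sub>M T) (\<lambda>p. Q (p, x))"
      using TTX.AE_integrable_snd[of "\<lambda>p x. Q (p, x)"] Q by simp
    then show ?thesis
      using AE_space
    proof eventually_elim
    case (elim x)
    then have i: "integrable (T \<Otimes>\<^sub>M T) (\<lambda>(t, s). F t x * F s x)" by (simp add: Q_def case_prod_unfold)
    have [measurable]: "(\<lambda>t. F t x) \<in> borel_measurable T" using elim(2) by measurable
    have "(\<integral>p. Q (p, x) \<partial>(T \<Otimes>\<^sub>M T)) = (\<integral>t. \<integral>s. F t x * F s x \<partial>T \<partial>T)"
      using TT.integral_fst'[OF i] by (simp add: Q_def case_prod_unfold)
    also have "\<dots> = (\<integral>t. F t x \<partial>T)\<^sup>2"
      by (simp add: power2_eq_square)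
    finally show ?case .
    qed
  qed
  have "integrable X (\<lambda>x. \<integral>p. Q (p, x) \<partial>(T \<Otimes>\<^sub>M T))"
    using TTX.integrable_snd[of "\<lambda>p x. Q (p, x)"] Q by simp
  then show "integrable X (\<lambda>x. (\<integral>t. F t x \<partial>T)\<^sup>2)"
    by (rule integrable_cong_AE_imp) (use Q' in auto)
  have "integrable (T \<Otimes>\<^sub>M T) (\<lambda>p. \<integral>x. Q (p, x) \<partial>X)"
    using TTX.integrable_fst[of "\<lambda>p x. Q (p, x)"] Q by simp
  then show "integrable (T \<Otimes>\<^sub>M T) (\<lambda>(t, s). \<integral>x. F t x * F s x \<partial>X)"
    by (simp add: Q_def case_prod_unfold)
  have "(\<integral>x. (\<integral>t. F t x \<partial>T)\<^sup>2 \<partial>X) = (\<integral>x. (\<integral>p. Q (p, x) \<partial>(T \<Otimes>\<^sub>M T)) \<partial>X)"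
    using Q' by (intro integral_cong_AE) auto
  also have "\<dots> = (\<integral>p. (\<integral>x. Q (p, x) \<partial>X) \<partial>(T \<Otimes>\<^sub>M T))"
    using TTX.Fubini_integral[of "\<lambda>p x. Q (p, x)"] Q by simp
  finally show "(\<integral>x. (\<integral>t. F t x \<partial>T)\<^sup>2 \<partial>X) = (\<integral>p. (case p of (t, s) \<Rightarrow> \<integral>x. F t x * F s x \<partial>X) \<partial>(T \<Otimes>\<^sub>M T))"
    by (simp add: Q_def case_prod_unfold)
qed

section \<open>Integration by parts along a direction\<close>

text \<open>The derivative in the direction \<open>e\<close> at every point. Working with one direction at a
  time means that only one-dimensional calculus is needed.\<close>

definition deriv_along :: "'a::euclidean_space \<Rightarrow> ('a \<Rightarrow> real) \<Rightarrow> ('a \<Rightarrow> real) \<Rightarrow> bool" where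
  "deriv_along e F F' \<longleftrightarrow> (\<forall>x. ((\<lambda>h. F (x + h *\<^sub>R e)) has_real_derivative F' x) (at 0))"

lemma deriv_alongD:
  assumes "deriv_along e F F'"
  shows "((\<lambda>h. F (x + h *\<^sub>R e)) has_real_derivative F' (x + h *\<^sub>R e)) (at h)"
proof -
  have "((\<lambda>k. F ((x + h *\<^sub>R e) + k *\<^sub>R e)) has_real_derivative F' (x + h *\<^sub>R e)) (at 0)"
    using assms unfolding deriv_along_def by blast
  then have "((\<lambda>k. F (x + (k + h) *\<^sub>R e)) has_real_derivative F' (x + h *\<^sub>R e)) (at 0)"
    by (simp add: algebra_simps)
  then show ?thesis
    using DERIV_shift[of "\<lambda>h. F (x + h *\<^sub>R e)" "F' (x + h *\<^sub>R e)" 0 h] by simp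
qed

lemma deriv_along_mult:
  assumes "deriv_along e f f'" "deriv_along e g g'"
  shows "deriv_along e (\<lambda>x. f x * g x) (\<lambda>x. f' x * g x + f x * g' x)"
  unfolding deriv_along_def
proof
  fix x
  show "((\<lambda>h. f (x + h *\<^sub>R e) * g (x + h *\<^sub>R e)) has_real_derivative f' x * g x + f x * g' x) (at 0)"
    using DERIV_mult[of "\<lambda>h. f (x + h *\<^sub>R e)" "f' x" 0 UNIV "\<lambda>h. g (x + h *\<^sub>R e)" "g' x"] assms
    unfolding deriv_along_def by (simp add: algebra_simps)
qed

lemma integrable_continuous_compact_support:
  fixes f :: "'a::euclidean_space \<Rightarrow> real"
  assumes f: "continuous_on UNIV f" and K: "compact K" "\<And>x. x \<notin> K \<Longrightarrow> f x = 0"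
  shows "integrable lborel f"
proof -
  have "integrable lborel (\<lambda>x. indicator K x *\<^sub>R f x)"
    using K f by (intro borel_integrable_compact) (auto intro: continuous_on_subset)
  also have "(\<lambda>x. indicator K x *\<^sub>R f x) = f"
    using K by (auto simp: indicator_def fun_eq_iff)
  finally show ?thesis .
qed

lemma bounded_continuous_compact_support:
  fixes f :: "'a::euclidean_space \<Rightarrow> real"
  assumes f: "continuous_on UNIV f" and K: "compact K" "\<And>x. x \<notin> K \<Longrightarrow> f x = 0"
  obtains M where "0 < M" "\<And>x. \<bar>f x\<bar> \<le> M"
proof -
  have "compact (f ` K)" using f K by (intro compact_continuous_image) (auto intro: continuous_on_subset)
  then obtain b where b: "0 < b" "\<And>y. y \<in> f ` K \<Longrightarrow> norm y \<le> b"
    using compact_imp_bounded bounded_pos by metis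
  show ?thesis by (rule that[of b]) (use b K(2) in \<open>force+\<close>)
qed

lemma integral_translate:
  fixes F :: "'a::euclidean_space \<Rightarrow> real"
  assumes [measurable]: "F \<in> borel_measurable borel"
  shows "(\<integral>x. F (x + v) \<partial>lborel) = (\<integral>x. F x \<partial>lborel)"
proof -
  have "(\<integral>x. F x \<partial>lborel) = (\<integral>x. F x \<partial>distr lborel borel ((+) v))"
    by (simp add: lborel_distr_plus)
  also have "\<dots> = (\<integral>x. F (v + x) \<partial>lborel)"
    by (subst integral_distr) auto
  finally show ?thesis by (simp add: add.commute)
qed

text \<open>The integral of \<open>F (x + h *\<^sub>R e)\<close> does not depend on \<open>h\<close> by
  translation invariance; differentiating it under the integral sign, the derivative
  \<open>\<integral>F'\<close> must vanish.\<close>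

lemma integral_deriv_along_zero:
  fixes F F' :: "'a::euclidean_space \<Rightarrow> real"
  assumes d: "deriv_along e F F'" and F: "continuous_on UNIV F" and F': "continuous_on UNIV F'"
    and K: "compact K" "\<And>x. x \<notin> K \<Longrightarrow> F x = 0" "\<And>x. x \<notin> K \<Longrightarrow> F' x = 0"
  shows "(\<integral>x. F' x \<partial>lborel) = 0"
proof -
  obtain M where M: "0 < M" "\<And>x. \<bar>F' x\<bar> \<le> M"
    using bounded_continuous_compact_support[OF F' K(1,3)] by blast
  define D where "D n x = (F (x + (1 / real (Suc n)) *\<^sub>R e) - F x) * real (Suc n)" for n x
  define K' where "K' = (\<lambda>(x, s). x - s *\<^sub>R e) ` (K \<times> {0..1::real})"
  have K': "compact K'" unfolding K'_def
    by (intro compact_continuous_image compact_Times K compact_Icc) (auto simp: case_prod_unfold intro!: continuous_intros)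
  have [measurable]: "F \<in> borel_measurable borel" "F' \<in> borel_measurable borel"
    using F F' by (auto intro: borel_measurable_continuous_onI)
  have iF: "integrable lborel F" by (rule integrable_continuous_compact_support[OF F K(1,2)])
  have D0: "(\<integral>x. D n x \<partial>lborel) = 0" for n
  proof -
    have "integrable lborel (\<lambda>x. F (x + (1 / real (Suc n)) *\<^sub>R e))"
    proof (rule integrable_continuous_compact_support)
      show "continuous_on UNIV (\<lambda>x. F (x + (1 / real (Suc n)) *\<^sub>R e))"
        by (intro continuous_on_compose2[OF F] continuous_intros) auto
      show "compact ((+) (- ((1 / real (Suc n)) *\<^sub>R e)) ` K)"
        by (intro compact_translation K)
      fix x assume "x \<notin> (+) (- ((1 / real (Suc n)) *\<^sub>R e)) ` K"
      then have "x + (1 / real (Suc n)) *\<^sub>R e \<notin> K"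
        by (metis add.commute add_diff_cancel_right' diff_conv_add_uminus image_eqI)
      then show "F (x + (1 / real (Suc n)) *\<^sub>R e) = 0" by (rule K)
    qed
    then have "(\<integral>x. F (x + (1 / real (Suc n)) *\<^sub>R e) - F x \<partial>lborel) = 0"
      using iF by (subst Bochner_Integration.integral_diff) (auto simp: integral_translate[of F])
    then show ?thesis unfolding D_def by (subst integral_mult_left_zero) simp
  qed
  have "(\<lambda>n. \<integral>x. D n x \<partial>lborel) \<longlonglongrightarrow> (\<integral>x. F' x \<partial>lborel)"
  proof (rule integral_dominated_convergence[where w="\<lambda>x. indicator K' x *\<^sub>R M"])
    show "integrable lborel (\<lambda>x. indicator K' x *\<^sub>R M)"
      using K' by (intro borel_integrable_compact) auto
    show "AE x in lborel. (\<lambda>n. D n x) \<longlonglongrightarrow> F' x"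
    proof (rule AE_I2)
      fix x
      have "((\<lambda>h. (F (x + (0 + h) *\<^sub>R e) - F (x + 0 *\<^sub>R e)) / h) \<longlongrightarrow> F' x) (at 0)"
        using d unfolding deriv_along_def DERIV_def by blast
      then have "(\<lambda>n. (F (x + (0 + 1 / real (Suc n)) *\<^sub>R e) - F (x + 0 *\<^sub>R e)) / (1 / real (Suc n))) \<longlonglongrightarrow> F' x"
        by (rule filterlim_compose) (use LIMSEQ_Suc[OF lim_1_over_n] in \<open>auto simp: filterlim_at intro!: eventuallyI\<close>)
      then show "(\<lambda>n. D n x) \<longlonglongrightarrow> F' x" by (simp add: D_def)
    qed
    fix n
    show "AE x in lborel. norm (D n x) \<le> indicator K' x *\<^sub>R M"
    proof (rule AE_I2)
      fix x
      let ?h = "1 / real (Suc n)"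
      show "norm (D n x) \<le> indicator K' x *\<^sub>R M"
      proof (cases "x \<in> K'")
        case True
        have "\<exists>z. 0 < z \<and> z < ?h \<and> F (x + ?h *\<^sub>R e) - F (x + 0 *\<^sub>R e) = (?h - 0) * F' (x + z *\<^sub>R e)"
          by (intro MVT2) (use deriv_alongD[OF d] in auto)
        then obtain z where "F (x + ?h *\<^sub>R e) - F x = ?h * F' (x + z *\<^sub>R e)" by auto
        then have "D n x = F' (x + z *\<^sub>R e)" unfolding D_def by simp
        then show ?thesis using M True by simp
      next
        case False
        have "x + s *\<^sub>R e \<notin> K" if "0 \<le> s" "s \<le> 1" for s
        proof
          assume "x + s *\<^sub>R e \<in> K"
          then have "(\<lambda>(x, s). x - s *\<^sub>R e) (x + s *\<^sub>R e, s) \<in> K'"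
            unfolding K'_def using that by (intro imageI) auto
          then show False using False by simp
        qed
        from this[of 0] this[of ?h] show ?thesis using K(2) M(1) by (auto simp: D_def)
      qed
    qed
  qed (auto simp: D_def)
  then show ?thesis unfolding D0 by (simp only: LIMSEQ_const_iff)
qed

lemma integration_by_parts_along:
  fixes f g :: "'a::euclidean_space \<Rightarrow> real"
  assumes f: "deriv_along e f f'" "continuous_on UNIV f" "continuous_on UNIV f'"
    and g: "deriv_along e g g'" "continuous_on UNIV g" "continuous_on UNIV g'"
    and K: "compact K" "\<And>x. x \<notin> K \<Longrightarrow> f x = 0" "\<And>x. x \<notin> K \<Longrightarrow> f' x = 0"
  shows "(\<integral>x. f' x * g x \<partial>lborel) = - (\<integral>x. f x * g' x \<partial>lborel)"
proof -
  have "(\<integral>x. f' x * g x + f x * g' x \<partial>lborel) = 0"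
    by (rule integral_deriv_along_zero[OF deriv_along_mult[OF f(1) g(1)] _ _ K(1)])
       (use f g K in \<open>auto intro!: continuous_intros\<close>)
  moreover have "integrable lborel (\<lambda>x. f' x * g x)" "integrable lborel (\<lambda>x. f x * g' x)"
    by (rule integrable_continuous_compact_support[OF _ K(1)]; use f g K in \<open>auto intro!: continuous_intros\<close>)+
  ultimately show ?thesis by simp
qed

section \<open>The heat equation\<close>

lemma continuous_on_gauss [continuous_intros]:
  assumes "continuous_on S f" "continuous_on S g" "\<And>x. x \<in> S \<Longrightarrow> 0 < f x"
  shows "continuous_on S (\<lambda>x. gauss (f x) (g x))"
proof -
  have "sqrt (f x) \<noteq> 0" if "x \<in> S" for x using assms(3)[OF that] by auto
  then show ?thesis
    unfolding gauss_def normal_density_def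
    by (intro continuous_intros assms) auto
qed

lemma deriv_along_gauss:
  fixes y :: "'a::euclidean_space"
  assumes "0 < r" 
  shows "deriv_along e (\<lambda>x. gauss r (x - y)) (\<lambda>x. - ((x - y) \<bullet> e / r) * gauss r (x - y))"
  unfolding deriv_along_def
proof
  fix x
  show "((\<lambda>h. gauss r (x + h *\<^sub>R e - y)) has_real_derivative - ((x - y) \<bullet> e / r) * gauss r (x - y)) (at 0)"
  proof -
    define c where "c = (2 * pi * r) powr (- real DIM('a) / 2)"
    have "(norm (x + h *\<^sub>R e - y))\<^sup>2 = (norm (x - y))\<^sup>2 + 2 * h * ((x - y) \<bullet> e) + h\<^sup>2 * (norm e)\<^sup>2" for h
      using dot_norm[of "x - y" "h *\<^sub>R e"] by (simp add: algebra_simps power_mult_distrib)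
    then have "(\<lambda>h. gauss r (x + h *\<^sub>R e - y)) =
       (\<lambda>h. c * exp (- ((norm (x - y))\<^sup>2 + 2 * h * ((x - y) \<bullet> e) + h\<^sup>2 * (norm e)\<^sup>2) / (2 * r)))"
      unfolding gauss_eq[OF assms] c_def by simp
    moreover have "(\<dots> has_real_derivative c * (exp (- (norm (x - y))\<^sup>2 / (2 * r)) * (- (2 * ((x - y) \<bullet> e)) / (2 * r)))) (at 0)"
      using assms by (auto intro!: derivative_eq_intros)
    moreover have "c * (exp (- (norm (x - y))\<^sup>2 / (2 * r)) * (- (2 * ((x - y) \<bullet> e)) / (2 * r))) = - ((x - y) \<bullet> e / r) * gauss r (x - y)"
      unfolding gauss_eq[OF assms] c_def by simp
    ultimately show ?thesis by (simp only:)
  qed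
qed

lemma deriv_along_gauss':
  fixes y :: "'a::euclidean_space"
  assumes "0 < r" "e \<in> Basis"
  shows "deriv_along e (\<lambda>x. ((x - y) \<bullet> e / r) * gauss r (x - y))
     (\<lambda>x. (1 / r - ((x - y) \<bullet> e)\<^sup>2 / r\<^sup>2) * gauss r (x - y))"
proof -
  have "deriv_along e (\<lambda>x. (x - y) \<bullet> e / r) (\<lambda>x. 1 / r)"
    unfolding deriv_along_def using assms
    by (auto intro!: derivative_eq_intros simp: inner_simps field_simps)
  from deriv_along_mult[OF this deriv_along_gauss[OF assms(1), where y=y]]
  have "deriv_along e (\<lambda>x. (x - y) \<bullet> e / r * gauss r (x - y))
    (\<lambda>x. 1 / r * gauss r (x - y) + (x - y) \<bullet> e / r * (- ((x - y) \<bullet> e / r) * gauss r (x - y)))" .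
  moreover have "1 / r * g + c / r * (- (c / r) * g) = (1 / r - c\<^sup>2 / r\<^sup>2) * g" for c g :: real
    by (simp add: power2_eq_square left_diff_distrib)
  ultimately show ?thesis by simp
qed

text \<open>Both derivatives are moved from the function onto the Gaussian kernel.\<close>

lemma heat_energy_deriv:
  fixes f f' :: "'a::euclidean_space \<Rightarrow> real"
  assumes r: "0 < r" and e: "e \<in> Basis"
    and f: "deriv_along e f f'" "continuous_on UNIV f" "continuous_on UNIV f'"
    and K: "compact K" "\<And>x. x \<notin> K \<Longrightarrow> f x = 0" "\<And>x. x \<notin> K \<Longrightarrow> f' x = 0"
  shows "heat_energy f' r = (\<integral>y. \<integral>x. f y * f x * ((1 / r - ((x - y) \<bullet> e)\<^sup>2 / r\<^sup>2) * gauss r (x - y)) \<partial>lborel \<partial>lborel)"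
proof -
  have 1: "heat f' r x = - (\<integral>y. f y * ((x - y) \<bullet> e / r * gauss r (x - y)) \<partial>lborel)" for x
  proof -
    have "heat f' r x = (\<integral>y. f' y * gauss r (y - x) \<partial>lborel)"
      unfolding heat_def by (simp add: gauss_commute)
    also have "\<dots> = - (\<integral>y. f y * (- ((y - x) \<bullet> e / r) * gauss r (y - x)) \<partial>lborel)"
      by (rule integration_by_parts_along[OF f deriv_along_gauss[OF r] _ _ K])
         (use r in \<open>auto intro!: continuous_intros\<close>)
    also have "\<dots> = - (\<integral>y. f y * ((x - y) \<bullet> e / r * gauss r (x - y)) \<partial>lborel)"
      by (simp add: gauss_commute[of r x] inner_diff_left diff_divide_distrib)
    finally show ?thesis .
  qed
  define H where "H = (\<lambda>(x, y). f' x * f y * ((x - y) \<bullet> e / r * gauss r (x - y)))"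
  have H: "integrable (lborel \<Otimes>\<^sub>M lborel) H"
    unfolding lborel_prod
  proof (rule integrable_continuous_compact_support)
    show "continuous_on UNIV H" unfolding H_def case_prod_unfold using r
      by (intro continuous_intros continuous_on_compose2[OF f(2)] continuous_on_compose2[OF f(3)]) auto
    show "compact (K \<times> K)" using K by (intro compact_Times)
    fix p assume "p \<notin> K \<times> K"
    then show "H p = 0" using K by (cases p) (auto simp: H_def)
  qed
  have "heat_energy f' r = - (\<integral>x. \<integral>y. H (x, y) \<partial>lborel \<partial>lborel)"
    unfolding heat_energy_def 1 H_def by (simp add: mult.assoc)
  also have "\<dots> = - (\<integral>y. \<integral>x. H (x, y) \<partial>lborel \<partial>lborel)"
    using lborel_pair.Fubini_integral[of "\<lambda>x y. H (x, y)"] H by simp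
  also have "\<dots> = - (\<integral>y. f y * (\<integral>x. f' x * ((x - y) \<bullet> e / r * gauss r (x - y)) \<partial>lborel) \<partial>lborel)"
    unfolding H_def integral_mult_right_zero[symmetric] by (simp add: mult_ac)
  also have "\<dots> = - (\<integral>y. f y * - (\<integral>x. f x * ((1 / r - ((x - y) \<bullet> e)\<^sup>2 / r\<^sup>2) * gauss r (x - y)) \<partial>lborel) \<partial>lborel)"
  proof -
    have "(\<integral>x. f' x * ((x - y) \<bullet> e / r * gauss r (x - y)) \<partial>lborel)
      = - (\<integral>x. f x * ((1 / r - ((x - y) \<bullet> e)\<^sup>2 / r\<^sup>2) * gauss r (x - y)) \<partial>lborel)" for y
      by (rule integration_by_parts_along[OF f deriv_along_gauss'[OF r e] _ _ K])
         (use r in \<open>auto intro!: continuous_intros\<close>)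
    then show ?thesis by simp
  qed
  finally show ?thesis by (simp add: mult.assoc)
qed

text \<open>The right-hand side is half of the Laplacian of the Gaussian, as summing
  \<open>deriv_along_gauss'\<close> over the basis shows. This is the heat equation.\<close>

lemma gauss_time_deriv:
  fixes z :: "'a::euclidean_space"
  assumes r: "0 < r"
  shows "((\<lambda>r. gauss r z) has_real_derivative gauss r z * ((norm z)\<^sup>2 / (2 * r\<^sup>2) - DIM('a) / (2 * r))) (at r)"
proof -
  define p where "p = - real DIM('a) / 2"
  have "((\<lambda>r. (2 * pi * r) powr p * exp (- (norm z)\<^sup>2 / (2 * r))) has_real_derivative
     (2 * pi * r) powr p * exp (- (norm z)\<^sup>2 / (2 * r)) * ((norm z)\<^sup>2 / (2 * r\<^sup>2)) +
     p * (2 * pi * r) powr (p - 1) * (2 * pi) * exp (- (norm z)\<^sup>2 / (2 * r))) (at r)"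
    using r by (auto intro!: derivative_eq_intros simp: power2_eq_square)
  moreover
  have "(2 * pi * r) powr (p - 1) * (2 * pi) = (2 * pi * r) powr p / r"
    using r by (simp add: powr_diff)
  then have "(2 * pi * r) powr p * exp (- (norm z)\<^sup>2 / (2 * r)) * ((norm z)\<^sup>2 / (2 * r\<^sup>2)) +
     p * (2 * pi * r) powr (p - 1) * (2 * pi) * exp (- (norm z)\<^sup>2 / (2 * r)) = gauss r z * ((norm z)\<^sup>2 / (2 * r\<^sup>2) - DIM('a) / (2 * r))"
    unfolding gauss_eq[OF r] p_def[symmetric] mult.assoc[of p] by (simp add: p_def algebra_simps)
  ultimately have "((\<lambda>r. (2 * pi * r) powr p * exp (- (norm z)\<^sup>2 / (2 * r))) has_real_derivative gauss r z * ((norm z)\<^sup>2 / (2 * r\<^sup>2) - DIM('a) / (2 * r))) (at r)"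
    by (simp only:)
  then show ?thesis
    by (rule has_field_derivative_transform_within_open[where S="{0<..}"]) (use r in \<open>auto simp: gauss_eq p_def\<close>)
qed

text \<open>The class of functions for which the two energies are compared: \<open>f' e\<close> is the partial
  derivative in the basis direction \<open>e\<close>.\<close>

locale C1_compact =
  fixes f :: "'a::euclidean_space \<Rightarrow> real" and f' :: "'a \<Rightarrow> 'a \<Rightarrow> real" and K :: "'a set"
  assumes f: "continuous_on UNIV f" and f': "\<And>e. e \<in> Basis \<Longrightarrow> continuous_on UNIV (f' e)"
    and deriv: "\<And>e. e \<in> Basis \<Longrightarrow> deriv_along e f (f' e)"
    and K: "compact K" and f_0: "\<And>x. x \<notin> K \<Longrightarrow> f x = 0"
    and f'_0: "\<And>e x. e \<in> Basis \<Longrightarrow> x \<notin> K \<Longrightarrow> f' e x = 0"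
begin

lemma f_measurable [measurable]: "f \<in> borel_measurable borel"
  using f by (rule borel_measurable_continuous_onI)

lemma f'_measurable [measurable]: "e \<in> Basis \<Longrightarrow> f' e \<in> borel_measurable borel"
  using f' by (rule borel_measurable_continuous_onI)

lemma f_integrable: "integrable lborel f"
  using integrable_continuous_compact_support[OF f K f_0] .

lemma f'_integrable: "e \<in> Basis \<Longrightarrow> integrable lborel (f' e)"
  using integrable_continuous_compact_support[OF f' K f'_0] .

lemma f_bounded: obtains M where "0 < M" "\<And>x. \<bar>f x\<bar> \<le> M"
  using bounded_continuous_compact_support[OF f K f_0] by blast

lemma f'_bounded: assumes "e \<in> Basis" obtains M where "0 < M" "\<And>x. \<bar>f' e x\<bar> \<le> M"
  using bounded_continuous_compact_support[OF f'[OF assms] K f'_0[OF assms]] by blast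

text \<open>This is \<open>\<integral> \<nabla>f \<bullet> P\<^sub>r \<nabla>f\<close>.\<close>

definition dirichlet :: "real \<Rightarrow> real" where
  "dirichlet r = (\<Sum>e\<in>Basis. heat_energy (f' e) r)"

lemma dirichlet_measurable [measurable]:
  assumes [measurable]: "a \<in> borel_measurable M"
  shows "(\<lambda>p. dirichlet (a p)) \<in> borel_measurable M"
  unfolding dirichlet_def by measurable

lemma heat_energy_f'_nonneg: "0 < r \<Longrightarrow> e \<in> Basis \<Longrightarrow> 0 \<le> heat_energy (f' e) r"
  using f'_bounded[of e] heat_energy_nonneg[OF _ f'_integrable] by metis

lemma dirichlet_nonneg: "0 < r \<Longrightarrow> 0 \<le> dirichlet r"
  unfolding dirichlet_def by (intro sum_nonneg heat_energy_f'_nonneg)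

lemma integrable_ff:
  assumes c: "continuous_on UNIV c"
  shows "integrable lborel (\<lambda>p. f (fst p) * f (snd p) * c p)"
proof (rule integrable_continuous_compact_support)
  show "continuous_on UNIV (\<lambda>p. f (fst p) * f (snd p) * c p)"
    by (intro continuous_intros continuous_on_compose2[OF f] c) auto
  show "compact (K \<times> K)" by (intro compact_Times K)
  fix p assume "p \<notin> K \<times> K"
  then show "f (fst p) * f (snd p) * c p = 0" using f_0 by (cases p) auto
qed

lemma integral_ff:
  assumes c: "continuous_on UNIV c"
  shows "(\<integral>p. f (fst p) * f (snd p) * c p \<partial>lborel) = (\<integral>x. \<integral>y. f x * f y * c (x, y) \<partial>lborel \<partial>lborel)"
  using lborel_pair.integral_fst'[of "\<lambda>p. f (fst p) * f (snd p) * c p"] integrable_ff[OF c] by (simp add: lborel_prod)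

lemma heat_energy_f:
  assumes "0 < r"
  shows "heat_energy f r = (\<integral>p. f (fst p) * f (snd p) * gauss r (snd p - fst p) \<partial>lborel)"
  using assms
  by (subst integral_ff) (auto simp: heat_energy_def heat_def gauss_commute mult.assoc intro!: continuous_intros)

lemma heat_energy_f':
  assumes r: "0 < r" and e: "e \<in> Basis"
  shows "heat_energy (f' e) r = (\<integral>p. f (fst p) * f (snd p) *
     ((1 / r - ((snd p - fst p) \<bullet> e)\<^sup>2 / r\<^sup>2) * gauss r (snd p - fst p)) \<partial>lborel)"
proof -
  have "continuous_on UNIV (\<lambda>p :: 'a \<times> 'a. (1 / r - ((snd p - fst p) \<bullet> e)\<^sup>2 / r\<^sup>2) * gauss r (snd p - fst p))"
    using r by (intro continuous_intros) auto
  from integral_ff[OF this] show ?thesis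
    using heat_energy_deriv[OF r e deriv[OF e] f f'[OF e] K f_0 f'_0[OF e]] by simp
qed

text \<open>By the heat equation for the kernel, \<open>- dirichlet r / 2\<close> is the time derivative of
  the heat energy, written as a double integral against the time derivative of the Gaussian.\<close>

lemma dirichlet_eq:
  assumes r: "0 < r"
  shows "- (dirichlet r / 2) = (\<integral>p. f (fst p) * f (snd p) *
     (gauss r (snd p - fst p) * ((norm (snd p - fst p))\<^sup>2 / (2 * r\<^sup>2) - DIM('a) / (2 * r))) \<partial>lborel)"
proof -
  have "dirichlet r = (\<integral>p. (\<Sum>e\<in>Basis. f (fst p) * f (snd p) *
     ((1 / r - ((snd p - fst p) \<bullet> e)\<^sup>2 / r\<^sup>2) * gauss r (snd p - fst p))) \<partial>lborel)"
    unfolding dirichlet_def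
  proof (subst Bochner_Integration.integral_sum)
    fix e :: 'a
    have "continuous_on UNIV (\<lambda>p :: 'a \<times> 'a. (1 / r - ((snd p - fst p) \<bullet> e)\<^sup>2 / r\<^sup>2) * gauss r (snd p - fst p))"
      using r by (intro continuous_intros) auto
    then show "integrable lborel (\<lambda>p. f (fst p) * f (snd p) * ((1 / r - ((snd p - fst p) \<bullet> e)\<^sup>2 / r\<^sup>2) * gauss r (snd p - fst p)))"
      by (rule integrable_ff)
  qed (simp add: heat_energy_f'[OF r])
  also have "\<dots> = (\<integral>p. - 2 * (f (fst p) * f (snd p) *
     (gauss r (snd p - fst p) * ((norm (snd p - fst p))\<^sup>2 / (2 * r\<^sup>2) - DIM('a) / (2 * r)))) \<partial>lborel)"
  proof (rule Bochner_Integration.integral_cong[OF refl])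
    fix p :: "'a \<times> 'a"
    define z where "z = snd p - fst p"
    have n: "(norm z)\<^sup>2 = (\<Sum>b\<in>Basis. (z \<bullet> b)\<^sup>2)"
      unfolding power2_norm_eq_inner by (subst euclidean_inner) (simp add: power2_eq_square)
    have "(\<Sum>e\<in>Basis. f (fst p) * f (snd p) * ((1 / r - (z \<bullet> e)\<^sup>2 / r\<^sup>2) * gauss r z)) =
      f (fst p) * f (snd p) * gauss r z * (\<Sum>e\<in>Basis. (1 / r - (z \<bullet> e)\<^sup>2 / r\<^sup>2))"
      by (simp add: sum_distrib_left mult_ac)
    also have "(\<Sum>e\<in>Basis. (1 / r - (z \<bullet> e)\<^sup>2 / r\<^sup>2)) = DIM('a) / r - (norm z)\<^sup>2 / r\<^sup>2"
      unfolding n by (simp add: sum_subtractf sum_divide_distrib)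
    finally show "(\<Sum>e\<in>Basis. f (fst p) * f (snd p) * ((1 / r - ((snd p - fst p) \<bullet> e)\<^sup>2 / r\<^sup>2) * gauss r (snd p - fst p)))
      = - 2 * (f (fst p) * f (snd p) * (gauss r (snd p - fst p) * ((norm (snd p - fst p))\<^sup>2 / (2 * r\<^sup>2) - DIM('a) / (2 * r))))"
      unfolding z_def using r by (simp add: field_simps)
  qed
  finally show ?thesis by (subst (asm) integral_mult_right_zero) simp
qed

text \<open>For small times the semigroup is bounded on bounded functions; for large times the second
  derivatives of the Gaussian are \<open>O(1 / r)\<close>. The two bounds together make the energy
  integrable against \<open>r powr (a - 1)\<close> for \<open>0 < a < 1\<close>.\<close>

lemma heat_energy_f'_bound:
  assumes e: "e \<in> Basis"
  obtains C where "0 < C" "\<And>r. 0 < r \<Longrightarrow> heat_energy (f' e) r \<le> C"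
    "\<And>r. 1 \<le> r \<Longrightarrow> heat_energy (f' e) r \<le> C / r"
proof -
  obtain M where M: "0 < M" "\<And>x. \<bar>f' e x\<bar> \<le> M" using f'_bounded[OF e] by blast
  define C1 where "C1 = (\<integral>x. \<bar>f' e x\<bar> * M \<partial>lborel)"
  define C2 where "C2 = (\<integral>p. \<bar>f (fst p) * f (snd p) * 1\<bar> * 3 \<partial>(lborel :: ('a \<times> 'a) measure))"
  have C1: "0 \<le> C1" unfolding C1_def using M by (intro Bochner_Integration.integral_nonneg) auto
  have C2: "0 \<le> C2" unfolding C2_def by (intro Bochner_Integration.integral_nonneg) auto
  have 1: "heat_energy (f' e) r \<le> C1" if r: "0 < r" for r
  proof -
    have [measurable]: "f' e \<in> borel_measurable borel" using e by simp
    have "heat_energy (f' e) r \<le> (\<integral>x. \<bar>f' e x\<bar> * M \<partial>lborel)"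
      unfolding heat_energy_def
    proof (rule integral_mono_AE')
      show "integrable lborel (\<lambda>x. \<bar>f' e x\<bar> * M)"
        using f'_integrable[OF e] by auto
      show "AE x in lborel. f' e x * heat (f' e) r x \<le> \<bar>f' e x\<bar> * M"
      proof (rule AE_I2)
        fix x
        have "f' e x * heat (f' e) r x \<le> \<bar>f' e x\<bar> * \<bar>heat (f' e) r x\<bar>" by (simp add: abs_mult[symmetric])
        also have "\<dots> \<le> \<bar>f' e x\<bar> * M" using M r by (intro mult_left_mono abs_heat_le) auto
        finally show "f' e x * heat (f' e) r x \<le> \<bar>f' e x\<bar> * M" .
      qed
    qed (use M in auto)
    then show ?thesis by (simp add: C1_def)
  qed
  have 2: "heat_energy (f' e) r \<le> C2 / r" if r: "1 \<le> r" for r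
  proof -
    have r0: "0 < r" using r by simp
    have b: "\<bar>(1 / r - (z \<bullet> e)\<^sup>2 / r\<^sup>2) * gauss r z\<bar> \<le> 3 / r" for z
    proof -
      define u where "u = (z \<bullet> e)\<^sup>2 / (2 * r)"
      have u: "0 \<le> u" using r by (simp add: u_def)
      have g: "gauss r z \<le> exp (- u)"
      proof -
        have "(2 * pi * r) powr (- real DIM('a) / 2) \<le> 1"
        proof -
          have "1 * 1 \<le> (2 * pi) * r" using r pi_gt3 by (intro mult_mono) auto
          then show ?thesis using powr_mono[of "- real DIM('a) / 2" 0 "2 * pi * r"] r by simp
        qed
        moreover have "exp (- (norm z)\<^sup>2 / (2 * r)) \<le> exp (- u)"
        proof -
          have "\<bar>z \<bullet> e\<bar> \<le> norm z" using e by (rule Basis_le_norm)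
          then have "(z \<bullet> e)\<^sup>2 \<le> (norm z)\<^sup>2" using power_mono[of "\<bar>z \<bullet> e\<bar>" "norm z" 2] by simp
          then show ?thesis using r by (simp add: u_def divide_right_mono)
        qed
        ultimately show ?thesis unfolding gauss_eq[OF r0]
          using mult_mono[of "(2 * pi * r) powr (- real DIM('a) / 2)" 1 "exp (- (norm z)\<^sup>2 / (2 * r))" "exp (- u)"] by simp
      qed
      have "u \<le> exp u" using exp_ge_add_one_self[of u] by linarith
      then have "u * exp (- u) \<le> 1" by (simp add: exp_minus divide_simps)
      moreover have "exp (- u) \<le> 1" using u by simp
      moreover have "(1 + 2 * u) * exp (- u) = exp (- u) + 2 * (u * exp (- u))" by (simp add: distrib_right)
      ultimately have u2: "(1 + 2 * u) * exp (- u) \<le> 3" by linarith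
      have "1 / r - (z \<bullet> e)\<^sup>2 / r\<^sup>2 = (1 - 2 * u) / r"
      proof -
        have "(z \<bullet> e)\<^sup>2 / r\<^sup>2 = 2 * u / r" unfolding u_def using r0 by (simp add: power2_eq_square[of r])
        then show ?thesis by (simp add: diff_divide_distrib)
      qed
      then have "\<bar>(1 / r - (z \<bullet> e)\<^sup>2 / r\<^sup>2) * gauss r z\<bar> = \<bar>1 - 2 * u\<bar> / r * gauss r z"
        using r by (simp add: abs_mult)
      also have "\<dots> \<le> (1 + 2 * u) / r * exp (- u)"
        using r u g by (intro mult_mono divide_right_mono) auto
      also have "\<dots> \<le> 3 / r" using u2 r by (simp add: divide_right_mono)
      finally show ?thesis .
    qed
    have "heat_energy (f' e) r \<le> (\<integral>p. \<bar>f (fst p) * f (snd p) * 1\<bar> * 3 / r \<partial>lborel)"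
      unfolding heat_energy_f'[OF r0 e]
    proof (rule integral_mono_AE')
      show "integrable lborel (\<lambda>p. \<bar>f (fst p) * f (snd p) * 1\<bar> * 3 / r)"
        using integrable_ff[of "\<lambda>_. 1"] by auto
      show "AE p in lborel. f (fst p) * f (snd p) * ((1 / r - ((snd p - fst p) \<bullet> e)\<^sup>2 / r\<^sup>2) * gauss r (snd p - fst p))
         \<le> \<bar>f (fst p) * f (snd p) * 1\<bar> * 3 / r"
      proof (rule AE_I2)
        fix p :: "'a \<times> 'a"
        let ?c = "(1 / r - ((snd p - fst p) \<bullet> e)\<^sup>2 / r\<^sup>2) * gauss r (snd p - fst p)"
        have "f (fst p) * f (snd p) * ?c \<le> \<bar>f (fst p) * f (snd p)\<bar> * \<bar>?c\<bar>"
          using abs_ge_self[of "f (fst p) * f (snd p) * ?c"] by (simp only: abs_mult)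
        also have "\<dots> \<le> \<bar>f (fst p) * f (snd p)\<bar> * (3 / r)"
          by (intro mult_left_mono b) auto
        finally show "f (fst p) * f (snd p) * ?c \<le> \<bar>f (fst p) * f (snd p) * 1\<bar> * 3 / r" by simp
      qed
    qed (use r0 in auto)
    also have "\<dots> = C2 / r" by (simp add: C2_def)
    finally show ?thesis .
  qed
  show ?thesis
  proof (rule that[of "C1 + C2 + 1"])
    show "heat_energy (f' e) r \<le> (C1 + C2 + 1)" if "0 < r" for r using 1[OF that] C2 by simp
    show "heat_energy (f' e) r \<le> (C1 + C2 + 1) / r" if "1 \<le> r" for r
      using 2[OF that] C1 that divide_right_mono[of C2 "C1 + C2 + 1" r] by simp
  qed (use C1 C2 in simp)
qed

text \<open>The fundamental theorem of calculus in time, in integrated form: the kernel is differentiated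
  pointwise and the order of integration is exchanged.\<close>

lemma heat_energy_diff:
  assumes e: "0 < \<epsilon>" "\<epsilon> \<le> r"
  shows "heat_energy f \<epsilon> - heat_energy f r = (\<integral>s. indicator {\<epsilon>..r} s * (dirichlet s / 2) \<partial>lborel)"
proof -
  let ?dg = "\<lambda>s z. gauss s z * ((norm z)\<^sup>2 / (2 * s\<^sup>2) - DIM('a) / (2 * s))"
  define H where "H = (\<lambda>(s, p). indicator ({\<epsilon>..r} \<times> (K \<times> K)) (s, p) *\<^sub>R (f (fst p) * f (snd p) * ?dg s (snd p - fst p)))"
  have H: "integrable (lborel \<Otimes>\<^sub>M lborel) H"
    unfolding lborel_prod H_def case_prod_unfold prod.collapse
  proof (rule borel_integrable_compact)
    show "compact ({\<epsilon>..r} \<times> (K \<times> K))" by (intro compact_Times K compact_Icc)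
    show "continuous_on ({\<epsilon>..r} \<times> K \<times> K) (\<lambda>p. f (fst (snd p)) * f (snd (snd p)) * ?dg (fst p) (snd (snd p) - fst (snd p)))"
    proof -
      have "fst p \<noteq> 0 \<and> 0 < fst p" if "p \<in> {\<epsilon>..r} \<times> K \<times> K" for p using e that by auto
      then show ?thesis
        by (intro continuous_intros continuous_on_compose2[OF f]) simp_all
    qed
  qed
  have HI: "H (s, p) = f (fst p) * f (snd p) * (indicator {\<epsilon>..r} s *\<^sub>R ?dg s (snd p - fst p))" for s p
    using f_0 by (cases "fst p \<in> K"; cases "snd p \<in> K"; cases "s \<in> {\<epsilon>..r}") (simp_all add: H_def mem_Times_iff)
  have "(\<integral>s. indicator {\<epsilon>..r} s * (dirichlet s / 2) \<partial>lborel) = (\<integral>s. - (\<integral>p. H (s, p) \<partial>lborel) \<partial>lborel)"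
  proof (rule Bochner_Integration.integral_cong[OF refl])
    fix s :: real
    show "indicator {\<epsilon>..r} s * (dirichlet s / 2) = - (\<integral>p. H (s, p) \<partial>lborel)"
      using dirichlet_eq[of s] e by (auto simp: HI indicator_def)
  qed
  also have "\<dots> = - (\<integral>p. \<integral>s. H (s, p) \<partial>lborel \<partial>lborel)"
  proof -
    have "(\<integral>p. \<integral>s. H (s, p) \<partial>lborel \<partial>lborel) = (\<integral>s. \<integral>p. H (s, p) \<partial>lborel \<partial>lborel)"
      by (rule lborel_pair.Fubini_integral) (simp add: H)
    then show ?thesis by (simp only: Bochner_Integration.integral_minus)
  qed
  also have "\<dots> = - (\<integral>p. f (fst p) * f (snd p) * (gauss r (snd p - fst p) - gauss \<epsilon> (snd p - fst p)) \<partial>lborel)"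
  proof -
    have "(\<integral>s. indicator {\<epsilon>..r} s *\<^sub>R ?dg s z \<partial>lborel) = gauss r z - gauss \<epsilon> z" for z :: 'a
    proof (rule integral_FTC_atLeastAtMost[where F="\<lambda>s. gauss s z" and f="\<lambda>s. ?dg s z", OF e(2)])
      fix x assume "\<epsilon> \<le> x" "x \<le> r"
      then have "0 < x" using e by simp
      from gauss_time_deriv[OF this, of z]
      show "((\<lambda>s. gauss s z) has_vector_derivative ?dg x z) (at x within {\<epsilon>..r})"
        by (simp only: has_real_derivative_iff_has_vector_derivative has_vector_derivative_at_within)
    next
      have "s \<noteq> 0 \<and> 0 < s" if "s \<in> {\<epsilon>..r}" for s using e that by auto
      then show "continuous_on {\<epsilon>..r} (\<lambda>s. ?dg s z)"
        by (intro continuous_intros) simp_all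
    qed
    then show ?thesis unfolding HI by (simp only: integral_mult_right_zero)
  qed
  also have "\<dots> = heat_energy f \<epsilon> - heat_energy f r"
  proof -
    have "continuous_on UNIV (\<lambda>p :: 'a \<times> 'a. gauss s (snd p - fst p))" if "0 < s" for s
      using that by (intro continuous_intros) auto
    note i = integrable_ff[OF this]
    show ?thesis unfolding right_diff_distrib
      using e by (subst Bochner_Integration.integral_diff[OF i i]) (auto simp: heat_energy_f)
  qed
  finally show ?thesis ..
qed

lemma heat_tendsto:
  "(\<lambda>n. heat f (1 / real (Suc n)) x) \<longlonglongrightarrow> f x"
proof -
  obtain M where M: "0 < M" "\<And>x. \<bar>f x\<bar> \<le> M" using f_bounded by blast
  have eq: "heat f t x = (\<integral>z. f (x + sqrt t *\<^sub>R z) * gauss 1 z \<partial>lborel)" if t: "0 < t" for t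
  proof -
    have "heat f t x = (\<integral>y. f y * gauss t (x - y) \<partial>(density (distr lborel borel (\<lambda>z. x + sqrt t *\<^sub>R z)) (\<lambda>_. \<bar>sqrt t\<bar>^DIM('a))))"
      unfolding heat_def using t by (subst lborel_affine[of "sqrt t" x]) auto
    also have "\<dots> = (\<integral>z. (sqrt t) ^ DIM('a) * (f (x + sqrt t *\<^sub>R z) * gauss t (- (sqrt t *\<^sub>R z))) \<partial>lborel)"
      using t by (subst integral_density) (auto simp: integral_distr)
    also have "\<dots> = (\<integral>z. f (x + sqrt t *\<^sub>R z) * gauss 1 z \<partial>lborel)"
    proof (rule Bochner_Integration.integral_cong[OF refl])
      fix z :: 'a
      have "(sqrt t) ^ DIM('a) * gauss t (- (sqrt t *\<^sub>R z)) = gauss 1 z"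
      proof -
        have "gauss t (- (sqrt t *\<^sub>R z)) = (2 * pi) powr (- real DIM('a) / 2) * t powr (- real DIM('a) / 2) * exp (- (norm z)\<^sup>2 / 2)"
          using t unfolding gauss_eq[OF t] by (simp add: powr_mult power_mult_distrib)
        moreover have "(sqrt t) ^ DIM('a) = t powr (real DIM('a) / 2)"
          using t by (simp add: powr_half_sqrt[symmetric] powr_powr powr_realpow[symmetric])
        moreover have "t powr (real DIM('a) / 2) * t powr (- real DIM('a) / 2) = 1"
          using t by (simp add: powr_add[symmetric])
        ultimately show ?thesis unfolding gauss_eq[OF zero_less_one] by (simp add: mult_ac)
      qed
      then show "(sqrt t) ^ DIM('a) * (f (x + sqrt t *\<^sub>R z) * gauss t (- (sqrt t *\<^sub>R z))) = f (x + sqrt t *\<^sub>R z) * gauss 1 z"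
        by (metis mult.left_commute)
    qed
    finally show ?thesis .
  qed
  have "(\<lambda>n. \<integral>z. f (x + sqrt (1 / real (Suc n)) *\<^sub>R z) * gauss 1 z \<partial>lborel) \<longlonglongrightarrow> (\<integral>z. f x * gauss 1 (z::'a) \<partial>lborel)"
  proof (rule integral_dominated_convergence[where w="\<lambda>z::'a. M * gauss 1 z"])
    show "integrable lborel (\<lambda>z::'a. M * gauss 1 z)"
      using integrable_gauss(1)[of 1 "0::'a"] by simp
    show "AE z in lborel. (\<lambda>n. f (x + sqrt (1 / real (Suc n)) *\<^sub>R z) * gauss 1 z) \<longlonglongrightarrow> f x * gauss 1 z"
    proof (rule AE_I2)
      fix z :: 'a
      have "(\<lambda>n. sqrt (1 / real (Suc n))) \<longlonglongrightarrow> sqrt 0"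
        by (intro tendsto_real_sqrt LIMSEQ_Suc[OF lim_1_over_n])
      then have "(\<lambda>n. x + sqrt (1 / real (Suc n)) *\<^sub>R z) \<longlonglongrightarrow> x + sqrt 0 *\<^sub>R z"
        by (intro tendsto_add tendsto_scaleR tendsto_const)
      then have "(\<lambda>n. x + sqrt (1 / real (Suc n)) *\<^sub>R z) \<longlonglongrightarrow> x" by simp
      then have "(\<lambda>n. f (x + sqrt (1 / real (Suc n)) *\<^sub>R z)) \<longlonglongrightarrow> f x"
        using f by (intro isCont_tendsto_compose[where g=f]) (auto simp: continuous_on_eq_continuous_at)
      then show "(\<lambda>n. f (x + sqrt (1 / real (Suc n)) *\<^sub>R z) * gauss 1 z) \<longlonglongrightarrow> f x * gauss 1 z"
        by (intro tendsto_intros)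
    qed
    show "AE z in lborel. norm (f (x + sqrt (1 / real (Suc n)) *\<^sub>R z) * gauss 1 z) \<le> M * gauss 1 z" for n
      using M by (intro AE_I2) (auto simp: abs_mult intro!: mult_right_mono)
  qed auto
  also have "(\<integral>z. f x * gauss 1 (z::'a) \<partial>lborel) = f x"
    using integral_gauss(1)[of 1 "0::'a"] by simp
  finally show ?thesis by (subst eq) auto
qed

lemma heat_energy_tendsto:
  "(\<lambda>n. heat_energy f (1 / real (Suc n))) \<longlonglongrightarrow> (\<integral>x. (f x)\<^sup>2 \<partial>lborel)"
proof -
  obtain M where M: "0 < M" "\<And>x. \<bar>f x\<bar> \<le> M" using f_bounded by blast
  show ?thesis unfolding heat_energy_def power2_eq_square
  proof (rule integral_dominated_convergence[where w="\<lambda>x. \<bar>f x\<bar> * M"])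
    show "integrable lborel (\<lambda>x. \<bar>f x\<bar> * M)" using f_integrable by auto
    show "AE x in lborel. (\<lambda>n. f x * heat f (1 / real (Suc n)) x) \<longlonglongrightarrow> f x * f x"
      by (intro AE_I2 tendsto_intros heat_tendsto)
    show "AE x in lborel. norm (f x * heat f (1 / real (Suc n)) x) \<le> \<bar>f x\<bar> * M" for n
      unfolding real_norm_def abs_mult using M by (intro AE_I2 mult_left_mono abs_heat_le) auto
  qed auto
qed

text \<open>Let the lower limit in \<open>heat_energy_diff\<close> tend to 0, where the heat energy tends to
  \<open>\<integral>f\<^sup>2\<close>.\<close>

lemma nn_integral_dirichlet:
  assumes r: "0 < r"
  shows "(\<integral>\<^sup>+s. ennreal (dirichlet s / 2) * indicator {0<..r} s \<partial>lborel) = ennreal ((\<integral>x. (f x)\<^sup>2 \<partial>lborel) - heat_energy f r)"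
proof -
  have "\<forall>e\<in>Basis. \<exists>C. \<forall>r>0. heat_energy (f' e) r \<le> C"
    using heat_energy_f'_bound by (metis (full_types))
  then obtain C where C: "\<And>e r. e \<in> Basis \<Longrightarrow> 0 < r \<Longrightarrow> heat_energy (f' e) r \<le> C e"
    by metis
  have bd: "dirichlet s \<le> (\<Sum>e\<in>Basis. C e)" if "0 < s" for s
    unfolding dirichlet_def using C that by (intro sum_mono) auto
  define F where "F n s = ennreal (dirichlet s / 2) * indicator {1 / real (Suc n)..r} s" for n s
  have inc: "incseq F"
  proof (intro incseq_SucI le_funI)
    fix n s
    have "1 / real (Suc (Suc n)) \<le> 1 / real (Suc n)" by (simp add: frac_le)
    then show "F n s \<le> F (Suc n) s" by (auto simp: F_def indicator_def simp del: of_nat_Suc)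
  qed
  have sup: "(SUP n. F n s) = ennreal (dirichlet s / 2) * indicator {0<..r} s" for s
  proof (cases "0 < s \<and> s \<le> r")
    case True
    then obtain n where n: "1 / real (Suc n) < s" using nat_approx_posE by metis
    show ?thesis
    proof (rule antisym)
      show "(SUP n. F n s) \<le> ennreal (dirichlet s / 2) * indicator {0<..r} s"
        using True by (intro SUP_least) (auto simp: F_def indicator_def)
      have "ennreal (dirichlet s / 2) * indicator {0<..r} s = F n s" using True n by (auto simp: F_def indicator_def)
      also have "\<dots> \<le> (SUP n. F n s)" by (rule SUP_upper) auto
      finally show "ennreal (dirichlet s / 2) * indicator {0<..r} s \<le> (SUP n. F n s)" .
    qed
  next
    case False
    have "F n s = 0" for n
    proof -
      have "s \<notin> {1 / real (Suc n)..r}"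
        using False order.strict_trans2[of 0 "1 / real (Suc n)" s] by auto
      then show ?thesis by (simp add: F_def)
    qed
    then show ?thesis using False by (auto simp: indicator_def)
  qed
  have int: "eventually (\<lambda>n. (\<integral>\<^sup>+s. F n s \<partial>lborel) = ennreal (heat_energy f (1 / real (Suc n)) - heat_energy f r)) sequentially"
  proof -
    obtain n0 where n0: "1 / real (Suc n0) < r" using nat_approx_posE[OF r] by metis
    show ?thesis
    proof (rule eventually_sequentiallyI[of n0])
      fix n assume "n0 \<le> n"
      then have "1 / real (Suc n) \<le> 1 / real (Suc n0)" by (intro divide_left_mono) auto
      then have n: "1 / real (Suc n) \<le> r" using n0 by simp
      have pos: "0 < 1 / real (Suc n)" by simp
      have 0: "0 \<le> indicator {1 / real (Suc n)..r} s * (dirichlet s / 2)" for s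
        using dirichlet_nonneg[of s] order.strict_trans2[OF pos, of s] by (cases "s \<in> {1 / real (Suc n)..r}") (auto simp del: of_nat_Suc)
      have "integrable lborel (\<lambda>s. indicator {1 / real (Suc n)..r} s * (dirichlet s / 2))"
      proof (rule Bochner_Integration.integrable_bound)
        show "integrable lborel (\<lambda>s. indicator {1 / real (Suc n)..r} s *\<^sub>R (\<Sum>e\<in>Basis. C e))"
          by (intro borel_integrable_compact) auto
        show "AE s in lborel. norm (indicator {1 / real (Suc n)..r} s * (dirichlet s / 2)) \<le> norm (indicator {1 / real (Suc n)..r} s *\<^sub>R (\<Sum>e\<in>Basis. C e))"
        proof (rule AE_I2)
          fix s
          show "norm (indicator {1 / real (Suc n)..r} s * (dirichlet s / 2)) \<le> norm (indicator {1 / real (Suc n)..r} s *\<^sub>R (\<Sum>e\<in>Basis. C e))"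
            using bd[of s] dirichlet_nonneg[of s] order.strict_trans2[OF pos, of s] by (cases "s \<in> {1 / real (Suc n)..r}") (auto simp del: of_nat_Suc)
        qed
      qed auto
      then have "(\<integral>\<^sup>+s. ennreal (indicator {1 / real (Suc n)..r} s * (dirichlet s / 2)) \<partial>lborel) =
        ennreal (\<integral>s. indicator {1 / real (Suc n)..r} s * (dirichlet s / 2) \<partial>lborel)"
        using 0 by (intro nn_integral_eq_integral) auto
      also have "\<dots> = ennreal (heat_energy f (1 / real (Suc n)) - heat_energy f r)"
        by (subst heat_energy_diff[OF pos n]) simp
      finally have *: "(\<integral>\<^sup>+s. ennreal (indicator {1 / real (Suc n)..r} s * (dirichlet s / 2)) \<partial>lborel) =
        ennreal (heat_energy f (1 / real (Suc n)) - heat_energy f r)" .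
      show "(\<integral>\<^sup>+s. F n s \<partial>lborel) = ennreal (heat_energy f (1 / real (Suc n)) - heat_energy f r)"
      proof -
        have "F n s = ennreal (indicator {1 / real (Suc n)..r} s * (dirichlet s / 2))" for s
          by (cases "s \<in> {1 / real (Suc n)..r}") (simp_all add: F_def)
        with * show ?thesis by simp
      qed
    qed
  qed
  have "(\<lambda>n. \<integral>\<^sup>+s. F n s \<partial>lborel) \<longlonglongrightarrow> (SUP n. \<integral>\<^sup>+s. F n s \<partial>lborel)"
    using inc unfolding incseq_def le_fun_def by (intro LIMSEQ_SUP) (simp add: incseq_def nn_integral_mono)
  also have "(SUP n. \<integral>\<^sup>+s. F n s \<partial>lborel) = (\<integral>\<^sup>+s. (SUP n. F n s) \<partial>lborel)"
    by (rule nn_integral_monotone_convergence_SUP[symmetric, OF inc]) (simp add: F_def[abs_def])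
  finally have 1: "(\<lambda>n. \<integral>\<^sup>+s. F n s \<partial>lborel) \<longlonglongrightarrow> (\<integral>\<^sup>+s. ennreal (dirichlet s / 2) * indicator {0<..r} s \<partial>lborel)"
    by (simp add: sup)
  have "(\<lambda>n. ennreal (heat_energy f (1 / real (Suc n)) - heat_energy f r)) \<longlonglongrightarrow> ennreal ((\<integral>x. (f x)\<^sup>2 \<partial>lborel) - heat_energy f r)"
    by (intro tendsto_ennrealI tendsto_intros heat_energy_tendsto)
  then have "(\<lambda>n. \<integral>\<^sup>+s. F n s \<partial>lborel) \<longlonglongrightarrow> ennreal ((\<integral>x. (f x)\<^sup>2 \<partial>lborel) - heat_energy f r)"
    using int by (subst tendsto_cong) auto
  then show ?thesis using 1 LIMSEQ_unique by blast
qed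

end

section \<open>Power weights in time and the Riesz kernel\<close>

text \<open>The measure \<open>t powr (a - 1) dt\<close> on the positive half-line, infinite in total, and
  near 0 even locally infinite when \<open>a \<le> 0\<close>.\<close>

definition mellin :: "real \<Rightarrow> real measure" where
  "mellin a = density lborel (\<lambda>t. ennreal (t powr (a - 1)) * indicator {0<..} t)"

lemma space_mellin [simp]: "space (mellin a) = UNIV"
  by (simp add: mellin_def)

lemma sets_mellin [simp, measurable_cong]: "sets (mellin a) = sets borel"
  by (simp add: mellin_def)

lemma sigma_finite_mellin: "sigma_finite_measure (mellin a)"
proof -
  have "(\<lambda>t. ennreal (t powr (a - 1)) * indicator {0<..} t) \<in> borel_measurable lborel" by measurable
  then show ?thesis unfolding mellin_def
    by (subst sigma_finite_measure.sigma_finite_iff_density_finite[OF sigma_finite_lborel]) (auto simp: indicator_def)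
qed

interpretation mellin: sigma_finite_measure "mellin a" by (rule sigma_finite_mellin)

lemma nn_integral_mellin:
  assumes [measurable]: "h \<in> borel_measurable borel"
  shows "(\<integral>\<^sup>+t. h t \<partial>mellin a) = (\<integral>\<^sup>+t. ennreal (t powr (a - 1)) * indicator {0<..} t * h t \<partial>lborel)"
  unfolding mellin_def by (rule nn_integral_density) measurable

lemma AE_mellin: "AE t in mellin a. 0 < t"
  unfolding mellin_def by (subst AE_density) (auto simp: indicator_def)

lemma nn_integral_gauss_mellin:
  fixes z :: "'a::euclidean_space"
  assumes "z \<noteq> 0"
  shows "(\<integral>\<^sup>+t. ennreal (gauss t z) \<partial>mellin a) = gauss_mix DIM('a) a * ennreal (norm z powr (2 * a - DIM('a)))"
proof -
  have "(\<integral>\<^sup>+t. ennreal (gauss t z) \<partial>mellin a) = (\<integral>\<^sup>+t. ennreal (t powr (a - 1) * gauss t z) * indicator {0<..} t \<partial>lborel)"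
    by (subst nn_integral_mellin) (auto simp: ennreal_mult mult_ac intro!: nn_integral_cong)
  then show ?thesis using nn_integral_gauss_mix[OF assms] by metis
qed

lemma nn_integral_mellin_powr_tail:
  assumes "a < b" "0 < s"
  shows "(\<integral>\<^sup>+t. ennreal (t powr (- b)) * indicator {s..} t \<partial>mellin a) = ennreal (s powr (a - b) / (b - a))"
proof -
  have "(\<integral>\<^sup>+t. ennreal (t powr (- b)) * indicator {s..} t \<partial>mellin a) = (\<integral>\<^sup>+t. ennreal (t powr (a - b - 1)) * indicator {s..} t \<partial>lborel)"
  proof (subst nn_integral_mellin, simp, rule nn_integral_cong)
    fix t
    have "t powr (a - 1) * t powr (- b) = t powr (a - b - 1)" by (simp add: powr_add[symmetric] algebra_simps)
    then show "ennreal (t powr (a - 1)) * indicator {0<..} t * (ennreal (t powr - b) * indicator {s..} t) =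
         ennreal (t powr (a - b - 1)) * indicator {s..} t"
      using assms by (cases "s \<le> t") (auto simp: ennreal_mult[symmetric] indicator_def)
  qed
  also have "\<dots> = ennreal (- (s powr (a - b - 1 + 1)) / (a - b - 1 + 1))"
    using assms by (intro nn_integral_has_integral_lebesgue' has_integral_powr_to_inf) auto
  also have "- (s powr (a - b - 1 + 1)) / (a - b - 1 + 1) = s powr (a - b) / (b - a)"
    using assms by (simp add: field_simps)
  finally show ?thesis .
qed

lemma nn_integral_mellin_head:
  assumes "0 < a"
  shows "emeasure (mellin a) {..1} = ennreal (1 / a)"
proof -
  have "emeasure (mellin a) {..1} = (\<integral>\<^sup>+t. indicator {..1} t \<partial>mellin a)" by simp
  also have "\<dots> = (\<integral>\<^sup>+t. ennreal (t powr (a - 1)) * indicator {0..1} t \<partial>lborel)"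
    by (subst nn_integral_mellin) (auto intro!: nn_integral_cong simp: indicator_def)
  also have "\<dots> = ennreal (1 / a)" using assms nn_integral_powr_to[of "a - 1" 1] by simp
  finally show ?thesis .
qed

text \<open>Representing the kernel by Gaussians, use \<open>P\<^sub>t f \<le> sup f\<close> for \<open>t
  \<le> 1\<close> and \<open>P\<^sub>t f \<le> (2 \<pi> t) powr (- n / 2) * \<integral>f\<close> for
  \<open>t > 1\<close>.\<close>

lemma riesz_kernel_bound:
  assumes a: "0 < a" "a < real DIM('a::euclidean_space) / 2"
  obtains C where "0 \<le> C"
    "\<And>f x M. f \<in> borel_measurable borel \<Longrightarrow> (\<And>y. f y \<le> M) \<Longrightarrow>
       (\<integral>\<^sup>+y. f y * ennreal (norm (x - y) powr (2 * a - DIM('a))) \<partial>lborel) \<le> ennreal C * (M + (\<integral>\<^sup>+(y::'a). f y \<partial>lborel))"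
proof -
  define n where "n = real DIM('a)"
  define g where "g = enn2real (gauss_mix DIM('a) a)"
  have g: "0 < g" "gauss_mix DIM('a) a = ennreal g"
    using gauss_mix_finite[of a "DIM('a)"] a gauss_mix_pos[of "DIM('a)" a]
    by (auto simp: g_def enn2real_positive_iff)
  define C where "C = (1 / a + (2 * pi) powr (- n / 2) / (n / 2 - a)) / g"
  have C: "0 \<le> C" using a g by (simp add: C_def n_def)
  show ?thesis
  proof (rule that[OF C])
    fix f :: "'a \<Rightarrow> ennreal" and x M assume [measurable]: "f \<in> borel_measurable borel" and M: "\<And>y. f y \<le> M"
    let ?I = "\<integral>\<^sup>+y. f y \<partial>lborel"
    have "(\<integral>\<^sup>+y. f y * ennreal (norm (x - y) powr (2 * a - DIM('a))) \<partial>lborel) * ennreal g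
       = (\<integral>\<^sup>+y. f y * (\<integral>\<^sup>+t. ennreal (gauss t (x - y)) \<partial>mellin a) \<partial>lborel)"
    proof (subst nn_integral_multc[symmetric], measurable, rule nn_integral_cong_AE)
      have "AE y in lborel. y \<noteq> x" by (rule AE_lborel_singleton)
      then show "AE y in lborel. f y * ennreal (norm (x - y) powr (2 * a - DIM('a))) * ennreal g = f y * (\<integral>\<^sup>+t. ennreal (gauss t (x - y)) \<partial>mellin a)"
        by eventually_elim (simp add: nn_integral_gauss_mellin g(2) mult_ac)
    qed
    also have "\<dots> = (\<integral>\<^sup>+y. \<integral>\<^sup>+t. f y * ennreal (gauss t (x - y)) \<partial>mellin a \<partial>lborel)"
      by (simp add: nn_integral_cmult)
    also have "\<dots> = (\<integral>\<^sup>+t. \<integral>\<^sup>+y. f y * ennreal (gauss t (x - y)) \<partial>lborel \<partial>mellin a)"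
    proof -
      interpret pair_sigma_finite "mellin a" "lborel :: 'a measure" ..
      show ?thesis by (rule Fubini') measurable
    qed
    also have "\<dots> \<le> (\<integral>\<^sup>+t. M * indicator {..1} t + ennreal ((2 * pi) powr (- n / 2)) * ?I * (ennreal (t powr (- (n / 2))) * indicator {1..} t) \<partial>mellin a)"
    proof (rule nn_integral_mono_AE)
      show "AE t in mellin a. (\<integral>\<^sup>+y. f y * ennreal (gauss t (x - y)) \<partial>lborel) \<le> M * indicator {..1} t + ennreal ((2 * pi) powr (- n / 2)) * ?I * (ennreal (t powr (- (n / 2))) * indicator {1..} t)"
        using AE_mellin
      proof eventually_elim
        case (elim t)
        show ?case
        proof (cases "t \<le> 1")
          case True
          have "(\<integral>\<^sup>+y. f y * ennreal (gauss t (x - y)) \<partial>lborel) \<le> (\<integral>\<^sup>+y. M * ennreal (gauss t (x - y)) \<partial>lborel)"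
            by (intro nn_integral_mono mult_right_mono M) auto
          also have "\<dots> = M" using elim by (simp add: nn_integral_cmult nn_integral_gauss_shift)
          also have "M \<le> M * indicator {..1} t + ennreal ((2 * pi) powr (- n / 2)) * ?I * (ennreal (t powr (- (n / 2))) * indicator {1..} t)"
            using True by simp
          finally show ?thesis .
        next
          case False
          have "(\<integral>\<^sup>+y. f y * ennreal (gauss t (x - y)) \<partial>lborel) \<le> (\<integral>\<^sup>+y. ennreal ((2 * pi * t) powr (- n / 2)) * f y \<partial>lborel)"
            unfolding n_def using gauss_le[OF elim]
            by (intro nn_integral_mono) (auto simp: mult.commute intro!: mult_left_mono ennreal_leI)
          also have "\<dots> = ennreal ((2 * pi * t) powr (- n / 2)) * ?I" by (simp add: nn_integral_cmult)
          also have "(2 * pi * t) powr (- n / 2) = (2 * pi) powr (- n / 2) * t powr (- (n / 2))"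
            using elim by (simp add: powr_mult)
          finally show ?thesis using False by (simp add: ennreal_mult mult_ac)
        qed
      qed
    qed
    also have "\<dots> = M * ennreal (1 / a) + ennreal ((2 * pi) powr (- n / 2)) * ?I * ennreal (1 / (n / 2 - a))"
      using a unfolding n_def
      by (simp add: nn_integral_add nn_integral_cmult nn_integral_mellin_head nn_integral_mellin_powr_tail)
    also have "\<dots> \<le> ennreal (C * g) * (M + ?I)"
    proof -
      have Cg: "ennreal (C * g) = ennreal (1 / a) + ennreal ((2 * pi) powr (- n / 2) / (n / 2 - a))"
        using a g by (subst ennreal_plus[symmetric]) (auto simp: C_def n_def)
      have "M * ennreal (1 / a) \<le> M * ennreal (C * g)"
        unfolding Cg by (intro mult_left_mono) auto
      moreover have "ennreal ((2 * pi) powr (- n / 2)) * ?I * ennreal (1 / (n / 2 - a)) = ?I * ennreal ((2 * pi) powr (- n / 2) / (n / 2 - a))"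
        using a by (simp add: ennreal_mult[symmetric] mult_ac n_def)
      moreover have "\<dots> \<le> ?I * ennreal (C * g)"
        unfolding Cg by (intro mult_left_mono) auto
      ultimately show ?thesis by (simp add: distrib_left add_mono mult.commute)
    qed
    finally have "(\<integral>\<^sup>+y. f y * ennreal (norm (x - y) powr (2 * a - DIM('a))) \<partial>lborel) * ennreal g \<le> (ennreal C * (M + ?I)) * ennreal g"
      using C g by (simp add: ennreal_mult mult_ac)
    then show "(\<integral>\<^sup>+y. f y * ennreal (norm (x - y) powr (2 * a - DIM('a))) \<partial>lborel) \<le> ennreal C * (M + ?I)"
      using g(1) ennreal_mult_le_mult_iff[of "ennreal g"] by (simp add: mult.commute[of _ "ennreal g"])
  qed
qed

text \<open>The Riesz potential is a superposition of heat evolutions.\<close>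

lemma riesz_heat:
  fixes f :: "'a::euclidean_space \<Rightarrow> real"
  assumes a: "0 < a" "a < real DIM('a) / 2" and f: "integrable lborel f" and b: "\<And>x. \<bar>f x\<bar> \<le> M"
  shows "integrable lborel (\<lambda>y. f y * norm (x - y) powr (2 * a - DIM('a)))"
    and "(\<integral>t. heat f t x \<partial>mellin a) = enn2real (gauss_mix DIM('a) a) * (\<integral>y. f y * norm (x - y) powr (2 * a - DIM('a)) \<partial>lborel)"
proof -
  have [measurable]: "f \<in> borel_measurable borel" using f by simp
  have M: "0 \<le> M" using b[of undefined] by linarith
  define g where "g = enn2real (gauss_mix DIM('a) a)"
  have g: "0 < g" "gauss_mix DIM('a) a = ennreal g"
    using gauss_mix_finite[of a "DIM('a)"] a gauss_mix_pos[of "DIM('a)" a]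
    by (auto simp: g_def enn2real_positive_iff)
  obtain C where C: "0 \<le> C" "\<And>f (x::'a) M. f \<in> borel_measurable borel \<Longrightarrow> (\<And>y. f y \<le> M) \<Longrightarrow>
       (\<integral>\<^sup>+y. f y * ennreal (norm (x - y) powr (2 * a - DIM('a))) \<partial>lborel) \<le> ennreal C * (M + (\<integral>\<^sup>+(y::'a). f y \<partial>lborel))"
    using riesz_kernel_bound[OF a] by blast
  have fin: "(\<integral>\<^sup>+y. ennreal (norm (f y)) \<partial>lborel) < \<infinity>"
    using f unfolding integrable_iff_bounded by simp
  have "(\<integral>\<^sup>+y. ennreal \<bar>f y\<bar> * ennreal (norm (x - y) powr (2 * a - DIM('a))) \<partial>lborel) \<le> ennreal C * (ennreal M + (\<integral>\<^sup>+y. ennreal \<bar>f y\<bar> \<partial>lborel))"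
    by (rule C(2)) (auto intro!: ennreal_leI b)
  also have "\<dots> < \<infinity>" using fin by (simp add: ennreal_mult_less_top)
  finally have fin2: "(\<integral>\<^sup>+y. ennreal \<bar>f y\<bar> * ennreal (norm (x - y) powr (2 * a - DIM('a))) \<partial>lborel) < \<infinity>" .
  then show "integrable lborel (\<lambda>y. f y * norm (x - y) powr (2 * a - DIM('a)))"
    by (intro integrableI_bounded) (auto simp: abs_mult ennreal_mult)
  interpret pair_sigma_finite "lborel :: 'a measure" "mellin a" ..
  have kern: "(\<integral>t. gauss t (x - y) \<partial>mellin a) = g * norm (x - y) powr (2 * a - DIM('a))" if "y \<noteq> x" for y
    using nn_integral_gauss_mellin[of "x - y" a] that g
    by (subst integral_eq_nn_integral) (auto simp: ennreal_mult[symmetric] simp del: ennreal_mult)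
  have "(\<integral>\<^sup>+p. ennreal (norm (case p of (y, t) \<Rightarrow> f y * gauss t (x - y))) \<partial>(lborel \<Otimes>\<^sub>M mellin a))
     = (\<integral>\<^sup>+y. \<integral>\<^sup>+t. ennreal \<bar>f y\<bar> * ennreal (gauss t (x - y)) \<partial>mellin a \<partial>lborel)"
    by (subst mellin.nn_integral_fst[symmetric]) (auto simp: abs_mult ennreal_mult)
  also have "\<dots> = (\<integral>\<^sup>+y. ennreal \<bar>f y\<bar> * (ennreal g * ennreal (norm (x - y) powr (2 * a - DIM('a)))) \<partial>lborel)"
  proof (rule nn_integral_cong_AE)
    have "AE y in lborel. y \<noteq> x" by (rule AE_lborel_singleton)
    then show "AE y in lborel. (\<integral>\<^sup>+t. ennreal \<bar>f y\<bar> * ennreal (gauss t (x - y)) \<partial>mellin a) = ennreal \<bar>f y\<bar> * (ennreal g * ennreal (norm (x - y) powr (2 * a - DIM('a))))"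
      by eventually_elim (simp add: nn_integral_cmult nn_integral_gauss_mellin g(2))
  qed
  also have "\<dots> = ennreal g * (\<integral>\<^sup>+y. ennreal \<bar>f y\<bar> * ennreal (norm (x - y) powr (2 * a - DIM('a))) \<partial>lborel)"
    by (subst nn_integral_cmult[symmetric]) (auto simp: mult_ac)
  also have "\<dots> < \<infinity>" using fin2 by (simp add: ennreal_mult_less_top)
  finally have i: "integrable (lborel \<Otimes>\<^sub>M mellin a) (\<lambda>(y, t). f y * gauss t (x - y))"
    by (intro integrableI_bounded) auto
  have "(\<integral>t. heat f t x \<partial>mellin a) = (\<integral>y. \<integral>t. f y * gauss t (x - y) \<partial>mellin a \<partial>lborel)"
    unfolding heat_def using Fubini_integral[OF i] by simp
  also have "\<dots> = (\<integral>y. g * (f y * norm (x - y) powr (2 * a - DIM('a))) \<partial>lborel)"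
  proof (rule integral_cong_AE)
    have "AE y in lborel. y \<noteq> x" by (rule AE_lborel_singleton)
    then show "AE y in lborel. (\<integral>t. f y * gauss t (x - y) \<partial>mellin a) = g * (f y * norm (x - y) powr (2 * a - DIM('a)))"
      by eventually_elim (simp add: kern)
  qed measurable
  finally show "(\<integral>t. heat f t x \<partial>mellin a) = enn2real (gauss_mix DIM('a) a) * (\<integral>y. f y * norm (x - y) powr (2 * a - DIM('a)) \<partial>lborel)"
    by (simp add: g_def)
qed

text \<open>The constant is \<open>Beta a a\<close>: substituting \<open>t = r \<tau>\<close>, the convolution
  of \<open>t powr (a - 1)\<close> with itself on the half-line is \<open>Beta a a * r powr (2 * a -
  1)\<close>.\<close>

lemma mellin_convolution:
  assumes a: "0 < a"
  obtains B where "0 < B" "\<And>h. h \<in> borel_measurable borel \<Longrightarrow>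
    (\<integral>\<^sup>+t. \<integral>\<^sup>+s. h (t + s) \<partial>mellin a \<partial>mellin a) = ennreal B * (\<integral>\<^sup>+r. h r \<partial>mellin (2 * a))"
proof (rule that[of "Beta a a"])
  show "0 < Beta a a" using a by (simp add: Beta_def)
  fix h :: "real \<Rightarrow> ennreal" assume [measurable]: "h \<in> borel_measurable borel"
  let ?w = "\<lambda>t. ennreal (t powr (a - 1)) * indicator {0<..} (t::real)"
  have "(\<integral>\<^sup>+t. \<integral>\<^sup>+s. h (t + s) \<partial>mellin a \<partial>mellin a) = (\<integral>\<^sup>+t. ?w t * (\<integral>\<^sup>+s. ?w s * h (t + s) \<partial>lborel) \<partial>lborel)"
    by (simp add: nn_integral_mellin)
  also have "\<dots> = (\<integral>\<^sup>+t. ?w t * (\<integral>\<^sup>+r. ?w (r - t) * h r \<partial>lborel) \<partial>lborel)"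
  proof -
    have "(\<integral>\<^sup>+s. ?w s * h (t + s) \<partial>lborel) = (\<integral>\<^sup>+r. ?w (r - t) * h r \<partial>lborel)" for t
      by (subst nn_integral_real_affine[where c=1 and t="- t"]) auto
    then show ?thesis by simp
  qed
  also have "\<dots> = (\<integral>\<^sup>+t. \<integral>\<^sup>+r. h r * (?w t * ?w (r - t)) \<partial>lborel \<partial>lborel)"
    by (subst nn_integral_cmult[symmetric]) (auto simp: mult_ac)
  also have "\<dots> = (\<integral>\<^sup>+r. \<integral>\<^sup>+t. h r * (?w t * ?w (r - t)) \<partial>lborel \<partial>lborel)"
    by (rule lborel_pair.Fubini') measurable
  also have "\<dots> = (\<integral>\<^sup>+r. h r * (\<integral>\<^sup>+t. ?w t * ?w (r - t) \<partial>lborel) \<partial>lborel)"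
    by (simp add: nn_integral_cmult)
  also have "\<dots> = (\<integral>\<^sup>+r. ennreal (Beta a a) * (ennreal (r powr (2 * a - 1)) * indicator {0<..} r * h r) \<partial>lborel)"
  proof (rule nn_integral_cong)
    fix r :: real
    have "(\<integral>\<^sup>+t. ?w t * ?w (r - t) \<partial>lborel) = ennreal (Beta a a) * (ennreal (r powr (2 * a - 1)) * indicator {0<..} r)"
    proof (cases "0 < r")
      case True
      have "(\<integral>\<^sup>+t. ?w t * ?w (r - t) \<partial>lborel) = ennreal r * (\<integral>\<^sup>+t. ?w (r * t) * ?w (r - r * t) \<partial>lborel)"
        using True by (subst nn_integral_real_affine[where c=r and t=0]) auto
      also have "(\<integral>\<^sup>+t. ?w (r * t) * ?w (r - r * t) \<partial>lborel)
        = (\<integral>\<^sup>+t. ennreal (r powr (2 * a - 2)) * (ennreal (t powr (a - 1) * (1 - t) powr (a - 1)) * indicator {0<..<1} t) \<partial>lborel)"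
      proof (rule nn_integral_cong)
        fix t :: real
        show "?w (r * t) * ?w (r - r * t) = ennreal (r powr (2 * a - 2)) * (ennreal (t powr (a - 1) * (1 - t) powr (a - 1)) * indicator {0<..<1} t)"
        proof (cases "0 < t \<and> t < 1")
          case t: True
          have "r - r * t = r * (1 - t)" by (simp add: algebra_simps)
          moreover have "r powr (a - 1) * r powr (a - 1) = r powr (2 * a - 2)" by (simp add: powr_add[symmetric])
          then have "(r * t) powr (a - 1) * (r * (1 - t)) powr (a - 1) = r powr (2 * a - 2) * (t powr (a - 1) * (1 - t) powr (a - 1))"
            using True t by (simp add: powr_mult)
          ultimately show ?thesis using True t by (simp add: ennreal_mult[symmetric])
        next
          case False
          then have "\<not> (0 < r * t \<and> 0 < r - r * t)" using True by (auto simp: zero_less_mult_iff)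
          then show ?thesis using False by (auto simp: indicator_def)
        qed
      qed
      also have "\<dots> = ennreal (r powr (2 * a - 2)) * ennreal (Beta a a)"
        using nn_integral_has_integral_lebesgue'[OF _ has_integral_Beta_real[OF a a, unfolded has_integral_Icc_iff_Ioo]]
        by (subst nn_integral_cmult) auto
      also have "ennreal r * (ennreal (r powr (2 * a - 2)) * ennreal (Beta a a)) = ennreal (Beta a a) * (ennreal (r powr (2 * a - 1)) * indicator {0<..} r)"
      proof -
        have "r * r powr (2 * a - 2) = r powr (2 * a - 1)" using True powr_add[of r 1 "2 * a - 2"] by simp
        then have "ennreal r * ennreal (r powr (2 * a - 2)) = ennreal (r powr (2 * a - 1))"
          using True by (simp add: ennreal_mult[symmetric])
        then show ?thesis using True by (simp add: mult.assoc[symmetric] mult.commute[of "ennreal (Beta a a)"])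
      qed
      finally show ?thesis .
    next
      case False
      have "(\<integral>\<^sup>+t. ?w t * ?w (r - t) \<partial>lborel) = (\<integral>\<^sup>+(t::real). 0 \<partial>lborel)"
        using False by (intro nn_integral_cong) (auto simp: indicator_def)
      then show ?thesis using False by simp
    qed
    then show "h r * (\<integral>\<^sup>+t. ?w t * ?w (r - t) \<partial>lborel) = ennreal (Beta a a) * (ennreal (r powr (2 * a - 1)) * indicator {0<..} r * h r)"
      by (simp add: mult_ac)
  qed
  also have "\<dots> = ennreal (Beta a a) * (\<integral>\<^sup>+r. h r \<partial>mellin (2 * a))"
    by (simp add: nn_integral_cmult nn_integral_mellin)
  finally show "(\<integral>\<^sup>+t. \<integral>\<^sup>+s. h (t + s) \<partial>mellin a \<partial>mellin a) = ennreal (Beta a a) * (\<integral>\<^sup>+r. h r \<partial>mellin (2 * a))" .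
qed

section \<open>Riesz energy and Gagliardo energy of smooth functions\<close>

context C1_compact begin

lemma dirichlet_finite:
  assumes "0 < a" "a < 1"
  shows "(\<integral>\<^sup>+r. ennreal (dirichlet r) \<partial>mellin a) < \<infinity>"
proof -
  have "\<forall>e\<in>Basis. \<exists>C>0. (\<forall>r>0. heat_energy (f' e) r \<le> C) \<and> (\<forall>r\<ge>1. heat_energy (f' e) r \<le> C / r)"
    using heat_energy_f'_bound by (metis (full_types))
  then obtain C where C: "\<And>e. e \<in> Basis \<Longrightarrow> 0 < C e" "\<And>e r. e \<in> Basis \<Longrightarrow> 0 < r \<Longrightarrow> heat_energy (f' e) r \<le> C e"
    "\<And>e r. e \<in> Basis \<Longrightarrow> 1 \<le> r \<Longrightarrow> heat_energy (f' e) r \<le> C e / r"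
    by metis
  define S where "S = (\<Sum>e\<in>Basis. C e)"
  have S: "0 \<le> S" unfolding S_def using C(1) by (intro sum_nonneg) (simp add: less_imp_le)
  define p where "p = (1::real)"
  have tail: "(\<integral>\<^sup>+r. ennreal (r powr (- p)) * indicator {1..} r \<partial>mellin a) = ennreal (1 / (1 - a))"
    using assms nn_integral_mellin_powr_tail[of a p 1] unfolding p_def by (simp only: powr_one_eq_one zero_less_one)
  have 1: "dirichlet r \<le> S" if "0 < r" for r
    unfolding dirichlet_def S_def using C(2) that by (intro sum_mono) auto
  have 2: "dirichlet r \<le> S * r powr (- p)" if "1 \<le> r" for r
    unfolding dirichlet_def S_def sum_distrib_right using C(3) that
    by (intro sum_mono) (simp add: p_def powr_minus_divide)
  have "(\<integral>\<^sup>+r. ennreal (dirichlet r) \<partial>mellin a) \<le> (\<integral>\<^sup>+r. ennreal S * indicator {..1} r + ennreal S * (ennreal (r powr (- p)) * indicator {1..} r) \<partial>mellin a)"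
  proof (rule nn_integral_mono_AE)
    show "AE r in mellin a. ennreal (dirichlet r) \<le> ennreal S * indicator {..1} r + ennreal S * (ennreal (r powr (- p)) * indicator {1..} r)"
      using AE_mellin
    proof eventually_elim
      case (elim r)
      show ?case
      proof (cases "r < 1")
        case True then show ?thesis using ennreal_leI[OF 1[OF elim]] by simp
      next
        case False
        then have "ennreal (dirichlet r) \<le> ennreal S * (ennreal (r powr (- p)) * indicator {1..} r)"
          using ennreal_leI[OF 2[of r]] S by (simp add: ennreal_mult[symmetric])
        also have "\<dots> \<le> ennreal S * indicator {..1} r + \<dots>" by simp
        finally show ?thesis .
      qed
    qed
  qed
  also have "\<dots> = ennreal S * ennreal (1 / a) + ennreal S * ennreal (1 / (1 - a))"
    using assms(1) by (simp add: nn_integral_add nn_integral_cmult nn_integral_mellin_head tail)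
  also have "\<dots> < \<infinity>" by (simp add: ennreal_mult_less_top)
  finally show ?thesis .
qed

text \<open>Expanding the square and using \<open>\<langle>P\<^sub>t g, P\<^sub>s g\<rangle> = \<langle>g,
  P\<^sub>t\<^sub>+\<^sub>s g\<rangle>\<close>.\<close>

lemma square_integral_riesz:
  assumes e: "e \<in> Basis" and a: "0 < a" "a < 1 / 2"
  shows "integrable lborel (\<lambda>x. (\<integral>t. heat (f' e) t x \<partial>mellin a)\<^sup>2)"
    and "(\<integral>\<^sup>+x. ennreal ((\<integral>t. heat (f' e) t x \<partial>mellin a)\<^sup>2) \<partial>lborel) = (\<integral>\<^sup>+t. \<integral>\<^sup>+s. ennreal (heat_energy (f' e) (t + s)) \<partial>mellin a \<partial>mellin a)"
proof -
  note [measurable] = f'_measurable[OF e]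
  obtain M where M: "0 < M" "\<And>x. \<bar>f' e x\<bar> \<le> M" using f'_bounded[OF e] by blast
  note fi = f'_integrable[OF e]
  obtain C where C: "0 < C" "\<And>r. 0 < r \<Longrightarrow> heat_energy (f' e) r \<le> C" "\<And>r. 1 \<le> r \<Longrightarrow> heat_energy (f' e) r \<le> C / r"
    using heat_energy_f'_bound[OF e] by blast
  define n where "n t = sqrt C * (if t \<le> 1 then 1 else t powr (- (1 / 2)))" for t :: real
  define F where "F t x = indicator {0<..} t * heat (f' e) t x" for t x
  have [measurable]: "case_prod F \<in> borel_measurable (mellin a \<Otimes>\<^sub>M lborel)" unfolding F_def by measurable
  have [measurable]: "n \<in> borel_measurable (mellin a)" unfolding n_def by measurable
  have n_pos: "0 < n t" for t using C by (auto simp: n_def)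
  have "(\<integral>\<^sup>+t. ennreal (n t) \<partial>mellin a) \<le> (\<integral>\<^sup>+t. ennreal (sqrt C) * indicator {..1} t + ennreal (sqrt C) * (ennreal (t powr (- (1 / 2))) * indicator {1..} t) \<partial>mellin a)"
    using C by (intro nn_integral_mono) (auto simp: n_def ennreal_mult[symmetric])
  also have "\<dots> = ennreal (sqrt C) * ennreal (1 / a) + ennreal (sqrt C) * ennreal (1 / (1 / 2 - a))"
    using a by (simp add: nn_integral_add nn_integral_cmult nn_integral_mellin_head nn_integral_mellin_powr_tail)
  also have "\<dots> < \<infinity>" by (simp add: ennreal_mult_less_top)
  finally have n_fin: "(\<integral>\<^sup>+t. ennreal (n t) \<partial>mellin a) < \<infinity>" .
  have F_le: "(\<integral>\<^sup>+x. ennreal ((F t x)\<^sup>2) \<partial>lborel) \<le> ennreal ((n t)\<^sup>2)" for t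
  proof (cases "0 < t")
    case True
    then have "(\<integral>\<^sup>+x. ennreal ((F t x)\<^sup>2) \<partial>lborel) = ennreal (heat_energy (f' e) (2 * t))"
      unfolding F_def using nn_integral_heat_square[OF True fi M(2)] by simp
    also have "\<dots> \<le> ennreal ((n t)\<^sup>2)"
    proof (rule ennreal_leI)
      show "heat_energy (f' e) (2 * t) \<le> (n t)\<^sup>2"
      proof (cases "t \<le> 1")
        case le: True
        then show ?thesis using C(2)[of "2 * t"] True C(1) by (simp add: n_def)
      next
        case False
        have "heat_energy (f' e) (2 * t) \<le> C / (2 * t)" using C(3)[of "2 * t"] False by simp
        also have "\<dots> \<le> C / t" using False C(1) by (simp add: field_simps)
        also have "\<dots> = (n t)\<^sup>2"
        proof -
          have "(t powr (- (1 / 2)))\<^sup>2 = t powr (- 1)" using False by (simp add: power2_eq_square powr_add[symmetric])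
          then show ?thesis using False C(1) by (simp add: n_def power_mult_distrib powr_minus_divide power_divide)
        qed
        finally show ?thesis .
      qed
    qed
    finally show ?thesis .
  qed (simp add: F_def)
  note FF = square_integral_Fubini[OF sigma_finite_mellin sigma_finite_lborel _ _ n_pos n_fin F_le, simplified]
  have FI: "(\<integral>t. F t x \<partial>mellin a) = (\<integral>t. heat (f' e) t x \<partial>mellin a)" for x
    using AE_mellin[of a] unfolding F_def
    by (intro integral_cong_AE) (auto elim!: eventually_mono)
  show int: "integrable lborel (\<lambda>x. (\<integral>t. heat (f' e) t x \<partial>mellin a)\<^sup>2)"
    using FF(1) by (simp add: FI)
  have prod: "(\<integral>x. F t x * F s x \<partial>lborel) = indicator {0<..} t * indicator {0<..} s * heat_energy (f' e) (t + s)" for t s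
    using inner_heat(2)[OF _ _ fi M(2), of t s] by (auto simp: F_def indicator_def)
  have prod_nonneg: "0 \<le> (\<integral>x. F t x * F s x \<partial>lborel)" for t s
    unfolding prod using heat_energy_f'_nonneg[OF _ e, of "t + s"] by (auto simp: indicator_def)
  have "(\<integral>\<^sup>+x. ennreal ((\<integral>t. heat (f' e) t x \<partial>mellin a)\<^sup>2) \<partial>lborel) = ennreal (\<integral>x. (\<integral>t. F t x \<partial>mellin a)\<^sup>2 \<partial>lborel)"
    using int by (subst nn_integral_eq_integral) (auto simp: FI)
  also have "\<dots> = (\<integral>\<^sup>+p. ennreal (case p of (t, s) \<Rightarrow> \<integral>x. F t x * F s x \<partial>lborel) \<partial>(mellin a \<Otimes>\<^sub>M mellin a))"
    unfolding FF(3) using FF(2) prod_nonneg by (subst nn_integral_eq_integral) auto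
  also have "\<dots> = (\<integral>\<^sup>+t. \<integral>\<^sup>+s. ennreal (\<integral>x. F t x * F s x \<partial>lborel) \<partial>mellin a \<partial>mellin a)"
    by (subst mellin.nn_integral_fst[symmetric]) auto
  also have "\<dots> = (\<integral>\<^sup>+t. \<integral>\<^sup>+s. ennreal (heat_energy (f' e) (t + s)) \<partial>mellin a \<partial>mellin a)"
  proof (rule nn_integral_cong_AE)
    show "AE t in mellin a. (\<integral>\<^sup>+s. ennreal (\<integral>x. F t x * F s x \<partial>lborel) \<partial>mellin a) = (\<integral>\<^sup>+s. ennreal (heat_energy (f' e) (t + s)) \<partial>mellin a)"
      using AE_mellin
    proof eventually_elim
      case (elim t)
      have "AE s in mellin a. ennreal (\<integral>x. F t x * F s x \<partial>lborel) = ennreal (heat_energy (f' e) (t + s))"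
        using AE_mellin by eventually_elim (simp add: prod elim)
      then show ?case by (rule nn_integral_cong_AE)
    qed
  qed
  finally show "(\<integral>\<^sup>+x. ennreal ((\<integral>t. heat (f' e) t x \<partial>mellin a)\<^sup>2) \<partial>lborel) = (\<integral>\<^sup>+t. \<integral>\<^sup>+s. ennreal (heat_energy (f' e) (t + s)) \<partial>mellin a \<partial>mellin a)" .
qed

lemma integrable_f_square: "integrable lborel (\<lambda>x. (f x)\<^sup>2)"
  by (rule integrable_continuous_compact_support[OF _ K]) (auto simp: f_0 intro!: continuous_intros f)

text \<open>Expanding the square, the left-hand side is \<open>2 (\<integral>f\<^sup>2 - \<langle>f, P\<^sub>t
  f\<rangle>)\<close>, and the difference is half of the integrated Dirichlet energy.\<close>

lemma nn_integral_difference_gauss: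
  assumes t: "0 < t"
  shows "(\<integral>\<^sup>+x. \<integral>\<^sup>+y. ennreal ((f x - f y)\<^sup>2) * ennreal (gauss t (x - y)) \<partial>lborel \<partial>lborel)
     = (\<integral>\<^sup>+s. ennreal (dirichlet s) * indicator {0<..t} s \<partial>lborel)"
proof -
  obtain M where M: "0 < M" "\<And>x. \<bar>f x\<bar> \<le> M" using f_bounded by blast
  define I where "I = (\<integral>x. (f x)\<^sup>2 \<partial>lborel)"
  have b: "(f x)\<^sup>2 \<le> M\<^sup>2" for x using power_mono[OF M(2)[of x], of 2] by simp
  have inner: "(\<integral>\<^sup>+y. ennreal ((f x - f y)\<^sup>2) * ennreal (gauss t (x - y)) \<partial>lborel) =
     ennreal ((f x)\<^sup>2 + heat (\<lambda>y. (f y)\<^sup>2) t x - 2 * (f x * heat f t x))"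
    and inner_nonneg: "0 \<le> (f x)\<^sup>2 + heat (\<lambda>y. (f y)\<^sup>2) t x - 2 * (f x * heat f t x)" for x
  proof -
    have i: "integrable lborel (\<lambda>y. g y * gauss t (x - y))" if [measurable]: "g \<in> borel_measurable borel" and g: "\<And>y. \<bar>g y\<bar> \<le> N" for g N
    proof (rule Bochner_Integration.integrable_bound[where f="\<lambda>y. N * gauss t (x - y)"])
      show "AE y in lborel. norm (g y * gauss t (x - y)) \<le> norm (N * gauss t (x - y))"
      proof (rule AE_I2)
        fix y show "norm (g y * gauss t (x - y)) \<le> norm (N * gauss t (x - y))"
          using g[of y] by (simp add: abs_mult mult_right_mono)
      qed
    qed (use t in auto)
    have eq: "(f x - f y)\<^sup>2 * gauss t (x - y) = (f x)\<^sup>2 * gauss t (x - y) + (f y)\<^sup>2 * gauss t (x - y) - 2 * f x * (f y * gauss t (x - y))" for y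
      by (simp add: power2_diff algebra_simps)
    have i1: "integrable lborel (\<lambda>y. (f y)\<^sup>2 * gauss t (x - y))" "integrable lborel (\<lambda>y. f y * gauss t (x - y))"
      using i[of "\<lambda>y. (f y)\<^sup>2" "M\<^sup>2"] i[of f M] M b by auto
    have "integrable lborel (\<lambda>y. (f x - f y)\<^sup>2 * gauss t (x - y))"
      unfolding eq using i1 t by (intro Bochner_Integration.integrable_add Bochner_Integration.integrable_diff integrable_mult_right) auto
    moreover have int: "(\<integral>y. (f x - f y)\<^sup>2 * gauss t (x - y) \<partial>lborel) = (f x)\<^sup>2 + heat (\<lambda>y. (f y)\<^sup>2) t x - 2 * (f x * heat f t x)"
      unfolding eq heat_def using i1 t by simp
    ultimately show "(\<integral>\<^sup>+y. ennreal ((f x - f y)\<^sup>2) * ennreal (gauss t (x - y)) \<partial>lborel) =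
       ennreal ((f x)\<^sup>2 + heat (\<lambda>y. (f y)\<^sup>2) t x - 2 * (f x * heat f t x))"
      by (simp add: ennreal_mult[symmetric] nn_integral_eq_integral)
    show "0 \<le> (f x)\<^sup>2 + heat (\<lambda>y. (f y)\<^sup>2) t x - 2 * (f x * heat f t x)"
      unfolding int[symmetric] by (intro Bochner_Integration.integral_nonneg) auto
  qed
  have i2: "integrable lborel (\<lambda>x. 1 * heat (\<lambda>y. (f y)\<^sup>2) t x)"
    by (rule integrable_heat[OF t integrable_f_square, where M=1]) auto
  have i3: "integrable lborel (\<lambda>x. f x * heat f t x)"
    by (rule integrable_heat[OF t f_integrable _ M(2)]) auto
  have h2: "(\<integral>x. heat (\<lambda>y. (f y)\<^sup>2) t x \<partial>lborel) = I"
  proof -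
    have "(\<integral>x. (f x)\<^sup>2 * heat (\<lambda>_. 1) t x \<partial>lborel) = (\<integral>x. 1 * heat (\<lambda>y. (f y)\<^sup>2) t x \<partial>lborel)"
      by (rule heat_symmetric[OF t integrable_f_square, where M=1]) auto
    then show ?thesis using t by (simp add: heat_def I_def)
  qed
  have "(\<integral>\<^sup>+x. \<integral>\<^sup>+y. ennreal ((f x - f y)\<^sup>2) * ennreal (gauss t (x - y)) \<partial>lborel \<partial>lborel)
     = ennreal (\<integral>x. (f x)\<^sup>2 + heat (\<lambda>y. (f y)\<^sup>2) t x - 2 * (f x * heat f t x) \<partial>lborel)"
    unfolding inner using i2 i3 integrable_f_square inner_nonneg
    by (intro nn_integral_eq_integral Bochner_Integration.integrable_add Bochner_Integration.integrable_diff integrable_mult_right) auto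
  also have "(\<integral>x. (f x)\<^sup>2 + heat (\<lambda>y. (f y)\<^sup>2) t x - 2 * (f x * heat f t x) \<partial>lborel) = 2 * (I - heat_energy f t)"
    using i2 i3 integrable_f_square h2 by (simp add: I_def heat_energy_def)
  also have "ennreal (2 * (I - heat_energy f t)) = ennreal 2 * (\<integral>\<^sup>+s. ennreal (dirichlet s / 2) * indicator {0<..t} s \<partial>lborel)"
    unfolding nn_integral_dirichlet[OF t] I_def by (subst ennreal_mult'[symmetric]) auto
  also have "\<dots> = (\<integral>\<^sup>+s. ennreal (dirichlet s) * indicator {0<..t} s \<partial>lborel)"
  proof (subst nn_integral_cmult[symmetric], measurable, rule nn_integral_cong)
    fix s
    have "ennreal 2 * ennreal (dirichlet s / 2) = ennreal (dirichlet s)"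
      by (subst ennreal_mult'[symmetric]) auto
    then show "ennreal 2 * (ennreal (dirichlet s / 2) * indicator {0<..t} s) = ennreal (dirichlet s) * indicator {0<..t} s"
      by (simp add: mult.assoc[symmetric])
  qed
  finally show ?thesis .
qed

text \<open>Integrate \<open>nn_integral_difference_gauss\<close> against \<open>t powr (- \<sigma> -
  1)\<close>. Exchanging the two time integrals replaces this weight by its tail \<open>s powr (-
  \<sigma>) / \<sigma>\<close>.\<close>

lemma gagliardo_dirichlet:
  assumes s: "0 < \<sigma>"
  shows "gauss_mix DIM('a) (- \<sigma>) * (\<integral>\<^sup>+x. \<integral>\<^sup>+y. ennreal ((f x - f y)\<^sup>2) * ennreal (norm (x - y) powr (- 2 * \<sigma> - DIM('a))) \<partial>lborel \<partial>lborel)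
     = ennreal (1 / \<sigma>) * (\<integral>\<^sup>+r. ennreal (dirichlet r) \<partial>mellin (1 - \<sigma>))"
proof -
  have kern: "gauss_mix DIM('a) (- \<sigma>) * (ennreal ((f x - f y)\<^sup>2) * ennreal (norm (x - y) powr (- 2 * \<sigma> - DIM('a))))
     = (\<integral>\<^sup>+t. ennreal ((f x - f y)\<^sup>2) * ennreal (gauss t (x - y)) \<partial>mellin (- \<sigma>))" for x y
  proof (cases "x = y")
    case False
    have "(\<integral>\<^sup>+t. ennreal ((f x - f y)\<^sup>2) * ennreal (gauss t (x - y)) \<partial>mellin (- \<sigma>))
      = ennreal ((f x - f y)\<^sup>2) * (\<integral>\<^sup>+t. ennreal (gauss t (x - y)) \<partial>mellin (- \<sigma>))"
      by (rule nn_integral_cmult) measurable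
    also have "(\<integral>\<^sup>+t. ennreal (gauss t (x - y)) \<partial>mellin (- \<sigma>)) = gauss_mix DIM('a) (- \<sigma>) * ennreal (norm (x - y) powr (- 2 * \<sigma> - DIM('a)))"
      using False nn_integral_gauss_mellin[of "x - y" "- \<sigma>"] by simp
    finally show ?thesis by (simp only: mult.left_commute)
  qed simp
  interpret A: pair_sigma_finite "mellin (- \<sigma>)" "lborel :: 'a measure" ..
  interpret B: pair_sigma_finite "mellin (- \<sigma>)" "lborel :: real measure" ..
  have "gauss_mix DIM('a) (- \<sigma>) * (\<integral>\<^sup>+x. \<integral>\<^sup>+y. ennreal ((f x - f y)\<^sup>2) * ennreal (norm (x - y) powr (- 2 * \<sigma> - DIM('a))) \<partial>lborel \<partial>lborel)
     = (\<integral>\<^sup>+x. \<integral>\<^sup>+y. \<integral>\<^sup>+t. ennreal ((f x - f y)\<^sup>2) * ennreal (gauss t (x - y)) \<partial>mellin (- \<sigma>) \<partial>lborel \<partial>lborel)"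
    unfolding kern[symmetric] by (simp add: nn_integral_cmult)
  also have "\<dots> = (\<integral>\<^sup>+x. \<integral>\<^sup>+t. \<integral>\<^sup>+y. ennreal ((f x - f y)\<^sup>2) * ennreal (gauss t (x - y)) \<partial>lborel \<partial>mellin (- \<sigma>) \<partial>lborel)"
    by (intro nn_integral_cong A.Fubini') measurable
  also have "\<dots> = (\<integral>\<^sup>+t. \<integral>\<^sup>+x. \<integral>\<^sup>+y. ennreal ((f x - f y)\<^sup>2) * ennreal (gauss t (x - y)) \<partial>lborel \<partial>lborel \<partial>mellin (- \<sigma>))"
    by (rule A.Fubini') measurable
  also have "\<dots> = (\<integral>\<^sup>+t. \<integral>\<^sup>+s. ennreal (dirichlet s) * indicator {0<..t} s \<partial>lborel \<partial>mellin (- \<sigma>))"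
    using AE_mellin[of "- \<sigma>"] by (intro nn_integral_cong_AE) (auto elim!: eventually_mono simp: nn_integral_difference_gauss)
  also have "\<dots> = (\<integral>\<^sup>+s. \<integral>\<^sup>+t. ennreal (dirichlet s) * indicator {0<..t} s \<partial>mellin (- \<sigma>) \<partial>lborel)"
  proof (rule B.Fubini'[symmetric])
    have "(\<lambda>(t, s). ennreal (dirichlet s) * indicator {0<..t} s) = (\<lambda>(t, s). if 0 < s \<and> s \<le> t then ennreal (dirichlet s) else 0)"
      by (auto simp: indicator_def fun_eq_iff)
    then show "(\<lambda>(t, s). ennreal (dirichlet s) * indicator {0<..t} s) \<in> borel_measurable (mellin (- \<sigma>) \<Otimes>\<^sub>M lborel)"
      by simp
  qed
  also have "\<dots> = (\<integral>\<^sup>+s. ennreal (1 / \<sigma>) * (ennreal (s powr (1 - \<sigma> - 1)) * indicator {0<..} s * ennreal (dirichlet s)) \<partial>lborel)"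
  proof (rule nn_integral_cong)
    fix s :: real
    show "(\<integral>\<^sup>+t. ennreal (dirichlet s) * indicator {0<..t} s \<partial>mellin (- \<sigma>)) = ennreal (1 / \<sigma>) * (ennreal (s powr (1 - \<sigma> - 1)) * indicator {0<..} s * ennreal (dirichlet s))"
    proof (cases "0 < s")
      case True
      have "(\<integral>\<^sup>+t. ennreal (dirichlet s) * indicator {0<..t} s \<partial>mellin (- \<sigma>)) = (\<integral>\<^sup>+t. ennreal (dirichlet s) * (ennreal (t powr (- 0)) * indicator {s..} t) \<partial>mellin (- \<sigma>))"
        using True by (intro nn_integral_cong) (auto simp: indicator_def)
      also have "\<dots> = ennreal (dirichlet s) * ennreal (s powr (- \<sigma>) / \<sigma>)"
        using nn_integral_mellin_powr_tail[of "- \<sigma>" 0 s] s True by (subst nn_integral_cmult) auto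
      also have "ennreal (s powr (- \<sigma>) / \<sigma>) = ennreal (1 / \<sigma>) * ennreal (s powr (- \<sigma>))"
        using s by (simp add: ennreal_mult[symmetric])
      finally show ?thesis using True by (simp add: mult_ac)
    qed simp
  qed
  also have "\<dots> = ennreal (1 / \<sigma>) * (\<integral>\<^sup>+r. ennreal (dirichlet r) \<partial>mellin (1 - \<sigma>))"
    by (simp add: nn_integral_cmult nn_integral_mellin)
  finally show ?thesis .
qed

lemma gagliardo_integral_finite:
  fixes \<sigma> :: real
  assumes s: "0 < \<sigma>" "\<sigma> < 1"
  shows "(\<integral>\<^sup>+x. \<integral>\<^sup>+y. ennreal ((f x - f y)\<^sup>2) * ennreal (norm (x - y) powr (- 2 * \<sigma> - DIM('a))) \<partial>lborel \<partial>lborel) < \<infinity>" (is "?G < _")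
proof -
  have "gauss_mix DIM('a) (- \<sigma>) * ?G < \<infinity>"
    unfolding gagliardo_dirichlet[OF s(1)] using dirichlet_finite[of "1 - \<sigma>"] s by (simp add: ennreal_mult_less_top)
  then show ?thesis using gauss_mix_pos[of "DIM('a)" "- \<sigma>"] by (auto simp: ennreal_mult_less_top)
qed

end

text \<open>The sum is, up to a constant, the squared \<open>L\<^sup>2\<close> norm of the gradient of the
  Riesz potential of order \<open>1 - \<sigma>\<close>, the double integral on the right is the
  squared Gagliardo seminorm. Both are multiples of the integral of the Dirichlet energy against
  \<open>mellin (1 - \<sigma>)\<close>, with constants that depend only on \<open>\<sigma>\<close>
  and the dimension.\<close>

lemma energy_identity:
  fixes \<sigma> :: real
  assumes s: "0 < \<sigma>" "\<sigma> < 1"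
  obtains c where "0 < c"
    "\<And>f f' K. C1_compact (f :: 'a::euclidean_space \<Rightarrow> real) f' K \<Longrightarrow>
      (\<Sum>e\<in>Basis. \<integral>\<^sup>+x. ennreal ((\<integral>y. f' e y * norm (x - y) powr (1 - \<sigma> - DIM('a)) \<partial>lborel)\<^sup>2) \<partial>lborel)
      = ennreal c * (\<integral>\<^sup>+x. \<integral>\<^sup>+y. ennreal ((f x - f y)\<^sup>2) * ennreal (norm (x - y) powr (- 2 * \<sigma> - DIM('a))) \<partial>lborel \<partial>lborel)"
proof -
  define a where "a = (1 - \<sigma>) / 2"
  have DIM: "1 \<le> real DIM('a)" using DIM_positive[where 'a='a] by simp
  have a: "0 < a" "a < 1 / 2" and a2: "2 * a = 1 - \<sigma>"
    using s by (simp_all add: a_def)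
  then have a3: "a < real DIM('a) / 2" using DIM by linarith
  define g where "g = enn2real (gauss_mix DIM('a) a)"
  have g: "0 < g" 
    using gauss_mix_finite[of a "DIM('a)"] a3 gauss_mix_pos[of "DIM('a)" a]
    by (auto simp: g_def enn2real_positive_iff)
  define h where "h = enn2real (gauss_mix DIM('a) (- \<sigma>))"
  have h: "0 < h" "gauss_mix DIM('a) (- \<sigma>) = ennreal h"
    using gauss_mix_finite[of "- \<sigma>" "DIM('a)"] s gauss_mix_pos[of "DIM('a)" "- \<sigma>"]
    by (auto simp: h_def enn2real_positive_iff)
  obtain B where B: "0 < B" "\<And>h. h \<in> borel_measurable borel \<Longrightarrow>
    (\<integral>\<^sup>+t. \<integral>\<^sup>+s. h (t + s) \<partial>mellin a \<partial>mellin a) = ennreal B * (\<integral>\<^sup>+r. h r \<partial>mellin (2 * a))"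
    using mellin_convolution[OF a(1)] by blast
  define c where "c = B * \<sigma> * h / g\<^sup>2"
  have c: "0 < c" using B h g s by (simp add: c_def)
  show ?thesis
  proof (rule that[OF c])
    fix f :: "'a \<Rightarrow> real" and f' K assume "C1_compact f f' K"
    then interpret C1_compact f f' K .
    let ?G = "\<integral>\<^sup>+x. \<integral>\<^sup>+y. ennreal ((f x - f y)\<^sup>2) * ennreal (norm (x - y) powr (- 2 * \<sigma> - DIM('a))) \<partial>lborel \<partial>lborel"
    let ?D = "\<integral>\<^sup>+r. ennreal (dirichlet r) \<partial>mellin (1 - \<sigma>)"
    have G: "ennreal h * ?G = ennreal (1 / \<sigma>) * ?D"
      using gagliardo_dirichlet[OF s(1)] by (simp add: h)
    have "ennreal (g\<^sup>2) * (\<Sum>e\<in>Basis. \<integral>\<^sup>+x. ennreal ((\<integral>y. f' e y * norm (x - y) powr (1 - \<sigma> - DIM('a)) \<partial>lborel)\<^sup>2) \<partial>lborel)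
      = (\<Sum>e\<in>Basis. \<integral>\<^sup>+x. ennreal ((\<integral>t. heat (f' e) t x \<partial>mellin a)\<^sup>2) \<partial>lborel)"
      unfolding sum_distrib_left
    proof (rule sum.cong[OF refl])
      fix e :: 'a assume e: "e \<in> Basis"
      note [measurable] = f'_measurable[OF e]
      obtain M where M: "0 < M" "\<And>x. \<bar>f' e x\<bar> \<le> M" using f'_bounded[OF e] by blast
      have "(\<integral>t. heat (f' e) t x \<partial>mellin a)\<^sup>2 = g\<^sup>2 * (\<integral>y. f' e y * norm (x - y) powr (1 - \<sigma> - DIM('a)) \<partial>lborel)\<^sup>2" for x
        using riesz_heat(2)[OF a(1) a3 f'_integrable[OF e] M(2), of x] by (simp add: g_def power_mult_distrib a2)
      then show "ennreal (g\<^sup>2) * (\<integral>\<^sup>+x. ennreal ((\<integral>y. f' e y * norm (x - y) powr (1 - \<sigma> - DIM('a)) \<partial>lborel)\<^sup>2) \<partial>lborel) = (\<integral>\<^sup>+x. ennreal ((\<integral>t. heat (f' e) t x \<partial>mellin a)\<^sup>2) \<partial>lborel)"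
        by (simp add: ennreal_mult nn_integral_cmult)
    qed
    also have "\<dots> = (\<Sum>e\<in>Basis. ennreal B * (\<integral>\<^sup>+r. ennreal (heat_energy (f' e) r) \<partial>mellin (1 - \<sigma>)))"
    proof (rule sum.cong[OF refl])
      fix e :: 'a assume e: "e \<in> Basis"
      note [measurable] = f'_measurable[OF e]
      show "(\<integral>\<^sup>+x. ennreal ((\<integral>t. heat (f' e) t x \<partial>mellin a)\<^sup>2) \<partial>lborel) = ennreal B * (\<integral>\<^sup>+r. ennreal (heat_energy (f' e) r) \<partial>mellin (1 - \<sigma>))"
        unfolding square_integral_riesz(2)[OF e a(1,2)] by (subst B(2)) (auto simp: a2)
    qed
    also have "\<dots> = ennreal B * (\<integral>\<^sup>+r. (\<Sum>e\<in>Basis. ennreal (heat_energy (f' e) r)) \<partial>mellin (1 - \<sigma>))"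
      by (subst nn_integral_sum) (auto simp: sum_distrib_left)
    also have "(\<integral>\<^sup>+r. (\<Sum>e\<in>Basis. ennreal (heat_energy (f' e) r)) \<partial>mellin (1 - \<sigma>)) = ?D"
      using AE_mellin[of "1 - \<sigma>"] unfolding dirichlet_def
      by (intro nn_integral_cong_AE) (auto elim!: eventually_mono simp: sum_ennreal heat_energy_f'_nonneg)
    also have "?D = ennreal (\<sigma> * h) * ?G"
    proof -
      have "ennreal (\<sigma> * h) * ?G = ennreal \<sigma> * (ennreal h * ?G)" using s h by (simp add: ennreal_mult mult.assoc)
      also have "\<dots> = ennreal \<sigma> * ennreal (1 / \<sigma>) * ?D" unfolding G by (simp add: mult.assoc)
      also have "ennreal \<sigma> * ennreal (1 / \<sigma>) = 1" using s by (simp add: ennreal_mult[symmetric])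
      finally show ?thesis by simp
    qed
    also have "ennreal B * (ennreal (\<sigma> * h) * ?G) = ennreal (g\<^sup>2) * (ennreal c * ?G)"
    proof -
      have "g\<^sup>2 * c = B * (\<sigma> * h)" using g by (simp add: c_def)
      then show ?thesis using B h s c by (simp add: mult.assoc[symmetric] ennreal_mult[symmetric] del: ennreal_mult)
    qed
    finally show "(\<Sum>e\<in>Basis. \<integral>\<^sup>+x. ennreal ((\<integral>y. f' e y * norm (x - y) powr (1 - \<sigma> - DIM('a)) \<partial>lborel)\<^sup>2) \<partial>lborel) = ennreal c * ?G"
      using g by (simp add: ennreal_mult_cancel_left)
  qed
qed

section \<open>Test functions\<close>

lemma partial_deriv_eq:
  assumes "(\<phi> has_derivative D) (at x)"
  shows "partial_deriv j \<phi> x = D (axis j 1)"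
  using frechet_derivative_at[OF assms] by (simp add: partial_deriv_def)

lemma Ck_continuous: "Ck k \<phi> \<Longrightarrow> continuous_on UNIV \<phi>"
  by (cases k) (auto intro: differentiable_imp_continuous_on)

lemma Ck_Suc_D: "Ck (Suc k) \<phi> \<Longrightarrow> Ck k \<phi>"
proof (induction k arbitrary: \<phi>)
  case 0 then show ?case unfolding Ck.simps(1) by (rule Ck_continuous)
next
  case (Suc k)
  then have "\<phi> differentiable_on UNIV" "Ck (Suc k) (partial_deriv j \<phi>)" for j
    unfolding Ck.simps(2)[of _ \<phi>] by blast+
  then show ?case using Suc.IH unfolding Ck.simps(2)[of k \<phi>] by blast
qed

lemma Ck_const: "Ck k (\<lambda>_. c)"
proof (induction k arbitrary: c)
  case (Suc k)
  have "partial_deriv j (\<lambda>_. c) = (\<lambda>_. 0)" for j :: 'a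
    by (rule ext, subst partial_deriv_eq[OF has_derivative_const]) simp
  then show ?case using Suc by simp
qed simp

lemma Ck_cmult: "Ck k \<phi> \<Longrightarrow> Ck k (\<lambda>x. c * \<phi> x)"
proof (induction k arbitrary: \<phi>)
  case 0 then show ?case by (auto intro!: continuous_intros)
next
  case (Suc k)
  then have d: "(\<phi> has_derivative frechet_derivative \<phi> (at x)) (at x)" for x
    by (auto simp: differentiable_on_def frechet_derivative_works)
  have "partial_deriv j (\<lambda>x. c * \<phi> x) = (\<lambda>x. c * partial_deriv j \<phi> x)" for j
    by (rule ext, subst partial_deriv_eq[OF has_derivative_mult_right[OF d]]) (simp add: partial_deriv_def)
  then show ?case using Suc by (auto intro!: derivative_intros)
qed

lemma Ck_add: "Ck k \<phi> \<Longrightarrow> Ck k \<psi> \<Longrightarrow> Ck k (\<lambda>x. \<phi> x + \<psi> x)"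
proof (induction k arbitrary: \<phi> \<psi>)
  case 0 then show ?case by (auto intro!: continuous_intros)
next
  case (Suc k)
  then have d: "(\<phi> has_derivative frechet_derivative \<phi> (at x)) (at x)" "(\<psi> has_derivative frechet_derivative \<psi> (at x)) (at x)" for x
    by (auto simp: differentiable_on_def frechet_derivative_works)
  have "partial_deriv j (\<lambda>x. \<phi> x + \<psi> x) = (\<lambda>x. partial_deriv j \<phi> x + partial_deriv j \<psi> x)" for j
    by (rule ext, subst partial_deriv_eq[OF has_derivative_add[OF d]]) (simp add: partial_deriv_def)
  then show ?case using Suc by (auto intro!: derivative_intros)
qed

lemma Ck_mult: "Ck k \<phi> \<Longrightarrow> Ck k \<psi> \<Longrightarrow> Ck k (\<lambda>x. \<phi> x * \<psi> x)"
proof (induction k arbitrary: \<phi> \<psi>)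
  case 0 then show ?case by (auto intro!: continuous_intros)
next
  case (Suc k)
  then have d: "(\<phi> has_derivative frechet_derivative \<phi> (at x)) (at x)" "(\<psi> has_derivative frechet_derivative \<psi> (at x)) (at x)" for x
    by (auto simp: differentiable_on_def frechet_derivative_works)
  have "partial_deriv j (\<lambda>x. \<phi> x * \<psi> x) = (\<lambda>x. \<phi> x * partial_deriv j \<psi> x + partial_deriv j \<phi> x * \<psi> x)" for j
    by (rule ext, subst partial_deriv_eq[OF has_derivative_mult[OF d]]) (simp add: partial_deriv_def)
  moreover have "Ck k \<phi>" "Ck k \<psi>" using Suc.prems Ck_Suc_D by blast+
  ultimately show ?case using Suc by (auto intro!: derivative_intros Ck_add Suc.IH)
qed

lemma Ck_prod: "finite I \<Longrightarrow> (\<And>i. i \<in> I \<Longrightarrow> Ck k (\<phi> i)) \<Longrightarrow> Ck k (\<lambda>x. \<Prod>i\<in>I. \<phi> i x)"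
  by (induction I rule: finite_induct) (auto intro: Ck_const Ck_mult)

lemma compact_closure_subset: "compact S \<Longrightarrow> closure T \<subseteq> S \<Longrightarrow> compact (closure T)"
  using compact_Int_closed[of S "closure T"] by (simp add: inf.absorb2)

lemma mem_box_symmetric:
  fixes x :: "'a::euclidean_space"
  assumes "norm x < r" shows "x \<in> box (- (r *\<^sub>R One)) (r *\<^sub>R One)"
proof -
  have "\<bar>x \<bullet> i\<bar> < r" if "i \<in> Basis" for i
    using Basis_le_norm[OF that, of x] assms by linarith
  then show ?thesis by (force simp: mem_box abs_less_iff)
qed

lemma test_fun_cmult:
  assumes "\<phi> \<in> test_fun \<Omega>" shows "(\<lambda>x. c * \<phi> x) \<in> test_fun \<Omega>"
proof -
  have s: "closure {x. c * \<phi> x \<noteq> 0} \<subseteq> closure {x. \<phi> x \<noteq> 0}" by (intro closure_mono) auto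
  then have "compact (closure {x. c * \<phi> x \<noteq> 0})"
    using assms compact_closure_subset unfolding test_fun_def by blast
  then show ?thesis using assms s by (auto simp: test_fun_def intro: Ck_cmult)
qed

lemma test_fun_add:
  assumes "\<phi> \<in> test_fun \<Omega>" "\<psi> \<in> test_fun \<Omega>" shows "(\<lambda>x. \<phi> x + \<psi> x) \<in> test_fun \<Omega>"
proof -
  have "closure {x. \<phi> x + \<psi> x \<noteq> 0} \<subseteq> closure ({x. \<phi> x \<noteq> 0} \<union> {x. \<psi> x \<noteq> 0})" by (intro closure_mono) auto
  then have s: "closure {x. \<phi> x + \<psi> x \<noteq> 0} \<subseteq> closure {x. \<phi> x \<noteq> 0} \<union> closure {x. \<psi> x \<noteq> 0}" by simp
  have "compact (closure {x. \<phi> x \<noteq> 0} \<union> closure {x. \<psi> x \<noteq> 0})"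
    using assms by (intro compact_Un) (auto simp: test_fun_def)
  then have "compact (closure {x. \<phi> x + \<psi> x \<noteq> 0})"
    using s compact_closure_subset by blast
  then show ?thesis using assms s by (auto simp: test_fun_def intro: Ck_add)
qed

lemma test_fun_diff:
  assumes "\<phi> \<in> test_fun \<Omega>" "\<psi> \<in> test_fun \<Omega>" shows "(\<lambda>x. \<phi> x - \<psi> x) \<in> test_fun \<Omega>"
  using test_fun_add[OF assms(1) test_fun_cmult[OF assms(2), of "-1"]] by simp

lemma test_fun_zero: "(\<lambda>_. 0) \<in> test_fun \<Omega>"
  by (auto simp: test_fun_def Ck_const)

lemma test_fun_continuous: "\<phi> \<in> test_fun \<Omega> \<Longrightarrow> continuous_on UNIV \<phi>"
  using Ck_continuous by (auto simp: test_fun_def)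

lemma test_fun_C1_compact:
  assumes "\<phi> \<in> test_fun \<Omega>"
  shows "C1_compact \<phi> (\<lambda>e x. frechet_derivative \<phi> (at x) e) (closure {x. \<phi> x \<noteq> 0})"
proof
  have C1: "Ck (Suc 0) \<phi>" using assms unfolding test_fun_def by blast
  then have d: "(\<phi> has_derivative frechet_derivative \<phi> (at x)) (at x)" for x
    by (auto simp: differentiable_on_def frechet_derivative_works)
  show "continuous_on UNIV \<phi>" using assms by (rule test_fun_continuous)
  show "compact (closure {x. \<phi> x \<noteq> 0})" using assms by (simp add: test_fun_def)
  show "\<phi> x = 0" if "x \<notin> closure {x. \<phi> x \<noteq> 0}" for x
    using that closure_subset[of "{x. \<phi> x \<noteq> 0}"] by auto
  show "frechet_derivative \<phi> (at x) e = 0" if "x \<notin> closure {x. \<phi> x \<noteq> 0}" for x e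
  proof -
    have "(\<phi> has_derivative (\<lambda>_. 0)) (at x)"
    proof (rule has_derivative_transform_within_open[where s="- closure {x. \<phi> x \<noteq> 0}"])
      show "((\<lambda>_. 0) has_derivative (\<lambda>_. 0)) (at x)" by simp
      show "0 = \<phi> y" if "y \<in> - closure {x. \<phi> x \<noteq> 0}" for y
        using that closure_subset[of "{x. \<phi> x \<noteq> 0}"] by auto
    qed (use that in auto)
    then show ?thesis using fun_cong[OF frechet_derivative_at, of \<phi> "\<lambda>_. 0" x e] by simp
  qed
  fix e :: "real^'a" assume "e \<in> Basis"
  then obtain j where e: "e = axis j 1" by (auto simp: Basis_vec_def)
  show "continuous_on UNIV (\<lambda>x. frechet_derivative \<phi> (at x) e)"
    using C1 by (simp add: e partial_deriv_def[abs_def])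
  show "deriv_along e \<phi> (\<lambda>x. frechet_derivative \<phi> (at x) e)"
    unfolding deriv_along_def
  proof
    fix x
    have "((\<lambda>h. \<phi> (x + h *\<^sub>R e)) has_derivative (\<lambda>h. frechet_derivative \<phi> (at x) (h *\<^sub>R e))) (at 0)"
    proof -
      have "((\<lambda>h. x + h *\<^sub>R e) has_derivative (\<lambda>h. h *\<^sub>R e)) (at 0)"
        by (auto intro!: derivative_eq_intros)
      from has_derivative_compose[OF this, of \<phi> "frechet_derivative \<phi> (at x)"] d[of x]
      show ?thesis by simp
    qed
    moreover have "frechet_derivative \<phi> (at x) (h *\<^sub>R e) = frechet_derivative \<phi> (at x) e * h" for h
      using linear_cmul[OF has_derivative_linear[OF d], of x h e] by simp
    ultimately show "((\<lambda>h. \<phi> (x + h *\<^sub>R e)) has_real_derivative frechet_derivative \<phi> (at x) e) (at 0)"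
      unfolding has_field_derivative_def by (simp only:)
  qed
qed

lemma test_fun_partial_deriv:
  assumes "\<phi> \<in> test_fun \<Omega>" shows "partial_deriv j \<phi> \<in> test_fun \<Omega>"
proof -
  interpret C1_compact \<phi> "\<lambda>e x. frechet_derivative \<phi> (at x) e" "closure {x. \<phi> x \<noteq> 0}"
    using assms by (rule test_fun_C1_compact)
  have "{x. partial_deriv j \<phi> x \<noteq> 0} \<subseteq> closure {x. \<phi> x \<noteq> 0}"
    using f'_0[of "axis j 1"] by (auto simp: partial_deriv_def axis_in_Basis_iff)
  then have s: "closure {x. partial_deriv j \<phi> x \<noteq> 0} \<subseteq> closure {x. \<phi> x \<noteq> 0}"
    by (rule closure_minimal) simp
  then have "compact (closure {x. partial_deriv j \<phi> x \<noteq> 0})"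
    using K compact_closure_subset by blast
  moreover have "Ck k (partial_deriv j \<phi>)" for k
  proof -
    have "Ck (Suc k) \<phi>" using assms unfolding test_fun_def by blast
    then show ?thesis by simp
  qed
  ultimately show ?thesis using s assms by (auto simp: test_fun_def)
qed

section \<open>Smooth cutoffs and the fundamental lemma of the calculus of variations\<close>

text \<open>The function \<open>exp (- 1 / x)\<close> continued by 0, together with its products with powers
  of \<open>1 / x\<close>: a family that is closed under differentiation up to linear combinations.\<close>

definition flat_exp :: "nat \<Rightarrow> real \<Rightarrow> real" where
  "flat_exp m x = (if 0 < x then (1 / x) ^ m * exp (- (1 / x)) else 0)"

lemma flat_exp_deriv: "(flat_exp m has_real_derivative flat_exp (m + 2) x - m * flat_exp (m + 1) x) (at x)"
proof -
  consider "0 < x" | "x < 0" | "x = 0" by linarith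
  then show ?thesis
  proof cases
    case 1
    have "((\<lambda>x. (1 / x) ^ m * exp (- (1 / x))) has_real_derivative
       (1 / x) ^ m * (exp (- (1 / x)) * (1 / x\<^sup>2)) + m * (1 / x) ^ (m - 1) * (- 1 / x\<^sup>2) * exp (- (1 / x))) (at x)"
      using 1 by (auto intro!: derivative_eq_intros simp: power2_eq_square)
    moreover have "(1 / x) ^ m * (exp (- (1 / x)) * (1 / x\<^sup>2)) + m * (1 / x) ^ (m - 1) * (- 1 / x\<^sup>2) * exp (- (1 / x))
       = flat_exp (m + 2) x - m * flat_exp (m + 1) x"
    proof (cases m)
      case 0 then show ?thesis using 1 by (simp add: flat_exp_def power2_eq_square field_simps)
    next
      case (Suc k) then show ?thesis using 1 by (simp add: flat_exp_def power2_eq_square field_simps)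
    qed
    ultimately have "((\<lambda>x. (1 / x) ^ m * exp (- (1 / x))) has_real_derivative flat_exp (m + 2) x - m * flat_exp (m + 1) x) (at x)"
      by simp
    then show ?thesis
      by (rule has_field_derivative_transform_within_open[where S="{0<..}"]) (use 1 in \<open>auto simp: flat_exp_def\<close>)
  next
    case 2
    have "((\<lambda>x. 0) has_real_derivative flat_exp (m + 2) x - m * flat_exp (m + 1) x) (at x)"
      using 2 by (simp add: flat_exp_def)
    then show ?thesis
      by (rule has_field_derivative_transform_within_open[where S="{..<0}"]) (use 2 in \<open>auto simp: flat_exp_def\<close>)
  next
    case 3
    have "((\<lambda>h. flat_exp (m + 1) h) \<longlongrightarrow> 0) (at_right 0)"
    proof -
      have "((\<lambda>x. x ^ (m + 1) / exp x) \<longlongrightarrow> (0::real)) at_top" by (rule tendsto_power_div_exp_0)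
      moreover have "filterlim (\<lambda>h::real. 1 / h) at_top (at_right 0)" 
        using filterlim_inverse_at_top_right by (simp add: inverse_eq_divide)
      ultimately have "((\<lambda>h. (1 / h) ^ (m + 1) / exp (1 / h)) \<longlongrightarrow> (0::real)) (at_right 0)"
        by (rule filterlim_compose)
      then show ?thesis
        by (rule Lim_transform_eventually) (auto simp: eventually_at_filter flat_exp_def exp_minus field_simps)
    qed
    moreover have "((\<lambda>h. flat_exp (m + 1) h) \<longlongrightarrow> 0) (at_left 0)"
      by (rule tendsto_eventually) (auto simp: eventually_at_filter flat_exp_def)
    ultimately have "((\<lambda>h. flat_exp (m + 1) h) \<longlongrightarrow> 0) (at 0)" by (rule filterlim_split_at[rotated])
    then have "((\<lambda>h. (flat_exp m (0 + h) - flat_exp m 0) / h) \<longlongrightarrow> 0) (at 0)"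
      by (rule Lim_transform_eventually) (auto simp: eventually_at_filter flat_exp_def field_simps)
    then show ?thesis using 3 by (simp add: DERIV_def flat_exp_def)
  qed
qed

text \<open>All orders follow by induction, because \<open>flat_exp_deriv\<close> stays within the family.\<close>

lemma Ck_flat_exp: "Ck k (\<lambda>x::real^'n. flat_exp m (c * x $ i + d))"
proof (induction k arbitrary: m)
  case 0
  have "continuous_on UNIV (flat_exp m)"
    using DERIV_isCont[OF flat_exp_deriv] by (auto simp: continuous_on_eq_continuous_at)
  then show ?case by (auto intro!: continuous_intros continuous_on_compose2[of UNIV "flat_exp m"])
next
  case (Suc k)
  let ?D = "\<lambda>x. flat_exp (m + 2) (c * x $ i + d) - m * flat_exp (m + 1) (c * x $ i + d)"
  have d: "((\<lambda>x::real^'n. flat_exp m (c * x $ i + d)) has_derivative (\<lambda>h. ?D x * (c * h $ i))) (at x)" for x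
  proof -
    have "((\<lambda>x::real^'n. c * x $ i + d) has_derivative (\<lambda>h. c * h $ i)) (at x)"
      by (auto intro!: derivative_eq_intros bounded_linear_imp_has_derivative[OF bounded_linear_vec_nth])
    from has_derivative_compose[OF this flat_exp_deriv[of m, unfolded has_field_derivative_def]]
    show ?thesis .
  qed
  have "partial_deriv j (\<lambda>x::real^'n. flat_exp m (c * x $ i + d)) = (\<lambda>x. (c * axis j 1 $ i) * ?D x)" for j
    by (rule ext, subst partial_deriv_eq[OF d]) (simp add: mult.commute)
  moreover have "Ck k ?D" using Ck_add[OF Suc.IH[of "m + 2"] Ck_cmult[OF Suc.IH[of "m + 1"], of "- real m"]] by simp
  ultimately show ?case using d by (auto simp: differentiable_on_def differentiable_def intro: Ck_cmult)
qed

text \<open>A smooth approximation from below of the indicator of the box between \<open>a\<close> and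
  \<open>b\<close>, which becomes exact as \<open>n\<close> grows.\<close>

definition bump :: "nat \<Rightarrow> real^'n \<Rightarrow> real^'n \<Rightarrow> real^'n \<Rightarrow> real" where
  "bump n a b x = (\<Prod>i\<in>UNIV. flat_exp 0 (real (Suc n) * (x $ i - a $ i)) * flat_exp 0 (real (Suc n) * (b $ i - x $ i)))"

lemma flat_exp_0_bounds: "0 \<le> flat_exp 0 x" "flat_exp 0 x \<le> 1"
  by (auto simp: flat_exp_def)

lemma bump_bounds: "0 \<le> bump n a b x" "bump n a b x \<le> 1"
  unfolding bump_def by (intro prod_nonneg prod_le_1; simp add: flat_exp_0_bounds mult_le_one)+

lemma bump_eq_0: "x \<notin> box a b \<Longrightarrow> bump n a b x = 0"
proof -
  assume "x \<notin> box a b"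
  then have "\<exists>i. x $ i \<le> a $ i \<or> b $ i \<le> x $ i" by (simp add: mem_box_cart not_less)
  then obtain i where "x $ i \<le> a $ i \<or> b $ i \<le> x $ i" by blast
  then have "flat_exp 0 (real (Suc n) * (x $ i - a $ i)) * flat_exp 0 (real (Suc n) * (b $ i - x $ i)) = 0"
    by (auto simp: flat_exp_def zero_less_mult_iff)
  then show ?thesis unfolding bump_def by (intro prod_zero) auto
qed

lemma bump_test_fun: "bump n a b \<in> test_fun UNIV"
proof -
  have "closure {x. bump n a b x \<noteq> 0} \<subseteq> cbox a b"
    using bump_eq_0[of _ a b n] box_subset_cbox by (intro closure_minimal) auto
  then have "compact (closure {x. bump n a b x \<noteq> 0})"
    using compact_closure_subset compact_cbox by blast
  moreover have "Ck k (bump n a b)" for k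
  proof -
    have "Ck k (\<lambda>x. flat_exp 0 (real (Suc n) * (x $ i - a $ i)))" "Ck k (\<lambda>x. flat_exp 0 (real (Suc n) * (b $ i - x $ i)))" for i
      using Ck_flat_exp[of k 0 "real (Suc n)" i "- real (Suc n) * a $ i"] Ck_flat_exp[of k 0 "- real (Suc n)" i "real (Suc n) * b $ i"]
      by (simp_all add: algebra_simps)
    then show ?thesis unfolding bump_def by (intro Ck_prod Ck_mult) auto
  qed
  ultimately show ?thesis by (simp add: test_fun_def)
qed

lemma bump_tendsto: "(\<lambda>n. bump n a b x) \<longlonglongrightarrow> indicator (box a b) x"
proof (cases "x \<in> box a b")
  case True
  have 1: "(\<lambda>n. flat_exp 0 (real (Suc n) * t)) \<longlonglongrightarrow> 1" if "0 < t" for t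
  proof -
    have "(\<lambda>n. exp (- (1 / (real (Suc n) * t)))) \<longlonglongrightarrow> exp (- 0)"
    proof (intro tendsto_exp tendsto_minus)
      have "(\<lambda>n. 1 / real (Suc n) * (1 / t)) \<longlonglongrightarrow> 0 * (1 / t)"
        by (intro tendsto_mult tendsto_const LIMSEQ_Suc[OF lim_1_over_n])
      then show "(\<lambda>n. 1 / (real (Suc n) * t)) \<longlonglongrightarrow> 0" by simp
    qed
    moreover have "0 < real (Suc n) * t" for n using that by simp
    ultimately show ?thesis unfolding flat_exp_def by simp
  qed
  have "(\<lambda>n. bump n a b x) \<longlonglongrightarrow> (\<Prod>i\<in>(UNIV::'a set). 1 * 1)"
    unfolding bump_def using True by (intro tendsto_prod tendsto_mult 1) (auto simp: mem_box_cart)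
  then show ?thesis using True by simp
qed (simp add: bump_eq_0)

lemma locally_integrable_mult_test_fun:
  fixes g :: "real^'n \<Rightarrow> real"
  assumes g: "locally_integrable g" and \<phi>: "\<phi> \<in> test_fun UNIV"
  shows "integrable lebesgue (\<lambda>x. g x * \<phi> x)"
proof -
  define S where "S = closure {x. \<phi> x \<noteq> 0}"
  have S: "compact S" using \<phi> by (simp add: S_def test_fun_def)
  have S0: "x \<notin> S \<Longrightarrow> \<phi> x = 0" for x unfolding S_def using closure_subset[of "{x. \<phi> x \<noteq> 0}"] by auto
  obtain M where M: "0 < M" "\<And>x. \<bar>\<phi> x\<bar> \<le> M"
    using bounded_continuous_compact_support[OF test_fun_continuous[OF \<phi>] S S0] by blast
  have i: "integrable lebesgue (\<lambda>x. indicator S x *\<^sub>R g x)"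
    using g S by (simp add: locally_integrable_def set_integrable_def)
  have [measurable]: "\<phi> \<in> borel_measurable lebesgue"
    using test_fun_continuous[OF \<phi>] by (intro measurable_completion) (simp add: borel_measurable_continuous_onI)
  have "integrable lebesgue (\<lambda>x. (indicator S x *\<^sub>R g x) * \<phi> x)"
  proof (rule Bochner_Integration.integrable_bound[where f="\<lambda>x. (indicator S x *\<^sub>R g x) * M"])
    show "integrable lebesgue (\<lambda>x. (indicator S x *\<^sub>R g x) * M)" using i by simp
    have [measurable]: "(\<lambda>x. indicator S x *\<^sub>R g x) \<in> borel_measurable lebesgue" using i by (rule borel_measurable_integrable)
    show "(\<lambda>x. (indicator S x *\<^sub>R g x) * \<phi> x) \<in> borel_measurable lebesgue" by measurable
    show "AE x in lebesgue. norm ((indicator S x *\<^sub>R g x) * \<phi> x) \<le> norm ((indicator S x *\<^sub>R g x) * M)"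
      using M unfolding norm_mult by (intro AE_I2 mult_left_mono) auto
  qed
  also have "(\<lambda>x. (indicator S x *\<^sub>R g x) * \<phi> x) = (\<lambda>x. g x * \<phi> x)"
    using S0 by (auto simp: fun_eq_iff indicator_def)
  finally show ?thesis .
qed

text \<open>The sets on which the integral vanishes form a Dynkin system, which contains the
  intersection-stable generator of boxes and hence all Borel sets.\<close>

lemma integral_boxes_zero_imp_AE_zero:
  fixes f :: "'a::euclidean_space \<Rightarrow> real"
  assumes f: "integrable lborel f" and 0: "\<And>a b. (\<integral>x. indicator (box a b) x * f x \<partial>lborel) = 0"
  shows "AE x in lborel. f x = 0"
proof -
  have [measurable]: "f \<in> borel_measurable borel" using f by simp
  have fA: "integrable lborel (\<lambda>x. indicator A x * f x)" if "A \<in> sets borel" for A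
    using integrable_mult_indicator[OF _ f, of A] that by simp
  have UN0: "(\<integral>x. f x \<partial>lborel) = 0"
  proof -
    have "(\<lambda>n. \<integral>x. indicator (box (- (real n *\<^sub>R One)) (real n *\<^sub>R One)) x * f x \<partial>lborel) \<longlonglongrightarrow> (\<integral>x. f x \<partial>lborel)"
    proof (rule integral_dominated_convergence[where w="\<lambda>x. \<bar>f x\<bar>"])
      show "AE x in lborel. (\<lambda>n. indicator (box (- (real n *\<^sub>R One)) (real n *\<^sub>R One)) x * f x) \<longlonglongrightarrow> f x"
      proof (rule AE_I2)
        fix x :: 'a
        have "eventually (\<lambda>n. x \<in> box (- (real n *\<^sub>R One)) (real n *\<^sub>R One)) sequentially"
        proof -
          obtain N where N: "norm x < real N" using reals_Archimedean2 by blast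
          show ?thesis
          proof (rule eventually_sequentiallyI[of N])
            fix n assume "N \<le> n"
            then have n: "norm x < real n" using N by simp
            show "x \<in> box (- (real n *\<^sub>R One)) (real n *\<^sub>R One)"
              by (rule mem_box_symmetric[OF n])
          qed
        qed
        then show "(\<lambda>n. indicator (box (- (real n *\<^sub>R One)) (real n *\<^sub>R One)) x * f x) \<longlonglongrightarrow> f x"
          by (intro tendsto_eventually) (erule eventually_mono, simp)
      qed
    qed (use f in \<open>auto simp: indicator_def\<close>)
    then show ?thesis unfolding 0 by (simp only: LIMSEQ_const_iff)
  qed
  have A0: "(\<integral>x. indicator A x * f x \<partial>lborel) = 0" if "A \<in> sets borel" for A
  proof -
    have "Int_stable (range (\<lambda>(a, b). box a b :: 'a set))"
      by (auto simp: Int_stable_def box_Int_box)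
    moreover have "range (\<lambda>(a, b). box a b :: 'a set) \<subseteq> Pow UNIV" by simp
    moreover have "A \<in> sigma_sets UNIV (range (\<lambda>(a, b). box a b :: 'a set))"
      using that by (simp add: borel_eq_box)
    ultimately show ?thesis
    proof (induction rule: sigma_sets_induct_disjoint)
      case (basic A) then show ?case by (auto simp: 0)
    next
      case empty show ?case by simp
    next
      case (compl A)
      have "A \<in> sets borel" using compl by (simp add: borel_eq_box)
      have "(\<integral>x. indicator (UNIV - A) x * f x \<partial>lborel) = (\<integral>x. f x - indicator A x * f x \<partial>lborel)"
        by (intro Bochner_Integration.integral_cong) (auto simp: indicator_def)
      also have "\<dots> = 0" using f fA[OF \<open>A \<in> sets borel\<close>] compl UN0 by simp
      finally show ?case .
    next
      case (union A)
      then have A: "A i \<in> sets borel" for i by (auto simp: borel_eq_box)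
      have "set_lebesgue_integral lborel (\<Union>i. A i) f = (\<Sum>i. set_lebesgue_integral lborel (A i) f)"
        using A union by (intro lebesgue_integral_countable_add)
         (auto simp: disjoint_family_on_def set_integrable_def intro!: fA sets.countable_UN)
      then show ?case using union by (simp add: set_lebesgue_integral_def)
    qed
  qed
  have p: "{x. 0 < f x} \<in> sets borel" "{x. f x < 0} \<in> sets borel" by measurable
  have "AE x in lborel. indicator {x. 0 < f x} x * f x = 0"
    using A0[OF p(1)] by (subst integral_nonneg_eq_0_iff_AE[OF fA[OF p(1)], symmetric]) (auto simp: indicator_def)
  moreover have "AE x in lborel. - (indicator {x. f x < 0} x * f x) = 0"
    using A0[OF p(2)] by (subst integral_nonneg_eq_0_iff_AE[OF integrable_minus[OF fA[OF p(2)]], symmetric]) (auto simp: indicator_def)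
  ultimately show ?thesis
    by eventually_elim (auto simp: indicator_def split: if_splits)
qed

text \<open>The fundamental lemma of the calculus of variations: testing with bumps shows that all integrals
  over boxes vanish.\<close>

lemma locally_integrable_AE_zero:
  fixes g :: "real^'n \<Rightarrow> real"
  assumes g: "locally_integrable g" and 0: "\<And>\<phi>. \<phi> \<in> test_fun UNIV \<Longrightarrow> (\<integral>x. g x * \<phi> x \<partial>lebesgue) = 0"
  shows "AE x in lebesgue. g x = 0"
proof -
  have ib: "integrable lebesgue (\<lambda>x. indicator (box a b) x * g x)" for a b
  proof -
    have "set_integrable lebesgue (cbox a b) g" using g by (simp add: locally_integrable_def)
    then have "set_integrable lebesgue (box a b) g"
      by (rule set_integrable_subset) (auto simp: box_subset_cbox)
    then show ?thesis by (simp add: set_integrable_def)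
  qed
  have b0: "(\<integral>x. indicator (box a b) x * g x \<partial>lebesgue) = 0" for a b
  proof -
    have "(\<lambda>n. \<integral>x. g x * bump n a b x \<partial>lebesgue) \<longlonglongrightarrow> (\<integral>x. indicator (box a b) x * g x \<partial>lebesgue)"
    proof (rule integral_dominated_convergence[where w="\<lambda>x. \<bar>indicator (box a b) x * g x\<bar>"])
      show "(\<lambda>x. indicator (box a b) x * g x) \<in> borel_measurable lebesgue" using ib[of a b] by simp
      show "integrable lebesgue (\<lambda>x. \<bar>indicator (box a b) x * g x\<bar>)" using ib[of a b] by (rule integrable_abs)
      show "(\<lambda>x. g x * bump n a b x) \<in> borel_measurable lebesgue" for n
        using locally_integrable_mult_test_fun[OF g bump_test_fun] by (rule borel_measurable_integrable)
      show "AE x in lebesgue. (\<lambda>n. g x * bump n a b x) \<longlonglongrightarrow> indicator (box a b) x * g x"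
      proof (rule AE_I2)
        fix x show "(\<lambda>n. g x * bump n a b x) \<longlonglongrightarrow> indicator (box a b) x * g x"
          using tendsto_mult[OF tendsto_const[of "g x"] bump_tendsto[of a b x]] by (simp add: mult.commute)
      qed
      show "AE x in lebesgue. norm (g x * bump n a b x) \<le> \<bar>indicator (box a b) x * g x\<bar>" for n
      proof (rule AE_I2)
        fix x show "norm (g x * bump n a b x) \<le> \<bar>indicator (box a b) x * g x\<bar>"
          using bump_bounds[of n a b x] bump_eq_0[of x a b n] by (cases "x \<in> box a b") (auto simp: abs_mult mult_left_le)
      qed
    qed
    then show ?thesis unfolding 0[OF bump_test_fun] by (simp only: LIMSEQ_const_iff)
  qed
  have "AE x in lebesgue. x \<in> box (- (real k *\<^sub>R One)) (real k *\<^sub>R One) \<longrightarrow> g x = 0" for k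
  proof -
    let ?B = "box (- (real k *\<^sub>R One)) (real k *\<^sub>R One) :: (real^'n) set"
    obtain f where [measurable]: "f \<in> borel_measurable lborel" and f: "AE x in lborel. indicator ?B x * g x = f x"
      using completion_ex_borel_measurable_real[OF borel_measurable_integrable[OF ib]] by blast
    have f': "AE x in lebesgue. indicator ?B x * g x = f x" using f by (rule AE_completion)
    have "integrable lebesgue f"
      using ib by (rule integrable_cong_AE_imp) (use f' in \<open>auto intro: measurable_completion elim: eventually_mono\<close>)
    then have "integrable lborel f" by (simp add: integrable_completion)
    moreover have "(\<integral>x. indicator (box a b) x * f x \<partial>lborel) = 0" for a b
    proof -
      have "(\<integral>x. indicator (box a b) x * f x \<partial>lborel) = (\<integral>x. indicator (box a b) x * f x \<partial>lebesgue)"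
        by (simp add: integral_completion)
      also have "\<dots> = (\<integral>x. indicator (box a b \<inter> ?B) x * g x \<partial>lebesgue)"
      proof (rule integral_cong_AE)
        show "(\<lambda>x. indicator (box a b) x * f x) \<in> borel_measurable lebesgue" by (intro measurable_completion) measurable
        show "(\<lambda>x. indicator (box a b \<inter> ?B) x * g x) \<in> borel_measurable lebesgue"
          unfolding box_Int_box by (rule borel_measurable_integrable[OF ib])
        show "AE x in lebesgue. indicator (box a b) x * f x = indicator (box a b \<inter> ?B) x * g x"
          using f' by eventually_elim (auto simp: indicator_def split: if_splits)
      qed
      also have "\<dots> = 0" unfolding box_Int_box by (rule b0)
      finally show ?thesis .
    qed
    ultimately have "AE x in lborel. f x = 0" by (rule integral_boxes_zero_imp_AE_zero)
    then have "AE x in lebesgue. f x = 0" by (rule AE_completion)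
    with f' show ?thesis by eventually_elim (auto simp: indicator_def)
  qed
  then have "AE x in lebesgue. \<forall>k. x \<in> box (- (real k *\<^sub>R One)) (real k *\<^sub>R One) \<longrightarrow> g x = 0"
    by (subst AE_all_countable) auto
  then show ?thesis
  proof eventually_elim
    case (elim x)
    obtain N where N: "norm x < real N" using reals_Archimedean2 by blast
    then have "x \<in> box (- (real N *\<^sub>R One)) (real N *\<^sub>R One)"
      by (rule mem_box_symmetric)
    then show ?case using elim by blast
  qed
qed

section \<open>The Hilbert space of square integrable fields\<close>

definition sq :: "('a::euclidean_space \<Rightarrow> 'b::euclidean_space) \<Rightarrow> bool" where
  "sq f \<longleftrightarrow> f \<in> borel_measurable lebesgue \<and> integrable lebesgue (\<lambda>x. (norm (f x))\<^sup>2)"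

lemma sq_measurable: "sq f \<Longrightarrow> f \<in> borel_measurable lebesgue"
  by (simp add: sq_def)

lemma sq_integrable: "sq f \<Longrightarrow> integrable lebesgue (\<lambda>x. (norm (f x))\<^sup>2)"
  by (simp add: sq_def)

lemma sq_zero: "sq (\<lambda>_. 0)"
  by (simp add: sq_def)

lemma sq_scaleR: "sq f \<Longrightarrow> sq (\<lambda>x. c *\<^sub>R f x)"
  by (auto simp: sq_def power_mult_distrib)

lemma sq_add:
  assumes "sq f" "sq g" shows "sq (\<lambda>x. f x + g x)"
proof -
  note [measurable] = assms[THEN sq_measurable]
  have "integrable lebesgue (\<lambda>x. (norm (f x + g x))\<^sup>2)"
  proof (rule Bochner_Integration.integrable_bound[where f="\<lambda>x. 2 * (norm (f x))\<^sup>2 + 2 * (norm (g x))\<^sup>2"])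
    show "AE x in lebesgue. norm ((norm (f x + g x))\<^sup>2) \<le> norm (2 * (norm (f x))\<^sup>2 + 2 * (norm (g x))\<^sup>2)"
    proof (rule AE_I2)
      fix x
      have "(norm (f x + g x))\<^sup>2 \<le> (norm (f x) + norm (g x))\<^sup>2" by (intro power_mono norm_triangle_ineq) simp
      also have "\<dots> \<le> 2 * (norm (f x))\<^sup>2 + 2 * (norm (g x))\<^sup>2"
        using sum_squares_bound[of "norm (f x)" "norm (g x)"] by (simp add: power2_sum)
      finally show "norm ((norm (f x + g x))\<^sup>2) \<le> norm (2 * (norm (f x))\<^sup>2 + 2 * (norm (g x))\<^sup>2)" by simp
    qed
  qed (use assms in \<open>auto simp: sq_integrable\<close>)
  then show ?thesis by (simp add: sq_def)
qed

lemma sq_minus: "sq f \<Longrightarrow> sq (\<lambda>x. - f x)"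
  using sq_scaleR[of f "-1"] by simp

lemma sq_diff: "sq f \<Longrightarrow> sq g \<Longrightarrow> sq (\<lambda>x. f x - g x)"
  using sq_add[of f "\<lambda>x. - g x"] sq_minus[of g] by simp

lemma sq_inner_integrable:
  assumes "sq f" "sq g" shows "integrable lebesgue (\<lambda>x. f x \<bullet> g x)"
proof -
  note [measurable] = assms[THEN sq_measurable]
  show ?thesis
  proof (rule Bochner_Integration.integrable_bound[where f="\<lambda>x. (norm (f x))\<^sup>2 + (norm (g x))\<^sup>2"])
    show "AE x in lebesgue. norm (f x \<bullet> g x) \<le> norm ((norm (f x))\<^sup>2 + (norm (g x))\<^sup>2)"
    proof (rule AE_I2)
      fix x
      have "\<bar>f x \<bullet> g x\<bar> \<le> norm (f x) * norm (g x)" by (rule Cauchy_Schwarz_ineq2)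
      also have "\<dots> \<le> 2 * norm (f x) * norm (g x)" by simp
      also have "\<dots> \<le> (norm (f x))\<^sup>2 + (norm (g x))\<^sup>2" by (rule sum_squares_bound)
      finally show "norm (f x \<bullet> g x) \<le> norm ((norm (f x))\<^sup>2 + (norm (g x))\<^sup>2)" by simp
    qed
  qed (use assms in \<open>auto simp: sq_integrable\<close>)
qed

text \<open>A choice of one representative in each class of functions that agree almost everywhere. It makes
  \<open>L\<^sup>2\<close> a plain type, without a quotient construction.\<close>

definition canon :: "('a::euclidean_space \<Rightarrow> 'b::euclidean_space) \<Rightarrow> 'a \<Rightarrow> 'b" where
  "canon f = (SOME g. sq g \<and> (AE x in lebesgue. g x = f x))"

lemma canon:
  assumes "sq f" shows "sq (canon f)" "AE x in lebesgue. canon f x = f x"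
  using someI[of "\<lambda>g. sq g \<and> (AE x in lebesgue. g x = f x)" f] assms by (auto simp: canon_def)

lemma canon_cong:
  assumes "AE x in lebesgue. f x = g x" shows "canon f = canon g"
proof -
  have "(AE x in lebesgue. h x = f x) \<longleftrightarrow> (AE x in lebesgue. h x = g x)" for h
    using assms by (auto elim!: eventually_elim2)
  then show ?thesis by (simp add: canon_def)
qed

typedef (overloaded) ('a::euclidean_space, 'b::euclidean_space) L2 = "{canon f | f :: 'a \<Rightarrow> 'b. sq f}"
  using sq_zero by blast

definition fld :: "('a::euclidean_space, 'b::euclidean_space) L2 \<Rightarrow> 'a \<Rightarrow> 'b" where
  "fld F = Rep_L2 F"

definition mkL2 :: "('a::euclidean_space \<Rightarrow> 'b::euclidean_space) \<Rightarrow> ('a, 'b) L2" where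
  "mkL2 f = Abs_L2 (canon f)"

lemma fld_sq [simp]: "sq (fld F)"
  using Rep_L2[of F] canon by (auto simp: fld_def)

lemma fld_measurable [measurable]: "fld F \<in> borel_measurable lebesgue"
  by (rule sq_measurable) simp

lemma fld_mkL2: "sq f \<Longrightarrow> AE x in lebesgue. fld (mkL2 f) x = f x"
  unfolding fld_def mkL2_def by (subst Abs_L2_inverse) (auto intro: canon)

lemma L2_eqI: "(AE x in lebesgue. fld F x = fld G x) \<Longrightarrow> F = G"
proof -
  assume a: "AE x in lebesgue. fld F x = fld G x"
  obtain f g where f: "sq f" "fld F = canon f" and g: "sq g" "fld G = canon g"
    using Rep_L2[of F] Rep_L2[of G] by (auto simp: fld_def)
  have "AE x in lebesgue. f x = g x"
    using a canon(2)[OF f(1)] canon(2)[OF g(1)] unfolding f g by eventually_elim simp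
  then have "Rep_L2 F = Rep_L2 G" using canon_cong[of f g] f g by (simp add: fld_def)
  then show ?thesis by (simp add: Rep_L2_inject)
qed

lemma mkL2_eqI: "(AE x in lebesgue. f x = g x) \<Longrightarrow> mkL2 f = mkL2 g"
  by (simp add: mkL2_def canon_cong)

lemma mkL2_fld [simp]: "mkL2 (fld F) = F"
  by (rule L2_eqI, rule fld_mkL2) simp

instantiation L2 :: (euclidean_space, euclidean_space) real_vector
begin

definition zero_L2 :: "('a, 'b) L2" where "zero_L2 = mkL2 (\<lambda>_. 0)"
definition plus_L2 :: "('a, 'b) L2 \<Rightarrow> ('a, 'b) L2 \<Rightarrow> ('a, 'b) L2" where "plus_L2 F G = mkL2 (\<lambda>x. fld F x + fld G x)"
definition minus_L2 :: "('a, 'b) L2 \<Rightarrow> ('a, 'b) L2 \<Rightarrow> ('a, 'b) L2" where "minus_L2 F G = mkL2 (\<lambda>x. fld F x - fld G x)"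
definition uminus_L2 :: "('a, 'b) L2 \<Rightarrow> ('a, 'b) L2" where "uminus_L2 F = mkL2 (\<lambda>x. - fld F x)"
definition scaleR_L2 :: "real \<Rightarrow> ('a, 'b) L2 \<Rightarrow> ('a, 'b) L2" where "scaleR_L2 c F = mkL2 (\<lambda>x. c *\<^sub>R fld F x)"
lemma fld_zero: "AE x in lebesgue. fld (0::('a, 'b) L2) x = 0"
  unfolding zero_L2_def by (intro fld_mkL2 sq_zero)
lemma fld_plus: "AE x in lebesgue. fld (F + G :: ('a, 'b) L2) x = fld F x + fld G x"
  unfolding plus_L2_def by (intro fld_mkL2 sq_add) auto
lemma fld_minus: "AE x in lebesgue. fld (F - G :: ('a, 'b) L2) x = fld F x - fld G x"
  unfolding minus_L2_def by (intro fld_mkL2 sq_diff) auto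
lemma fld_uminus: "AE x in lebesgue. fld (- F :: ('a, 'b) L2) x = - fld F x"
  unfolding uminus_L2_def by (intro fld_mkL2 sq_minus) auto
lemma fld_scaleR: "AE x in lebesgue. fld (c *\<^sub>R F :: ('a, 'b) L2) x = c *\<^sub>R fld F x"
  unfolding scaleR_L2_def by (intro fld_mkL2 sq_scaleR) auto

instance
proof
  fix F G H :: "('a, 'b) L2" and c d :: real
  show "F + G + H = F + (G + H)"
    by (rule L2_eqI) (use fld_plus[of "F + G" H] fld_plus[of F G] fld_plus[of F "G + H"] fld_plus[of G H] in eventually_elim, simp)
  show "F + G = G + F"
    by (rule L2_eqI) (use fld_plus[of F G] fld_plus[of G F] in eventually_elim, simp)
  show "0 + F = F"
    by (rule L2_eqI) (use fld_plus[of 0 F] fld_zero in eventually_elim, simp)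
  show "- F + F = 0"
    by (rule L2_eqI) (use fld_plus[of "- F" F] fld_uminus[of F] fld_zero in eventually_elim, simp)
  show "F - G = F + - G"
    by (rule L2_eqI) (use fld_minus[of F G] fld_plus[of F "- G"] fld_uminus[of G] in eventually_elim, simp)
  show "c *\<^sub>R (F + G) = c *\<^sub>R F + c *\<^sub>R G"
    by (rule L2_eqI) (use fld_scaleR[of c "F + G"] fld_scaleR[of c F] fld_scaleR[of c G] fld_plus[of F G] fld_plus[of "c *\<^sub>R F" "c *\<^sub>R G"] in eventually_elim, simp add: scaleR_add_right)
  show "(c + d) *\<^sub>R F = c *\<^sub>R F + d *\<^sub>R F"
    by (rule L2_eqI) (use fld_scaleR[of "c + d" F] fld_scaleR[of c F] fld_scaleR[of d F] fld_plus[of "c *\<^sub>R F" "d *\<^sub>R F"] in eventually_elim, simp add: scaleR_add_left)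
  show "c *\<^sub>R d *\<^sub>R F = (c * d) *\<^sub>R F"
    by (rule L2_eqI) (use fld_scaleR[of c "d *\<^sub>R F"] fld_scaleR[of d F] fld_scaleR[of "c * d" F] in eventually_elim, simp)
  show "1 *\<^sub>R F = F"
    by (rule L2_eqI) (use fld_scaleR[of 1 F] in eventually_elim, simp)
qed

end

instantiation L2 :: (euclidean_space, euclidean_space) real_inner
begin

definition inner_L2 :: "('a, 'b) L2 \<Rightarrow> ('a, 'b) L2 \<Rightarrow> real" where "inner_L2 F G = (LINT x|lebesgue. fld F x \<bullet> fld G x)"
definition norm_L2 :: "('a, 'b) L2 \<Rightarrow> real" where "norm_L2 F = sqrt (F \<bullet> F)"
definition sgn_L2 :: "('a, 'b) L2 \<Rightarrow> ('a, 'b) L2" where "sgn_L2 F = F /\<^sub>R norm F"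
definition dist_L2 :: "('a, 'b) L2 \<Rightarrow> ('a, 'b) L2 \<Rightarrow> real" where "dist_L2 F G = norm (F - G)"
definition uniformity_L2 :: "(('a, 'b) L2 \<times> ('a, 'b) L2) filter" where
  "uniformity_L2 = (INF e\<in>{0<..}. principal {(F, G). dist F G < e})"
definition open_L2 :: "('a, 'b) L2 set \<Rightarrow> bool" where
  "open_L2 U \<longleftrightarrow> (\<forall>F\<in>U. eventually (\<lambda>(F', G). F' = F \<longrightarrow> G \<in> U) uniformity)"

instance
proof
  fix F G H :: "('a, 'b) L2" and c :: real
  show "F \<bullet> G = G \<bullet> F"
    unfolding inner_L2_def by (simp add: inner_commute)
  show "(F + G) \<bullet> H = F \<bullet> H + G \<bullet> H"
  proof -
    have "(F + G) \<bullet> H = (LINT x|lebesgue. fld F x \<bullet> fld H x + fld G x \<bullet> fld H x)"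
      unfolding inner_L2_def
    proof (rule integral_cong_AE)
      show "AE x in lebesgue. fld (F + G) x \<bullet> fld H x = fld F x \<bullet> fld H x + fld G x \<bullet> fld H x"
        using fld_plus[of F G] by eventually_elim (simp add: inner_add_left)
    qed measurable
    then show ?thesis
      by (simp add: inner_L2_def sq_inner_integrable)
  qed
  show "c *\<^sub>R F \<bullet> G = c * (F \<bullet> G)"
  proof -
    have "c *\<^sub>R F \<bullet> G = (LINT x|lebesgue. c * (fld F x \<bullet> fld G x))"
      unfolding inner_L2_def
    proof (rule integral_cong_AE)
      show "AE x in lebesgue. fld (c *\<^sub>R F) x \<bullet> fld G x = c * (fld F x \<bullet> fld G x)"
        using fld_scaleR[of c F] by eventually_elim simp
    qed measurable
    then show ?thesis by (simp add: inner_L2_def)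
  qed
  show "0 \<le> F \<bullet> F" unfolding inner_L2_def by (rule Bochner_Integration.integral_nonneg) simp
  show "F \<bullet> F = 0 \<longleftrightarrow> F = 0"
  proof
    assume "F \<bullet> F = 0"
    then have z: "AE x in lebesgue. fld F x \<bullet> fld F x = 0"
      unfolding inner_L2_def by (subst (asm) integral_nonneg_eq_0_iff_AE) (auto simp: sq_inner_integrable)
    show "F = 0"
    proof (rule L2_eqI)
      show "AE x in lebesgue. fld F x = fld 0 x"
        using z fld_zero by eventually_elim simp
    qed
  next
    assume "F = 0"
    have "(0::('a, 'b) L2) \<bullet> 0 = (LINT x|(lebesgue::'a measure). 0)"
      unfolding inner_L2_def
    proof (rule integral_cong_AE)
      show "AE x in lebesgue. fld (0::('a, 'b) L2) x \<bullet> fld (0::('a, 'b) L2) x = 0"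
        using fld_zero by eventually_elim simp
    qed measurable
    then show "F \<bullet> F = 0" using \<open>F = 0\<close> by simp
  qed
  show "dist F G = norm (F - G)" by (rule dist_L2_def)
  show "sgn F = F /\<^sub>R norm F" by (rule sgn_L2_def)
  show "norm F = sqrt (F \<bullet> F)" by (rule norm_L2_def)
  show "(uniformity :: (('a, 'b) L2 \<times> ('a, 'b) L2) filter) = (INF e\<in>{0<..}. principal {(F, G). dist F G < e})"
    by (rule uniformity_L2_def)
  show "open U \<longleftrightarrow> (\<forall>F\<in>U. eventually (\<lambda>(F', G). F' = F \<longrightarrow> G \<in> U) uniformity)" for U :: "('a, 'b) L2 set"
    by (rule open_L2_def)
qed

end

lemma norm_L2_square: "(norm F)\<^sup>2 = (LINT x|lebesgue. (norm (fld F x))\<^sup>2)"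
  unfolding power2_norm_eq_inner by (simp add: inner_L2_def)

lemma norm_mkL2_square:
  assumes "sq f" shows "(norm (mkL2 f))\<^sup>2 = (LINT x|lebesgue. (norm (f x))\<^sup>2)"
  unfolding norm_L2_square
proof (rule integral_cong_AE)
  note [measurable] = assms[THEN sq_measurable]
  show "(\<lambda>x. (norm (f x))\<^sup>2) \<in> borel_measurable lebesgue" by measurable
  show "AE x in lebesgue. (norm (fld (mkL2 f) x))\<^sup>2 = (norm (f x))\<^sup>2"
    using fld_mkL2[OF assms] by eventually_elim simp
qed measurable

lemma nn_integral_L2: "(\<integral>\<^sup>+x. ennreal ((norm (fld F x))\<^sup>2) \<partial>lebesgue) = ennreal ((norm F)\<^sup>2)"
  unfolding norm_L2_square by (rule nn_integral_eq_integral) (auto simp: sq_integrable)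

lemma inner_mkL2:
  assumes "sq f" "sq g"
  shows "mkL2 f \<bullet> mkL2 g = (LINT x|lebesgue. f x \<bullet> g x)"
  unfolding inner_L2_def
proof (rule integral_cong_AE)
  show "AE x in lebesgue. fld (mkL2 f) x \<bullet> fld (mkL2 g) x = f x \<bullet> g x"
    using fld_mkL2[OF assms(1)] fld_mkL2[OF assms(2)] by eventually_elim simp
  note [measurable] = assms[THEN sq_measurable]
  show "(\<lambda>x. f x \<bullet> g x) \<in> borel_measurable lebesgue" by measurable
qed measurable

lemma mkL2_add:
  assumes "sq f" "sq g" shows "mkL2 (\<lambda>x. f x + g x) = mkL2 f + mkL2 g"
  by (rule L2_eqI) (use fld_plus[of "mkL2 f" "mkL2 g"] fld_mkL2[OF assms(1)] fld_mkL2[OF assms(2)] fld_mkL2[OF sq_add[OF assms]] in eventually_elim, simp)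

lemma mkL2_diff:
  assumes "sq f" "sq g" shows "mkL2 (\<lambda>x. f x - g x) = mkL2 f - mkL2 g"
  by (rule L2_eqI) (use fld_minus[of "mkL2 f" "mkL2 g"] fld_mkL2[OF assms(1)] fld_mkL2[OF assms(2)] fld_mkL2[OF sq_diff[OF assms]] in eventually_elim, simp)

lemma mkL2_scaleR:
  assumes "sq f" shows "mkL2 (\<lambda>x. c *\<^sub>R f x) = c *\<^sub>R mkL2 f"
  by (rule L2_eqI) (use fld_scaleR[of c "mkL2 f"] fld_mkL2[OF assms] fld_mkL2[OF sq_scaleR[OF assms, of c]] in eventually_elim, simp)

text \<open>The Riesz--Fischer argument: along a subsequence with geometrically decreasing gaps the increments
  are summable almost everywhere.\<close>

lemma L2_AE_subseq:
  fixes X :: "nat \<Rightarrow> ('a::euclidean_space, 'b::euclidean_space) L2"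
  assumes X: "Cauchy X"
  obtains r f where "strict_mono (r :: nat \<Rightarrow> nat)" "f \<in> borel_measurable lebesgue"
    "AE x in lebesgue. (\<lambda>k. fld (X (r k)) x) \<longlonglongrightarrow> f x"
proof -
  have "\<exists>N. \<forall>m\<ge>N. \<forall>n\<ge>N. norm (X m - X n) < (1 / 4) ^ k" for k
    using X by (rule CauchyD) simp
  then obtain N where N: "\<And>k m n. m \<ge> N k \<Longrightarrow> n \<ge> N k \<Longrightarrow> norm (X m - X n) < (1 / 4) ^ k" by metis
  define r where "r = rec_nat (N 0) (\<lambda>k rk. max (Suc rk) (N (Suc k)))"
  have r_Suc: "r (Suc k) = max (Suc (r k)) (N (Suc k))" for k by (simp add: r_def)
  have r: "strict_mono r" by (rule strict_mono_Suc_iff[THEN iffD2]) (auto simp: r_Suc)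
  have rN: "N k \<le> r k" for k by (cases k) (auto simp: r_def)
  define d where "d k = X (r (Suc k)) - X (r k)" for k
  have d: "norm (d k) \<le> (1 / 4) ^ k" for k
    unfolding d_def using N[of k "r (Suc k)" "r k"] rN[of k] strict_monoD[OF r, of k "Suc k"] by (simp add: less_imp_le)
  have "(\<integral>\<^sup>+x. (\<Sum>k. ennreal (2 ^ k * (norm (fld (d k) x))\<^sup>2)) \<partial>lebesgue) = (\<Sum>k. \<integral>\<^sup>+x. ennreal (2 ^ k * (norm (fld (d k) x))\<^sup>2) \<partial>lebesgue)"
    by (rule nn_integral_suminf) measurable
  also have "\<dots> = (\<Sum>k. ennreal (2 ^ k * (norm (d k))\<^sup>2))"
    by (simp add: ennreal_mult nn_integral_cmult nn_integral_L2)
  also have "\<dots> \<le> (\<Sum>k. ennreal ((1 / 8) ^ k))"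
  proof (intro suminf_le ennreal_leI)
    fix k
    have "2 ^ k * (norm (d k))\<^sup>2 \<le> 2 ^ k * ((1 / 4) ^ k)\<^sup>2" by (intro mult_left_mono power_mono d) auto
    also have "\<dots> = (1 / 8 :: real) ^ k" by (simp add: power2_eq_square power_mult_distrib[symmetric])
    finally show "2 ^ k * (norm (d k))\<^sup>2 \<le> (1 / 8) ^ k" .
  qed auto
  also have "\<dots> = ennreal (\<Sum>k. (1 / 8) ^ k)" by (rule suminf_ennreal2) (auto intro: summable_geometric)
  also have "\<dots> < \<infinity>" by simp
  finally have "AE x in lebesgue. (\<Sum>k. ennreal (2 ^ k * (norm (fld (d k) x))\<^sup>2)) \<noteq> \<infinity>"
    by (intro nn_integral_PInf_AE) auto
  moreover have "AE x in lebesgue. \<forall>k. fld (d k) x = fld (X (r (Suc k))) x - fld (X (r k)) x"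
    unfolding d_def AE_all_countable by (intro allI fld_minus)
  ultimately have conv: "AE x in lebesgue. convergent (\<lambda>k. fld (X (r k)) x)"
  proof eventually_elim
    case (elim x)
    have s: "summable (\<lambda>k. 2 ^ k * (norm (fld (d k) x))\<^sup>2)"
      using elim(1) by (intro summable_suminf_not_top) auto
    have "Bseq (\<lambda>k. 2 ^ k * (norm (fld (d k) x))\<^sup>2)"
      by (rule convergent_imp_Bseq[OF convergentI[OF summable_LIMSEQ_zero[OF s]]])
    then obtain C where C: "0 < C" "\<And>k. norm (2 ^ k * (norm (fld (d k) x))\<^sup>2) \<le> C" by (auto simp: Bseq_def)
    have "norm (fld (d k) x) \<le> sqrt C * (1 / sqrt 2) ^ k" for k
    proof -
      have "(norm (fld (d k) x))\<^sup>2 \<le> C / 2 ^ k" using C(2)[of k] by (simp add: abs_mult pos_le_divide_eq mult.commute)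
      then have "sqrt ((norm (fld (d k) x))\<^sup>2) \<le> sqrt (C / 2 ^ k)" by (rule real_sqrt_le_mono)
      moreover have "sqrt (C / 2 ^ k) = sqrt C * (1 / sqrt 2) ^ k"
        by (simp only: real_sqrt_divide real_sqrt_power power_divide power_one times_divide_eq_right mult_1_right)
      ultimately show ?thesis by simp
    qed
    moreover have "summable (\<lambda>k. sqrt C * (1 / sqrt 2) ^ k)" by (intro summable_mult summable_geometric) simp
    ultimately have "summable (\<lambda>k. fld (d k) x)" by (rule summable_comparison_test'[of _ 0, rotated]) 
    then have "convergent (\<lambda>n. \<Sum>k<n. fld (d k) x)" by (simp add: summable_iff_convergent)
    moreover have "(\<Sum>k<n. fld (d k) x) = fld (X (r n)) x - fld (X (r 0)) x" for n
      using elim(2) sum_lessThan_telescope[of "\<lambda>k. fld (X (r k)) x" n] by simp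
    ultimately have "convergent (\<lambda>n. fld (X (r n)) x - fld (X (r 0)) x)" by simp
    then have "convergent (\<lambda>n. (fld (X (r n)) x - fld (X (r 0)) x) + fld (X (r 0)) x)"
      by (intro convergent_add convergent_const)
    then show ?case by simp
  qed
  show ?thesis
  proof (rule that[OF r])
    show "(\<lambda>x. lim (\<lambda>k. fld (X (r k)) x)) \<in> borel_measurable lebesgue"
      by (rule borel_measurable_lim_metric) measurable
    show "AE x in lebesgue. (\<lambda>k. fld (X (r k)) x) \<longlonglongrightarrow> lim (\<lambda>k. fld (X (r k)) x)"
      using conv by eventually_elim (simp add: convergent_LIMSEQ_iff)
  qed
qed

instance L2 :: (euclidean_space, euclidean_space) complete_space
proof
  fix X :: "nat \<Rightarrow> ('a, 'b) L2" assume X: "Cauchy X"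
  obtain r f where r: "strict_mono (r :: nat \<Rightarrow> nat)" and f [measurable]: "f \<in> borel_measurable lebesgue"
    and lim: "AE x in lebesgue. (\<lambda>k. fld (X (r k)) x) \<longlonglongrightarrow> f x"
    using L2_AE_subseq[OF X] by blast
  have Fatou: "(\<integral>\<^sup>+x. ennreal ((norm (fld (X n) x - f x))\<^sup>2) \<partial>lebesgue) \<le> ennreal (e\<^sup>2)"
    if N: "\<And>m. m \<ge> N \<Longrightarrow> norm (X n - X m) \<le> e" for n N e
  proof -
    have "(\<integral>\<^sup>+x. ennreal ((norm (fld (X n) x - f x))\<^sup>2) \<partial>lebesgue) =
      (\<integral>\<^sup>+x. liminf (\<lambda>k. ennreal ((norm (fld (X n) x - fld (X (r k)) x))\<^sup>2)) \<partial>lebesgue)"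
    proof (rule nn_integral_cong_AE)
      show "AE x in lebesgue. ennreal ((norm (fld (X n) x - f x))\<^sup>2) = liminf (\<lambda>k. ennreal ((norm (fld (X n) x - fld (X (r k)) x))\<^sup>2))"
        using lim
      proof eventually_elim
        case (elim x)
        have "(\<lambda>k. ennreal ((norm (fld (X n) x - fld (X (r k)) x))\<^sup>2)) \<longlonglongrightarrow> ennreal ((norm (fld (X n) x - f x))\<^sup>2)"
          by (intro tendsto_intros elim)
        then show ?case by (rule lim_imp_Liminf[OF sequentially_bot, symmetric])
      qed
    qed
    also have "\<dots> \<le> liminf (\<lambda>k. \<integral>\<^sup>+x. ennreal ((norm (fld (X n) x - fld (X (r k)) x))\<^sup>2) \<partial>lebesgue)"
      by (rule nn_integral_liminf) measurable
    also have "\<dots> \<le> ennreal (e\<^sup>2)"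
    proof (rule Liminf_le)
      show "eventually (\<lambda>k. (\<integral>\<^sup>+x. ennreal ((norm (fld (X n) x - fld (X (r k)) x))\<^sup>2) \<partial>lebesgue) \<le> ennreal (e\<^sup>2)) sequentially"
      proof (rule eventually_sequentiallyI[of N])
        fix k assume "N \<le> k"
        then have "N \<le> r k" using seq_suble[OF r, of k] by simp
        have "(\<integral>\<^sup>+x. ennreal ((norm (fld (X n) x - fld (X (r k)) x))\<^sup>2) \<partial>lebesgue) = (\<integral>\<^sup>+x. ennreal ((norm (fld (X n - X (r k)) x))\<^sup>2) \<partial>lebesgue)"
          using fld_minus[of "X n" "X (r k)"] by (intro nn_integral_cong_AE) (auto elim: eventually_mono)
        also have "\<dots> \<le> ennreal (e\<^sup>2)"
          unfolding nn_integral_L2 using N[OF \<open>N \<le> r k\<close>] by (intro ennreal_leI power_mono) auto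
        finally show "(\<integral>\<^sup>+x. ennreal ((norm (fld (X n) x - fld (X (r k)) x))\<^sup>2) \<partial>lebesgue) \<le> ennreal (e\<^sup>2)" .
      qed
    qed simp
    finally show ?thesis .
  qed
  have sqd: "sq (\<lambda>x. fld (X n) x - f x)" if N: "\<And>m. m \<ge> N \<Longrightarrow> norm (X n - X m) \<le> e" for n N e
    unfolding sq_def
  proof (intro conjI integrableI_bounded)
    show "(\<integral>\<^sup>+x. ennreal (norm ((norm (fld (X n) x - f x))\<^sup>2)) \<partial>lebesgue) < \<infinity>"
      using le_less_trans[OF Fatou[where N=N and n=n and e=e, OF N] ennreal_less_top] by simp
  qed measurable
  obtain N1 where "\<And>m n. m \<ge> N1 \<Longrightarrow> n \<ge> N1 \<Longrightarrow> norm (X m - X n) < 1" using CauchyD[OF X, of 1] by auto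
  then have "sq (\<lambda>x. fld (X N1) x - f x)" by (intro sqd[where N=N1 and e=1]) (auto intro: less_imp_le)
  from sq_diff[OF fld_sq[of "X N1"] this] have sqf: "sq f" by simp
  have "X \<longlonglongrightarrow> mkL2 f"
  proof (rule LIMSEQ_I)
    fix e :: real assume "0 < e"
    then obtain N where N: "\<And>m n. m \<ge> N \<Longrightarrow> n \<ge> N \<Longrightarrow> norm (X m - X n) < e / 2" using CauchyD[OF X, of "e / 2"] by auto
    show "\<exists>no. \<forall>n\<ge>no. norm (X n - mkL2 f) < e"
    proof (intro exI[of _ N] allI impI)
      fix n assume n: "n \<ge> N"
      have "ennreal ((norm (X n - mkL2 f))\<^sup>2) = (\<integral>\<^sup>+x. ennreal ((norm (fld (X n) x - f x))\<^sup>2) \<partial>lebesgue)"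
        unfolding nn_integral_L2[symmetric]
      proof (rule nn_integral_cong_AE)
        show "AE x in lebesgue. ennreal ((norm (fld (X n - mkL2 f) x))\<^sup>2) = ennreal ((norm (fld (X n) x - f x))\<^sup>2)"
          using fld_minus[of "X n" "mkL2 f"] fld_mkL2[OF sqf] by eventually_elim simp
      qed
      also have "\<dots> \<le> ennreal ((e / 2)\<^sup>2)"
        using N n by (intro Fatou[where N=N]) (auto intro: less_imp_le)
      finally have "(norm (X n - mkL2 f))\<^sup>2 \<le> (e / 2)\<^sup>2" by simp
      then have "norm (X n - mkL2 f) \<le> e / 2" by (rule power2_le_imp_le) (use \<open>0 < e\<close> in auto)
      then show "norm (X n - mkL2 f) < e" using \<open>0 < e\<close> by simp
    qed
  qed
  then show "convergent X" by (rule convergentI)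
qed

section \<open>The Lions--Stampacchia theorem\<close>

text \<open>The solution minimizes \<open>J u = (u \<bullet> u) / 2 - L u\<close> over \<open>K\<close>.
  Minimizing sequences are Cauchy by the parallelogram law, and the inequality is the first-order
  condition at the minimum. The functional is only required to be defined and bounded on a subspace
  \<open>S\<close> that contains \<open>K\<close>.\<close>

lemma strongly_convex_minimizer:
  fixes K :: "'h::{real_inner, complete_space} set" and L :: "'h \<Rightarrow> real"
  assumes K: "closed K" "convex K" "K \<noteq> {}" "K \<subseteq> S" and S: "subspace S"
    and L_add: "\<And>u v. u \<in> S \<Longrightarrow> v \<in> S \<Longrightarrow> L (u + v) = L u + L v"
    and L_scale: "\<And>c u. u \<in> S \<Longrightarrow> L (c *\<^sub>R u) = c * L u"
    and L_bound: "\<And>u. u \<in> S \<Longrightarrow> \<bar>L u\<bar> \<le> C * norm u"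
  obtains u where "u \<in> K" "\<And>v. v \<in> K \<Longrightarrow> u \<bullet> (v - u) \<ge> L (v - u)"
proof -
  define J where "J u = (u \<bullet> u) / 2 - L u" for u
  have KS: "u \<in> K \<Longrightarrow> u \<in> S" for u using K by auto
  have L_diff: "L (u - v) = L u - L v" if "u \<in> S" "v \<in> S" for u v
    using L_add[of u "(-1) *\<^sub>R v"] L_scale[of v "-1"] that S by (simp add: subspace_neg)
  have lower: "- (C\<^sup>2 / 2) \<le> J u" if "u \<in> K" for u
  proof -
    have "L u \<le> C * norm u" using L_bound[OF KS[OF that]] by linarith
    moreover have "0 \<le> (norm u - C)\<^sup>2" by simp
    ultimately have "L u \<le> (norm u)\<^sup>2 / 2 + C\<^sup>2 / 2" by (simp add: power2_diff mult.commute)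
    then show ?thesis by (simp add: J_def power2_norm_eq_inner[symmetric])
  qed
  define m where "m = Inf (J ` K)"
  have bdd: "bdd_below (J ` K)" using lower by (auto intro!: bdd_belowI)
  have m_le: "m \<le> J u" if "u \<in> K" for u unfolding m_def using bdd that by (auto intro: cInf_lower)
  have "\<exists>u\<in>K. J u < m + 1 / real (Suc n)" for n
    using cInf_lessD[of "J ` K" "m + 1 / real (Suc n)"] K by (auto simp: m_def)
  then obtain U where U: "\<And>n. U n \<in> K" "\<And>n. J (U n) < m + 1 / real (Suc n)" by metis
  have par: "(norm (u - v))\<^sup>2 \<le> 4 * (J u + J v - 2 * m)" if u: "u \<in> K" and v: "v \<in> K" for u v
  proof -
    define w where "w = (1 / 2) *\<^sub>R u + (1 / 2) *\<^sub>R v"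
    have "w \<in> K" unfolding w_def using K u v by (intro convexD) auto
    then have "m \<le> J w" by (rule m_le)
    moreover have "L w = L u / 2 + L v / 2"
      unfolding w_def using KS u v S by (simp add: L_add L_scale subspace_scale)
    moreover have "w \<bullet> w = (u \<bullet> u + 2 * (u \<bullet> v) + v \<bullet> v) / 4"
      unfolding w_def by (simp add: inner_add_left inner_add_right inner_commute field_simps)
    moreover have "(norm (u - v))\<^sup>2 = u \<bullet> u - 2 * (u \<bullet> v) + v \<bullet> v"
      unfolding power2_norm_eq_inner by (simp add: inner_diff_left inner_diff_right inner_commute)
    ultimately show ?thesis unfolding J_def by (simp add: field_simps)
  qed
  have "Cauchy U"
  proof (rule CauchyI)
    fix e :: real assume e: "0 < e"
    then obtain M where M: "1 / real (Suc M) < e\<^sup>2 / 8" using nat_approx_posE[of "e\<^sup>2 / 8"] by auto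
    show "\<exists>M. \<forall>i\<ge>M. \<forall>j\<ge>M. norm (U i - U j) < e"
    proof (intro exI[of _ M] allI impI)
      fix i j assume ij: "i \<ge> M" "j \<ge> M"
      have "1 / real (Suc i) \<le> 1 / real (Suc M)" "1 / real (Suc j) \<le> 1 / real (Suc M)" using ij by (auto simp: frac_le)
      then have "J (U i) + J (U j) - 2 * m < e\<^sup>2 / 4" using U(2)[of i] U(2)[of j] M by linarith
      from mult_strict_left_mono[OF this, of 4] have "4 * (J (U i) + J (U j) - 2 * m) < e\<^sup>2" by simp
      then have "(norm (U i - U j))\<^sup>2 < e\<^sup>2" by (rule le_less_trans[OF par[OF U(1) U(1)]])
      then show "norm (U i - U j) < e" by (rule power2_less_imp_less) (use e in auto)
    qed
  qed
  then obtain u where u: "U \<longlonglongrightarrow> u" using Cauchy_convergent by (auto simp: convergent_def)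
  have uK: "u \<in> K" using K(1) U(1) u by (meson closed_sequentially)
  have "(\<lambda>n. J (U n)) \<longlonglongrightarrow> J u"
  proof -
    have "(\<lambda>n. L (U n) - L u) \<longlonglongrightarrow> 0"
    proof (rule Lim_null_comparison[where g="\<lambda>n. C * norm (U n - u)"])
      show "eventually (\<lambda>n. norm (L (U n) - L u) \<le> C * norm (U n - u)) sequentially"
      proof (rule always_eventually, rule allI)
        fix n show "norm (L (U n) - L u) \<le> C * norm (U n - u)"
          using L_bound[of "U n - u"] KS U(1)[of n] uK S by (simp add: L_diff subspace_diff)
      qed
      show "(\<lambda>n. C * norm (U n - u)) \<longlonglongrightarrow> 0"
        using u by (intro tendsto_mult_right_zero tendsto_norm_zero) (simp add: LIM_zero_iff)
    qed
    then have "(\<lambda>n. L (U n)) \<longlonglongrightarrow> L u" by (simp add: LIM_zero_iff)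
    then show ?thesis unfolding J_def by (intro tendsto_intros u) auto
  qed
  moreover have "(\<lambda>n. m + 1 / real (Suc n)) \<longlonglongrightarrow> m + 0"
    by (intro tendsto_intros LIMSEQ_Suc[OF lim_1_over_n])
  ultimately have "J u \<le> m + 0"
    by (rule LIMSEQ_le) (use U(2) in \<open>auto intro!: exI[of _ 0] less_imp_le\<close>)
  then have Ju: "J u \<le> J v" if "v \<in> K" for v using m_le[OF that] by simp
  show ?thesis
  proof (rule that[OF uK])
    fix v assume v: "v \<in> K"
    define d where "d = v - u"
    have dS: "d \<in> S" unfolding d_def using KS v uK S by (intro subspace_diff) auto
    have key: "- (u \<bullet> d - L d) \<le> t * ((d \<bullet> d) / 2)" if t: "0 < t" "t \<le> 1" for t
    proof -
      have "u + t *\<^sub>R d = (1 - t) *\<^sub>R u + t *\<^sub>R v" by (simp add: d_def algebra_simps)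
      also have "\<dots> \<in> K" using K uK v t by (intro convexD) auto
      finally have "J u \<le> J (u + t *\<^sub>R d)" by (rule Ju)
      moreover have "J (u + t *\<^sub>R d) = J u + t * (u \<bullet> d - L d) + t * (t * ((d \<bullet> d) / 2))"
        unfolding J_def using KS uK dS S
        by (simp add: L_add L_scale subspace_scale inner_add_left inner_add_right inner_commute field_simps)
      ultimately have "0 \<le> t * ((u \<bullet> d - L d) + t * ((d \<bullet> d) / 2))" by (simp add: algebra_simps)
      then show ?thesis using t by (simp add: zero_le_mult_iff)
    qed
    have "((\<lambda>t. t * ((d \<bullet> d) / 2)) \<longlongrightarrow> 0 * ((d \<bullet> d) / 2)) (at_right 0)" by (intro tendsto_intros)
    moreover have "eventually (\<lambda>t. - (u \<bullet> d - L d) \<le> t * ((d \<bullet> d) / 2)) (at_right 0)"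
      by (rule eventually_at_rightI[of 0 1], rule key, simp, simp, simp)
    ultimately have "- (u \<bullet> d - L d) \<le> 0 * ((d \<bullet> d) / 2)"
      by (rule tendsto_lowerbound) simp
    then show "u \<bullet> (v - u) \<ge> L (v - u)" by (simp add: d_def)
  qed
qed

text \<open>For a nonsymmetric operator there is nothing to minimize. Instead, \<open>P w\<close> denotes the
  solution for the identity operator with load \<open>(w - \<rho> T w) + \<rho> L\<close>; a fixed
  point of \<open>P\<close> solves the original problem, and \<open>P\<close> is a contraction since
  \<open>w \<mapsto> w - \<rho> T w\<close> is one for small \<open>\<rho>\<close>.\<close>

theorem lions_stampacchia:
  fixes K :: "'h::{real_inner, complete_space} set" and L :: "'h \<Rightarrow> real" and T :: "'h \<Rightarrow> 'h"
  assumes K: "closed K" "convex K" "K \<noteq> {}" "K \<subseteq> S" and S: "subspace S"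
    and L_add: "\<And>u v. u \<in> S \<Longrightarrow> v \<in> S \<Longrightarrow> L (u + v) = L u + L v"
    and L_scale: "\<And>c u. u \<in> S \<Longrightarrow> L (c *\<^sub>R u) = c * L u"
    and L_bound: "\<And>u. u \<in> S \<Longrightarrow> \<bar>L u\<bar> \<le> C * norm u"
    and T: "linear T" and T_coercive: "\<And>u. a * (norm u)\<^sup>2 \<le> T u \<bullet> u" and T_bound: "\<And>u. norm (T u) \<le> b * norm u"
    and a: "0 < a" and b: "0 < b"
  obtains u where "u \<in> K" "\<And>v. v \<in> K \<Longrightarrow> T u \<bullet> (v - u) \<ge> L (v - u)"
proof -
  \<comment> \<open>The minimum over \<rho> of the contraction factor 1 - 2 \<rho> a + (\<rho> b)^2; the maximum
    with 0 below covers a > b, which can occur in the zero space.\<close>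
  define \<rho> where "\<rho> = a / b\<^sup>2"
  have \<rho>: "0 < \<rho>" using a b by (simp add: \<rho>_def)
  define q where "q = max 0 (1 - a\<^sup>2 / b\<^sup>2)"
  have q: "0 \<le> q" "q < 1" using a b by (auto simp: q_def)
  define k where "k = sqrt q"
  have k: "0 \<le> k" "k < 1" using q by (auto simp: k_def)
  have contr: "norm (w - \<rho> *\<^sub>R T w) \<le> k * norm w" for w
  proof -
    have "(norm (w - \<rho> *\<^sub>R T w))\<^sup>2 = (norm w)\<^sup>2 - 2 * \<rho> * (T w \<bullet> w) + \<rho>\<^sup>2 * (norm (T w))\<^sup>2"
      unfolding power2_norm_eq_inner by (simp add: inner_diff_left inner_diff_right inner_commute power2_eq_square algebra_simps)
    also have "\<dots> \<le> (norm w)\<^sup>2 - 2 * \<rho> * (a * (norm w)\<^sup>2) + \<rho>\<^sup>2 * (b * norm w)\<^sup>2"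
      using \<rho> T_coercive[of w] T_bound[of w] by (intro add_mono diff_mono mult_left_mono power_mono) auto
    also have "\<dots> = (1 - a\<^sup>2 / b\<^sup>2) * (norm w)\<^sup>2"
      using b by (simp add: \<rho>_def field_simps power2_eq_square)
    also have "\<dots> \<le> q * (norm w)\<^sup>2" by (intro mult_right_mono) (auto simp: q_def)
    also have "\<dots> = (k * norm w)\<^sup>2" using q by (simp add: k_def power_mult_distrib)
    finally show ?thesis by (rule power2_le_imp_le) (use k in auto)
  qed
  define Lw where "Lw w v = (w - \<rho> *\<^sub>R T w) \<bullet> v + \<rho> * L v" for w v
  have "\<exists>u\<in>K. \<forall>v\<in>K. u \<bullet> (v - u) \<ge> Lw w (v - u)" for w
  proof -
    have "\<bar>Lw w u\<bar> \<le> (norm (w - \<rho> *\<^sub>R T w) + \<rho> * C) * norm u" if "u \<in> S" for u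
    proof -
      have "\<bar>Lw w u\<bar> \<le> \<bar>(w - \<rho> *\<^sub>R T w) \<bullet> u\<bar> + \<bar>\<rho> * L u\<bar>" unfolding Lw_def by (rule abs_triangle_ineq)
      also have "\<dots> \<le> norm (w - \<rho> *\<^sub>R T w) * norm u + \<rho> * (C * norm u)"
        using \<rho> L_bound[OF that] by (intro add_mono Cauchy_Schwarz_ineq2) (auto simp: abs_mult)
      finally show ?thesis by (simp add: algebra_simps)
    qed
    then obtain u where "u \<in> K" "\<And>v. v \<in> K \<Longrightarrow> u \<bullet> (v - u) \<ge> Lw w (v - u)"
      by (rule strongly_convex_minimizer[OF K S, of "Lw w", rotated 2])
        (auto simp: Lw_def inner_add_right L_add L_scale algebra_simps)
    then show ?thesis by blast
  qed
  then obtain P where P: "\<And>w. P w \<in> K" "\<And>w v. v \<in> K \<Longrightarrow> P w \<bullet> (v - P w) \<ge> Lw w (v - P w)" by metis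
  have L_diff: "L (u - v) = - L (v - u)" if "u \<in> K" "v \<in> K" for u v
  proof -
    have "v - u \<in> S" using that K S by (intro subspace_diff) auto
    then show ?thesis using L_scale[of "v - u" "-1"] by simp
  qed
  have Pc: "dist (P w) (P z) \<le> k * dist w z" for w z
  proof -
    define d where "d = P w - P z"
    have "P w \<bullet> (P z - P w) \<ge> Lw w (P z - P w)" "P z \<bullet> d \<ge> Lw z d"
      using P(2)[OF P(1), of w z] P(2)[OF P(1), of z w] by (auto simp: d_def)
    moreover have "P z - P w = - d" by (simp add: d_def)
    ultimately have 1: "Lw z d \<le> P z \<bullet> d" "Lw w (- d) \<le> - (P w \<bullet> d)" by auto
    have "Lw w (- d) = - Lw w d" unfolding Lw_def using L_diff[OF P(1) P(1), of z w] by (simp add: d_def algebra_simps)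
    then have "d \<bullet> d \<le> Lw w d - Lw z d" using 1 by (simp add: d_def inner_diff_left)
    also have "\<dots> = ((w - z) - \<rho> *\<^sub>R T (w - z)) \<bullet> d"
      unfolding Lw_def linear_diff[OF T, of w z] by (simp add: algebra_simps inner_diff_left)
    also have "\<dots> \<le> norm ((w - z) - \<rho> *\<^sub>R T (w - z)) * norm d" by (rule norm_cauchy_schwarz)
    also have "\<dots> \<le> k * norm (w - z) * norm d" by (intro mult_right_mono contr) auto
    finally have "norm d * norm d \<le> k * norm (w - z) * norm d" by (simp add: power2_norm_eq_inner[symmetric] power2_eq_square)
    then have "norm d \<le> k * norm (w - z)" using k by (cases "norm d = 0") auto
    then show ?thesis by (simp add: dist_norm d_def)
  qed
  have "\<exists>!u. P u = u"
    using Pc by (intro banach_fix_type[OF k]) auto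
  then obtain u where u: "P u = u" by blast
  show ?thesis
  proof (rule that[of u])
    show "u \<in> K" using P(1)[of u] u by simp
    fix v assume "v \<in> K"
    then have "u \<bullet> (v - u) \<ge> (u - \<rho> *\<^sub>R T u) \<bullet> (v - u) + \<rho> * L (v - u)" using P(2)[of v u] u by (simp add: Lw_def)
    then have "\<rho> * L (v - u) \<le> \<rho> * (T u \<bullet> (v - u))" by (simp add: inner_diff_left)
    then show "T u \<bullet> (v - u) \<ge> L (v - u)" using \<rho> by simp
  qed
qed

section \<open>The Gagliardo seminorm\<close>

lemma borel_representative:
  fixes u :: "'a::euclidean_space \<Rightarrow> real"
  assumes "u \<in> borel_measurable lebesgue"
  obtains u' where "u' \<in> borel_measurable borel" "AE x in lebesgue. u x = u' x"
proof -
  obtain u' where u': "u' \<in> borel_measurable lborel" "AE x in lborel. u x = u' x"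
    using completion_ex_borel_measurable_real[OF assms] by blast
  show ?thesis by (rule that[of u']) (use u'(1) AE_completion[OF u'(2)] in simp_all)
qed

lemma Lp2_norm: "Lp_norm 2 M u = sqrt (LINT x|M. (u x)\<^sup>2)"
  by (simp add: Lp_norm_def powr_half_sqrt Bochner_Integration.integral_nonneg)

lemma Lp2_iff: "u \<in> Lp 2 lebesgue \<longleftrightarrow> sq (u :: real^'n \<Rightarrow> real)"
  by (simp add: Lp_def sq_def)

lemma gagliardo_cong:
  assumes "AE x in lebesgue. u x = v x"
  shows "gagliardo \<sigma> u = gagliardo \<sigma> v"
  unfolding gagliardo_def
proof (rule nn_integral_cong_AE)
  show "AE x in lebesgue. (\<integral>\<^sup>+y. ennreal ((u x - u y)\<^sup>2 / norm (x - y) powr (real CARD('a) + 2 * \<sigma>)) \<partial>lebesgue) =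
    (\<integral>\<^sup>+y. ennreal ((v x - v y)\<^sup>2 / norm (x - y) powr (real CARD('a) + 2 * \<sigma>)) \<partial>lebesgue)"
    using assms
  proof eventually_elim
    case (elim x)
    show ?case
    proof (rule nn_integral_cong_AE)
      show "AE y in lebesgue. ennreal ((u x - u y)\<^sup>2 / norm (x - y) powr (real CARD('a) + 2 * \<sigma>)) =
        ennreal ((v x - v y)\<^sup>2 / norm (x - y) powr (real CARD('a) + 2 * \<sigma>))"
        using assms by eventually_elim (simp add: elim)
    qed
  qed
qed

text \<open>Borel measurable functions admit the product measure theory of \<open>lborel\<close>, so that
  estimates are proved for Borel representatives and transferred.\<close>

lemma gagliardo_lborel:
  fixes u :: "real^'n \<Rightarrow> real"
  assumes [measurable]: "u \<in> borel_measurable borel"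
  shows "gagliardo \<sigma> u = (\<integral>\<^sup>+x. \<integral>\<^sup>+y. ennreal ((u x - u y)\<^sup>2) * ennreal (norm (x - y) powr (- 2 * \<sigma> - DIM(real^'n))) \<partial>lborel \<partial>lborel)"
proof -
  have e: "ennreal ((u x - u y)\<^sup>2 / norm (x - y) powr (real CARD('n) + 2 * \<sigma>)) = ennreal ((u x - u y)\<^sup>2) * ennreal (norm (x - y) powr (- 2 * \<sigma> - DIM(real^'n)))" for x y
  proof -
    have "norm (x - y) powr (- 2 * \<sigma> - DIM(real^'n)) = 1 / norm (x - y) powr (real CARD('n) + 2 * \<sigma>)"
    proof -
      have "- 2 * \<sigma> - DIM(real^'n) = - (real CARD('n) + 2 * \<sigma>)" by simp
      then show ?thesis by (simp only: powr_minus_divide)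
    qed
    then show ?thesis by (simp add: ennreal_mult[symmetric])
  qed
  show ?thesis unfolding gagliardo_def e
    by (subst nn_integral_completion, simp, subst nn_integral_completion, simp_all)
qed

lemma gagliardo_cmult:
  fixes u :: "real^'n \<Rightarrow> real"
  assumes "u \<in> borel_measurable lebesgue"
  shows "gagliardo \<sigma> (\<lambda>x. c * u x) = ennreal (c\<^sup>2) * gagliardo \<sigma> u"
proof -
  obtain u' where [measurable]: "u' \<in> borel_measurable borel" and u': "AE x in lebesgue. u x = u' x"
    using borel_representative[OF assms] .
  have "gagliardo \<sigma> (\<lambda>x. c * u x) = gagliardo \<sigma> (\<lambda>x. c * u' x)"
    by (rule gagliardo_cong) (use u' in eventually_elim, simp)
  also have "\<dots> = ennreal (c\<^sup>2) * gagliardo \<sigma> u'"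
    by (simp add: gagliardo_lborel right_diff_distrib[symmetric] power_mult_distrib ennreal_mult mult.assoc nn_integral_cmult)
  also have "gagliardo \<sigma> u' = gagliardo \<sigma> u"
    by (rule gagliardo_cong) (use u' in eventually_elim, simp)
  finally show ?thesis .
qed

lemma gagliardo_add:
  fixes u v :: "real^'n \<Rightarrow> real"
  assumes "u \<in> borel_measurable lebesgue" "v \<in> borel_measurable lebesgue"
  shows "gagliardo \<sigma> (\<lambda>x. u x + v x) \<le> 2 * gagliardo \<sigma> u + 2 * gagliardo \<sigma> v"
proof -
  obtain u' where [measurable]: "u' \<in> borel_measurable borel" and u': "AE x in lebesgue. u x = u' x"
    using borel_representative[OF assms(1)] .
  obtain v' where [measurable]: "v' \<in> borel_measurable borel" and v': "AE x in lebesgue. v x = v' x"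
    using borel_representative[OF assms(2)] .
  have b: "ennreal ((u' x + v' x - (u' y + v' y))\<^sup>2) \<le> 2 * ennreal ((u' x - u' y)\<^sup>2) + 2 * ennreal ((v' x - v' y)\<^sup>2)" for x y
  proof -
    have "(u' x + v' x - (u' y + v' y))\<^sup>2 \<le> 2 * (u' x - u' y)\<^sup>2 + 2 * (v' x - v' y)\<^sup>2"
      using sum_squares_bound[of "u' x - u' y" "v' x - v' y"] by (simp add: power2_eq_square algebra_simps)
    then have "ennreal ((u' x + v' x - (u' y + v' y))\<^sup>2) \<le> ennreal (2 * (u' x - u' y)\<^sup>2 + 2 * (v' x - v' y)\<^sup>2)"
      by (rule ennreal_leI)
    then show ?thesis by (simp add: ennreal_mult)
  qed
  have "gagliardo \<sigma> (\<lambda>x. u x + v x) = gagliardo \<sigma> (\<lambda>x. u' x + v' x)"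
    by (rule gagliardo_cong) (use u' v' in eventually_elim, simp)
  also have "\<dots> \<le> (\<integral>\<^sup>+x. \<integral>\<^sup>+y. (2 * ennreal ((u' x - u' y)\<^sup>2) + 2 * ennreal ((v' x - v' y)\<^sup>2)) * ennreal (norm (x - y) powr (- 2 * \<sigma> - DIM(real^'n))) \<partial>lborel \<partial>lborel)"
    by (subst gagliardo_lborel, measurable) (intro nn_integral_mono mult_right_mono b, simp)
  also have "\<dots> = 2 * gagliardo \<sigma> u' + 2 * gagliardo \<sigma> v'"
    by (simp add: gagliardo_lborel distrib_right nn_integral_add nn_integral_cmult mult.assoc)
  also have "gagliardo \<sigma> u' = gagliardo \<sigma> u"
    by (rule gagliardo_cong) (use u' in eventually_elim, simp)
  also have "gagliardo \<sigma> v' = gagliardo \<sigma> v"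
    by (rule gagliardo_cong) (use v' in eventually_elim, simp)
  finally show ?thesis .
qed

lemma gagliardo_minus: "gagliardo \<sigma> (\<lambda>x. u x - v x) = gagliardo \<sigma> (\<lambda>x. v x - u x)"
proof -
  have "(u x - v x - (u y - v y))\<^sup>2 = (v x - u x - (v y - u y))\<^sup>2" for x y
    by (simp add: power2_eq_square algebra_simps)
  then show ?thesis by (simp add: gagliardo_def)
qed

lemma gagliardo_triangle:
  fixes u v w :: "real^'n \<Rightarrow> real"
  assumes "u \<in> borel_measurable lebesgue" "v \<in> borel_measurable lebesgue" "w \<in> borel_measurable lebesgue"
  shows "gagliardo \<sigma> (\<lambda>x. u x - w x) \<le> 2 * gagliardo \<sigma> (\<lambda>x. u x - v x) + 2 * gagliardo \<sigma> (\<lambda>x. v x - w x)"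
  using gagliardo_add[of "\<lambda>x. u x - v x" "\<lambda>x. v x - w x" \<sigma>] assms by simp

lemma gagliardo_Fatou:
  fixes u :: "nat \<Rightarrow> real^'n \<Rightarrow> real"
  assumes u: "\<And>k. u k \<in> borel_measurable lebesgue" and v: "v \<in> borel_measurable lebesgue"
    and lim: "AE x in lebesgue. (\<lambda>k. u k x) \<longlonglongrightarrow> v x"
  shows "gagliardo \<sigma> v \<le> liminf (\<lambda>k. gagliardo \<sigma> (u k))"
proof -
  have "\<exists>u'. u' \<in> borel_measurable borel \<and> (AE x in lebesgue. u k x = u' x)" for k
    using borel_representative[OF u[of k]] by metis
  then obtain u' where [measurable]: "\<And>k. u' k \<in> borel_measurable borel" and u': "\<And>k. AE x in lebesgue. u k x = u' k x"
    by metis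
  have [measurable]: "(\<lambda>x. u' k x) \<in> borel_measurable borel" for k by measurable
  obtain v' where [measurable]: "v' \<in> borel_measurable borel" and v': "AE x in lebesgue. v x = v' x"
    using borel_representative[OF v] .
  let ?k = "\<lambda>x y. ennreal (norm (x - y) powr (- 2 * \<sigma> - DIM(real^'n)))"
  have "AE x in lebesgue. \<forall>k. u k x = u' k x" using u' by (simp add: AE_all_countable)
  then have "AE x in lebesgue. (\<lambda>k. u' k x) \<longlonglongrightarrow> v' x"
    using lim v' by eventually_elim simp
  then have lim': "AE x in lborel. (\<lambda>k. u' k x) \<longlonglongrightarrow> v' x" by (simp add: AE_completion_iff)
  have "gagliardo \<sigma> v = gagliardo \<sigma> v'" by (rule gagliardo_cong[OF v'])
  also have "\<dots> = (\<integral>\<^sup>+x. \<integral>\<^sup>+y. ennreal ((v' x - v' y)\<^sup>2) * ?k x y \<partial>lborel \<partial>lborel)" by (simp add: gagliardo_lborel)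
  also have "\<dots> \<le> (\<integral>\<^sup>+x. liminf (\<lambda>k. \<integral>\<^sup>+y. ennreal ((u' k x - u' k y)\<^sup>2) * ?k x y \<partial>lborel) \<partial>lborel)"
  proof (rule nn_integral_mono_AE)
    show "AE x in lborel. (\<integral>\<^sup>+y. ennreal ((v' x - v' y)\<^sup>2) * ?k x y \<partial>lborel) \<le> liminf (\<lambda>k. \<integral>\<^sup>+y. ennreal ((u' k x - u' k y)\<^sup>2) * ?k x y \<partial>lborel)"
      using lim'
    proof eventually_elim
      case (elim x)
      have "(\<integral>\<^sup>+y. ennreal ((v' x - v' y)\<^sup>2) * ?k x y \<partial>lborel) = (\<integral>\<^sup>+y. liminf (\<lambda>k. ennreal ((u' k x - u' k y)\<^sup>2) * ?k x y) \<partial>lborel)"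
      proof (rule nn_integral_cong_AE)
        show "AE y in lborel. ennreal ((v' x - v' y)\<^sup>2) * ?k x y = liminf (\<lambda>k. ennreal ((u' k x - u' k y)\<^sup>2) * ?k x y)"
          using lim'
        proof eventually_elim
          case (elim y)
          have "(\<lambda>k. ennreal ((u' k x - u' k y)\<^sup>2 * norm (x - y) powr (- 2 * \<sigma> - DIM(real^'n)))) \<longlonglongrightarrow> ennreal ((v' x - v' y)\<^sup>2 * norm (x - y) powr (- 2 * \<sigma> - DIM(real^'n)))"
            by (intro tendsto_ennrealI tendsto_mult tendsto_power tendsto_diff elim \<open>(\<lambda>k. u' k x) \<longlonglongrightarrow> v' x\<close> tendsto_const)
          then have "(\<lambda>k. ennreal ((u' k x - u' k y)\<^sup>2) * ?k x y) \<longlonglongrightarrow> ennreal ((v' x - v' y)\<^sup>2) * ?k x y"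
            by (simp add: ennreal_mult)
          then show ?case by (rule lim_imp_Liminf[OF sequentially_bot, symmetric])
        qed
      qed
      also have "\<dots> \<le> liminf (\<lambda>k. \<integral>\<^sup>+y. ennreal ((u' k x - u' k y)\<^sup>2) * ?k x y \<partial>lborel)"
        by (rule nn_integral_liminf) measurable
      finally show ?case .
    qed
  qed
  also have "\<dots> \<le> liminf (\<lambda>k. \<integral>\<^sup>+x. \<integral>\<^sup>+y. ennreal ((u' k x - u' k y)\<^sup>2) * ?k x y \<partial>lborel \<partial>lborel)"
    by (rule nn_integral_liminf) measurable
  also have "\<dots> = liminf (\<lambda>k. gagliardo \<sigma> (u k))"
  proof -
    have "gagliardo \<sigma> (u k) = (\<integral>\<^sup>+x. \<integral>\<^sup>+y. ennreal ((u' k x - u' k y)\<^sup>2) * ?k x y \<partial>lborel \<partial>lborel)" for k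
      using gagliardo_cong[OF u'[of k]] by (simp add: gagliardo_lborel)
    then show ?thesis by simp
  qed
  finally show ?thesis .
qed

text \<open>If \<open>u\<close> vanishes outside \<open>\<Omega>\<close>, restrict the inner integral, for
  \<open>x \<in> \<Omega>\<close>, to a fixed ball \<open>B\<close> disjoint from
  \<open>\<Omega>\<close>: there \<open>u y = 0\<close> and \<open>norm (x - y)\<close> is bounded.\<close>

lemma gagliardo_Poincare:
  fixes \<Omega> :: "(real^'n) set"
  assumes "bounded \<Omega>" and \<sigma>: "0 < \<sigma>"
  obtains C where "0 < C" "\<And>u. u \<in> borel_measurable lebesgue \<Longrightarrow> (AE x in lebesgue. x \<notin> \<Omega> \<longrightarrow> u x = 0) \<Longrightarrow>
    (\<integral>\<^sup>+x. ennreal ((u x)\<^sup>2) \<partial>lebesgue) \<le> ennreal C * gagliardo \<sigma> u"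
proof -
  obtain R where R: "0 < R" "\<And>x. x \<in> \<Omega> \<Longrightarrow> norm x \<le> R" using assms(1) bounded_pos by metis
  \<comment> \<open>The unit ball around z is disjoint from the ball of radius R, and its points have distance
    at most 2 R + 3 from those of \<Omega>.\<close>
  define z :: "real^'n" where "z = (R + 2) *\<^sub>R axis undefined 1"
  have z: "norm z = R + 2" using R by (simp add: z_def)
  define B where "B = ball z 1"
  define m where "m = measure lebesgue B"
  have m: "0 < m" "emeasure lebesgue B = ennreal m"
    using emeasure_lborel_ball_finite[of z 1]
    by (auto simp: m_def B_def content_ball_pos less_top intro!: emeasure_eq_ennreal_measure)
  define p where "p = real CARD('n) + 2 * \<sigma>"
  define M where "M = (2 * R + 3) powr p"
  have p: "0 < p" using \<sigma> by (simp add: p_def add_nonneg_pos)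
  have M: "0 < M" using R by (simp add: M_def)
  show ?thesis
  proof (rule that[of "M / m"])
    show "0 < M / m" using M m by simp
    fix u :: "real^'n \<Rightarrow> real" assume [measurable]: "u \<in> borel_measurable lebesgue" and u0: "AE x in lebesgue. x \<notin> \<Omega> \<longrightarrow> u x = 0"
    have Bout: "y \<notin> \<Omega>" if "y \<in> B" for y
    proof
      assume "y \<in> \<Omega>"
      then have "norm y \<le> R" by (rule R)
      moreover have "norm z \<le> norm y + dist z y" by (metis add.commute dist_norm norm_triangle_sub)
      ultimately show False using that z by (simp add: B_def)
    qed
    have "(\<integral>\<^sup>+x. ennreal (m / M) * ennreal ((u x)\<^sup>2) \<partial>lebesgue) \<le> gagliardo \<sigma> u"
      unfolding gagliardo_def
    proof (rule nn_integral_mono_AE)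
      show "AE x in lebesgue. ennreal (m / M) * ennreal ((u x)\<^sup>2) \<le> (\<integral>\<^sup>+y. ennreal ((u x - u y)\<^sup>2 / norm (x - y) powr (real CARD('n) + 2 * \<sigma>)) \<partial>lebesgue)"
        using u0
      proof eventually_elim
        case (elim x)
        show ?case
        proof (cases "x \<in> \<Omega>")
          case True
          have "ennreal (m / M) * ennreal ((u x)\<^sup>2) = ennreal ((u x)\<^sup>2 / M) * emeasure lebesgue B"
            using m M by (simp add: ennreal_mult[symmetric] mult.commute)
          also have "\<dots> = (\<integral>\<^sup>+y. ennreal ((u x)\<^sup>2 / M) * indicator B y \<partial>lebesgue)"
            by (subst nn_integral_cmult_indicator) (auto simp: B_def)
          also have "\<dots> \<le> (\<integral>\<^sup>+y. ennreal ((u x - u y)\<^sup>2 / norm (x - y) powr (real CARD('n) + 2 * \<sigma>)) \<partial>lebesgue)"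
          proof (rule nn_integral_mono_AE)
            show "AE y in lebesgue. ennreal ((u x)\<^sup>2 / M) * indicator B y \<le> ennreal ((u x - u y)\<^sup>2 / norm (x - y) powr (real CARD('n) + 2 * \<sigma>))"
              using u0
            proof eventually_elim
              case (elim y)
              show ?case
              proof (cases "y \<in> B")
                case yB: True
                then have uy: "u y = 0" using elim Bout by blast
                have "x \<noteq> y" using True Bout yB by blast
                have "norm (x - y) \<le> norm x + norm z + dist z y"
                  using norm_triangle_ineq4[of x y] norm_triangle_ineq4[of z "z - y"] by (simp add: dist_norm)
                also have "\<dots> \<le> 2 * R + 3" using R(2)[OF True] z yB by (simp add: B_def)
                finally have "norm (x - y) powr p \<le> M" unfolding M_def using p by (intro powr_mono2) auto
                then have "(u x)\<^sup>2 / M \<le> (u x)\<^sup>2 / norm (x - y) powr p"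
                  using \<open>x \<noteq> y\<close> M by (intro divide_left_mono mult_pos_pos) auto
                then show ?thesis using yB uy by (simp add: p_def ennreal_leI)
              qed simp
            qed
          qed
          finally show ?thesis .
        qed (use elim in simp)
      qed
    qed
    then have "ennreal (m / M) * (\<integral>\<^sup>+x. ennreal ((u x)\<^sup>2) \<partial>lebesgue) \<le> gagliardo \<sigma> u"
      by (simp add: nn_integral_cmult)
    then have "ennreal (M / m) * (ennreal (m / M) * (\<integral>\<^sup>+x. ennreal ((u x)\<^sup>2) \<partial>lebesgue)) \<le> ennreal (M / m) * gagliardo \<sigma> u"
      by (rule mult_left_mono) simp
    moreover have "ennreal (M / m) * ennreal (m / M) = 1"
      using m M by (simp add: ennreal_mult[symmetric])
    ultimately show "(\<integral>\<^sup>+x. ennreal ((u x)\<^sup>2) \<partial>lebesgue) \<le> ennreal (M / m) * gagliardo \<sigma> u"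
      by (simp add: mult.assoc[symmetric])
  qed
qed

section \<open>The closure of the test functions\<close>

lemma Hs_D: "u \<in> Hs \<sigma> \<Longrightarrow> sq u" "u \<in> Hs \<sigma> \<Longrightarrow> gagliardo \<sigma> u < \<infinity>"
  unfolding Hs_def Lp2_iff by auto

lemma Hs_I: "sq u \<Longrightarrow> gagliardo \<sigma> u < \<infinity> \<Longrightarrow> u \<in> Hs \<sigma>"
  unfolding Hs_def Lp2_iff by auto

lemma Hs_add:
  assumes "u \<in> Hs \<sigma>" "v \<in> Hs \<sigma>" shows "(\<lambda>x. u x + v x) \<in> Hs \<sigma>"
proof (rule Hs_I)
  show "sq (\<lambda>x. u x + v x)" using assms by (intro sq_add Hs_D)
  have "gagliardo \<sigma> (\<lambda>x. u x + v x) \<le> 2 * gagliardo \<sigma> u + 2 * gagliardo \<sigma> v"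
    using assms by (intro gagliardo_add sq_measurable Hs_D)
  also have "\<dots> < \<infinity>" using Hs_D(2)[OF assms(1)] Hs_D(2)[OF assms(2)] by (simp add: ennreal_mult_less_top)
  finally show "gagliardo \<sigma> (\<lambda>x. u x + v x) < \<infinity>" .
qed

lemma Hs_cmult:
  assumes "u \<in> Hs \<sigma>" shows "(\<lambda>x. c * u x) \<in> Hs \<sigma>"
proof (rule Hs_I)
  show "sq (\<lambda>x. c * u x)" using sq_scaleR[OF Hs_D(1)[OF assms], of c] by simp
  have "gagliardo \<sigma> (\<lambda>x. c * u x) = ennreal (c\<^sup>2) * gagliardo \<sigma> u"
    using assms by (intro gagliardo_cmult sq_measurable Hs_D)
  also have "\<dots> < \<infinity>" using Hs_D(2)[OF assms] by (simp add: ennreal_mult_less_top)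
  finally show "gagliardo \<sigma> (\<lambda>x. c * u x) < \<infinity>" .
qed

lemma Hs_diff: "u \<in> Hs \<sigma> \<Longrightarrow> v \<in> Hs \<sigma> \<Longrightarrow> (\<lambda>x. u x - v x) \<in> Hs \<sigma>"
  using Hs_add[of u \<sigma> "\<lambda>x. -1 * v x"] Hs_cmult[of v \<sigma> "-1"] by simp

lemma test_fun_sq: assumes "\<phi> \<in> test_fun \<Omega>" shows "sq \<phi>"
proof -
  interpret C1_compact \<phi> "\<lambda>e x. frechet_derivative \<phi> (at x) e" "closure {x. \<phi> x \<noteq> 0}"
    using assms by (rule test_fun_C1_compact)
  show ?thesis using integrable_f_square
    by (simp add: sq_def integrable_completion measurable_completion)
qed

lemma test_fun_Hs:
  assumes "\<phi> \<in> test_fun \<Omega>" "0 < \<sigma>" "\<sigma> < 1" shows "\<phi> \<in> Hs \<sigma>"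
proof (rule Hs_I[OF test_fun_sq[OF assms(1)]])
  interpret C1_compact \<phi> "\<lambda>e x. frechet_derivative \<phi> (at x) e" "closure {x. \<phi> x \<noteq> 0}"
    using assms(1) by (rule test_fun_C1_compact)
  show "gagliardo \<sigma> \<phi> < \<infinity>"
    unfolding gagliardo_lborel[OF f_measurable] by (rule gagliardo_integral_finite[OF assms(2,3)])
qed

lemma Hs0_approx:
  assumes u: "u \<in> Hs0 \<sigma> \<Omega>" and s: "0 < \<sigma>" "\<sigma> < 1" and e: "0 < e"
  obtains \<phi> where "\<phi> \<in> test_fun \<Omega>" "(LINT x|lebesgue. (u x - \<phi> x)\<^sup>2) < e" "gagliardo \<sigma> (\<lambda>x. u x - \<phi> x) < ennreal e"
proof -
  obtain \<phi> where \<phi>: "\<phi> \<in> test_fun \<Omega>" "Hs_norm \<sigma> (\<lambda>x. u x - \<phi> x) < sqrt e"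
  proof -
    have "0 < sqrt e" using e by simp
    then show ?thesis using u that unfolding Hs0_def by blast
  qed
  let ?I = "LINT x|lebesgue. (u x - \<phi> x)\<^sup>2"
  have I: "0 \<le> ?I" by (intro Bochner_Integration.integral_nonneg) simp
  have "u \<in> Hs \<sigma>" using u by (simp add: Hs0_def)
  then have "(\<lambda>x. u x - \<phi> x) \<in> Hs \<sigma>" using test_fun_Hs[OF \<phi>(1) s] by (rule Hs_diff)
  then have g: "gagliardo \<sigma> (\<lambda>x. u x - \<phi> x) < \<infinity>" by (rule Hs_D)
  have "?I + enn2real (gagliardo \<sigma> (\<lambda>x. u x - \<phi> x)) < e"
    using \<phi>(2) I unfolding Hs_norm_def Lp2_norm by simp
  then have "?I < e" "enn2real (gagliardo \<sigma> (\<lambda>x. u x - \<phi> x)) < e"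
    using I enn2real_nonneg[of "gagliardo \<sigma> (\<lambda>x. u x - \<phi> x)"] by linarith+
  moreover have "gagliardo \<sigma> (\<lambda>x. u x - \<phi> x) < ennreal e"
    using calculation(2) g by (metis ennreal_enn2real ennreal_lessI infinity_ennreal_def e)
  ultimately show ?thesis using that \<phi>(1) by blast
qed

lemma Hs0_I:
  assumes u: "u \<in> Hs \<sigma>" 
    and a: "\<And>e. 0 < e \<Longrightarrow> \<exists>\<phi>\<in>test_fun \<Omega>. (LINT x|lebesgue. (u x - \<phi> x)\<^sup>2) < e \<and> gagliardo \<sigma> (\<lambda>x. u x - \<phi> x) < ennreal e"
  shows "u \<in> Hs0 \<sigma> \<Omega>"
  unfolding Hs0_def
proof (intro CollectI conjI u allI impI)
  fix e :: real assume e: "0 < e"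
  obtain \<phi> where \<phi>: "\<phi> \<in> test_fun \<Omega>" "(LINT x|lebesgue. (u x - \<phi> x)\<^sup>2) < e\<^sup>2 / 2" "gagliardo \<sigma> (\<lambda>x. u x - \<phi> x) < ennreal (e\<^sup>2 / 2)"
    using a[of "e\<^sup>2 / 2"] e by auto
  have I: "0 \<le> (LINT x|lebesgue. (u x - \<phi> x)\<^sup>2)" by (intro Bochner_Integration.integral_nonneg) simp
  have "enn2real (gagliardo \<sigma> (\<lambda>x. u x - \<phi> x)) \<le> e\<^sup>2 / 2"
    using \<phi>(3) by (intro enn2real_leI) auto
  then have "(LINT x|lebesgue. (u x - \<phi> x)\<^sup>2) + enn2real (gagliardo \<sigma> (\<lambda>x. u x - \<phi> x)) < e\<^sup>2" using \<phi>(2) by linarith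
  then have "sqrt ((LINT x|lebesgue. (u x - \<phi> x)\<^sup>2) + enn2real (gagliardo \<sigma> (\<lambda>x. u x - \<phi> x))) < e"
    using e by (intro real_less_lsqrt) (auto intro: add_nonneg_nonneg I)
  then show "\<exists>\<phi>\<in>test_fun \<Omega>. Hs_norm \<sigma> (\<lambda>x. u x - \<phi> x) < e"
    using \<phi>(1) I unfolding Hs_norm_def Lp2_norm by auto
qed

lemma integral_square_add:
  assumes "sq u" "sq v"
  shows "(LINT x|lebesgue. (u x + v x :: real)\<^sup>2) \<le> 2 * (LINT x|lebesgue. (u x)\<^sup>2) + 2 * (LINT x|lebesgue. (v x)\<^sup>2)"
proof -
  have "(LINT x|lebesgue. (u x + v x)\<^sup>2) \<le> (LINT x|lebesgue. 2 * (u x)\<^sup>2 + 2 * (v x)\<^sup>2)"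
  proof (rule integral_mono)
    show "(u x + v x)\<^sup>2 \<le> 2 * (u x)\<^sup>2 + 2 * (v x)\<^sup>2" for x
      using sum_squares_bound[of "u x" "v x"] by (simp add: power2_sum)
  qed (use sq_integrable[OF sq_add[OF assms]] sq_integrable[OF assms(1)] sq_integrable[OF assms(2)] in auto)
  then show ?thesis using sq_integrable[OF assms(1)] sq_integrable[OF assms(2)] by simp
qed

lemma Hs0_Hs: "u \<in> Hs0 \<sigma> \<Omega> \<Longrightarrow> u \<in> Hs \<sigma>"
  by (simp add: Hs0_def)

lemma Hs0_sq: "u \<in> Hs0 \<sigma> \<Omega> \<Longrightarrow> sq u"
  using Hs0_Hs Hs_D by blast

lemma Hs0_measurable: "u \<in> Hs0 \<sigma> \<Omega> \<Longrightarrow> u \<in> borel_measurable lebesgue"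
  using Hs0_sq sq_measurable by blast

lemma Hs0_add:
  assumes u: "u \<in> Hs0 \<sigma> \<Omega>" and v: "v \<in> Hs0 \<sigma> \<Omega>" and s: "0 < \<sigma>" "\<sigma> < 1"
  shows "(\<lambda>x. u x + v x) \<in> Hs0 \<sigma> \<Omega>"
proof (rule Hs0_I[OF Hs_add[OF Hs0_Hs[OF u] Hs0_Hs[OF v]]])
  fix e :: real assume e: "0 < e"
  obtain \<phi> where \<phi>: "\<phi> \<in> test_fun \<Omega>" "(LINT x|lebesgue. (u x - \<phi> x)\<^sup>2) < e / 8" "gagliardo \<sigma> (\<lambda>x. u x - \<phi> x) < ennreal (e / 8)"
    using Hs0_approx[OF u s, of "e / 8"] e by auto
  obtain \<psi> where \<psi>: "\<psi> \<in> test_fun \<Omega>" "(LINT x|lebesgue. (v x - \<psi> x)\<^sup>2) < e / 8" "gagliardo \<sigma> (\<lambda>x. v x - \<psi> x) < ennreal (e / 8)"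
    using Hs0_approx[OF v s, of "e / 8"] e by auto
  have sq: "sq (\<lambda>x. u x - \<phi> x)" "sq (\<lambda>x. v x - \<psi> x)"
    using u v \<phi> \<psi> by (auto intro: sq_diff Hs0_sq test_fun_sq)
  have eq: "u x + v x - (\<phi> x + \<psi> x) = (u x - \<phi> x) + (v x - \<psi> x)" for x by simp
  have "(LINT x|lebesgue. (u x + v x - (\<phi> x + \<psi> x))\<^sup>2) < e"
    unfolding eq using integral_square_add[OF sq] \<phi>(2) \<psi>(2) e by linarith
  moreover have "gagliardo \<sigma> (\<lambda>x. u x + v x - (\<phi> x + \<psi> x)) < ennreal e"
  proof -
    have "gagliardo \<sigma> (\<lambda>x. u x + v x - (\<phi> x + \<psi> x)) \<le> 2 * gagliardo \<sigma> (\<lambda>x. u x - \<phi> x) + 2 * gagliardo \<sigma> (\<lambda>x. v x - \<psi> x)"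
      unfolding eq by (intro gagliardo_add sq_measurable sq)
    also have "\<dots> \<le> 2 * ennreal (e / 8) + 2 * ennreal (e / 8)"
      using \<phi>(3) \<psi>(3) by (intro add_mono mult_left_mono) auto
    also have "\<dots> = ennreal (2 * (e / 8) + 2 * (e / 8))"
    proof -
      have "2 * ennreal (e / 8) = ennreal (2 * (e / 8))" using ennreal_mult[of 2 "e / 8"] e by simp
      then show ?thesis using e by (simp only: ennreal_plus[symmetric])
    qed
    also have "\<dots> < ennreal e" using e by (intro ennreal_lessI) auto
    finally show ?thesis .
  qed
  ultimately show "\<exists>\<phi>\<in>test_fun \<Omega>. (LINT x|lebesgue. (u x + v x - \<phi> x)\<^sup>2) < e \<and> gagliardo \<sigma> (\<lambda>x. u x + v x - \<phi> x) < ennreal e"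
    using test_fun_add[OF \<phi>(1) \<psi>(1)] by (intro bexI[of _ "\<lambda>x. \<phi> x + \<psi> x"]) auto
qed

lemma Hs0_cmult:
  assumes u: "u \<in> Hs0 \<sigma> \<Omega>" and s: "0 < \<sigma>" "\<sigma> < 1"
  shows "(\<lambda>x. c * u x) \<in> Hs0 \<sigma> \<Omega>"
proof (rule Hs0_I[OF Hs_cmult[OF Hs0_Hs[OF u]]])
  fix e :: real assume e: "0 < e"
  define d where "d = e / (c\<^sup>2 + 1)"
  have c1: "0 < c\<^sup>2 + 1" by (simp add: add_nonneg_pos)
  have d: "0 < d" using e c1 by (simp add: d_def)
  have cd: "c\<^sup>2 * d < e"
  proof -
    have "c\<^sup>2 * e < (c\<^sup>2 + 1) * e" using e by (simp add: distrib_right)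
    then show ?thesis using c1 by (simp add: d_def pos_divide_less_eq mult.commute)
  qed
  obtain \<phi> where \<phi>: "\<phi> \<in> test_fun \<Omega>" "(LINT x|lebesgue. (u x - \<phi> x)\<^sup>2) < d" "gagliardo \<sigma> (\<lambda>x. u x - \<phi> x) < ennreal d"
    using Hs0_approx[OF u s d] .
  have eq: "c * u x - c * \<phi> x = c * (u x - \<phi> x)" for x by (simp add: right_diff_distrib)
  have "(LINT x|lebesgue. (c * u x - c * \<phi> x)\<^sup>2) = c\<^sup>2 * (LINT x|lebesgue. (u x - \<phi> x)\<^sup>2)"
    unfolding eq power_mult_distrib by simp
  also have "\<dots> \<le> c\<^sup>2 * d" using \<phi>(2) by (intro mult_left_mono) auto
  also have "\<dots> < e" by (rule cd)
  finally have 1: "(LINT x|lebesgue. (c * u x - c * \<phi> x)\<^sup>2) < e" .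
  have "gagliardo \<sigma> (\<lambda>x. c * u x - c * \<phi> x) = ennreal (c\<^sup>2) * gagliardo \<sigma> (\<lambda>x. u x - \<phi> x)"
    unfolding eq using u \<phi>(1) by (intro gagliardo_cmult sq_measurable sq_diff Hs0_sq test_fun_sq)
  also have "\<dots> \<le> ennreal (c\<^sup>2) * ennreal d" using \<phi>(3) by (intro mult_left_mono) auto
  also have "\<dots> = ennreal (c\<^sup>2 * d)" using d by (simp add: ennreal_mult)
  also have "\<dots> < ennreal e" using cd e by (intro ennreal_lessI) auto
  finally have 2: "gagliardo \<sigma> (\<lambda>x. c * u x - c * \<phi> x) < ennreal e" .
  show "\<exists>\<phi>\<in>test_fun \<Omega>. (LINT x|lebesgue. (c * u x - \<phi> x)\<^sup>2) < e \<and> gagliardo \<sigma> (\<lambda>x. c * u x - \<phi> x) < ennreal e"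
    using test_fun_cmult[OF \<phi>(1), of c] 1 2 by (intro bexI[of _ "\<lambda>x. c * \<phi> x"]) auto
qed

lemma Hs0_diff:
  assumes "u \<in> Hs0 \<sigma> \<Omega>" "v \<in> Hs0 \<sigma> \<Omega>" "0 < \<sigma>" "\<sigma> < 1"
  shows "(\<lambda>x. u x - v x) \<in> Hs0 \<sigma> \<Omega>"
  using Hs0_add[OF assms(1) Hs0_cmult[OF assms(2-4), of "-1"] assms(3,4)] by simp

lemma test_fun_Hs0:
  assumes "\<phi> \<in> test_fun \<Omega>" "0 < \<sigma>" "\<sigma> < 1" shows "\<phi> \<in> Hs0 \<sigma> \<Omega>"
proof (rule Hs0_I[OF test_fun_Hs[OF assms]])
  fix e :: real assume "0 < e"
  have "gagliardo \<sigma> (\<lambda>x. \<phi> x - \<phi> x) = 0" by (simp add: gagliardo_def)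
  then show "\<exists>\<psi>\<in>test_fun \<Omega>. (LINT x|lebesgue. (\<phi> x - \<psi> x)\<^sup>2) < e \<and> gagliardo \<sigma> (\<lambda>x. \<phi> x - \<psi> x) < ennreal e"
    using assms(1) \<open>0 < e\<close> by (intro bexI[of _ \<phi>]) auto
qed

lemma Hs0_zero: "0 < \<sigma> \<Longrightarrow> \<sigma> < 1 \<Longrightarrow> (\<lambda>_. 0) \<in> Hs0 \<sigma> \<Omega>"
  using test_fun_Hs0 test_fun_zero by blast

lemma Hs0_supported:
  assumes u: "u \<in> Hs0 \<sigma> \<Omega>" and s: "0 < \<sigma>" "\<sigma> < 1" and \<Omega>: "open \<Omega>"
  shows "AE x in lebesgue. x \<notin> \<Omega> \<longrightarrow> u x = 0"
proof -
  have [measurable]: "u \<in> borel_measurable lebesgue" using u by (rule Hs0_measurable)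
  have [measurable]: "\<Omega> \<in> sets lebesgue" using \<Omega> by (intro sets_completionI_sets) auto
  have small: "(\<integral>\<^sup>+x. ennreal ((u x)\<^sup>2) * indicator (- \<Omega>) x \<partial>lebesgue) \<le> ennreal e" if e: "0 < e" for e
  proof -
    obtain \<phi> where \<phi>: "\<phi> \<in> test_fun \<Omega>" "(LINT x|lebesgue. (u x - \<phi> x)\<^sup>2) < e" "gagliardo \<sigma> (\<lambda>x. u x - \<phi> x) < ennreal e"
      using Hs0_approx[OF u s e] .
    have \<phi>0: "\<phi> x = 0" if "x \<notin> \<Omega>" for x
      using that \<phi>(1) closure_subset[of "{x. \<phi> x \<noteq> 0}"] by (auto simp: test_fun_def)
    have sq: "sq (\<lambda>x. u x - \<phi> x)" using u \<phi>(1) by (intro sq_diff Hs0_sq test_fun_sq)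
    have "(\<integral>\<^sup>+x. ennreal ((u x)\<^sup>2) * indicator (- \<Omega>) x \<partial>lebesgue) \<le> (\<integral>\<^sup>+x. ennreal ((u x - \<phi> x)\<^sup>2) \<partial>lebesgue)"
      using \<phi>0 by (intro nn_integral_mono) (auto simp: indicator_def)
    also have "\<dots> = ennreal (LINT x|lebesgue. (u x - \<phi> x)\<^sup>2)"
      using sq_integrable[OF sq] by (intro nn_integral_eq_integral) auto
    also have "\<dots> \<le> ennreal e" using \<phi>(2) by (intro ennreal_leI) auto
    finally show ?thesis .
  qed
  have "(\<integral>\<^sup>+x. ennreal ((u x)\<^sup>2) * indicator (- \<Omega>) x \<partial>lebesgue) \<le> 0"
  proof (rule ennreal_le_epsilon)
    fix e :: real assume "0 < e"
    from small[OF this] show "(\<integral>\<^sup>+x. ennreal ((u x)\<^sup>2) * indicator (- \<Omega>) x \<partial>lebesgue) \<le> 0 + ennreal e" by simp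
  qed
  then have "(\<integral>\<^sup>+x. ennreal ((u x)\<^sup>2) * indicator (- \<Omega>) x \<partial>lebesgue) = 0" by simp
  then have "AE x in lebesgue. ennreal ((u x)\<^sup>2) * indicator (- \<Omega>) x = 0"
    by (subst (asm) nn_integral_0_iff_AE) simp_all
  then show ?thesis by eventually_elim (auto simp: indicator_def split: if_splits)
qed

section \<open>Convolution with the Riesz kernel\<close>

definition riesz_conv :: "real \<Rightarrow> ('a::euclidean_space \<Rightarrow> real) \<Rightarrow> 'a \<Rightarrow> real" where
  "riesz_conv s u x = (\<integral>y. u y * norm (x - y) powr (s - real DIM('a)) \<partial>lborel)"

lemma riesz_conv_measurable [measurable]:
  assumes [measurable]: "u \<in> borel_measurable borel"
  shows "riesz_conv s u \<in> borel_measurable borel"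
  unfolding riesz_conv_def by measurable

lemma lborel_reflect: "distr lborel borel (\<lambda>z. x - z) = (lborel :: 'a::euclidean_space measure)"
proof -
  have "(lborel :: 'a measure) = density (distr lborel borel (\<lambda>z. x + (-1) *\<^sub>R z)) (\<lambda>_. 1)"
    by (subst lborel_affine[of "-1" x]) auto
  then show ?thesis by (simp add: density_1)
qed

lemma DIM_ge_1: "1 \<le> real DIM('a::euclidean_space)"
  using DIM_positive[where 'a='a] by (simp add: Suc_le_eq)

lemma nn_riesz_kernel_bound:
  assumes s: "0 < s" "s < 1"
  obtains C where "0 \<le> C"
    "\<And>f x M. f \<in> borel_measurable borel \<Longrightarrow> (\<And>y. f y \<le> M) \<Longrightarrow>
       (\<integral>\<^sup>+y. f y * ennreal (norm (x - y) powr (s - real DIM('a))) \<partial>lborel) \<le> ennreal C * (M + (\<integral>\<^sup>+(y::'a::euclidean_space). f y \<partial>lborel))"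
proof -
  have "0 < s / 2" "s / 2 < real DIM('a) / 2" using s DIM_ge_1[where 'a='a] by linarith+
  then obtain C where "0 \<le> C" "\<And>f (x::'a) M. f \<in> borel_measurable borel \<Longrightarrow> (\<And>y. f y \<le> M) \<Longrightarrow>
       (\<integral>\<^sup>+y. f y * ennreal (norm (x - y) powr (2 * (s / 2) - real DIM('a))) \<partial>lborel) \<le> ennreal C * (M + (\<integral>\<^sup>+y. f y \<partial>lborel))"
    using riesz_kernel_bound[of "s / 2", where 'a='a] by blast
  then show ?thesis by (intro that[of C]) auto
qed

lemma riesz_conv_integrable:
  fixes f :: "'a::euclidean_space \<Rightarrow> real"
  assumes s: "0 < s" "s < 1" and f: "integrable lborel f" and b: "\<And>x. \<bar>f x\<bar> \<le> M"
  shows "integrable lborel (\<lambda>y. f y * norm (x - y) powr (s - real DIM('a)))"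
proof -
  have "0 < s / 2" "s / 2 < real DIM('a) / 2" using s DIM_ge_1[where 'a='a] by linarith+
  from riesz_heat(1)[OF this f b, of x] show ?thesis by simp
qed

lemma riesz_conv_bounded:
  fixes f :: "'a::euclidean_space \<Rightarrow> real"
  assumes s: "0 < s" "s < 1" and f: "integrable lborel f" and b: "\<And>x. \<bar>f x\<bar> \<le> M"
  shows "\<exists>B\<ge>0. (\<forall>x. (\<integral>\<^sup>+y. ennreal \<bar>f y\<bar> * ennreal (norm (x - y) powr (s - real DIM('a))) \<partial>lborel) \<le> ennreal B) \<and>
    (\<forall>x. \<bar>riesz_conv s f x\<bar> \<le> B)"
proof -
  have [measurable]: "f \<in> borel_measurable borel" using f by simp
  have M: "0 \<le> M" using b[of undefined] by linarith
  obtain C where C: "0 \<le> C" "\<And>f (x::'a) M. f \<in> borel_measurable borel \<Longrightarrow> (\<And>y. f y \<le> M) \<Longrightarrow>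
       (\<integral>\<^sup>+y. f y * ennreal (norm (x - y) powr (s - real DIM('a))) \<partial>lborel) \<le> ennreal C * (M + (\<integral>\<^sup>+y. f y \<partial>lborel))"
    using nn_riesz_kernel_bound[OF s, where 'a='a] by blast
  define I where "I = (\<integral>y. \<bar>f y\<bar> \<partial>lborel)"
  have I: "(\<integral>\<^sup>+y. ennreal \<bar>f y\<bar> \<partial>lborel) = ennreal I" "0 \<le> I"
    using integrable_abs[OF f] by (auto simp: I_def nn_integral_eq_integral)
  have bd: "(\<integral>\<^sup>+y. ennreal \<bar>f y\<bar> * ennreal (norm (x - y) powr (s - real DIM('a))) \<partial>lborel) \<le> ennreal (C * (M + I))" for x
  proof -
    have "(\<integral>\<^sup>+y. ennreal \<bar>f y\<bar> * ennreal (norm (x - y) powr (s - real DIM('a))) \<partial>lborel) \<le> ennreal C * (ennreal M + ennreal I)"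
      unfolding I(1)[symmetric] by (rule C(2)) (auto intro!: ennreal_leI b)
    also have "\<dots> = ennreal (C * (M + I))" using C(1) M I(2) by (simp add: ennreal_mult)
    finally show ?thesis .
  qed
  have "\<bar>riesz_conv s f x\<bar> \<le> C * (M + I)" for x
  proof -
    have "\<bar>riesz_conv s f x\<bar> \<le> (\<integral>y. \<bar>f y * norm (x - y) powr (s - real DIM('a))\<bar> \<partial>lborel)"
      unfolding riesz_conv_def by (rule integral_abs_bound)
    also have "\<dots> \<le> C * (M + I)"
    proof -
      have "ennreal (\<integral>y. \<bar>f y * norm (x - y) powr (s - real DIM('a))\<bar> \<partial>lborel) = (\<integral>\<^sup>+y. ennreal \<bar>f y * norm (x - y) powr (s - real DIM('a))\<bar> \<partial>lborel)"
        by (rule nn_integral_eq_integral[symmetric]) (auto intro!: integrable_abs riesz_conv_integrable[OF s f b])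
      also have "\<dots> \<le> ennreal (C * (M + I))" using bd[of x] by (simp add: abs_mult ennreal_mult)
      finally show ?thesis using C(1) M I(2) by simp
    qed
    finally show ?thesis .
  qed
  then show ?thesis using C(1) M I(2) bd by (intro exI[of _ "C * (M + I)"]) auto
qed

lemma riesz_conv_Fubini:
  fixes u \<theta> :: "'a::euclidean_space \<Rightarrow> real"
  assumes s: "0 < s" "s < 1" and u: "integrable lborel u" and \<theta>: "integrable lborel \<theta>" and b: "\<And>x. \<bar>\<theta> x\<bar> \<le> M"
  shows "integrable lborel (\<lambda>x. riesz_conv s u x * \<theta> x)"
    and "(\<integral>x. riesz_conv s u x * \<theta> x \<partial>lborel) = (\<integral>x. u x * riesz_conv s \<theta> x \<partial>lborel)"
    and "(\<integral>\<^sup>+x. \<integral>\<^sup>+y. ennreal \<bar>\<theta> x * (u y * norm (x - y) powr (s - real DIM('a)))\<bar> \<partial>lborel \<partial>lborel) < \<infinity>"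
proof -
  have [measurable]: "u \<in> borel_measurable borel" "\<theta> \<in> borel_measurable borel" using u \<theta> by simp_all
  obtain B where B: "0 \<le> B" "\<And>x. (\<integral>\<^sup>+y. ennreal \<bar>\<theta> y\<bar> * ennreal (norm (x - y) powr (s - real DIM('a))) \<partial>lborel) \<le> ennreal B"
    using riesz_conv_bounded[OF s \<theta> b] by blast
  define H where "H = (\<lambda>(x, y). \<theta> x * (u y * norm (x - y) powr (s - real DIM('a))))"
  have [measurable]: "H \<in> borel_measurable (lborel \<Otimes>\<^sub>M lborel)" unfolding H_def by measurable
  have "(\<integral>\<^sup>+x. \<integral>\<^sup>+y. ennreal \<bar>\<theta> x * (u y * norm (x - y) powr (s - real DIM('a)))\<bar> \<partial>lborel \<partial>lborel)
      = (\<integral>\<^sup>+y. \<integral>\<^sup>+x. ennreal \<bar>\<theta> x * (u y * norm (x - y) powr (s - real DIM('a)))\<bar> \<partial>lborel \<partial>lborel)"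
    by (rule lborel_pair.Fubini') measurable
  also have "\<dots> = (\<integral>\<^sup>+y. ennreal \<bar>u y\<bar> * (\<integral>\<^sup>+x. ennreal \<bar>\<theta> x\<bar> * ennreal (norm (y - x) powr (s - real DIM('a))) \<partial>lborel) \<partial>lborel)"
    by (subst nn_integral_cmult[symmetric]) (auto simp: abs_mult ennreal_mult mult_ac norm_minus_commute)
  also have "\<dots> \<le> (\<integral>\<^sup>+y. ennreal \<bar>u y\<bar> * ennreal B \<partial>lborel)"
    by (intro nn_integral_mono mult_left_mono B) auto
  also have "\<dots> = (\<integral>\<^sup>+y. ennreal \<bar>u y\<bar> \<partial>lborel) * ennreal B" by (simp add: nn_integral_multc)
  also have "\<dots> < \<infinity>" using u unfolding integrable_iff_bounded by (simp add: ennreal_mult_less_top)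
  finally show fin: "(\<integral>\<^sup>+x. \<integral>\<^sup>+y. ennreal \<bar>\<theta> x * (u y * norm (x - y) powr (s - real DIM('a)))\<bar> \<partial>lborel \<partial>lborel) < \<infinity>" .
  have "(\<integral>\<^sup>+p. ennreal (norm (H p)) \<partial>(lborel \<Otimes>\<^sub>M lborel)) = (\<integral>\<^sup>+x. \<integral>\<^sup>+y. ennreal \<bar>\<theta> x * (u y * norm (x - y) powr (s - real DIM('a)))\<bar> \<partial>lborel \<partial>lborel)"
    by (subst lborel.nn_integral_fst[symmetric]) (auto simp: H_def)
  then have H: "integrable (lborel \<Otimes>\<^sub>M lborel) H"
    using fin by (intro integrableI_bounded) auto
  have 1: "(\<integral>y. H (x, y) \<partial>lborel) = riesz_conv s u x * \<theta> x" for x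
    by (simp add: H_def riesz_conv_def)
  have 2: "(\<integral>x. H (x, y) \<partial>lborel) = u y * riesz_conv s \<theta> y" for y
    unfolding H_def riesz_conv_def prod.case integral_mult_right_zero[symmetric]
    by (intro Bochner_Integration.integral_cong) (auto simp: mult_ac norm_minus_commute)
  show "integrable lborel (\<lambda>x. riesz_conv s u x * \<theta> x)"
    using lborel_pair.integrable_fst'[OF H] by (simp add: 1)
  have "(\<integral>y. \<integral>x. H (x, y) \<partial>lborel \<partial>lborel) = (\<integral>x. \<integral>y. H (x, y) \<partial>lborel \<partial>lborel)"
    by (rule lborel_pair.Fubini_integral) (simp add: H)
  then show "(\<integral>x. riesz_conv s u x * \<theta> x \<partial>lborel) = (\<integral>x. u x * riesz_conv s \<theta> x \<partial>lborel)"
    by (simp only: 1 2)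
qed

text \<open>Written as an integral over \<open>z = x - y\<close>, the convolution puts no derivative on the
  singular kernel: for each fixed \<open>z\<close> the classical integration by parts applies to the
  translate \<open>f (x - z)\<close>.\<close>

lemma riesz_conv_by_parts:
  fixes f \<theta> :: "'a::euclidean_space \<Rightarrow> real"
  assumes s: "0 < s" "s < 1"
    and f: "deriv_along e f f'" "continuous_on UNIV f" "continuous_on UNIV f'"
    and K: "compact K" "\<And>x. x \<notin> K \<Longrightarrow> f x = 0" "\<And>x. x \<notin> K \<Longrightarrow> f' x = 0"
    and \<theta>: "deriv_along e \<theta> \<theta>'" "continuous_on UNIV \<theta>" "continuous_on UNIV \<theta>'"
    and L: "compact L" "\<And>x. x \<notin> L \<Longrightarrow> \<theta> x = 0" "\<And>x. x \<notin> L \<Longrightarrow> \<theta>' x = 0"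
  shows "(\<integral>x. riesz_conv s f x * \<theta>' x \<partial>lborel) = - (\<integral>x. riesz_conv s f' x * \<theta> x \<partial>lborel)"
proof -
  have int: "(\<integral>x. riesz_conv s u x * \<psi> x \<partial>lborel) = (\<integral>z. norm z powr (s - real DIM('a)) * (\<integral>x. \<psi> x * u (x - z) \<partial>lborel) \<partial>lborel)"
    if u: "continuous_on UNIV u" "\<And>x. x \<notin> K \<Longrightarrow> u x = 0" and \<psi>: "continuous_on UNIV \<psi>" "\<And>x. x \<notin> L \<Longrightarrow> \<psi> x = 0" for u \<psi> :: "'a \<Rightarrow> real"
  proof -
    have [measurable]: "u \<in> borel_measurable borel" "\<psi> \<in> borel_measurable borel"
      using u \<psi> by (auto intro: borel_measurable_continuous_onI)
    have ui: "integrable lborel u" by (rule integrable_continuous_compact_support[OF u(1) K(1) u(2)])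
    have \<psi>i: "integrable lborel \<psi>" by (rule integrable_continuous_compact_support[OF \<psi>(1) L(1) \<psi>(2)])
    obtain M where M: "\<And>x. \<bar>\<psi> x\<bar> \<le> M" using bounded_continuous_compact_support[OF \<psi>(1) L(1) \<psi>(2)] by blast
    define H where "H = (\<lambda>(x, z). \<psi> x * (u (x - z) * norm z powr (s - real DIM('a))))"
    have [measurable]: "H \<in> borel_measurable (lborel \<Otimes>\<^sub>M lborel)" unfolding H_def by measurable
    have "(\<integral>\<^sup>+p. ennreal (norm (H p)) \<partial>(lborel \<Otimes>\<^sub>M lborel)) = (\<integral>\<^sup>+x. \<integral>\<^sup>+z. ennreal \<bar>\<psi> x * (u (x - z) * norm z powr (s - real DIM('a)))\<bar> \<partial>lborel \<partial>lborel)"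
      by (subst lborel.nn_integral_fst[symmetric]) (auto simp: H_def)
    also have "\<dots> = (\<integral>\<^sup>+x. \<integral>\<^sup>+y. ennreal \<bar>\<psi> x * (u y * norm (x - y) powr (s - real DIM('a)))\<bar> \<partial>lborel \<partial>lborel)"
    proof (rule nn_integral_cong)
      fix x :: 'a
      have "(\<integral>\<^sup>+y. ennreal \<bar>\<psi> x * (u y * norm (x - y) powr (s - real DIM('a)))\<bar> \<partial>lborel)
          = (\<integral>\<^sup>+y. ennreal \<bar>\<psi> x * (u y * norm (x - y) powr (s - real DIM('a)))\<bar> \<partial>distr lborel borel (\<lambda>z. x - z))"
        by (simp only: lborel_reflect)
      also have "\<dots> = (\<integral>\<^sup>+z. ennreal \<bar>\<psi> x * (u (x - z) * norm z powr (s - real DIM('a)))\<bar> \<partial>lborel)"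
        by (subst nn_integral_distr) auto
      finally show "(\<integral>\<^sup>+z. ennreal \<bar>\<psi> x * (u (x - z) * norm z powr (s - real DIM('a)))\<bar> \<partial>lborel) =
        (\<integral>\<^sup>+y. ennreal \<bar>\<psi> x * (u y * norm (x - y) powr (s - real DIM('a)))\<bar> \<partial>lborel)" ..
    qed
    also have "\<dots> < \<infinity>" by (rule riesz_conv_Fubini(3)[OF s ui \<psi>i M])
    finally have H: "integrable (lborel \<Otimes>\<^sub>M lborel) H"
      by (intro integrableI_bounded) auto
    have 1: "(\<integral>z. H (x, z) \<partial>lborel) = riesz_conv s u x * \<psi> x" for x
    proof -
      have "riesz_conv s u x = (\<integral>y. u y * norm (x - y) powr (s - real DIM('a)) \<partial>distr lborel borel (\<lambda>z. x - z))"
        by (simp only: lborel_reflect riesz_conv_def)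
      also have "\<dots> = (\<integral>z. u (x - z) * norm z powr (s - real DIM('a)) \<partial>lborel)"
        by (subst integral_distr) auto
      finally show ?thesis by (simp add: H_def)
    qed
    have 2: "(\<integral>x. H (x, z) \<partial>lborel) = norm z powr (s - real DIM('a)) * (\<integral>x. \<psi> x * u (x - z) \<partial>lborel)" for z
      unfolding H_def prod.case integral_mult_right_zero[symmetric]
      by (intro Bochner_Integration.integral_cong) (auto simp: mult_ac)
    have "(\<integral>z. \<integral>x. H (x, z) \<partial>lborel \<partial>lborel) = (\<integral>x. \<integral>z. H (x, z) \<partial>lborel \<partial>lborel)"
      by (rule lborel_pair.Fubini_integral) (simp add: H)
    then show ?thesis by (simp only: 1 2)
  qed
  have parts: "(\<integral>x. \<theta>' x * f (x - z) \<partial>lborel) = - (\<integral>x. \<theta> x * f' (x - z) \<partial>lborel)" for z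
  proof (rule integration_by_parts_along[OF \<theta> _ _ _ L])
    show "deriv_along e (\<lambda>x. f (x - z)) (\<lambda>x. f' (x - z))"
      unfolding deriv_along_def
    proof
      fix x
      have "((\<lambda>h. f ((x - z) + h *\<^sub>R e)) has_real_derivative f' (x - z)) (at 0)"
        using f(1) unfolding deriv_along_def by blast
      then show "((\<lambda>h. f (x + h *\<^sub>R e - z)) has_real_derivative f' (x - z)) (at 0)"
        by (simp add: algebra_simps)
    qed
  qed (auto intro!: continuous_on_compose2[OF f(2)] continuous_on_compose2[OF f(3)] continuous_intros)
  have "(\<integral>x. riesz_conv s f x * \<theta>' x \<partial>lborel) = (\<integral>z. - (norm z powr (s - real DIM('a)) * (\<integral>x. \<theta> x * f' (x - z) \<partial>lborel)) \<partial>lborel)"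
    using int[OF f(2) K(2) \<theta>(3) L(3)] by (simp add: parts)
  also have "\<dots> = - (\<integral>x. riesz_conv s f' x * \<theta> x \<partial>lborel)"
    using int[OF f(3) K(3) \<theta>(2) L(2)] by simp
  finally show ?thesis .
qed

section \<open>The fractional gradient\<close>

lemma riesz_potential_conv:
  fixes u u' :: "real^'n \<Rightarrow> real"
  assumes [measurable]: "u' \<in> borel_measurable borel" "u \<in> borel_measurable lebesgue" and uu': "AE x in lebesgue. u x = u' x"
  shows "riesz_potential s u x = riesz_const CARD('n) s * riesz_conv s u' x"
proof -
  have k: "a / norm z powr (real CARD('n) - s) = a * norm z powr (s - real DIM(real^'n))" for a and z :: "real^'n"
    using powr_minus_divide[of "norm z" "real CARD('n) - s"] by simp
  have "(LINT y|lebesgue. u y / norm (x - y) powr (real CARD('n) - s)) = (LINT y|lebesgue. u' y * norm (x - y) powr (s - real DIM(real^'n)))"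
    unfolding k
  proof (rule integral_cong_AE)
    have [measurable]: "(\<lambda>y. norm (x - y) powr (s - real DIM(real^'n))) \<in> borel_measurable lebesgue" "u' \<in> borel_measurable lebesgue"
      by (intro measurable_completion; simp)+
    show "(\<lambda>y. u y * norm (x - y) powr (s - real DIM(real^'n))) \<in> borel_measurable lebesgue" by measurable
    show "(\<lambda>y. u' y * norm (x - y) powr (s - real DIM(real^'n))) \<in> borel_measurable lebesgue" by measurable
    show "AE y in lebesgue. u y * norm (x - y) powr (s - real DIM(real^'n)) = u' y * norm (x - y) powr (s - real DIM(real^'n))"
      using uu' by eventually_elim simp
  qed
  also have "\<dots> = riesz_conv s u' x"
    unfolding riesz_conv_def by (rule integral_completion) simp
  finally show ?thesis by (simp add: riesz_potential_def)
qed

lemma riesz_const_pos: "0 < s \<Longrightarrow> s < 1 \<Longrightarrow> 1 \<le> n \<Longrightarrow> 0 < riesz_const n s"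
  by (auto simp: riesz_const_def intro!: divide_pos_pos mult_pos_pos Gamma_real_pos)

lemma test_fun_bounded_integrable:
  fixes \<phi> :: "real^'n \<Rightarrow> real"
  assumes "\<phi> \<in> test_fun \<Omega>"
  shows "integrable lborel \<phi>" "\<exists>M. \<forall>x. \<bar>\<phi> x\<bar> \<le> M" "\<phi> \<in> borel_measurable borel"
proof -
  interpret C1_compact \<phi> "\<lambda>e x. frechet_derivative \<phi> (at x) e" "closure {x. \<phi> x \<noteq> 0}"
    using assms by (rule test_fun_C1_compact)
  show "integrable lborel \<phi>" by (rule f_integrable)
  show "\<exists>M. \<forall>x. \<bar>\<phi> x\<bar> \<le> M" using f_bounded by blast
  show "\<phi> \<in> borel_measurable borel" by simp
qed

text \<open>The identity that defines the distributional gradient of the Riesz potential, with both the derivative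
  and the potential moved onto the test function. In this form it is linear in \<open>u\<close> against a bounded
  function, and hence stable under \<open>L\<^sup>2\<close> limits on a bounded domain.\<close>
definition weak_frac_grad :: "real \<Rightarrow> (real^'n \<Rightarrow> real) \<Rightarrow> (real^'n \<Rightarrow> real^'n) \<Rightarrow> bool" where
  "weak_frac_grad \<sigma> u g \<longleftrightarrow> (\<forall>\<theta>\<in>test_fun UNIV. \<forall>j.
     (LINT x|lebesgue. u x * (riesz_const CARD('n) (1 - \<sigma>) * riesz_conv (1 - \<sigma>) (partial_deriv j \<theta>) x)) = - (LINT x|lebesgue. g x $ j * \<theta> x))"

lemma riesz_conv_test_bounded:
  fixes \<theta> :: "real^'n \<Rightarrow> real"
  assumes s: "0 < s" "s < 1" and \<theta>: "\<theta> \<in> test_fun \<Omega>"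
  obtains B where "\<And>x. \<bar>riesz_conv s \<theta> x\<bar> \<le> B"
proof -
  obtain M where M: "\<And>x. \<bar>\<theta> x\<bar> \<le> M" using test_fun_bounded_integrable(2)[OF \<theta>] by blast
  show ?thesis
    using riesz_conv_bounded[OF s test_fun_bounded_integrable(1)[OF \<theta>] M] that by blast
qed

text \<open>By Fubini's theorem the Riesz potential is moved from \<open>u\<close> to the derivative of the
  test function.\<close>

lemma has_distr_gradient_iff:
  fixes u :: "real^'n \<Rightarrow> real"
  assumes \<sigma>: "0 < \<sigma>" "\<sigma> < 1" and u: "integrable lebesgue u"
  shows "has_distr_gradient (riesz_potential (1 - \<sigma>) u) g \<longleftrightarrow> locally_integrable g \<and> weak_frac_grad \<sigma> u g"
proof -
  define s where "s = 1 - \<sigma>"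
  have s: "0 < s" "s < 1" using \<sigma> by (auto simp: s_def)
  define rc where "rc = riesz_const CARD('n) s"
  obtain u' where [measurable]: "u' \<in> borel_measurable borel" and u': "AE x in lebesgue. u x = u' x"
    using borel_representative[OF borel_measurable_integrable[OF u]] .
  have "integrable lebesgue u'"
    using u by (rule integrable_cong_AE_imp) (use u' in \<open>auto intro: measurable_completion elim: eventually_mono\<close>)
  then have u'i: "integrable lborel u'" by (simp add: integrable_completion)
  have pot: "riesz_potential s u = (\<lambda>x. rc * riesz_conv s u' x)"
    by (rule ext) (simp add: riesz_potential_conv[OF _ borel_measurable_integrable[OF u] u'] rc_def)
  have "locally_integrable (riesz_potential s u)"
    unfolding locally_integrable_def set_integrable_def
  proof (intro allI impI)
    fix K :: "(real^'n) set" assume K: "compact K"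
    have "integrable lborel (indicator K :: real^'n \<Rightarrow> real)"
      using borel_integrable_compact[OF K, of "\<lambda>_. 1::real"] by simp
    then have "integrable lborel (\<lambda>x. riesz_conv s u' x * indicator K x)"
      by (rule riesz_conv_Fubini(1)[OF s u'i, where M=1]) (auto simp: indicator_def)
    then have "integrable lborel (\<lambda>x. rc * (riesz_conv s u' x * indicator K x))" by simp
    moreover have "K \<in> sets borel" using K by (rule borel_compact)
    ultimately show "integrable lebesgue (\<lambda>x. indicator K x *\<^sub>R riesz_potential s u x)"
      unfolding pot by (subst integrable_completion) (auto simp: mult_ac)
  qed
  moreover have "(LINT x|lebesgue. riesz_potential s u x * partial_deriv j \<theta> x) = (LINT x|lebesgue. u x * (rc * riesz_conv s (partial_deriv j \<theta>) x))"
    if \<theta>: "\<theta> \<in> test_fun UNIV" for \<theta> j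
  proof -
    note t = test_fun_bounded_integrable[OF test_fun_partial_deriv[OF \<theta>], of j]
    have [measurable]: "partial_deriv j \<theta> \<in> borel_measurable borel" by (rule t(3))
    obtain M where M: "\<And>x. \<bar>partial_deriv j \<theta> x\<bar> \<le> M" using t(2) by blast
    have "(LINT x|lebesgue. riesz_potential s u x * partial_deriv j \<theta> x) = (\<integral>x. rc * (riesz_conv s u' x * partial_deriv j \<theta> x) \<partial>lborel)"
      unfolding pot by (subst integral_completion) (auto simp: mult.assoc)
    also have "\<dots> = rc * (\<integral>x. u' x * riesz_conv s (partial_deriv j \<theta>) x \<partial>lborel)"
      using riesz_conv_Fubini(2)[OF s u'i t(1) M] by simp
    also have "\<dots> = (\<integral>x. u' x * (rc * riesz_conv s (partial_deriv j \<theta>) x) \<partial>lborel)"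
      unfolding integral_mult_right_zero[symmetric] by (simp add: mult_ac)
    also have "\<dots> = (LINT x|lebesgue. u' x * (rc * riesz_conv s (partial_deriv j \<theta>) x))"
      by (rule integral_completion[symmetric]) simp
    also have "\<dots> = (LINT x|lebesgue. u x * (rc * riesz_conv s (partial_deriv j \<theta>) x))"
    proof (rule integral_cong_AE)
      have [measurable]: "riesz_conv s (partial_deriv j \<theta>) \<in> borel_measurable lebesgue" "u' \<in> borel_measurable lebesgue" "u \<in> borel_measurable lebesgue"
        using u by (auto intro!: measurable_completion)
      show "(\<lambda>x. u x * (rc * riesz_conv s (partial_deriv j \<theta>) x)) \<in> borel_measurable lebesgue" by measurable
      show "(\<lambda>x. u' x * (rc * riesz_conv s (partial_deriv j \<theta>) x)) \<in> borel_measurable lebesgue" by measurable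
      show "AE x in lebesgue. u' x * (rc * riesz_conv s (partial_deriv j \<theta>) x) = u x * (rc * riesz_conv s (partial_deriv j \<theta>) x)"
        using u' by eventually_elim simp
    qed
    finally show ?thesis .
  qed
  ultimately show ?thesis
    unfolding has_distr_gradient_def weak_frac_grad_def s_def[symmetric] rc_def[symmetric] by auto
qed

lemma sq_locally_integrable:
  assumes "sq g" shows "locally_integrable (g :: real^'n \<Rightarrow> 'b::euclidean_space)"
  unfolding locally_integrable_def set_integrable_def
proof (intro allI impI)
  fix K :: "(real^'n) set" assume K: "compact K"
  have [measurable]: "g \<in> borel_measurable lebesgue" "K \<in> sets lebesgue"
    using assms sets_completionI_sets[of K lborel] borel_compact[OF K] by (auto simp: sq_measurable)
  have Kb: "integrable lborel (\<lambda>x. indicator K x *\<^sub>R (1::real))"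
    using K by (intro borel_integrable_compact) auto
  have [measurable]: "K \<in> sets borel" using K by (rule borel_compact)
  have iK: "integrable lebesgue (\<lambda>x. indicator K x *\<^sub>R (1::real))"
    using Kb by (subst integrable_completion) auto
  show "integrable lebesgue (\<lambda>x. indicator K x *\<^sub>R g x)"
  proof (rule Bochner_Integration.integrable_bound[where f="\<lambda>x. indicator K x *\<^sub>R (1::real) + (norm (g x))\<^sup>2"])
    show "integrable lebesgue (\<lambda>x. indicator K x *\<^sub>R (1::real) + (norm (g x))\<^sup>2)"
      using iK sq_integrable[OF assms] by (rule Bochner_Integration.integrable_add)
    show "(\<lambda>x. indicator K x *\<^sub>R g x) \<in> borel_measurable lebesgue" by measurable
    show "AE x in lebesgue. norm (indicator K x *\<^sub>R g x) \<le> norm (indicator K x *\<^sub>R (1::real) + (norm (g x))\<^sup>2)"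
    proof (rule AE_I2)
      fix x
      have "norm (g x) \<le> 1 + (norm (g x))\<^sup>2"
        using sum_squares_bound[of 1 "norm (g x)"] norm_ge_zero[of "g x"] unfolding power_one mult_1_right by linarith
      then show "norm (indicator K x *\<^sub>R g x) \<le> norm (indicator K x *\<^sub>R (1::real) + (norm (g x))\<^sup>2)"
        by (auto simp: indicator_def)
    qed
  qed
qed

lemma locally_integrable_measurable:
  assumes "locally_integrable (g :: real^'n \<Rightarrow> 'b::euclidean_space)" shows "g \<in> borel_measurable lebesgue"
proof (rule borel_measurable_LIMSEQ_metric)
  show "(\<lambda>x. indicator (cball 0 (real n)) x *\<^sub>R g x) \<in> borel_measurable lebesgue" for n
    using assms unfolding locally_integrable_def set_integrable_def by (intro borel_measurable_integrable) auto
  fix x :: "real^'n"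
  obtain N where N: "norm x < real N" using reals_Archimedean2 by blast
  show "(\<lambda>n. indicator (cball 0 (real n)) x *\<^sub>R g x) \<longlonglongrightarrow> g x"
  proof (rule tendsto_eventually, rule eventually_sequentiallyI[of N])
    fix n assume "N \<le> n"
    then have "norm x \<le> real n" using N by simp
    then show "indicator (cball 0 (real n)) x *\<^sub>R g x = g x" by simp
  qed
qed

lemma locally_integrable_component:
  assumes "locally_integrable (g :: real^'n \<Rightarrow> real^'n)" shows "locally_integrable (\<lambda>x. g x $ j)"
  unfolding locally_integrable_def set_integrable_def
proof (intro allI impI)
  fix K :: "(real^'n) set" assume "compact K"
  then have "integrable lebesgue (\<lambda>x. indicator K x *\<^sub>R g x)"
    using assms unfolding locally_integrable_def set_integrable_def by blast
  from integrable_bounded_linear[OF bounded_linear_vec_nth this, of j]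
  show "integrable lebesgue (\<lambda>x. indicator K x *\<^sub>R g x $ j)" by simp
qed

text \<open>A distribution is represented by at most one locally integrable function.\<close>

lemma weak_frac_grad_unique:
  assumes g: "locally_integrable (g :: real^'n \<Rightarrow> real^'n)" "weak_frac_grad \<sigma> u g"
    and h: "locally_integrable h" "weak_frac_grad \<sigma> u h"
  shows "AE x in lebesgue. g x = h x"
proof -
  have "AE x in lebesgue. g x $ j - h x $ j = 0" for j
  proof (rule locally_integrable_AE_zero)
    show "locally_integrable (\<lambda>x. g x $ j - h x $ j)"
      using locally_integrable_component[OF g(1), of j] locally_integrable_component[OF h(1), of j]
      unfolding locally_integrable_def by (auto intro: set_integral_diff)
    fix \<theta> :: "real^'n \<Rightarrow> real" assume \<theta>: "\<theta> \<in> test_fun UNIV"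
    have "(\<integral>x. g x $ j * \<theta> x \<partial>lebesgue) = (\<integral>x. h x $ j * \<theta> x \<partial>lebesgue)"
    proof -
      have "- (\<integral>x. g x $ j * \<theta> x \<partial>lebesgue) = - (\<integral>x. h x $ j * \<theta> x \<partial>lebesgue)"
        using g(2)[unfolded weak_frac_grad_def, rule_format, OF \<theta>, of j] h(2)[unfolded weak_frac_grad_def, rule_format, OF \<theta>, of j]
        by (rule trans[OF sym])
      then show ?thesis by simp
    qed
    then show "(\<integral>x. (g x $ j - h x $ j) * \<theta> x \<partial>lebesgue) = 0"
      using locally_integrable_mult_test_fun[OF locally_integrable_component[OF g(1)] \<theta>, of j]
        locally_integrable_mult_test_fun[OF locally_integrable_component[OF h(1)] \<theta>, of j]
      by (simp add: left_diff_distrib)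
  qed
  then have "AE x in lebesgue. \<forall>j. g x $ j - h x $ j = 0" unfolding AE_all_countable by blast
  then show ?thesis by eventually_elim (simp add: vec_eq_iff)
qed

lemma Basis_axis: "Basis = range (\<lambda>j::'n::finite. axis j (1::real))"
  by (auto simp: Basis_vec_def)

lemma sum_Basis_axis: "(\<Sum>e\<in>(Basis :: (real^'n) set). F e) = (\<Sum>j\<in>UNIV. F (axis j 1))"
  unfolding Basis_axis by (subst sum.reindex) (auto intro!: injI simp: axis_eq_axis)

lemma weak_frac_grad_lincomb:
  fixes u v :: "real^'n \<Rightarrow> real"
  assumes \<sigma>: "0 < \<sigma>" "\<sigma> < 1" and u: "integrable lebesgue u" and v: "integrable lebesgue v"
    and g: "locally_integrable g" "weak_frac_grad \<sigma> u g" and h: "locally_integrable h" "weak_frac_grad \<sigma> v h"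
  shows "weak_frac_grad \<sigma> (\<lambda>x. a * u x + b * v x) (\<lambda>x. a *\<^sub>R g x + b *\<^sub>R h x)"
  unfolding weak_frac_grad_def
proof (intro ballI allI)
  fix \<theta> :: "real^'n \<Rightarrow> real" and j :: 'n assume \<theta>: "\<theta> \<in> test_fun UNIV"
  define P where "P x = riesz_const CARD('n) (1 - \<sigma>) * riesz_conv (1 - \<sigma>) (partial_deriv j \<theta>) x" for x
  have s: "0 < 1 - \<sigma>" "1 - \<sigma> < 1" using \<sigma> by auto
  obtain B where B: "\<And>x. \<bar>riesz_conv (1 - \<sigma>) (partial_deriv j \<theta>) x\<bar> \<le> B"
    using riesz_conv_test_bounded[OF s test_fun_partial_deriv[OF \<theta>], of j] by blast
  have [measurable]: "riesz_conv (1 - \<sigma>) (partial_deriv j \<theta>) \<in> borel_measurable lebesgue"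
    using test_fun_bounded_integrable(3)[OF test_fun_partial_deriv[OF \<theta>]]
    by (intro measurable_completion) simp
  have [measurable]: "P \<in> borel_measurable lebesgue" unfolding P_def by measurable
  have PB: "\<bar>P x\<bar> \<le> \<bar>riesz_const CARD('n) (1 - \<sigma>)\<bar> * B" for x
    unfolding P_def abs_mult by (intro mult_left_mono B) simp
  have int: "integrable lebesgue (\<lambda>x. w x * P x)" if w: "integrable lebesgue w" for w :: "real^'n \<Rightarrow> real"
  proof (rule Bochner_Integration.integrable_bound[where f="\<lambda>x. (\<bar>riesz_const CARD('n) (1 - \<sigma>)\<bar> * B) * w x"])
    show "AE x in lebesgue. norm (w x * P x) \<le> norm ((\<bar>riesz_const CARD('n) (1 - \<sigma>)\<bar> * B) * w x)"
    proof (rule AE_I2)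
      fix x
      have "\<bar>P x\<bar> * \<bar>w x\<bar> \<le> \<bar>\<bar>riesz_const CARD('n) (1 - \<sigma>)\<bar> * B\<bar> * \<bar>w x\<bar>"
        using PB[of x] by (intro mult_right_mono) auto
      then show "norm (w x * P x) \<le> norm ((\<bar>riesz_const CARD('n) (1 - \<sigma>)\<bar> * B) * w x)"
        by (simp add: abs_mult mult.commute)
    qed
    show "(\<lambda>x. w x * P x) \<in> borel_measurable lebesgue" using borel_measurable_integrable[OF w] by measurable
  qed (use w in simp)
  have ig: "integrable lebesgue (\<lambda>x. g x $ j * \<theta> x)" by (rule locally_integrable_mult_test_fun[OF locally_integrable_component[OF g(1)] \<theta>])
  have ih: "integrable lebesgue (\<lambda>x. h x $ j * \<theta> x)" by (rule locally_integrable_mult_test_fun[OF locally_integrable_component[OF h(1)] \<theta>])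
  have "(LINT x|lebesgue. (a * u x + b * v x) * P x) = (LINT x|lebesgue. a * (u x * P x) + b * (v x * P x))"
    by (simp add: distrib_right mult.assoc)
  also have "\<dots> = a * (LINT x|lebesgue. u x * P x) + b * (LINT x|lebesgue. v x * P x)"
    using int[OF u] int[OF v] by simp
  also have "\<dots> = a * - (LINT x|lebesgue. g x $ j * \<theta> x) + b * - (LINT x|lebesgue. h x $ j * \<theta> x)"
    using g(2)[unfolded weak_frac_grad_def, rule_format, OF \<theta>, of j] h(2)[unfolded weak_frac_grad_def, rule_format, OF \<theta>, of j]
    unfolding P_def by presburger
  also have "\<dots> = - (LINT x|lebesgue. a * (g x $ j * \<theta> x) + b * (h x $ j * \<theta> x))"
    using ig ih by simp
  also have "\<dots> = - (LINT x|lebesgue. (a *\<^sub>R g x + b *\<^sub>R h x) $ j * \<theta> x)"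
    by (simp add: distrib_right mult.assoc)
  finally show "(LINT x|lebesgue. (a * u x + b * v x) * (riesz_const CARD('n) (1 - \<sigma>) * riesz_conv (1 - \<sigma>) (partial_deriv j \<theta>) x)) = - (LINT x|lebesgue. (a *\<^sub>R g x + b *\<^sub>R h x) $ j * \<theta> x)"
    unfolding P_def .
qed

text \<open>The candidate for the fractional gradient of a smooth function: the Riesz potential of its
  classical gradient.\<close>

definition test_grad :: "real \<Rightarrow> (real^'n \<Rightarrow> real) \<Rightarrow> real^'n \<Rightarrow> real^'n" where
  "test_grad \<sigma> \<phi> x = (\<chi> j. riesz_const CARD('n) (1 - \<sigma>) * riesz_conv (1 - \<sigma>) (partial_deriv j \<phi>) x)"

lemma test_grad_measurable:
  fixes \<phi> :: "real^'n \<Rightarrow> real"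
  assumes \<phi>: "\<phi> \<in> test_fun \<Omega>" shows "test_grad \<sigma> \<phi> \<in> borel_measurable borel"
proof -
  have "(\<lambda>x. riesz_const CARD('n) (1 - \<sigma>) * riesz_conv (1 - \<sigma>) (partial_deriv j \<phi>) x) \<in> borel_measurable borel" for j
    using test_fun_bounded_integrable(3)[OF test_fun_partial_deriv[OF \<phi>], of j] by measurable
  then show ?thesis
    by (intro borel_measurable_euclidean_space[THEN iffD2]) (auto simp: Basis_axis inner_axis test_grad_def)
qed

text \<open>This is \<open>energy_identity\<close>, whose left-hand side is the squared norm of the gradient
  up to the normalization of the Riesz potential.\<close>

lemma test_grad_energy:
  assumes \<sigma>: "0 < \<sigma>" "\<sigma> < (1::real)"
  shows "\<exists>C>0. \<forall>\<Omega>. \<forall>\<phi>\<in>test_fun \<Omega>. sq (test_grad \<sigma> (\<phi> :: real^'n \<Rightarrow> real)) \<and>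
       ennreal ((norm (mkL2 (test_grad \<sigma> \<phi>)))\<^sup>2) = ennreal C * gagliardo \<sigma> \<phi>"
proof -
  obtain c where c: "0 < c" "\<And>f f' K. C1_compact (f :: real^'n \<Rightarrow> real) f' K \<Longrightarrow>
      (\<Sum>e\<in>Basis. \<integral>\<^sup>+x. ennreal ((\<integral>y. f' e y * norm (x - y) powr (1 - \<sigma> - DIM(real^'n)) \<partial>lborel)\<^sup>2) \<partial>lborel)
      = ennreal c * (\<integral>\<^sup>+x. \<integral>\<^sup>+y. ennreal ((f x - f y)\<^sup>2) * ennreal (norm (x - y) powr (- 2 * \<sigma> - DIM(real^'n))) \<partial>lborel \<partial>lborel)"
    using energy_identity[OF \<sigma>, where 'a="real^'n"] by blast
  define rc where "rc = riesz_const CARD('n) (1 - \<sigma>)"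
  have rc: "0 < rc" unfolding rc_def using \<sigma> by (intro riesz_const_pos) (auto simp: Suc_le_eq)
  show ?thesis
  proof (intro exI[of _ "rc\<^sup>2 * c"] conjI allI ballI)
    show "0 < rc\<^sup>2 * c" using rc c(1) by simp
    fix \<phi> :: "real^'n \<Rightarrow> real" and \<Omega> assume \<phi>: "\<phi> \<in> test_fun \<Omega>"
    have [measurable]: "test_grad \<sigma> \<phi> \<in> borel_measurable borel" by (rule test_grad_measurable[OF \<phi>])
    have [measurable]: "riesz_conv (1 - \<sigma>) (partial_deriv j \<phi>) \<in> borel_measurable borel" for j
      using test_fun_bounded_integrable(3)[OF test_fun_partial_deriv[OF \<phi>], of j] by measurable
    have nsq: "(norm (test_grad \<sigma> \<phi> x))\<^sup>2 = (\<Sum>j\<in>UNIV. rc\<^sup>2 * (riesz_conv (1 - \<sigma>) (partial_deriv j \<phi>) x)\<^sup>2)" for x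
      unfolding power2_norm_eq_inner inner_vec_def test_grad_def by (simp add: rc_def power2_eq_square mult_ac)
    have "(\<integral>\<^sup>+x. ennreal ((norm (test_grad \<sigma> \<phi> x))\<^sup>2) \<partial>lborel)
        = (\<Sum>j\<in>UNIV. ennreal (rc\<^sup>2) * (\<integral>\<^sup>+x. ennreal ((riesz_conv (1 - \<sigma>) (partial_deriv j \<phi>) x)\<^sup>2) \<partial>lborel))"
      unfolding nsq by (simp add: sum_ennreal[symmetric] ennreal_mult nn_integral_sum nn_integral_cmult)
    also have "\<dots> = ennreal (rc\<^sup>2) * (\<Sum>e\<in>Basis. \<integral>\<^sup>+x. ennreal ((\<integral>y. frechet_derivative \<phi> (at y) e * norm (x - y) powr (1 - \<sigma> - DIM(real^'n)) \<partial>lborel)\<^sup>2) \<partial>lborel)"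
      unfolding sum_Basis_axis riesz_conv_def partial_deriv_def sum_distrib_left ..
    also have "\<dots> = ennreal (rc\<^sup>2 * c) * gagliardo \<sigma> \<phi>"
      unfolding c(2)[OF test_fun_C1_compact[OF \<phi>]] gagliardo_lborel[OF test_fun_bounded_integrable(3)[OF \<phi>]]
      using c(1) by (simp add: ennreal_mult mult.assoc)
    finally have e: "(\<integral>\<^sup>+x. ennreal ((norm (test_grad \<sigma> \<phi> x))\<^sup>2) \<partial>lebesgue) = ennreal (rc\<^sup>2 * c) * gagliardo \<sigma> \<phi>"
      by (simp add: nn_integral_completion)
    have m: "test_grad \<sigma> \<phi> \<in> borel_measurable lebesgue" by (rule measurable_completion) simp
    have "gagliardo \<sigma> \<phi> < \<infinity>" using test_fun_Hs[OF \<phi> \<sigma>] by (rule Hs_D)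
    then have "(\<integral>\<^sup>+x. ennreal ((norm (test_grad \<sigma> \<phi> x))\<^sup>2) \<partial>lebesgue) < \<infinity>"
      unfolding e by (simp add: ennreal_mult_less_top)
    then have i: "integrable lebesgue (\<lambda>x. (norm (test_grad \<sigma> \<phi> x))\<^sup>2)"
      using m by (intro integrableI_nonneg) auto
    then have sq: "sq (test_grad \<sigma> \<phi>)" unfolding sq_def using m by blast
    moreover have "ennreal ((norm (mkL2 (test_grad \<sigma> \<phi>)))\<^sup>2) = ennreal (rc\<^sup>2 * c) * gagliardo \<sigma> \<phi>"
      unfolding norm_mkL2_square[OF sq] e[symmetric] using i by (intro nn_integral_eq_integral[symmetric]) auto
    ultimately show "sq (test_grad \<sigma> \<phi>)" "ennreal ((norm (mkL2 (test_grad \<sigma> \<phi>)))\<^sup>2) = ennreal (rc\<^sup>2 * c) * gagliardo \<sigma> \<phi>"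
      by blast+
  qed
qed

lemma test_grad_weak:
  fixes \<phi> :: "real^'n \<Rightarrow> real"
  assumes \<sigma>: "0 < \<sigma>" "\<sigma> < 1" and \<phi>: "\<phi> \<in> test_fun \<Omega>"
  shows "weak_frac_grad \<sigma> \<phi> (test_grad \<sigma> \<phi>)"
  unfolding weak_frac_grad_def
proof (intro ballI allI)
  fix \<theta> :: "real^'n \<Rightarrow> real" and j :: 'n assume \<theta>: "\<theta> \<in> test_fun UNIV"
  define s where "s = 1 - \<sigma>"
  have s: "0 < s" "s < 1" using \<sigma> by (auto simp: s_def)
  interpret f: C1_compact \<phi> "\<lambda>e x. frechet_derivative \<phi> (at x) e" "closure {x. \<phi> x \<noteq> 0}" by (rule test_fun_C1_compact[OF \<phi>])
  interpret t: C1_compact \<theta> "\<lambda>e x. frechet_derivative \<theta> (at x) e" "closure {x. \<theta> x \<noteq> 0}" by (rule test_fun_C1_compact[OF \<theta>])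
  have e: "axis j (1::real) \<in> Basis" by (simp add: Basis_axis)
  have pd: "partial_deriv j \<psi> = (\<lambda>x. frechet_derivative \<psi> (at x) (axis j 1))" for \<psi> :: "real^'n \<Rightarrow> real"
    by (simp add: partial_deriv_def fun_eq_iff)
  note t' = test_fun_bounded_integrable[OF test_fun_partial_deriv[OF \<theta>], of j]
  note f' = test_fun_bounded_integrable[OF test_fun_partial_deriv[OF \<phi>], of j]
  have [measurable]: "partial_deriv j \<theta> \<in> borel_measurable borel" "partial_deriv j \<phi> \<in> borel_measurable borel" by (rule t'(3) f'(3))+
  have [measurable]: "\<phi> \<in> borel_measurable borel" "\<theta> \<in> borel_measurable borel"
    using test_fun_bounded_integrable(3)[OF \<phi>] test_fun_bounded_integrable(3)[OF \<theta>] .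
  obtain M where M: "\<And>x. \<bar>partial_deriv j \<theta> x\<bar> \<le> M" using t'(2) by blast
  let ?rc = "riesz_const CARD('n) s"
  have "(LINT x|lebesgue. \<phi> x * (?rc * riesz_conv s (partial_deriv j \<theta>) x)) = (\<integral>x. ?rc * (\<phi> x * riesz_conv s (partial_deriv j \<theta>) x) \<partial>lborel)"
    by (subst integral_completion) (auto simp: mult_ac)
  also have "\<dots> = ?rc * (\<integral>x. riesz_conv s \<phi> x * partial_deriv j \<theta> x \<partial>lborel)"
    using riesz_conv_Fubini(2)[OF s test_fun_bounded_integrable(1)[OF \<phi>] t'(1) M] by simp
  also have "(\<integral>x. riesz_conv s \<phi> x * partial_deriv j \<theta> x \<partial>lborel) = - (\<integral>x. riesz_conv s (partial_deriv j \<phi>) x * \<theta> x \<partial>lborel)"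
    unfolding pd
    by (rule riesz_conv_by_parts[OF s f.deriv[OF e] f.f f.f'[OF e] f.K f.f_0 f.f'_0[OF e] t.deriv[OF e] t.f t.f'[OF e] t.K t.f_0 t.f'_0[OF e]])
  also have "?rc * - (\<integral>x. riesz_conv s (partial_deriv j \<phi>) x * \<theta> x \<partial>lborel) = - (\<integral>x. ?rc * (riesz_conv s (partial_deriv j \<phi>) x * \<theta> x) \<partial>lborel)"
    by simp
  also have "\<dots> = - (LINT x|lebesgue. test_grad \<sigma> \<phi> x $ j * \<theta> x)"
    by (subst integral_completion) (auto simp: mult_ac test_grad_def s_def[symmetric])
  finally show "(LINT x|lebesgue. \<phi> x * (riesz_const CARD('n) (1 - \<sigma>) * riesz_conv (1 - \<sigma>) (partial_deriv j \<theta>) x)) = - (LINT x|lebesgue. test_grad \<sigma> \<phi> x $ j * \<theta> x)"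
    unfolding s_def .
qed

lemma sq_cong: "sq f \<Longrightarrow> (AE x in lebesgue. f x = g x) \<Longrightarrow> g \<in> borel_measurable lebesgue \<Longrightarrow> sq g"
  unfolding sq_def by (auto elim!: integrable_cong_AE_imp)

lemma ennreal_twice_add: "0 \<le> x \<Longrightarrow> 0 \<le> y \<Longrightarrow> 2 * ennreal x + 2 * ennreal y = ennreal (2 * x + 2 * y)"
  by (simp add: ennreal_plus ennreal_mult)

lemma tendsto_norm_square:
  fixes X :: "nat \<Rightarrow> 'b::real_normed_vector"
  assumes "\<And>n. (norm (X n - L))\<^sup>2 \<le> C * (1 / real (Suc n))"
  shows "X \<longlonglongrightarrow> L"
proof -
  have "(\<lambda>n. C * (1 / real (Suc n))) \<longlonglongrightarrow> C * 0"
    using LIMSEQ_inverse_real_of_nat by (intro tendsto_intros) (simp add: inverse_eq_divide)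
  then have g: "(\<lambda>n. C * (1 / real (Suc n))) \<longlonglongrightarrow> 0" by (simp only: mult_zero_right)
  have "eventually (\<lambda>n. norm ((norm (X n - L))\<^sup>2) \<le> C * (1 / real (Suc n))) sequentially"
    by (intro always_eventually allI) (simp only: real_norm_def abs_power2 assms)
  then have "(\<lambda>n. (norm (X n - L))\<^sup>2) \<longlonglongrightarrow> 0" using g by (rule Lim_null_comparison)
  then have "(\<lambda>n. sqrt ((norm (X n - L))\<^sup>2)) \<longlonglongrightarrow> sqrt 0" by (rule tendsto_real_sqrt)
  then have "(\<lambda>n. norm (X n - L)) \<longlonglongrightarrow> 0" by simp
  then show ?thesis by (rule LIM_zero_cancel[OF tendsto_norm_zero_cancel])
qed

lemma Cauchy_norm_square:
  fixes X :: "nat \<Rightarrow> 'b::real_normed_vector"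
  assumes "\<And>n m. (norm (X n - X m))\<^sup>2 \<le> C * (1 / real (Suc n) + 1 / real (Suc m))"
  shows "Cauchy X"
proof (rule metric_CauchyI)
  fix e :: real assume e: "0 < e"
  have "0 \<le> (norm (X 0 - X 0))\<^sup>2" by simp
  also have "\<dots> \<le> C * 2" using assms[of 0 0] by simp
  finally have C: "0 \<le> C" by simp
  obtain N where N: "2 * C / e\<^sup>2 < real N" using reals_Archimedean2 by blast
  have "dist (X m) (X n) < e" if "N \<le> m" "N \<le> n" for m n
  proof -
    have N0: "0 < real (Suc N)" by simp
    have "1 / real (Suc m) \<le> 1 / real (Suc N)" "1 / real (Suc n) \<le> 1 / real (Suc N)"
      using that by (auto intro!: divide_left_mono)
    then have "C * (1 / real (Suc m) + 1 / real (Suc n)) \<le> C * (2 / real (Suc N))"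
      using C by (intro mult_left_mono) auto
    also have "\<dots> < e\<^sup>2"
    proof -
      have "2 * C < e\<^sup>2 * real (Suc N)"
      proof -
        have "2 * C = (2 * C / e\<^sup>2) * e\<^sup>2" using e by simp
        also have "\<dots> \<le> real N * e\<^sup>2" using N by (intro mult_right_mono) auto
        also have "\<dots> < e\<^sup>2 * real (Suc N)" using e by (simp add: distrib_left)
        finally show ?thesis .
      qed
      then show ?thesis using N0 by (simp add: divide_less_eq mult.commute)
    qed
    finally have "(norm (X m - X n))\<^sup>2 < e\<^sup>2" using assms[of m n] by linarith
    then show ?thesis unfolding dist_norm by (rule power2_less_imp_less) (use e in simp)
  qed
  then show "\<exists>M. \<forall>m\<ge>M. \<forall>n\<ge>M. dist (X m) (X n) < e" by blast
qed

locale fractional_domain =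
  fixes \<sigma> :: real and \<Omega> :: "(real^'n) set"
  assumes \<sigma>: "0 < \<sigma>" "\<sigma> < 1" and \<Omega>: "open \<Omega>" "bounded \<Omega>"
begin

lemma domain_measurable [measurable]: "\<Omega> \<in> sets lebesgue"
  using \<Omega>(1) by (simp add: sets_completionI_sets)

lemma domain_indicator_integrable: "integrable lebesgue (indicator \<Omega> :: real^'n \<Rightarrow> real)"
  using \<Omega> lmeasurable_open[of \<Omega>] by (auto simp: integrable_indicator_iff fmeasurable_def)

lemma Hs0_integrable:
  assumes u: "u \<in> Hs0 \<sigma> \<Omega>" shows "integrable lebesgue u"
proof (rule Bochner_Integration.integrable_bound[where f="\<lambda>x. indicator \<Omega> x + (norm (u x))\<^sup>2"])
  show "integrable lebesgue (\<lambda>x. indicator \<Omega> x + (norm (u x))\<^sup>2)"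
    using domain_indicator_integrable sq_integrable[OF Hs0_sq[OF u]] by (rule Bochner_Integration.integrable_add)
  show "u \<in> borel_measurable lebesgue" by (rule Hs0_measurable[OF u])
  show "AE x in lebesgue. norm (u x) \<le> norm (indicator \<Omega> x + (norm (u x))\<^sup>2)"
    using Hs0_supported[OF u \<sigma> \<Omega>(1)]
  proof eventually_elim
    fix x assume z: "x \<notin> \<Omega> \<longrightarrow> u x = 0"
    have "norm (u x) \<le> 1 + (norm (u x))\<^sup>2"
      using sum_squares_bound[of 1 "norm (u x)"] norm_ge_zero[of "u x"] unfolding power_one mult_1_right by linarith
    then show "norm (u x) \<le> norm (indicator \<Omega> x + (norm (u x))\<^sup>2)"
      using z by (cases "x \<in> \<Omega>") auto
  qed
qed

lemma bounded_on_domain_sq: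
  assumes "\<psi> \<in> borel_measurable lebesgue" "\<And>x. \<bar>\<psi> x\<bar> \<le> B"
  shows "sq (\<lambda>x. indicator \<Omega> x * \<psi> x :: real)"
  unfolding sq_def
proof
  show m: "(\<lambda>x. indicator \<Omega> x * \<psi> x) \<in> borel_measurable lebesgue" using assms(1) by measurable
  show "integrable lebesgue (\<lambda>x. (norm (indicator \<Omega> x * \<psi> x))\<^sup>2)"
  proof (rule Bochner_Integration.integrable_bound[where f="\<lambda>x. B\<^sup>2 * indicator \<Omega> x"])
    show "AE x in lebesgue. norm ((norm (indicator \<Omega> x * \<psi> x))\<^sup>2) \<le> norm (B\<^sup>2 * indicator \<Omega> x :: real)"
    proof (rule AE_I2)
      fix x
      have "\<bar>\<psi> x\<bar>\<^sup>2 \<le> B\<^sup>2" by (rule power_mono[OF assms(2)]) simp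
      then show "norm ((norm (indicator \<Omega> x * \<psi> x))\<^sup>2) \<le> norm (B\<^sup>2 * indicator \<Omega> x :: real)"
        by (cases "x \<in> \<Omega>") simp_all
    qed
  qed (use m domain_indicator_integrable in auto)
qed

text \<open>Take test functions \<open>\<phi> n\<close> that converge to \<open>u\<close> in
  \<open>L\<^sup>2\<close> and in the Gagliardo seminorm. Their gradients form a Cauchy sequence in
  \<open>L\<^sup>2\<close> because differences of test functions are test functions. Both sides of
  the identity that defines \<open>weak_frac_grad\<close> are \<open>L\<^sup>2\<close> inner
  products with fixed elements and so pass to the limit; on the left this uses that all functions
  vanish outside \<open>\<Omega>\<close>, where the Riesz potential of the test function need not be
  square integrable. The factors 2 come from the quasi-triangle inequality for the squared seminorm.\<close>

lemma frac_grad_construct: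
  obtains C where "0 < C"
    "\<And>u. u \<in> Hs0 \<sigma> \<Omega> \<Longrightarrow> \<exists>g. sq g \<and> weak_frac_grad \<sigma> u g \<and>
       (norm (mkL2 g))\<^sup>2 \<le> C * enn2real (gagliardo \<sigma> u) \<and> enn2real (gagliardo \<sigma> u) \<le> C * (norm (mkL2 g))\<^sup>2"
proof -
  obtain K where K: "0 < K" "\<And>\<phi>. (\<phi> :: real^'n \<Rightarrow> real) \<in> test_fun \<Omega> \<Longrightarrow> sq (test_grad \<sigma> \<phi>) \<and>
       ennreal ((norm (mkL2 (test_grad \<sigma> \<phi>)))\<^sup>2) = ennreal K * gagliardo \<sigma> \<phi>"
    using test_grad_energy[OF \<sigma>, where 'n='n] by blast
  have main: "\<exists>g. sq g \<and> weak_frac_grad \<sigma> u g \<and>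
       (norm (mkL2 g))\<^sup>2 \<le> 2 * K * enn2real (gagliardo \<sigma> u) \<and> K * enn2real (gagliardo \<sigma> u) \<le> 2 * (norm (mkL2 g))\<^sup>2"
    if u: "u \<in> Hs0 \<sigma> \<Omega>" for u
  proof -
    have "\<forall>n. \<exists>\<phi>. \<phi> \<in> test_fun \<Omega> \<and> (LINT x|lebesgue. (u x - \<phi> x)\<^sup>2) < 1 / real (Suc n) \<and> gagliardo \<sigma> (\<lambda>x. u x - \<phi> x) < ennreal (1 / real (Suc n))"
    proof
      fix n
      have "0 < 1 / real (Suc n)" by simp
      from Hs0_approx[OF u \<sigma> this] show "\<exists>\<phi>. \<phi> \<in> test_fun \<Omega> \<and> (LINT x|lebesgue. (u x - \<phi> x)\<^sup>2) < 1 / real (Suc n) \<and> gagliardo \<sigma> (\<lambda>x. u x - \<phi> x) < ennreal (1 / real (Suc n))" by blast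
    qed
    from choice[OF this]
    obtain \<phi> where \<phi>: "\<And>n. \<phi> n \<in> test_fun \<Omega>" "\<And>n. (LINT x|lebesgue. (u x - \<phi> n x)\<^sup>2) < 1 / real (Suc n)"
      "\<And>n. gagliardo \<sigma> (\<lambda>x. u x - \<phi> n x) < ennreal (1 / real (Suc n))" by blast
    note ms = Hs0_measurable[OF u] sq_measurable[OF test_fun_sq[OF \<phi>(1)]]
    define F where "F n = mkL2 (test_grad \<sigma> (\<phi> n))" for n
    have sqn: "sq (test_grad \<sigma> (\<phi> n))" for n using K(2)[OF \<phi>(1)] by blast
    have int: "integrable lebesgue (\<phi> n)" for n by (rule Hs0_integrable[OF test_fun_Hs0[OF \<phi>(1) \<sigma>]])
    define a where "a = enn2real (gagliardo \<sigma> u)"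
    have a: "gagliardo \<sigma> u = ennreal a" "0 \<le> a" using Hs_D(2)[OF Hs0_Hs[OF u]] by (auto simp: a_def)
    define b where "b n = enn2real (gagliardo \<sigma> (\<phi> n))" for n
    have b: "gagliardo \<sigma> (\<phi> n) = ennreal (b n)" "0 \<le> b n" for n using Hs_D(2)[OF test_fun_Hs[OF \<phi>(1) \<sigma>]] by (auto simp: b_def)
    have Fb: "(norm (F n))\<^sup>2 = K * b n" for n
    proof -
      have "ennreal ((norm (F n))\<^sup>2) = ennreal (K * b n)"
        using K(2)[OF \<phi>(1), of n] K(1) b[of n] by (simp add: F_def ennreal_mult)
      then show ?thesis using K(1) b(2)[of n] by simp
    qed
    have bd: "gagliardo \<sigma> (\<lambda>x. \<phi> n x - \<phi> m x) \<le> ennreal (2 * (1 / real (Suc n) + 1 / real (Suc m)))" for n m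
    proof -
      have "gagliardo \<sigma> (\<lambda>x. \<phi> n x - \<phi> m x) \<le> 2 * gagliardo \<sigma> (\<lambda>x. \<phi> n x - u x) + 2 * gagliardo \<sigma> (\<lambda>x. u x - \<phi> m x)"
        by (rule gagliardo_triangle) (rule ms)+
      also have "\<dots> \<le> 2 * ennreal (1 / real (Suc n)) + 2 * ennreal (1 / real (Suc m))"
        using \<phi>(3)[of n] \<phi>(3)[of m] by (intro add_mono mult_left_mono) (auto simp: gagliardo_minus[of \<sigma> "\<phi> n" u])
      also have "\<dots> = ennreal (2 * (1 / real (Suc n) + 1 / real (Suc m)))"
        unfolding distrib_left by (rule ennreal_twice_add) simp_all
      finally show ?thesis .
    qed
    have FC: "(norm (F n - F m))\<^sup>2 \<le> (2 * K) * (1 / real (Suc n) + 1 / real (Suc m))" for n m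
    proof -
      have td: "(\<lambda>x. \<phi> n x - \<phi> m x) \<in> test_fun \<Omega>" by (rule test_fun_diff[OF \<phi>(1) \<phi>(1)])
      have sqd: "sq (test_grad \<sigma> (\<lambda>x. \<phi> n x - \<phi> m x))" using K(2)[OF td] by blast
      have "weak_frac_grad \<sigma> (\<lambda>x. 1 * \<phi> n x + (-1) * \<phi> m x) (\<lambda>x. 1 *\<^sub>R test_grad \<sigma> (\<phi> n) x + (-1) *\<^sub>R test_grad \<sigma> (\<phi> m) x)"
        using sq_locally_integrable[OF sqn] test_grad_weak[OF \<sigma> \<phi>(1)] by (intro weak_frac_grad_lincomb[OF \<sigma> int int]) auto
      then have w: "weak_frac_grad \<sigma> (\<lambda>x. \<phi> n x - \<phi> m x) (\<lambda>x. test_grad \<sigma> (\<phi> n) x - test_grad \<sigma> (\<phi> m) x)" by simp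
      have "AE x in lebesgue. test_grad \<sigma> (\<phi> n) x - test_grad \<sigma> (\<phi> m) x = test_grad \<sigma> (\<lambda>x. \<phi> n x - \<phi> m x) x"
        by (rule weak_frac_grad_unique[OF sq_locally_integrable[OF sq_diff[OF sqn sqn]] w sq_locally_integrable[OF sqd] test_grad_weak[OF \<sigma> td]])
      then have "F n - F m = mkL2 (test_grad \<sigma> (\<lambda>x. \<phi> n x - \<phi> m x))"
        unfolding F_def mkL2_diff[OF sqn sqn, symmetric] by (rule mkL2_eqI)
      then have "ennreal ((norm (F n - F m))\<^sup>2) = ennreal K * gagliardo \<sigma> (\<lambda>x. \<phi> n x - \<phi> m x)" using K(2)[OF td] by simp
      also have "\<dots> \<le> ennreal K * ennreal (2 * (1 / real (Suc n) + 1 / real (Suc m)))" by (intro mult_left_mono bd) simp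
      also have "\<dots> = ennreal ((2 * K) * (1 / real (Suc n) + 1 / real (Suc m)))" using K(1)
        by (subst ennreal_mult[symmetric]) (simp_all only: mult.assoc mult.left_commute[of K 2] less_imp_le, simp)
      finally have "ennreal ((norm (F n - F m))\<^sup>2) \<le> ennreal ((2 * K) * (1 / real (Suc n) + 1 / real (Suc m)))" .
      moreover have "0 \<le> (2 * K) * (1 / real (Suc n) + 1 / real (Suc m))" using K(1) by simp
      ultimately show ?thesis using ennreal_le_iff by blast
    qed
    then have "Cauchy F" by (rule Cauchy_norm_square)
    then obtain G where G: "F \<longlonglongrightarrow> G" using Cauchy_convergent convergent_def by blast
    have lim0: "(\<lambda>n. 1 / real (Suc n)) \<longlonglongrightarrow> 0" using LIMSEQ_inverse_real_of_nat by (simp add: inverse_eq_divide)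
    have G2: "(\<lambda>n. (norm (F n))\<^sup>2) \<longlonglongrightarrow> (norm G)\<^sup>2" using G by (intro tendsto_intros)
    have ba: "b n \<le> 2 * a + 2 * (1 / real (Suc n))" and ab: "a \<le> 2 * b n + 2 * (1 / real (Suc n))" for n
    proof -
      have pm: "ennreal (2 * x + 2 * (1 / real (Suc n))) = 2 * ennreal (1 / real (Suc n)) + 2 * ennreal x" if "0 \<le> x" for x
        unfolding add.commute[of "2 * x"] using that by (intro ennreal_twice_add[symmetric]) simp_all
      have "gagliardo \<sigma> (\<lambda>x. \<phi> n x - 0) \<le> 2 * gagliardo \<sigma> (\<lambda>x. \<phi> n x - u x) + 2 * gagliardo \<sigma> (\<lambda>x. u x - 0)"
        by (rule gagliardo_triangle) (use ms in auto)
      also have "\<dots> \<le> 2 * ennreal (1 / real (Suc n)) + 2 * gagliardo \<sigma> u"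
        using \<phi>(3)[of n] by (intro add_mono mult_left_mono) (auto simp: gagliardo_minus[of \<sigma> "\<phi> n" u])
      finally have "ennreal (b n) \<le> ennreal (2 * a + 2 * (1 / real (Suc n)))" unfolding pm[OF a(2)] using a b by simp
      then show "b n \<le> 2 * a + 2 * (1 / real (Suc n))" using a(2) ennreal_le_iff[of "2 * a + 2 * (1 / real (Suc n))" "b n"] by simp
      have "gagliardo \<sigma> (\<lambda>x. u x - 0) \<le> 2 * gagliardo \<sigma> (\<lambda>x. u x - \<phi> n x) + 2 * gagliardo \<sigma> (\<lambda>x. \<phi> n x - 0)"
        by (rule gagliardo_triangle) (use ms in auto)
      also have "\<dots> \<le> 2 * ennreal (1 / real (Suc n)) + 2 * gagliardo \<sigma> (\<phi> n)"
        using \<phi>(3)[of n] by (intro add_mono mult_left_mono) auto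
      finally have "ennreal a \<le> ennreal (2 * b n + 2 * (1 / real (Suc n)))" unfolding pm[OF b(2)] using a b by simp
      then show "a \<le> 2 * b n + 2 * (1 / real (Suc n))" using b(2)[of n] ennreal_le_iff[of "2 * b n + 2 * (1 / real (Suc n))" a] by simp
    qed
    have "(norm G)\<^sup>2 \<le> K * (2 * a + 2 * 0)"
    proof (rule LIMSEQ_le[OF G2])
      show "(\<lambda>n. K * (2 * a + 2 * (1 / real (Suc n)))) \<longlonglongrightarrow> K * (2 * a + 2 * 0)" by (intro tendsto_intros lim0)
      show "\<exists>N. \<forall>n\<ge>N. (norm (F n))\<^sup>2 \<le> K * (2 * a + 2 * (1 / real (Suc n)))"
        unfolding Fb using ba K(1) by (auto intro!: mult_left_mono simp del: of_nat_Suc)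
    qed
    then have up: "(norm G)\<^sup>2 \<le> 2 * K * a" by simp
    have "K * a \<le> 2 * (norm G)\<^sup>2 + K * (2 * 0)"
    proof (rule LIMSEQ_le[OF tendsto_const])
      show "(\<lambda>n. 2 * (norm (F n))\<^sup>2 + K * (2 * (1 / real (Suc n)))) \<longlonglongrightarrow> 2 * (norm G)\<^sup>2 + K * (2 * 0)" by (intro tendsto_intros lim0 G2)
      show "\<exists>N. \<forall>n\<ge>N. K * a \<le> 2 * (norm (F n))\<^sup>2 + K * (2 * (1 / real (Suc n)))"
      proof (intro exI allI impI)
        fix n
        have "K * a \<le> K * (2 * b n + 2 * (1 / real (Suc n)))" using ab K(1) by (intro mult_left_mono) auto
        then show "K * a \<le> 2 * (norm (F n))\<^sup>2 + K * (2 * (1 / real (Suc n)))" unfolding Fb by (simp only: distrib_left mult.left_commute[of K])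
      qed
    qed
    then have lo: "K * a \<le> 2 * (norm G)\<^sup>2" by simp
    have Un: "(\<lambda>n. mkL2 (\<phi> n)) \<longlonglongrightarrow> mkL2 u"
    proof (rule tendsto_norm_square)
      fix n
      have "(norm (mkL2 (\<phi> n) - mkL2 u))\<^sup>2 = (norm (mkL2 u - mkL2 (\<phi> n)))\<^sup>2" by (simp add: norm_minus_commute)
      also have "\<dots> = (LINT x|lebesgue. (norm (u x - \<phi> n x))\<^sup>2)"
        unfolding mkL2_diff[OF Hs0_sq[OF u] test_fun_sq[OF \<phi>(1)], symmetric]
        by (rule norm_mkL2_square[OF sq_diff[OF Hs0_sq[OF u] test_fun_sq[OF \<phi>(1)]]])
      also have "\<dots> \<le> 1 * (1 / real (Suc n))" using \<phi>(2)[of n] by simp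
      finally show "(norm (mkL2 (\<phi> n) - mkL2 u))\<^sup>2 \<le> 1 * (1 / real (Suc n))" .
    qed
    have "weak_frac_grad \<sigma> u (fld G)"
      unfolding weak_frac_grad_def
    proof (intro ballI allI)
      fix \<theta> :: "real^'n \<Rightarrow> real" and j :: 'n assume \<theta>: "\<theta> \<in> test_fun UNIV"
      define P where "P x = riesz_const CARD('n) (1 - \<sigma>) * riesz_conv (1 - \<sigma>) (partial_deriv j \<theta>) x" for x
      have s: "0 < 1 - \<sigma>" "1 - \<sigma> < 1" using \<sigma> by auto
      obtain B where B: "\<And>x. \<bar>riesz_conv (1 - \<sigma>) (partial_deriv j \<theta>) x\<bar> \<le> B"
        using riesz_conv_test_bounded[OF s test_fun_partial_deriv[OF \<theta>], of j] by blast
      have [measurable]: "riesz_conv (1 - \<sigma>) (partial_deriv j \<theta>) \<in> borel_measurable lebesgue"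
        using test_fun_bounded_integrable(3)[OF test_fun_partial_deriv[OF \<theta>]]
        by (intro measurable_completion) simp
      have Pm [measurable]: "P \<in> borel_measurable lebesgue" unfolding P_def by measurable
      have PB: "\<bar>P x\<bar> \<le> \<bar>riesz_const CARD('n) (1 - \<sigma>)\<bar> * B" for x
        unfolding P_def abs_mult by (intro mult_left_mono B) simp
      note Psq = bounded_on_domain_sq[OF Pm PB]
      have lhs: "(LINT x|lebesgue. w x * P x) = mkL2 w \<bullet> mkL2 (\<lambda>x. indicator \<Omega> x * P x)" if w: "w \<in> Hs0 \<sigma> \<Omega>" for w
        unfolding inner_mkL2[OF Hs0_sq[OF w] Psq]
      proof (rule integral_cong_AE)
        show "AE x in lebesgue. w x * P x = w x \<bullet> (indicator \<Omega> x * P x)"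
          using Hs0_supported[OF w \<sigma> \<Omega>(1)] by eventually_elim (auto simp: indicator_def)
      qed (use Hs0_measurable[OF w] in measurable)
      have tsq: "sq (\<lambda>x. \<theta> x *\<^sub>R axis j (1::real))"
        using test_fun_sq[OF \<theta>] by (auto simp: sq_def)
      have rhs: "(LINT x|lebesgue. g x $ j * \<theta> x) = mkL2 g \<bullet> mkL2 (\<lambda>x. \<theta> x *\<^sub>R axis j (1::real))" if g: "sq g" for g
        unfolding inner_mkL2[OF g tsq] by (simp add: inner_axis mult.commute)
      have l1: "(\<lambda>n. mkL2 (\<phi> n) \<bullet> mkL2 (\<lambda>x. indicator \<Omega> x * P x)) \<longlonglongrightarrow> mkL2 u \<bullet> mkL2 (\<lambda>x. indicator \<Omega> x * P x)"
        by (intro tendsto_intros Un)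
      have l2: "(\<lambda>n. mkL2 (\<phi> n) \<bullet> mkL2 (\<lambda>x. indicator \<Omega> x * P x)) = (\<lambda>n. - (F n \<bullet> mkL2 (\<lambda>x. \<theta> x *\<^sub>R axis j (1::real))))"
      proof
        fix n
        show "mkL2 (\<phi> n) \<bullet> mkL2 (\<lambda>x. indicator \<Omega> x * P x) = - (F n \<bullet> mkL2 (\<lambda>x. \<theta> x *\<^sub>R axis j (1::real)))"
          using test_grad_weak[OF \<sigma> \<phi>(1)[of n], unfolded weak_frac_grad_def, rule_format, OF \<theta>, of j, folded P_def]
          unfolding lhs[OF test_fun_Hs0[OF \<phi>(1) \<sigma>]] rhs[OF sqn] F_def .
      qed
      have l3: "(\<lambda>n. - (F n \<bullet> mkL2 (\<lambda>x. \<theta> x *\<^sub>R axis j (1::real)))) \<longlonglongrightarrow> - (G \<bullet> mkL2 (\<lambda>x. \<theta> x *\<^sub>R axis j (1::real)))"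
        by (intro tendsto_intros G)
      have "mkL2 u \<bullet> mkL2 (\<lambda>x. indicator \<Omega> x * P x) = - (G \<bullet> mkL2 (\<lambda>x. \<theta> x *\<^sub>R axis j (1::real)))"
        by (rule LIMSEQ_unique[OF l1[unfolded l2] l3])
      then show "(LINT x|lebesgue. u x * (riesz_const CARD('n) (1 - \<sigma>) * riesz_conv (1 - \<sigma>) (partial_deriv j \<theta>) x)) = - (LINT x|lebesgue. fld G x $ j * \<theta> x)"
        unfolding P_def[symmetric] lhs[OF u] rhs[OF fld_sq] mkL2_fld .
    qed
    then show ?thesis using up lo by (intro exI[of _ "fld G"]) (simp add: a_def)
  qed
  show ?thesis
  proof (rule that[of "max (2 * K) (2 / K)"])
    show "0 < max (2 * K) (2 / K)" using K(1) by simp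
    fix u assume u: "u \<in> Hs0 \<sigma> \<Omega>"
    obtain g where g: "sq g" "weak_frac_grad \<sigma> u g" "(norm (mkL2 g))\<^sup>2 \<le> 2 * K * enn2real (gagliardo \<sigma> u)" "K * enn2real (gagliardo \<sigma> u) \<le> 2 * (norm (mkL2 g))\<^sup>2"
      using main[OF u] by blast
    have m1: "2 * K * enn2real (gagliardo \<sigma> u) \<le> max (2 * K) (2 / K) * enn2real (gagliardo \<sigma> u)" by (intro mult_right_mono) auto
    have m2: "enn2real (gagliardo \<sigma> u) \<le> (2 / K) * (norm (mkL2 g))\<^sup>2" using g(4) K(1) by (simp add: pos_le_divide_eq mult.commute)
    have m3: "(2 / K) * (norm (mkL2 g))\<^sup>2 \<le> max (2 * K) (2 / K) * (norm (mkL2 g))\<^sup>2" by (intro mult_right_mono) auto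
    have "(norm (mkL2 g))\<^sup>2 \<le> max (2 * K) (2 / K) * enn2real (gagliardo \<sigma> u)"
      "enn2real (gagliardo \<sigma> u) \<le> max (2 * K) (2 / K) * (norm (mkL2 g))\<^sup>2" by (rule order_trans[OF g(3) m1] order_trans[OF m2 m3])+
    then show "\<exists>g. sq g \<and> weak_frac_grad \<sigma> u g \<and>
       (norm (mkL2 g))\<^sup>2 \<le> max (2 * K) (2 / K) * enn2real (gagliardo \<sigma> u) \<and> enn2real (gagliardo \<sigma> u) \<le> max (2 * K) (2 / K) * (norm (mkL2 g))\<^sup>2"
      using g(1,2) by blast
  qed
qed

end

section \<open>The Hilbert space of fractional gradients\<close>

context fractional_domain
begin

definition grad :: "(real^'n \<Rightarrow> real) \<Rightarrow> (real^'n, real^'n) L2" where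
  "grad u = mkL2 (frac_grad \<sigma> u)"

text \<open>The choice in \<open>frac_grad\<close> is made among the distributional gradients, all of which
  agree almost everywhere.\<close>

lemma frac_grad_AE:
  assumes u: "u \<in> Hs0 \<sigma> \<Omega>" and g: "sq g" "weak_frac_grad \<sigma> u g"
  shows "sq (frac_grad \<sigma> u)" "weak_frac_grad \<sigma> u (frac_grad \<sigma> u)" "AE x in lebesgue. frac_grad \<sigma> u x = g x"
proof -
  note iff = has_distr_gradient_iff[OF \<sigma> Hs0_integrable[OF u]]
  have "has_distr_gradient (riesz_potential (1 - \<sigma>) u) g" unfolding iff using sq_locally_integrable[OF g(1)] g(2) by blast
  then have "has_distr_gradient (riesz_potential (1 - \<sigma>) u) (frac_grad \<sigma> u)" unfolding frac_grad_def
    by (rule someI[where P="has_distr_gradient (riesz_potential (1 - \<sigma>) u)"])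
  then have l: "locally_integrable (frac_grad \<sigma> u)" and w: "weak_frac_grad \<sigma> u (frac_grad \<sigma> u)" unfolding iff by blast+
  show "weak_frac_grad \<sigma> u (frac_grad \<sigma> u)" by (rule w)
  show ae: "AE x in lebesgue. frac_grad \<sigma> u x = g x"
    by (rule weak_frac_grad_unique[OF l w sq_locally_integrable[OF g(1)] g(2)])
  show "sq (frac_grad \<sigma> u)"
    by (rule sq_cong[OF g(1)]) (use ae locally_integrable_measurable[OF l] in \<open>auto elim: eventually_mono\<close>)
qed

lemma
  assumes "u \<in> Hs0 \<sigma> \<Omega>"
  shows frac_grad_sq: "sq (frac_grad \<sigma> u)"
  and frac_grad_weak: "weak_frac_grad \<sigma> u (frac_grad \<sigma> u)"
proof -
  obtain g where "sq g" "weak_frac_grad \<sigma> u g" using frac_grad_construct assms by metis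
  from frac_grad_AE[OF assms this] show "sq (frac_grad \<sigma> u)" "weak_frac_grad \<sigma> u (frac_grad \<sigma> u)" by blast+
qed

lemma grad_norm_equiv:
  "\<exists>C>0. \<forall>u\<in>Hs0 \<sigma> \<Omega>. (norm (grad u))\<^sup>2 \<le> C * enn2real (gagliardo \<sigma> u) \<and> enn2real (gagliardo \<sigma> u) \<le> C * (norm (grad u))\<^sup>2"
proof -
  obtain C where C: "0 < C"
    "\<And>u. u \<in> Hs0 \<sigma> \<Omega> \<Longrightarrow> \<exists>g. sq g \<and> weak_frac_grad \<sigma> u g \<and>
       (norm (mkL2 g))\<^sup>2 \<le> C * enn2real (gagliardo \<sigma> u) \<and> enn2real (gagliardo \<sigma> u) \<le> C * (norm (mkL2 g))\<^sup>2"
    using frac_grad_construct by blast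
  have "(norm (grad u))\<^sup>2 \<le> C * enn2real (gagliardo \<sigma> u) \<and> enn2real (gagliardo \<sigma> u) \<le> C * (norm (grad u))\<^sup>2"
    if u: "u \<in> Hs0 \<sigma> \<Omega>" for u
  proof -
    obtain g where g: "sq g" "weak_frac_grad \<sigma> u g" "(norm (mkL2 g))\<^sup>2 \<le> C * enn2real (gagliardo \<sigma> u) \<and> enn2real (gagliardo \<sigma> u) \<le> C * (norm (mkL2 g))\<^sup>2"
      using C(2)[OF u] by blast
    have "grad u = mkL2 g" unfolding grad_def by (rule mkL2_eqI[OF frac_grad_AE(3)[OF u g(1,2)]])
    then show ?thesis using g(3) by simp
  qed
  then show ?thesis using C(1) by blast
qed

lemma Hs0_lincomb:
  assumes u: "u \<in> Hs0 \<sigma> \<Omega>" and v: "v \<in> Hs0 \<sigma> \<Omega>"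
  shows "(\<lambda>x. a * u x + b * v x) \<in> Hs0 \<sigma> \<Omega>"
  by (rule Hs0_add[OF Hs0_cmult[OF u \<sigma>] Hs0_cmult[OF v \<sigma>] \<sigma>])

lemma frac_grad_lincomb:
  assumes u: "u \<in> Hs0 \<sigma> \<Omega>" and v: "v \<in> Hs0 \<sigma> \<Omega>"
  shows "AE x in lebesgue. frac_grad \<sigma> (\<lambda>x. a * u x + b * v x) x = a *\<^sub>R frac_grad \<sigma> u x + b *\<^sub>R frac_grad \<sigma> v x"
  by (intro frac_grad_AE(3)[OF Hs0_lincomb[OF u v]] sq_add sq_scaleR frac_grad_sq u v
        weak_frac_grad_lincomb[OF \<sigma> Hs0_integrable Hs0_integrable sq_locally_integrable _ sq_locally_integrable] frac_grad_weak)

lemma grad_lincomb: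
  assumes u: "u \<in> Hs0 \<sigma> \<Omega>" and v: "v \<in> Hs0 \<sigma> \<Omega>"
  shows "grad (\<lambda>x. a * u x + b * v x) = a *\<^sub>R grad u + b *\<^sub>R grad v"
proof -
  note su = frac_grad_sq[OF u] and sv = frac_grad_sq[OF v]
  have "grad (\<lambda>x. a * u x + b * v x) = mkL2 (\<lambda>x. a *\<^sub>R frac_grad \<sigma> u x + b *\<^sub>R frac_grad \<sigma> v x)"
    unfolding grad_def by (rule mkL2_eqI[OF frac_grad_lincomb[OF u v]])
  also have "\<dots> = a *\<^sub>R grad u + b *\<^sub>R grad v"
    unfolding grad_def mkL2_add[OF sq_scaleR[OF su] sq_scaleR[OF sv]] mkL2_scaleR[OF su] mkL2_scaleR[OF sv] ..
  finally show ?thesis .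
qed

lemma grad_diff: "u \<in> Hs0 \<sigma> \<Omega> \<Longrightarrow> v \<in> Hs0 \<sigma> \<Omega> \<Longrightarrow> grad (\<lambda>x. u x - v x) = grad u - grad v"
  using grad_lincomb[of u v 1 "-1"] by simp

lemma grad_add: "u \<in> Hs0 \<sigma> \<Omega> \<Longrightarrow> v \<in> Hs0 \<sigma> \<Omega> \<Longrightarrow> grad (\<lambda>x. u x + v x) = grad u + grad v"
  using grad_lincomb[of u v 1 1] by simp

lemma grad_cmult: "u \<in> Hs0 \<sigma> \<Omega> \<Longrightarrow> grad (\<lambda>x. a * u x) = a *\<^sub>R grad u"
  using grad_lincomb[of u u a 0] by simp

lemma grad_zero: "grad (\<lambda>_. 0) = 0"
  using grad_cmult[OF Hs0_zero[OF \<sigma>], of 0] by simp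

lemma grad_fld: "u \<in> Hs0 \<sigma> \<Omega> \<Longrightarrow> AE x in lebesgue. fld (grad u) x = frac_grad \<sigma> u x"
  unfolding grad_def by (rule fld_mkL2[OF frac_grad_sq])

lemma Hs0_norm_grad: assumes u: "u \<in> Hs0 \<sigma> \<Omega>" shows "Hs0_norm \<sigma> u = norm (grad u)"
proof -
  have "(norm (grad u))\<^sup>2 = (LINT x|lebesgue. (norm (frac_grad \<sigma> u x))\<^sup>2)"
    unfolding grad_def by (rule norm_mkL2_square[OF frac_grad_sq[OF u]])
  then show ?thesis unfolding Hs0_norm_def Lp2_norm by (metis norm_ge_zero real_sqrt_unique)
qed

lemma Hs0_gagliardo_Poincare:
  "\<exists>C>0. \<forall>u. u \<in> borel_measurable lebesgue \<longrightarrow> (AE x in lebesgue. x \<notin> \<Omega> \<longrightarrow> u x = 0) \<longrightarrow>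
    (\<integral>\<^sup>+x. ennreal ((u x)\<^sup>2) \<partial>lebesgue) \<le> ennreal C * gagliardo \<sigma> u"
  using gagliardo_Poincare[OF \<Omega>(2) \<sigma>(1)] by blast

lemma square_integral_zero_AE:
  assumes u: "u \<in> borel_measurable lebesgue" and 0: "(\<integral>\<^sup>+x. ennreal ((u x)\<^sup>2) \<partial>lebesgue) \<le> 0"
  shows "AE x in lebesgue. u x = (0::real)"
proof -
  have "(\<integral>\<^sup>+x. ennreal ((u x)\<^sup>2) \<partial>lebesgue) = 0" using 0 by simp
  then have "AE x in lebesgue. ennreal ((u x)\<^sup>2) = 0" using u by (subst (asm) nn_integral_0_iff_AE) auto
  then show ?thesis by eventually_elim (simp add: ennreal_eq_0_iff)
qed

lemma grad_eq_0: assumes u: "u \<in> Hs0 \<sigma> \<Omega>" and 0: "grad u = 0" shows "AE x in lebesgue. u x = 0"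
proof -
  obtain C where C: "0 < C" "\<And>u. u \<in> borel_measurable lebesgue \<Longrightarrow> (AE x in lebesgue. x \<notin> \<Omega> \<longrightarrow> u x = 0) \<Longrightarrow>
    (\<integral>\<^sup>+x. ennreal ((u x)\<^sup>2) \<partial>lebesgue) \<le> ennreal C * gagliardo \<sigma> u"
    using Hs0_gagliardo_Poincare by blast
  have "enn2real (gagliardo \<sigma> u) \<le> 0" using grad_norm_equiv u 0 by force
  then have "gagliardo \<sigma> u = 0" using Hs_D(2)[OF Hs0_Hs[OF u]] enn2real_nonneg[of "gagliardo \<sigma> u"]
    by (auto simp: enn2real_eq_0_iff antisym_conv)
  then show ?thesis
    using C(2)[OF Hs0_measurable[OF u] Hs0_supported[OF u \<sigma> \<Omega>(1)]]
    by (intro square_integral_zero_AE[OF Hs0_measurable[OF u]]) simp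
qed

lemma grad_eq_iff:
  assumes u: "u \<in> Hs0 \<sigma> \<Omega>" and v: "v \<in> Hs0 \<sigma> \<Omega>" and eq: "grad u = grad v"
  shows "AE x in lebesgue. u x = v x"
proof -
  have "AE x in lebesgue. u x - v x = 0"
    by (rule grad_eq_0[OF Hs0_diff[OF u v \<sigma>]]) (simp add: grad_diff[OF u v] eq)
  then show ?thesis by eventually_elim simp
qed

text \<open>The Poincare inequality turns a Cauchy sequence for the Gagliardo seminorm into one in
  \<open>L\<^sup>2\<close>, of which a subsequence converges almost everywhere. By Fatou's lemma for
  the seminorm the limit is attained in the seminorm, and so lies in the closure of the test
  functions.\<close>

lemma Hs0_complete:
  fixes u :: "nat \<Rightarrow> real^'n \<Rightarrow> real"
  assumes u: "\<And>n. u n \<in> Hs0 \<sigma> \<Omega>"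
    and C: "\<And>e. 0 < e \<Longrightarrow> \<exists>N. \<forall>m\<ge>N. \<forall>n\<ge>N. gagliardo \<sigma> (\<lambda>x. u m x - u n x) \<le> ennreal e"
  shows "\<exists>v\<in>Hs0 \<sigma> \<Omega>. \<forall>e>0. \<exists>N. \<forall>n\<ge>N. gagliardo \<sigma> (\<lambda>x. u n x - v x) \<le> ennreal e"
proof -
  obtain P where P: "0 < P" "\<And>u. u \<in> borel_measurable lebesgue \<Longrightarrow> (AE x in lebesgue. x \<notin> \<Omega> \<longrightarrow> u x = 0) \<Longrightarrow>
    (\<integral>\<^sup>+x. ennreal ((u x)\<^sup>2) \<partial>lebesgue) \<le> ennreal P * gagliardo \<sigma> u"
    using Hs0_gagliardo_Poincare by blast
  note m = Hs0_measurable[OF u] and s = Hs0_sq[OF u]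
  have Pr: "(LINT x|lebesgue. (w x)\<^sup>2) \<le> P * e"
    if w: "w \<in> borel_measurable lebesgue" "AE x in lebesgue. x \<notin> \<Omega> \<longrightarrow> w x = 0" "gagliardo \<sigma> w \<le> ennreal e" "0 \<le> e" "sq w" for w e
  proof -
    have "ennreal (LINT x|lebesgue. (w x)\<^sup>2) = (\<integral>\<^sup>+x. ennreal ((w x)\<^sup>2) \<partial>lebesgue)"
      using sq_integrable[OF w(5)] by (intro nn_integral_eq_integral[symmetric]) auto
    also have "\<dots> \<le> ennreal P * gagliardo \<sigma> w" by (rule P(2)[OF w(1,2)])
    also have "\<dots> \<le> ennreal P * ennreal e" by (rule mult_left_mono[OF w(3)]) simp
    also have "\<dots> = ennreal (P * e)" using P(1) w(4) by (simp add: ennreal_mult)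
    finally show ?thesis using P(1) w(4) by (simp add: ennreal_le_iff)
  qed
  have "Cauchy (\<lambda>n. mkL2 (u n))"
  proof (rule metric_CauchyI)
    fix e :: real assume e: "0 < e"
    define d where "d = e\<^sup>2 / (2 * P)"
    have d: "0 < d" using e P(1) by (simp add: d_def)
    obtain N where N: "\<And>m n. N \<le> m \<Longrightarrow> N \<le> n \<Longrightarrow> gagliardo \<sigma> (\<lambda>x. u m x - u n x) \<le> ennreal d" using C[OF d] by blast
    have "dist (mkL2 (u i)) (mkL2 (u n)) < e" if "N \<le> i" "N \<le> n" for i n
    proof -
      note D = Hs0_diff[OF u u \<sigma>, of i n]
      have "(norm (mkL2 (u i) - mkL2 (u n)))\<^sup>2 = (LINT x|lebesgue. (norm (u i x - u n x))\<^sup>2)"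
        unfolding mkL2_diff[OF s s, symmetric] by (rule norm_mkL2_square[OF sq_diff[OF s s]])
      also have "\<dots> = (LINT x|lebesgue. (u i x - u n x)\<^sup>2)" by simp
      also have "\<dots> \<le> P * d"
        using N[OF that] d by (intro Pr[OF Hs0_measurable[OF D] Hs0_supported[OF D \<sigma> \<Omega>(1)] _ _ Hs0_sq[OF D]]) auto
      also have "\<dots> = e\<^sup>2 / 2" using P(1) by (simp add: d_def)
      also have "\<dots> < e\<^sup>2" using e by simp
      finally show ?thesis unfolding dist_norm by (rule power2_less_imp_less) (use e in simp)
    qed
    then show "\<exists>M. \<forall>m\<ge>M. \<forall>n\<ge>M. dist (mkL2 (u m)) (mkL2 (u n)) < e" by blast
  qed
  then obtain r v where r: "strict_mono (r :: nat \<Rightarrow> nat)" and v [measurable]: "v \<in> borel_measurable lebesgue"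
    and lim0: "AE x in lebesgue. (\<lambda>k. fld (mkL2 (u (r k))) x) \<longlonglongrightarrow> v x"
    using L2_AE_subseq by blast
  have "AE x in lebesgue. \<forall>k. fld (mkL2 (u (r k))) x = u (r k) x"
    unfolding AE_all_countable using fld_mkL2[OF s] by blast
  with lim0 have lim: "AE x in lebesgue. (\<lambda>k. u (r k) x) \<longlonglongrightarrow> v x"
    by eventually_elim simp
  have conv: "\<exists>N. \<forall>n\<ge>N. gagliardo \<sigma> (\<lambda>x. u n x - v x) \<le> ennreal e" if e: "0 < e" for e
  proof -
    obtain N where N: "\<And>m n. N \<le> m \<Longrightarrow> N \<le> n \<Longrightarrow> gagliardo \<sigma> (\<lambda>x. u m x - u n x) \<le> ennreal e" using C[OF e] by blast
    have "gagliardo \<sigma> (\<lambda>x. u n x - v x) \<le> ennreal e" if n: "N \<le> n" for n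
    proof -
      have "gagliardo \<sigma> (\<lambda>x. u n x - v x) \<le> liminf (\<lambda>k. gagliardo \<sigma> (\<lambda>x. u n x - u (r k) x))"
      proof (rule gagliardo_Fatou)
        show "AE x in lebesgue. (\<lambda>k. u n x - u (r k) x) \<longlonglongrightarrow> u n x - v x"
          using lim by eventually_elim (intro tendsto_intros)
      qed (use m v in auto)
      also have "\<dots> \<le> ennreal e"
      proof (rule Liminf_le)
        show "\<forall>\<^sub>F k in sequentially. gagliardo \<sigma> (\<lambda>x. u n x - u (r k) x) \<le> ennreal e"
          using N[OF n] seq_suble[OF r] by (intro eventually_sequentiallyI[of N]) (meson order_trans)
      qed simp
      finally show ?thesis .
    qed
    then show ?thesis by blast
  qed
  have "AE x in lebesgue. \<forall>k. x \<notin> \<Omega> \<longrightarrow> u (r k) x = 0"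
    unfolding AE_all_countable using Hs0_supported[OF u \<sigma> \<Omega>(1)] by blast
  with lim have v0: "AE x in lebesgue. x \<notin> \<Omega> \<longrightarrow> v x = 0"
  proof eventually_elim
    fix x assume l: "(\<lambda>k. u (r k) x) \<longlonglongrightarrow> v x" and z: "\<forall>k. x \<notin> \<Omega> \<longrightarrow> u (r k) x = 0"
    show "x \<notin> \<Omega> \<longrightarrow> v x = 0"
    proof
      assume "x \<notin> \<Omega>"
      then have "(\<lambda>k. 0) \<longlonglongrightarrow> v x" using l z by simp
      then show "v x = 0" by (rule LIMSEQ_unique[OF _ tendsto_const])
    qed
  qed
  have d0: "AE x in lebesgue. x \<notin> \<Omega> \<longrightarrow> u n x - v x = 0" for n
    using Hs0_supported[OF u[of n] \<sigma> \<Omega>(1)] v0 by eventually_elim simp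
  have dm: "(\<lambda>x. u n x - v x) \<in> borel_measurable lebesgue" for n using m[of n] by measurable
  have dsq: "sq (\<lambda>x. u n x - v x)" if fin: "gagliardo \<sigma> (\<lambda>x. u n x - v x) \<le> ennreal e" for n e
  proof -
    have "(\<integral>\<^sup>+x. ennreal ((u n x - v x)\<^sup>2) \<partial>lebesgue) \<le> ennreal P * gagliardo \<sigma> (\<lambda>x. u n x - v x)" by (rule P(2)[OF dm d0])
    also have "\<dots> \<le> ennreal P * ennreal e" by (rule mult_left_mono[OF fin]) simp
    also have "\<dots> < \<infinity>" by (simp add: ennreal_mult_less_top)
    finally show ?thesis unfolding sq_def using dm[of n] by (auto intro!: integrableI_nonneg)
  qed
  obtain n0 where n0: "gagliardo \<sigma> (\<lambda>x. u n0 x - v x) \<le> ennreal 1" using conv[of 1] by auto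
  have vsq: "sq v" using sq_diff[OF s[of n0] dsq[OF n0]] by simp
  have "gagliardo \<sigma> (\<lambda>x. v x - 0) \<le> 2 * gagliardo \<sigma> (\<lambda>x. v x - u n0 x) + 2 * gagliardo \<sigma> (\<lambda>x. u n0 x - 0)"
    by (rule gagliardo_triangle) (use m in auto)
  also have "\<dots> < \<infinity>"
    using n0 Hs_D(2)[OF Hs0_Hs[OF u[of n0]]] unfolding gagliardo_minus[of \<sigma> v "u n0"]
    by (auto simp: ennreal_mult_less_top intro: le_less_trans)
  finally have vH: "v \<in> Hs \<sigma>" using vsq by (intro Hs_I) simp_all
  have "v \<in> Hs0 \<sigma> \<Omega>"
  proof (rule Hs0_I[OF vH])
    fix e :: real assume e: "0 < e"
    \<comment> \<open>The approximation of v by some u n and that of u n by a test function may each cost e / 8;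
      the quasi-triangle inequality doubles both.\<close>
    define d where "d = min (e / (8 * P)) (e / 8)"
    have d: "0 < d" "P * d \<le> e / 8" "d \<le> e / 8"
    proof -
      show "0 < d" using e P(1) by (simp add: d_def)
      have "P * d \<le> P * (e / (8 * P))" using P(1) by (intro mult_left_mono) (auto simp: d_def)
      then show "P * d \<le> e / 8" using P(1) by simp
    qed (simp add: d_def)
    obtain n where n: "gagliardo \<sigma> (\<lambda>x. u n x - v x) \<le> ennreal d" using conv[OF d(1)] by auto
    have e8: "0 < e / 8" using e by simp
    obtain \<phi> where \<phi>: "\<phi> \<in> test_fun \<Omega>" "(LINT x|lebesgue. (u n x - \<phi> x)\<^sup>2) < e / 8" "gagliardo \<sigma> (\<lambda>x. u n x - \<phi> x) < ennreal (e / 8)"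
      using Hs0_approx[OF u[of n] \<sigma> e8] by blast
    note sp = test_fun_sq[OF \<phi>(1)]
    have "(LINT x|lebesgue. (v x - \<phi> x)\<^sup>2) = (LINT x|lebesgue. ((v x - u n x) + (u n x - \<phi> x))\<^sup>2)" by simp
    also have "\<dots> \<le> 2 * (LINT x|lebesgue. (v x - u n x)\<^sup>2) + 2 * (LINT x|lebesgue. (u n x - \<phi> x)\<^sup>2)"
      by (rule integral_square_add[OF sq_diff[OF vsq s] sq_diff[OF s sp]])
    also have "(LINT x|lebesgue. (v x - u n x)\<^sup>2) = (LINT x|lebesgue. (u n x - v x)\<^sup>2)" by (simp add: power2_commute)
    also have "\<dots> \<le> P * d" using d(1) by (intro Pr[OF dm d0 n _ dsq[OF n]]) simp
    finally have 1: "(LINT x|lebesgue. (v x - \<phi> x)\<^sup>2) < e" using d \<phi>(2) e by linarith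
    have "gagliardo \<sigma> (\<lambda>x. v x - \<phi> x) \<le> 2 * gagliardo \<sigma> (\<lambda>x. v x - u n x) + 2 * gagliardo \<sigma> (\<lambda>x. u n x - \<phi> x)"
      by (rule gagliardo_triangle) (use m v sq_measurable[OF sp] in auto)
    also have "\<dots> \<le> 2 * ennreal (e / 8) + 2 * ennreal (e / 8)"
      using n \<phi>(3) order_trans[OF n ennreal_leI[OF d(3)]] unfolding gagliardo_minus[of \<sigma> v "u n"]
      by (intro add_mono mult_left_mono) auto
    also have "\<dots> = ennreal (2 * (e / 8) + 2 * (e / 8))" using e by (intro ennreal_twice_add) auto
    also have "\<dots> < ennreal e" using e by (intro ennreal_lessI) auto
    finally show "\<exists>\<phi>\<in>test_fun \<Omega>. (LINT x|lebesgue. (v x - \<phi> x)\<^sup>2) < e \<and> gagliardo \<sigma> (\<lambda>x. v x - \<phi> x) < ennreal e"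
      using 1 \<phi>(1) by blast
  qed
  then show ?thesis using conv by blast
qed

text \<open>Gradients that converge in \<open>L\<^sup>2\<close> come from functions that are Cauchy for the
  equivalent Gagliardo seminorm.\<close>

lemma grad_closed: "closed (grad ` Hs0 \<sigma> \<Omega>)"
  unfolding closed_sequential_limits
proof (intro allI impI, elim conjE)
  fix X F assume X: "\<forall>n. X n \<in> grad ` Hs0 \<sigma> \<Omega>" and F: "X \<longlonglongrightarrow> F"
  have "\<forall>n. \<exists>w. w \<in> Hs0 \<sigma> \<Omega> \<and> X n = grad w" using X by blast
  from choice[OF this] obtain u where u: "\<And>n. u n \<in> Hs0 \<sigma> \<Omega>" "\<And>n. X n = grad (u n)" by blast
  obtain C where C: "0 < C" "\<And>w. w \<in> Hs0 \<sigma> \<Omega> \<Longrightarrow> (norm (grad w))\<^sup>2 \<le> C * enn2real (gagliardo \<sigma> w)"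
    "\<And>w. w \<in> Hs0 \<sigma> \<Omega> \<Longrightarrow> enn2real (gagliardo \<sigma> w) \<le> C * (norm (grad w))\<^sup>2" using grad_norm_equiv by blast
  have "\<exists>N. \<forall>m\<ge>N. \<forall>n\<ge>N. gagliardo \<sigma> (\<lambda>x. u m x - u n x) \<le> ennreal e" if e: "0 < e" for e
  proof -
    have "0 < sqrt (e / C)" using e C(1) by simp
    then obtain N where N: "\<And>m n. N \<le> m \<Longrightarrow> N \<le> n \<Longrightarrow> norm (X m - X n) < sqrt (e / C)"
      using LIMSEQ_imp_Cauchy[OF F] unfolding Cauchy_iff by blast
    have "gagliardo \<sigma> (\<lambda>x. u m x - u n x) \<le> ennreal e" if "N \<le> m" "N \<le> n" for m n
    proof -
      note D = Hs0_diff[OF u(1) u(1) \<sigma>, of m n]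
      have "(norm (X m - X n))\<^sup>2 \<le> (sqrt (e / C))\<^sup>2" using N[OF that] by (intro power_mono) auto
      also have "\<dots> = e / C" using e C(1) by simp
      finally have "C * (norm (X m - X n))\<^sup>2 \<le> C * (e / C)" using C(1) by (intro mult_left_mono) auto
      then have "enn2real (gagliardo \<sigma> (\<lambda>x. u m x - u n x)) \<le> e"
        using C(3)[OF D] C(1) unfolding grad_diff[OF u(1) u(1)] u(2) by simp
      moreover have "gagliardo \<sigma> (\<lambda>x. u m x - u n x) < \<infinity>" by (rule Hs_D(2)[OF Hs0_Hs[OF D]])
      ultimately show ?thesis by (metis ennreal_enn2real ennreal_leI infinity_ennreal_def)
    qed
    then show ?thesis by blast
  qed
  from Hs0_complete[OF u(1) this] obtain v where v: "v \<in> Hs0 \<sigma> \<Omega>"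
    and conv: "\<And>e. 0 < e \<Longrightarrow> \<exists>N. \<forall>n\<ge>N. gagliardo \<sigma> (\<lambda>x. u n x - v x) \<le> ennreal e" by blast
  have "X \<longlonglongrightarrow> grad v"
  proof (rule metric_LIMSEQ_I)
    fix e :: real assume e: "0 < e"
    define d where "d = e\<^sup>2 / (2 * C)"
    have d: "0 < d" using e C(1) by (simp add: d_def)
    obtain N where N: "\<And>n. N \<le> n \<Longrightarrow> gagliardo \<sigma> (\<lambda>x. u n x - v x) \<le> ennreal d" using conv[OF d] by blast
    have "dist (X n) (grad v) < e" if n: "N \<le> n" for n
    proof -
      note D = Hs0_diff[OF u(1)[of n] v \<sigma>]
      have "enn2real (gagliardo \<sigma> (\<lambda>x. u n x - v x)) \<le> d" using N[OF n] d by (intro enn2real_leI) auto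
      then have "C * enn2real (gagliardo \<sigma> (\<lambda>x. u n x - v x)) \<le> C * d" using C(1) by simp
      also have "C * d = e\<^sup>2 / 2" using C(1) by (simp add: d_def)
      also have "\<dots> < e\<^sup>2" using e by simp
      finally have "(norm (X n - grad v))\<^sup>2 < e\<^sup>2"
        using C(2)[OF D] unfolding grad_diff[OF u(1) v] u(2) by linarith
      then show ?thesis unfolding dist_norm by (rule power2_less_imp_less) (use e in simp)
    qed
    then show "\<exists>N. \<forall>n\<ge>N. dist (X n) (grad v) < e" by blast
  qed
  then have "F = grad v" using F by (rule LIMSEQ_unique[rotated])
  then show "F \<in> grad ` Hs0 \<sigma> \<Omega>" using v by blast
qed

lemma grad_subspace: "subspace (grad ` Hs0 \<sigma> \<Omega>)"
proof (rule subspaceI)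
  show "0 \<in> grad ` Hs0 \<sigma> \<Omega>" using Hs0_zero[OF \<sigma>] grad_zero by (metis imageI)
  show "F + G \<in> grad ` Hs0 \<sigma> \<Omega>" if "F \<in> grad ` Hs0 \<sigma> \<Omega>" "G \<in> grad ` Hs0 \<sigma> \<Omega>" for F G
  proof -
    from that obtain u v where uv: "u \<in> Hs0 \<sigma> \<Omega>" "F = grad u" "v \<in> Hs0 \<sigma> \<Omega>" "G = grad v" by blast
    show ?thesis unfolding uv grad_add[OF uv(1,3), symmetric] by (rule imageI[OF Hs0_add[OF uv(1,3) \<sigma>]])
  qed
  show "c *\<^sub>R F \<in> grad ` Hs0 \<sigma> \<Omega>" if "F \<in> grad ` Hs0 \<sigma> \<Omega>" for c F
  proof -
    from that obtain u where u: "u \<in> Hs0 \<sigma> \<Omega>" "F = grad u" by blast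
    show ?thesis unfolding u grad_cmult[OF u(1), symmetric] by (rule imageI[OF Hs0_cmult[OF u(1) \<sigma>]])
  qed
qed

end

section \<open>The Hoelder inequality\<close>

text \<open>Young's inequality applied to the two functions divided by their norms.\<close>

lemma Holder_finite:
  fixes f v :: "'a \<Rightarrow> real"
  assumes pq: "1 < p" "1 < q" "1 / p + 1 / q = 1" and f: "f \<in> Lp (ereal p) M" and v: "v \<in> Lp (ereal q) M"
  shows "integrable M (\<lambda>x. f x * v x)" "\<bar>LINT x|M. f x * v x\<bar> \<le> Lp_norm (ereal p) M f * Lp_norm (ereal q) M v"
proof -
  have fm [measurable]: "f \<in> borel_measurable M" and fi: "integrable M (\<lambda>x. \<bar>f x\<bar> powr p)" using f by (auto simp: Lp_def)
  have vm [measurable]: "v \<in> borel_measurable M" and vi: "integrable M (\<lambda>x. \<bar>v x\<bar> powr q)" using v by (auto simp: Lp_def)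
  have young: "\<bar>a * b\<bar> \<le> \<bar>a\<bar> powr p / p + \<bar>b\<bar> powr q / q" for a b :: real
    using Youngs_inequality[OF pq, of "\<bar>a\<bar>" "\<bar>b\<bar>"] by (simp add: abs_mult)
  show int: "integrable M (\<lambda>x. f x * v x)"
  proof (rule Bochner_Integration.integrable_bound[where f="\<lambda>x. \<bar>f x\<bar> powr p / p + \<bar>v x\<bar> powr q / q"])
    show "integrable M (\<lambda>x. \<bar>f x\<bar> powr p / p + \<bar>v x\<bar> powr q / q)" using fi vi by simp
    show "AE x in M. norm (f x * v x) \<le> norm (\<bar>f x\<bar> powr p / p + \<bar>v x\<bar> powr q / q)"
    proof (rule AE_I2)
      fix x
      show "norm (f x * v x) \<le> norm (\<bar>f x\<bar> powr p / p + \<bar>v x\<bar> powr q / q)"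
        using young[of "f x" "v x"] unfolding real_norm_def by linarith
    qed
  qed measurable
  define a where "a = (LINT x|M. \<bar>f x\<bar> powr p)"
  define b where "b = (LINT x|M. \<bar>v x\<bar> powr q)"
  have nn: "0 \<le> a" "0 \<le> b" by (simp_all add: a_def b_def integral_nonneg_AE)
  have N: "Lp_norm (ereal p) M f = a powr (1 / p)" "Lp_norm (ereal q) M v = b powr (1 / q)"
    by (simp_all add: Lp_norm_def a_def b_def)
  show "\<bar>LINT x|M. f x * v x\<bar> \<le> Lp_norm (ereal p) M f * Lp_norm (ereal q) M v"
  proof (cases "a = 0 \<or> b = 0")
    case True
    then have "AE x in M. f x * v x = 0"
    proof
      assume "a = 0"
      then have "AE x in M. \<bar>f x\<bar> powr p = 0"
        using integral_nonneg_eq_0_iff_AE[OF fi] by (simp add: a_def)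
      then show ?thesis by eventually_elim simp
    next
      assume "b = 0"
      then have "AE x in M. \<bar>v x\<bar> powr q = 0"
        using integral_nonneg_eq_0_iff_AE[OF vi] by (simp add: b_def)
      then show ?thesis by eventually_elim simp
    qed
    then have "(LINT x|M. f x * v x) = 0" by (rule integral_eq_zero_AE)
    then show ?thesis unfolding N by simp
  next
    case False
    then have ab: "0 < a" "0 < b" using nn by auto
    define s t where "s = a powr (1 / p)" and "t = b powr (1 / q)"
    have st: "0 < s" "0 < t" using ab by (simp_all add: s_def t_def)
    have sp: "s powr p = a" "t powr q = b" using ab pq by (simp_all add: s_def t_def powr_powr)
    have "\<bar>f x * v x\<bar> \<le> s * t * (\<bar>f x\<bar> powr p / (a * p) + \<bar>v x\<bar> powr q / (b * q))" for x
    proof -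
      have "\<bar>f x * v x\<bar> = s * t * \<bar>(f x / s) * (v x / t)\<bar>" using st by (simp add: abs_mult)
      also have "\<dots> \<le> s * t * (\<bar>f x / s\<bar> powr p / p + \<bar>v x / t\<bar> powr q / q)"
        using st by (intro mult_left_mono young) simp
      also have "\<bar>f x / s\<bar> powr p = \<bar>f x\<bar> powr p / a" using st by (simp add: powr_divide sp)
      also have "\<bar>v x / t\<bar> powr q = \<bar>v x\<bar> powr q / b" using st by (simp add: powr_divide sp)
      finally show ?thesis by (simp add: mult.commute)
    qed
    moreover have rint: "integrable M (\<lambda>x. s * t * (\<bar>f x\<bar> powr p / (a * p) + \<bar>v x\<bar> powr q / (b * q)))" using fi vi by simp
    ultimately have "(LINT x|M. \<bar>f x * v x\<bar>) \<le> (LINT x|M. s * t * (\<bar>f x\<bar> powr p / (a * p) + \<bar>v x\<bar> powr q / (b * q)))"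
      using int by (intro integral_mono) auto
    also have "\<dots> = s * t * (a / (a * p) + b / (b * q))" using fi vi by (simp add: a_def b_def)
    also have "a / (a * p) + b / (b * q) = 1" using ab pq(3) by simp
    finally have "(LINT x|M. \<bar>f x * v x\<bar>) \<le> s * t" by simp
    then show ?thesis unfolding N s_def[symmetric] t_def[symmetric]
      using integral_abs_bound[of M "\<lambda>x. f x * v x"] by linarith
  qed
qed

lemma Holder_one_infinity:
  fixes f v :: "'a \<Rightarrow> real"
  assumes f: "f \<in> Lp 1 M" and v: "v \<in> Lp \<infinity> M"
  shows "integrable M (\<lambda>x. f x * v x)" "\<bar>LINT x|M. f x * v x\<bar> \<le> Lp_norm 1 M f * Lp_norm \<infinity> M v"
proof -
  have fm [measurable]: "f \<in> borel_measurable M" and fi: "integrable M (\<lambda>x. \<bar>f x\<bar>)" using f by (auto simp: Lp_def)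
  obtain C where [measurable]: "v \<in> borel_measurable M" and C: "AE x in M. \<bar>v x\<bar> \<le> C" using v by (auto simp: Lp_def)
  define s where "s = esssup M (\<lambda>x. ereal \<bar>v x\<bar>)"
  have sC: "s \<le> ereal C" unfolding s_def by (rule esssup_I) (use C in auto)
  have ae: "AE x in M. \<bar>v x\<bar> \<le> real_of_ereal s"
    using esssup_AE[of "\<lambda>x. ereal \<bar>v x\<bar>" M]
  proof eventually_elim
    fix x assume "ereal \<bar>v x\<bar> \<le> esssup M (\<lambda>x. ereal \<bar>v x\<bar>)"
    then show "\<bar>v x\<bar> \<le> real_of_ereal s" using sC unfolding s_def[symmetric] by (cases s) auto
  qed
  then have le: "AE x in M. \<bar>f x * v x\<bar> \<le> real_of_ereal s * \<bar>f x\<bar>"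
  proof eventually_elim
    fix x assume "\<bar>v x\<bar> \<le> real_of_ereal s"
    then have "\<bar>v x\<bar> * \<bar>f x\<bar> \<le> real_of_ereal s * \<bar>f x\<bar>" by (rule mult_right_mono) simp
    then show "\<bar>f x * v x\<bar> \<le> real_of_ereal s * \<bar>f x\<bar>" by (simp add: abs_mult mult.commute)
  qed
  show int: "integrable M (\<lambda>x. f x * v x)"
  proof (rule Bochner_Integration.integrable_bound[where f="\<lambda>x. real_of_ereal s * \<bar>f x\<bar>"])
    show "AE x in M. norm (f x * v x) \<le> norm (real_of_ereal s * \<bar>f x\<bar>)"
      using le by eventually_elim (metis abs_ge_self order_trans real_norm_def)
  qed (use fi in auto)
  have "\<bar>LINT x|M. f x * v x\<bar> \<le> (LINT x|M. \<bar>f x * v x\<bar>)" by (rule integral_abs_bound)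
  also have "\<dots> \<le> (LINT x|M. real_of_ereal s * \<bar>f x\<bar>)" using le fi int by (intro integral_mono_AE) auto
  also have "\<dots> = Lp_norm 1 M f * Lp_norm \<infinity> M v"
    using integral_nonneg_AE[of "\<lambda>x. \<bar>f x\<bar>" M] by (simp add: Lp_norm_def s_def)
  finally show "\<bar>LINT x|M. f x * v x\<bar> \<le> Lp_norm 1 M f * Lp_norm \<infinity> M v" .
qed

text \<open>In each of the three ranges of \<open>\<sigma>\<close> the exponents \<open>two_sharp\<close> and
  \<open>two_star\<close> are conjugate.\<close>

lemma Holder_sobolev:
  fixes f v :: "'a \<Rightarrow> real"
  assumes "0 < \<sigma>" "1 < q" and f: "f \<in> Lp (two_sharp N \<sigma> q) M" and v: "v \<in> Lp (two_star N \<sigma> q) M"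
  shows "integrable M (\<lambda>x. f x * v x) \<and> \<bar>LINT x|M. f x * v x\<bar> \<le> Lp_norm (two_sharp N \<sigma> q) M f * Lp_norm (two_star N \<sigma> q) M v"
proof -
  consider (sub) "\<sigma> < real N / 2" | (crit) "\<sigma> = real N / 2" | (super) "real N / 2 < \<sigma>" by linarith
  then show ?thesis
  proof cases
    case sub
    define p r where "p = 2 * real N / (real N + 2 * \<sigma>)" and "r = 2 * real N / (real N - 2 * \<sigma>)"
    have e: "two_sharp N \<sigma> q = ereal p" "two_star N \<sigma> q = ereal r" using sub by (simp_all add: two_sharp_def two_star_def p_def r_def)
    have N: "0 < real N" "2 * \<sigma> < real N" using sub assms(1) by linarith+
    have "1 < p" using N assms(1) by (simp add: p_def less_divide_eq)
    moreover have "1 < r" using N assms(1) by (simp add: r_def less_divide_eq)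
    moreover have "1 / p + 1 / r = 1" using N assms(1) unfolding p_def r_def by (simp add: add_divide_distrib[symmetric])
    ultimately show ?thesis using Holder_finite[of p r f M v] f v unfolding e by blast
  next
    case crit
    have e: "two_sharp N \<sigma> q = ereal (q / (q - 1))" "two_star N \<sigma> q = ereal q" using crit by (simp_all add: two_sharp_def two_star_def)
    have "1 < q / (q - 1)" using assms(2) by (simp add: less_divide_eq)
    moreover have "1 / (q / (q - 1)) + 1 / q = 1" using assms(2) by (simp add: add_divide_distrib[symmetric])
    ultimately show ?thesis using Holder_finite[of "q / (q - 1)" q f M v] f v assms(2) unfolding e by blast
  next
    case super
    then have e: "two_sharp N \<sigma> q = 1" "two_star N \<sigma> q = \<infinity>" by (simp_all add: two_sharp_def two_star_def)
    show ?thesis using Holder_one_infinity[of f M v] f v unfolding e by blast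
  qed
qed

section \<open>Variational inequalities on dilated convex sets\<close>

text \<open>Variational inequalities on the dilates of a fixed convex set. The functional \<open>L\<close> is
  given on a subspace \<open>S\<close> only, since the load of the problem is defined on the
  gradients of functions, not on all vector fields.\<close>

locale scaled_constraint =
  fixes S K :: "'h::{real_inner, complete_space} set" and L :: "'h \<Rightarrow> real" and T :: "'h \<Rightarrow> 'h" and a b C :: real
  assumes S: "subspace S" and K: "closed K" "convex K" "0 \<in> K" "K \<subseteq> S"
    and L_add: "\<And>u v. u \<in> S \<Longrightarrow> v \<in> S \<Longrightarrow> L (u + v) = L u + L v"
    and L_scale: "\<And>c u. u \<in> S \<Longrightarrow> L (c *\<^sub>R u) = c * L u"
    and L_bound: "\<And>u. u \<in> S \<Longrightarrow> \<bar>L u\<bar> \<le> C * norm u"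
    and T: "linear T" and T_coercive: "\<And>u. a * (norm u)\<^sup>2 \<le> T u \<bullet> u" and T_bound: "\<And>u. norm (T u) \<le> b * norm u"
    and a: "0 < a" and b: "0 < b" and C: "0 \<le> C"
begin

definition solves :: "real \<Rightarrow> 'h \<Rightarrow> bool" where
  "solves s u \<longleftrightarrow> u \<in> (*\<^sub>R) s ` K \<and> (\<forall>v\<in>(*\<^sub>R) s ` K. T u \<bullet> (v - u) \<ge> L (v - u))"

lemma scaled_K_subset: "(*\<^sub>R) s ` K \<subseteq> S"
  using K(4) S by (auto intro: subspace_scale)

lemma solution_exists: "\<exists>u. solves s u"
proof -
  obtain u where "u \<in> (*\<^sub>R) s ` K" "\<And>v. v \<in> (*\<^sub>R) s ` K \<Longrightarrow> T u \<bullet> (v - u) \<ge> L (v - u)"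
    using lions_stampacchia[OF closed_scaling[OF K(1), of s] convex_scaling[OF K(2), of s] _ scaled_K_subset S L_add L_scale L_bound T T_coercive T_bound a b] K(3)
    by blast
  then show ?thesis unfolding solves_def by blast
qed

lemma L_minus: "u \<in> S \<Longrightarrow> L (- u) = - L u"
  using L_scale[of u "-1"] by simp

text \<open>Test the inequality with 0.\<close>

lemma solution_norm:
  assumes "solves s u" shows "norm u \<le> C / a"
proof -
  have uS: "u \<in> S" using assms scaled_K_subset unfolding solves_def by blast
  have "0 \<in> (*\<^sub>R) s ` K" using K(3) by force
  then have "T u \<bullet> (0 - u) \<ge> L (0 - u)" using assms unfolding solves_def by blast
  then have "T u \<bullet> u \<le> L u" using L_minus[OF uS] by simp
  then have "a * (norm u)\<^sup>2 \<le> C * norm u" using T_coercive[of u] L_bound[OF uS] by linarith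
  then have "norm u * (a * norm u) \<le> norm u * C" by (simp add: power2_eq_square mult_ac)
  then have "a * norm u \<le> C \<or> norm u = 0" using mult_le_cancel_left_pos[of "norm u"] norm_ge_zero[of u] by fastforce
  then show ?thesis using a C by (auto simp: pos_le_divide_eq mult.commute)
qed

text \<open>Let \<open>\<mu> = s2 / s1\<close>. The point \<open>w = \<mu> *\<^sub>R u1\<close> lies in
  \<open>s2 K\<close> and solves the inequality there with \<open>\<mu> L\<close> in place of
  \<open>L\<close>. Adding this inequality, tested with \<open>u2\<close>, to the one for
  \<open>u2\<close>, tested with \<open>w\<close>, bounds \<open>norm (w - u2)\<close> by
  \<open>(\<mu> - 1) * (C / a)\<close>, and \<open>norm (w - u1)\<close> has the same bound by
  \<open>solution_norm\<close>.\<close>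

lemma solution_scale:
  assumes u1: "solves s1 u1" and u2: "solves s2 u2" and s: "0 < s1" "s1 \<le> s2"
  shows "norm (u1 - u2) \<le> 2 * (C / a) * ((s2 - s1) / s1)"
proof -
  define \<mu> where "\<mu> = s2 / s1"
  have \<mu>: "1 \<le> \<mu>" "\<mu> * s1 = s2" "\<mu> - 1 = (s2 - s1) / s1" using s by (auto simp: \<mu>_def diff_divide_distrib)
  define w where "w = \<mu> *\<^sub>R u1"
  obtain k1 where k1: "k1 \<in> K" "u1 = s1 *\<^sub>R k1" using u1 unfolding solves_def by blast
  obtain k2 where k2: "k2 \<in> K" "u2 = s2 *\<^sub>R k2" using u2 unfolding solves_def by blast
  have wK: "w \<in> (*\<^sub>R) s2 ` K" unfolding w_def k1(2) using k1(1) \<mu>(2) by auto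
  have u1S: "u1 \<in> S" and u2S: "u2 \<in> S" and wS: "w \<in> S" using u1 u2 wK scaled_K_subset unfolding solves_def by blast+
  have "T u1 \<bullet> (s1 *\<^sub>R k2 - u1) \<ge> L (s1 *\<^sub>R k2 - u1)" using u1 k2(1) unfolding solves_def by blast
  then have "\<mu> * \<mu> * (T u1 \<bullet> (s1 *\<^sub>R k2 - u1)) \<ge> \<mu> * \<mu> * L (s1 *\<^sub>R k2 - u1)"
    using \<mu>(1) by (intro mult_left_mono) auto
  moreover have d: "u2 - w = \<mu> *\<^sub>R (s1 *\<^sub>R k2 - u1)" unfolding k2(2) w_def \<mu>(2)[symmetric] by (simp add: scaleR_diff_right)
  moreover have "T w = \<mu> *\<^sub>R T u1" unfolding w_def by (rule linear_scale[OF T])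
  moreover have dS: "s1 *\<^sub>R k2 - u1 \<in> S" using k2(1) K(4) u1S S by (auto intro!: subspace_diff subspace_scale)
  ultimately have 1: "T w \<bullet> (u2 - w) \<ge> \<mu> * L (u2 - w)" by (simp add: L_scale mult.assoc)
  have 2: "T u2 \<bullet> (w - u2) \<ge> L (w - u2)" using u2 wK unfolding solves_def by blast
  have zS: "w - u2 \<in> S" using wS u2S S by (rule subspace_diff[rotated])
  have n: "u2 - w = - (w - u2)" by simp
  have "T (w - u2) \<bullet> (w - u2) = T w \<bullet> (w - u2) - T u2 \<bullet> (w - u2)" by (simp add: linear_diff[OF T] inner_diff_left)
  also have "\<dots> \<le> \<mu> * L (w - u2) - L (w - u2)"
    using 1 2 unfolding n L_minus[OF zS] inner_minus_right by linarith
  also have "\<dots> = (\<mu> - 1) * L (w - u2)" by (simp add: left_diff_distrib)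
  also have "\<dots> \<le> (\<mu> - 1) * (C * norm (w - u2))" using \<mu>(1) L_bound[OF zS] by (intro mult_left_mono) auto
  finally have "a * (norm (w - u2))\<^sup>2 \<le> (\<mu> - 1) * (C * norm (w - u2))" using T_coercive[of "w - u2"] by linarith
  then have "norm (w - u2) * (a * norm (w - u2)) \<le> norm (w - u2) * ((\<mu> - 1) * C)" by (simp add: power2_eq_square mult_ac)
  then have "a * norm (w - u2) \<le> (\<mu> - 1) * C \<or> norm (w - u2) = 0"
    using mult_le_cancel_left_pos[of "norm (w - u2)"] norm_ge_zero[of "w - u2"] by fastforce
  then have r2: "norm (w - u2) \<le> (\<mu> - 1) * (C / a)"
    using a C \<mu>(1) by (auto simp: pos_le_divide_eq mult.commute)
  \<comment> \<open>Together with r2 this gives the factor 2 of the smallness condition.\<close>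
  have r1: "norm (u1 - w) \<le> (\<mu> - 1) * (C / a)"
  proof -
    have "u1 - w = - ((\<mu> - 1) *\<^sub>R u1)" by (simp add: w_def scaleR_left_diff_distrib)
    then have "norm (u1 - w) = (\<mu> - 1) * norm u1" using \<mu>(1) by simp
    also have "\<dots> \<le> (\<mu> - 1) * (C / a)" using \<mu>(1) by (intro mult_left_mono solution_norm[OF u1]) auto
    finally show ?thesis .
  qed
  have "norm (u1 - u2) \<le> norm (u1 - w) + norm (w - u2)" using norm_triangle_ineq[of "u1 - w" "w - u2"] by simp
  from order_trans[OF this add_mono[OF r1 r2]] have "norm (u1 - u2) \<le> 2 * ((\<mu> - 1) * (C / a))" unfolding mult_2 .
  then show ?thesis unfolding \<mu>(3) by (simp add: mult_ac)
qed

lemma solution_unique: "solves s u \<Longrightarrow> solves s u' \<Longrightarrow> 0 < s \<Longrightarrow> u = u'"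
  using solution_scale[of s u s u'] by simp

lemma solution_Lipschitz:
  assumes u1: "solves s1 u1" and u2: "solves s2 u2" and s: "0 < m" "m \<le> s1" "m \<le> s2"
  shows "norm (u1 - u2) \<le> 2 * (C / a) / m * \<bar>s1 - s2\<bar>"
proof -
  have *: "norm (u1 - u2) \<le> 2 * (C / a) / m * \<bar>s1 - s2\<bar>"
    if "solves s1 u1" "solves s2 u2" "m \<le> s1" "s1 \<le> s2" for s1 s2 u1 u2
  proof -
    have "norm (u1 - u2) \<le> 2 * (C / a) * ((s2 - s1) / s1)" using that s(1) by (intro solution_scale) auto
    also have "\<dots> \<le> 2 * (C / a) * ((s2 - s1) / m)"
      using that s(1) a C by (intro mult_left_mono divide_left_mono) auto
    finally show ?thesis using that(4) by (simp add: mult_ac)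
  qed
  show ?thesis
  proof (cases "s1 \<le> s2")
    case True then show ?thesis using *[OF u1 u2] s by simp
  next
    case False
    then have "norm (u2 - u1) \<le> 2 * (C / a) / m * \<bar>s2 - s1\<bar>" using *[OF u2 u1] s by simp
    then show ?thesis by (simp add: norm_minus_commute abs_minus_commute)
  qed
qed

text \<open>Solutions correspond to the fixed points of \<open>s \<mapsto> g (sol s)\<close> on
  \<open>{m..M}\<close>, where \<open>sol s\<close> is the solution for the dilate \<open>s\<close>.
  The problem is thereby reduced to the contraction principle on a real interval.\<close>

theorem unique_quasi_solution:
  fixes g :: "'h \<Rightarrow> real"
  assumes g_bounds: "\<And>u. u \<in> S \<Longrightarrow> norm u \<le> C / a \<Longrightarrow> m \<le> g u \<and> g u \<le> M" and m: "0 < m"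
    and g_lipschitz: "\<And>u v. u \<in> S \<Longrightarrow> v \<in> S \<Longrightarrow> norm u \<le> C / a \<Longrightarrow> norm v \<le> C / a \<Longrightarrow> \<bar>g u - g v\<bar> \<le> c * norm (u - v)"
    and c: "0 \<le> c" and small: "2 * (C / a) / m * c < 1"
  shows "\<exists>!u. solves (g u) u"
proof -
  define sol where "sol s = (SOME u. solves s u)" for s
  have sol: "solves s (sol s)" for s unfolding sol_def by (rule someI_ex[OF solution_exists])
  have solS: "u \<in> S" if "solves s u" for s u using that scaled_K_subset unfolding solves_def by blast
  have Ca: "0 \<le> C / a" using C a by simp
  have "\<exists>!s\<in>{m..M}. g (sol s) = s"
  proof (rule Banach_fix[OF compact_imp_complete[OF compact_Icc], where c="2 * (C / a) / m * c"])
    show "{m..M} \<noteq> {}" using g_bounds[OF subspace_0[OF S]] Ca by auto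
    show "0 \<le> 2 * (C / a) / m * c" using C a m c by simp
    show "2 * (C / a) / m * c < 1" by (rule small)
    show "(\<lambda>s. g (sol s)) ` {m..M} \<subseteq> {m..M}" using g_bounds[OF solS[OF sol] solution_norm[OF sol]] by auto
    fix s t assume st: "s \<in> {m..M}" "t \<in> {m..M}"
    have "\<bar>g (sol s) - g (sol t)\<bar> \<le> c * norm (sol s - sol t)"
      by (intro g_lipschitz solS[OF sol] solution_norm[OF sol])
    also have "\<dots> \<le> c * (2 * (C / a) / m * \<bar>s - t\<bar>)"
      using st by (intro mult_left_mono c solution_Lipschitz[OF sol sol m]) auto
    finally show "dist (g (sol s)) (g (sol t)) \<le> 2 * (C / a) / m * c * dist s t" by (simp add: dist_real_def mult_ac)
  qed
  then obtain s where s: "s \<in> {m..M}" "g (sol s) = s" and uniq: "\<And>t. t \<in> {m..M} \<Longrightarrow> g (sol t) = t \<Longrightarrow> t = s" by blast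
  show ?thesis
  proof (rule ex1I[of _ "sol s"])
    show "solves (g (sol s)) (sol s)" using sol[of s] s(2) by simp
    fix u assume u: "solves (g u) u"
    have gu: "g u \<in> {m..M}" using g_bounds[OF solS[OF u] solution_norm[OF u]] by simp
    then have "u = sol (g u)" using m by (intro solution_unique[OF u sol]) simp
    then have "g u = s" by (intro uniq[OF gu]) simp
    then show "u = sol s" using \<open>u = sol (g u)\<close> by simp
  qed
qed

end

section \<open>The elliptic problem in the space of gradients\<close>

lemma matrix_vector_mult_measurable:
  fixes A :: "'a \<Rightarrow> real^'n^'m"
  assumes A: "A \<in> borel_measurable M" and g: "g \<in> borel_measurable M"
  shows "(\<lambda>x. A x *v g x) \<in> borel_measurable M"
proof -
  have "(\<lambda>x. (A x, g x)) \<in> borel_measurable M" using A g by (rule borel_measurable_Pair)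
  moreover have "(\<lambda>p::(real^'n^'m) \<times> (real^'n). fst p *v snd p) \<in> borel_measurable borel"
    by (intro borel_measurable_continuous_onI) (auto simp: matrix_vector_mult_def intro!: continuous_intros)
  ultimately show ?thesis by (auto dest: measurable_compose)
qed

text \<open>The part of the data that does not depend on the load: the operator, and the profile
  \<open>\<phi>\<close> of the constraint.\<close>

locale elliptic_problem = fractional_domain \<sigma> \<Omega> for \<sigma> :: real and \<Omega> :: "(real^'n) set" +
  fixes A :: "real^'n \<Rightarrow> real^'n^'n" and a b :: real and \<phi> :: "real^'n \<Rightarrow> real" and \<nu> :: real
  assumes a: "0 < a" and b: "0 < b" and A: "elliptic_matrix a b A" and \<nu>: "0 < \<nu>" and \<phi>: "\<phi> \<in> Linf_ge \<nu>"
begin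

definition apply_A :: "(real^'n, real^'n) L2 \<Rightarrow> (real^'n, real^'n) L2" where
  "apply_A F = mkL2 (\<lambda>x. A x *v fld F x)"

lemma A_measurable [measurable]: "A \<in> borel_measurable lebesgue"
  using A by (simp add: elliptic_matrix_def)

lemma A_AE: "AE x in lebesgue. \<forall>\<xi>. a * (norm \<xi>)\<^sup>2 \<le> (A x *v \<xi>) \<bullet> \<xi> \<and> norm (A x *v \<xi>) \<le> b * norm \<xi>"
proof -
  have "AE x in lebesgue. \<forall>\<xi> \<zeta>. a * (norm \<xi>)\<^sup>2 \<le> (A x *v \<xi>) \<bullet> \<xi> \<and> (A x *v \<xi>) \<bullet> \<zeta> \<le> b * norm \<xi> * norm \<zeta>"
    using A by (simp add: elliptic_matrix_def)
  then show ?thesis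
  proof eventually_elim
    fix x assume h: "\<forall>\<xi> \<zeta>. a * (norm \<xi>)\<^sup>2 \<le> (A x *v \<xi>) \<bullet> \<xi> \<and> (A x *v \<xi>) \<bullet> \<zeta> \<le> b * norm \<xi> * norm \<zeta>"
    have "norm (A x *v \<xi>) \<le> b * norm \<xi>" for \<xi>
    proof (cases "A x *v \<xi> = 0")
      case False
      have "norm (A x *v \<xi>) * norm (A x *v \<xi>) \<le> b * norm \<xi> * norm (A x *v \<xi>)"
        using h[rule_format, of \<xi> "A x *v \<xi>"] by (simp add: norm_eq_sqrt_inner)
      then show ?thesis using False by simp
    qed (use b in simp)
    then show "\<forall>\<xi>. a * (norm \<xi>)\<^sup>2 \<le> (A x *v \<xi>) \<bullet> \<xi> \<and> norm (A x *v \<xi>) \<le> b * norm \<xi>" using h by blast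
  qed
qed

lemma apply_A_sq: assumes g: "sq g" shows "sq (\<lambda>x. A x *v g x)"
  unfolding sq_def
proof
  have gm: "g \<in> borel_measurable lebesgue" by (rule sq_measurable[OF g])
  show m: "(\<lambda>x. A x *v g x) \<in> borel_measurable lebesgue" by (rule matrix_vector_mult_measurable[OF A_measurable gm])
  show "integrable lebesgue (\<lambda>x. (norm (A x *v g x))\<^sup>2)"
  proof (rule Bochner_Integration.integrable_bound[where f="\<lambda>x. b\<^sup>2 * (norm (g x))\<^sup>2"])
    show "integrable lebesgue (\<lambda>x. b\<^sup>2 * (norm (g x))\<^sup>2)" using sq_integrable[OF g] by simp
    show "(\<lambda>x. (norm (A x *v g x))\<^sup>2) \<in> borel_measurable lebesgue" using m by measurable
    show "AE x in lebesgue. norm ((norm (A x *v g x))\<^sup>2) \<le> norm (b\<^sup>2 * (norm (g x))\<^sup>2)"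
      using A_AE
    proof eventually_elim
      fix x assume "\<forall>\<xi>. a * (norm \<xi>)\<^sup>2 \<le> (A x *v \<xi>) \<bullet> \<xi> \<and> norm (A x *v \<xi>) \<le> b * norm \<xi>"
      then have "(norm (A x *v g x))\<^sup>2 \<le> (b * norm (g x))\<^sup>2" by (intro power_mono) auto
      then show "norm ((norm (A x *v g x))\<^sup>2) \<le> norm (b\<^sup>2 * (norm (g x))\<^sup>2)" by (simp add: power_mult_distrib)
    qed
  qed
qed

lemma apply_A_linear: "linear apply_A"
proof (rule linearI)
  fix F G :: "(real^'n, real^'n) L2" and c :: real
  have "apply_A (F + G) = mkL2 (\<lambda>x. A x *v fld F x + A x *v fld G x)" unfolding apply_A_def
    by (rule mkL2_eqI) (use fld_plus[of F G] in eventually_elim, simp add: matrix_vector_right_distrib)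
  then show "apply_A (F + G) = apply_A F + apply_A G" unfolding apply_A_def by (simp add: mkL2_add apply_A_sq)
  have "apply_A (c *\<^sub>R F) = mkL2 (\<lambda>x. c *\<^sub>R (A x *v fld F x))" unfolding apply_A_def
    by (rule mkL2_eqI) (use fld_scaleR[of c F] in eventually_elim, simp add: matrix_vector_mult_scaleR)
  then show "apply_A (c *\<^sub>R F) = c *\<^sub>R apply_A F" unfolding apply_A_def by (simp add: mkL2_scaleR apply_A_sq)
qed

lemma apply_A_coercive: "a * (norm F)\<^sup>2 \<le> apply_A F \<bullet> F"
proof -
  have "a * (norm F)\<^sup>2 = (LINT x|lebesgue. a * (norm (fld F x))\<^sup>2)" by (simp add: norm_L2_square)
  also have "\<dots> \<le> (LINT x|lebesgue. (A x *v fld F x) \<bullet> fld F x)"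
  proof (rule integral_mono_AE)
    show "AE x in lebesgue. a * (norm (fld F x))\<^sup>2 \<le> (A x *v fld F x) \<bullet> fld F x" using A_AE by eventually_elim blast
  qed (auto intro!: sq_inner_integrable apply_A_sq sq_integrable[OF fld_sq])
  also have "\<dots> = apply_A F \<bullet> mkL2 (fld F)" unfolding apply_A_def by (rule inner_mkL2[symmetric]) (simp_all add: apply_A_sq)
  finally show ?thesis by simp
qed

lemma apply_A_bound: "norm (apply_A F) \<le> b * norm F"
proof (rule power2_le_imp_le)
  have "(norm (apply_A F))\<^sup>2 = (LINT x|lebesgue. (norm (A x *v fld F x))\<^sup>2)" unfolding apply_A_def by (rule norm_mkL2_square) (simp add: apply_A_sq)
  also have "\<dots> \<le> (LINT x|lebesgue. b\<^sup>2 * (norm (fld F x))\<^sup>2)"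
  proof (rule integral_mono_AE)
    show "AE x in lebesgue. (norm (A x *v fld F x))\<^sup>2 \<le> b\<^sup>2 * (norm (fld F x))\<^sup>2"
      using A_AE
    proof eventually_elim
      fix x assume "\<forall>\<xi>. a * (norm \<xi>)\<^sup>2 \<le> (A x *v \<xi>) \<bullet> \<xi> \<and> norm (A x *v \<xi>) \<le> b * norm \<xi>"
      then have "(norm (A x *v fld F x))\<^sup>2 \<le> (b * norm (fld F x))\<^sup>2" by (intro power_mono) auto
      then show "(norm (A x *v fld F x))\<^sup>2 \<le> b\<^sup>2 * (norm (fld F x))\<^sup>2" by (simp add: power_mult_distrib)
    qed
  qed (auto intro!: sq_integrable[OF apply_A_sq] sq_integrable[OF fld_sq])
  also have "\<dots> = (b * norm F)\<^sup>2" by (simp add: norm_L2_square power_mult_distrib)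
  finally show "(norm (apply_A F))\<^sup>2 \<le> (b * norm F)\<^sup>2" .
qed (use b in simp)

lemma \<phi>_measurable [measurable]: "\<phi> \<in> borel_measurable lebesgue"
  using \<phi> by (simp add: Linf_ge_def Lp_def)

lemma \<phi>_nonneg: "AE x in lebesgue. 0 \<le> \<phi> x"
proof -
  have "AE x in lebesgue. \<nu> \<le> \<phi> x" using \<phi> by (simp add: Linf_ge_def)
  then show ?thesis by eventually_elim (use \<nu> in linarith)
qed

text \<open>The constraint with \<open>\<Gamma> = 1\<close>; the set for a positive value \<open>s\<close> of
  \<open>\<Gamma>\<close> is its dilate by \<open>s\<close>, see
  \<open>scaled_constraint_iff\<close>.\<close>

definition unit_constraint :: "(real^'n, real^'n) L2 set" where
  "unit_constraint = {F \<in> grad ` Hs0 \<sigma> \<Omega>. AE x in lebesgue. norm (fld F x) \<le> \<phi> x}"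

lemma unit_constraint_zero: "0 \<in> unit_constraint"
proof -
  have "AE x in lebesgue. norm (fld (0 :: (real^'n, real^'n) L2) x) \<le> \<phi> x"
    using fld_zero[where 'a="real^'n" and 'b="real^'n"] \<phi>_nonneg by eventually_elim simp
  then show ?thesis unfolding unit_constraint_def using subspace_0[OF grad_subspace] by blast
qed

lemma unit_constraint_convex: "convex unit_constraint"
proof (rule convexI)
  fix F G :: "(real^'n, real^'n) L2" and s t :: real
  assume F: "F \<in> unit_constraint" and G: "G \<in> unit_constraint" and st: "0 \<le> s" "0 \<le> t" "s + t = 1"
  have "s *\<^sub>R F + t *\<^sub>R G \<in> grad ` Hs0 \<sigma> \<Omega>"
    using F G grad_subspace unfolding unit_constraint_def by (auto intro!: subspace_add subspace_scale)
  moreover have "AE x in lebesgue. norm (fld F x) \<le> \<phi> x" "AE x in lebesgue. norm (fld G x) \<le> \<phi> x"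
    using F G unfolding unit_constraint_def by auto
  then have "AE x in lebesgue. norm (fld (s *\<^sub>R F + t *\<^sub>R G) x) \<le> \<phi> x"
    using fld_plus[of "s *\<^sub>R F" "t *\<^sub>R G"] fld_scaleR[of s F] fld_scaleR[of t G]
  proof eventually_elim
    fix x assume n: "norm (fld F x) \<le> \<phi> x" "norm (fld G x) \<le> \<phi> x"
      and e: "fld (s *\<^sub>R F + t *\<^sub>R G) x = fld (s *\<^sub>R F) x + fld (t *\<^sub>R G) x" "fld (s *\<^sub>R F) x = s *\<^sub>R fld F x" "fld (t *\<^sub>R G) x = t *\<^sub>R fld G x"
    have "norm (s *\<^sub>R fld F x + t *\<^sub>R fld G x) \<le> s * norm (fld F x) + t * norm (fld G x)"
      using norm_triangle_ineq[of "s *\<^sub>R fld F x" "t *\<^sub>R fld G x"] st by simp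
    also have "\<dots> \<le> s * \<phi> x + t * \<phi> x" using n st by (intro add_mono mult_left_mono)
    also have "\<dots> = \<phi> x" using st(3) by (simp add: distrib_right[symmetric])
    finally show "norm (fld (s *\<^sub>R F + t *\<^sub>R G) x) \<le> \<phi> x" unfolding e .
  qed
  ultimately show "s *\<^sub>R F + t *\<^sub>R G \<in> unit_constraint" unfolding unit_constraint_def by blast
qed

text \<open>For \<open>F\<close> the limit of \<open>X\<close>, the excess of \<open>norm (fld F x)\<close>
  over \<open>\<phi> x\<close> is pointwise at most the distance to any admissible field, so its
  \<open>L\<^sup>2\<close> norm is at most \<open>norm (X n - F)\<close> for every \<open>n\<close>.\<close>

lemma unit_constraint_closed: "closed unit_constraint"
  unfolding closed_sequential_limits
proof (intro allI impI, elim conjE)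
  fix X F assume X: "\<forall>n. X n \<in> unit_constraint" and F: "X \<longlonglongrightarrow> F"
  have "F \<in> grad ` Hs0 \<sigma> \<Omega>"
    using X by (intro closed_sequentially[OF grad_closed _ F]) (simp add: unit_constraint_def)
  moreover have "AE x in lebesgue. norm (fld F x) \<le> \<phi> x"
  proof -
    define h where "h x = max 0 (norm (fld F x) - \<phi> x)" for x
    have hm: "h \<in> borel_measurable lebesgue" unfolding h_def by measurable
    have le: "(\<integral>\<^sup>+x. ennreal ((h x)\<^sup>2) \<partial>lebesgue) \<le> ennreal ((norm (X n - F))\<^sup>2)" for n
      unfolding nn_integral_L2[symmetric]
    proof (rule nn_integral_mono_AE)
      have "AE x in lebesgue. norm (fld (X n) x) \<le> \<phi> x" using X unfolding unit_constraint_def by blast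
      then show "AE x in lebesgue. ennreal ((h x)\<^sup>2) \<le> ennreal ((norm (fld (X n - F) x))\<^sup>2)"
        using fld_minus[of "X n" F]
      proof eventually_elim
        fix x assume e: "fld (X n - F) x = fld (X n) x - fld F x" and n: "norm (fld (X n) x) \<le> \<phi> x"
        have "norm (fld F x) - norm (fld (X n) x) \<le> norm (fld (X n) x - fld F x)"
          using norm_triangle_ineq2[of "fld F x" "fld (X n) x"] by (simp add: norm_minus_commute)
        then have "h x \<le> norm (fld (X n - F) x)" unfolding h_def e using n by simp
        then show "ennreal ((h x)\<^sup>2) \<le> ennreal ((norm (fld (X n - F) x))\<^sup>2)"
          by (intro ennreal_leI power_mono) (auto simp: h_def)
      qed
    qed
    have "(\<lambda>n. (norm (X n - F))\<^sup>2) \<longlonglongrightarrow> (norm (F - F))\<^sup>2" by (intro tendsto_intros F)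
    then have "(\<lambda>n. ennreal ((norm (X n - F))\<^sup>2)) \<longlonglongrightarrow> ennreal 0" by (intro tendsto_ennrealI) simp
    then have "(\<integral>\<^sup>+x. ennreal ((h x)\<^sup>2) \<partial>lebesgue) \<le> ennreal 0" by (rule LIMSEQ_le_const) (use le in blast)
    then have "AE x in lebesgue. h x = 0" by (intro square_integral_zero_AE[OF hm]) simp
    then show ?thesis by eventually_elim (simp add: h_def max_def split: if_splits)
  qed
  ultimately show "F \<in> unit_constraint" unfolding unit_constraint_def by blast
qed

lemma scaled_constraint_iff:
  assumes v: "v \<in> Hs0 \<sigma> \<Omega>" and s: "0 < s"
  shows "v \<in> constraint_set \<sigma> \<Omega> (\<lambda>x. \<phi> x * s) \<longleftrightarrow> grad v \<in> (*\<^sub>R) s ` unit_constraint"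
proof -
  have "grad v \<in> (*\<^sub>R) s ` unit_constraint \<longleftrightarrow> inverse s *\<^sub>R grad v \<in> unit_constraint"
  proof
    assume "inverse s *\<^sub>R grad v \<in> unit_constraint"
    then have "s *\<^sub>R (inverse s *\<^sub>R grad v) \<in> (*\<^sub>R) s ` unit_constraint" by (rule imageI)
    then show "grad v \<in> (*\<^sub>R) s ` unit_constraint" using s by simp
  qed (use s in auto)
  also have "\<dots> \<longleftrightarrow> (AE x in lebesgue. norm (fld (inverse s *\<^sub>R grad v) x) \<le> \<phi> x)"
    using subspace_scale[OF grad_subspace imageI[OF v]] unfolding unit_constraint_def by blast
  also have "\<dots> \<longleftrightarrow> (AE x in lebesgue. norm (frac_grad \<sigma> v x) \<le> \<phi> x * s)"
  proof (rule eventually_subst)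
    show "AE x in lebesgue. (norm (fld (inverse s *\<^sub>R grad v) x) \<le> \<phi> x) = (norm (frac_grad \<sigma> v x) \<le> \<phi> x * s)"
      using fld_scaleR[of "inverse s" "grad v"] grad_fld[OF v]
    proof eventually_elim
      fix x assume e: "fld (inverse s *\<^sub>R grad v) x = inverse s *\<^sub>R fld (grad v) x" "fld (grad v) x = frac_grad \<sigma> v x"
      have "norm (fld (inverse s *\<^sub>R grad v) x) = norm (frac_grad \<sigma> v x) / s" unfolding e using s by (simp add: divide_inverse mult.commute)
      then show "(norm (fld (inverse s *\<^sub>R grad v) x) \<le> \<phi> x) = (norm (frac_grad \<sigma> v x) \<le> \<phi> x * s)" using s by (simp add: pos_divide_le_eq)
    qed
  qed
  finally show ?thesis unfolding constraint_set_def using v by blast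
qed

lemma apply_A_grad:
  assumes u: "u \<in> Hs0 \<sigma> \<Omega>" and v: "v \<in> Hs0 \<sigma> \<Omega>"
  shows "(LINT x|lebesgue. (A x *v frac_grad \<sigma> u x) \<bullet> frac_grad \<sigma> v x) = apply_A (grad u) \<bullet> grad v"
proof -
  have "apply_A (grad u) = mkL2 (\<lambda>x. A x *v frac_grad \<sigma> u x)"
    unfolding apply_A_def by (rule mkL2_eqI) (use grad_fld[OF u] in eventually_elim, simp)
  then show ?thesis
    unfolding grad_def[of v] using inner_mkL2[OF apply_A_sq[OF frac_grad_sq[OF u]] frac_grad_sq[OF v]] by simp
qed

end

section \<open>The quasi-variational inequality\<close>

text \<open>On \<open>X\<close> modulo equality almost everywhere, both the load and \<open>\<Gamma>\<close>
  are functions of the gradient; for \<open>\<Gamma>\<close> this follows from its Lipschitz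
  continuity. The abstract theorem then applies with \<open>m = \<eta>(R\<^sub>f)\<close>, \<open>M
  = E(R\<^sub>f)\<close> and \<open>c = \<gamma>(R\<^sub>f)\<close>. If \<open>R\<^sub>f \<le>
  0\<close>, the hypotheses on \<open>\<eta>\<close>, \<open>E\<close> and \<open>\<gamma>\<close>
  say nothing at \<open>R\<^sub>f\<close>, but then the load vanishes, the only relevant point is 0,
  and \<open>m = M = \<Gamma>(0)\<close> and \<open>c = 0\<close> will do.\<close>

theorem theorem4p4:
  fixes \<sigma> q \<nu> a_low a_up C_star C_sharp R0 R_f :: real
    and \<Omega> :: "(real^'n) set"
    and A :: "real^'n \<Rightarrow> real^'n^'n"
    and f \<phi> :: "real^'n \<Rightarrow> real"
    and \<Gamma> :: "(real^'n \<Rightarrow> real) \<Rightarrow> real"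
    and \<eta> E \<gamma> :: "real \<Rightarrow> real"
  assumes \<sigma>: "0 < \<sigma>" "\<sigma> < 1"
    and \<Omega>: "open \<Omega>" "connected \<Omega>" "\<Omega> \<noteq> {}" "bounded \<Omega>" "lipschitz_boundary \<Omega>"
    and A: "0 < a_low" "0 < a_up" "elliptic_matrix a_low a_up A"
    and q: "1 < q"
    and C_star: "sobolev_const \<sigma> q \<Omega> C_star"
    and f: "f \<in> Lp (two_sharp CARD('n) \<sigma> q) (lebesgue_on \<Omega>)"
    and \<phi>: "0 < \<nu>" "\<phi> \<in> Linf_ge \<nu>"
    and C_sharp: "C_sharp = C_star / a_low"
    and R_f: "R_f = C_sharp * Lp_norm (two_sharp CARD('n) \<sigma> q) (lebesgue_on \<Omega>) f"
    and \<Gamma>_pos: "\<And>u. u \<in> Hs0 \<sigma> \<Omega> \<Longrightarrow> 0 < \<Gamma> u"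
    and bounds_pos: "\<And>R. 0 < R \<Longrightarrow> 0 < \<eta> R \<and> 0 < E R \<and> 0 < \<gamma> R"
    and bounds_mono: "mono_on {0<..} \<eta>" "mono_on {0<..} E" "mono_on {0<..} \<gamma>"
    and R0: "0 < R0" "0 < R_f \<Longrightarrow> R0 \<le> R_f"
    and \<Gamma>_bounds: "\<And>R u. R0 \<le> R \<Longrightarrow> u \<in> Hs0_ball \<sigma> \<Omega> R \<Longrightarrow> \<eta> R \<le> \<Gamma> u \<and> \<Gamma> u \<le> E R"
    and \<Gamma>_lipschitz: "\<And>R u\<^sub>1 u\<^sub>2. R0 \<le> R \<Longrightarrow> u\<^sub>1 \<in> Hs0_ball \<sigma> \<Omega> R \<Longrightarrow> u\<^sub>2 \<in> Hs0_ball \<sigma> \<Omega> R \<Longrightarrow>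
          \<bar>\<Gamma> u\<^sub>1 - \<Gamma> u\<^sub>2\<bar> \<le> \<gamma> R * Hs0_norm \<sigma> (\<lambda>x. u\<^sub>1 x - u\<^sub>2 x)"
    and small: "2 * C_sharp * (\<gamma> R_f / \<eta> R_f) *
          Lp_norm (two_sharp CARD('n) \<sigma> q) (lebesgue_on \<Omega>) f < 1"
  shows "\<exists>u. qvi_solution \<sigma> \<Omega> A f (\<lambda>w x. \<phi> x * \<Gamma> w) u \<and>
             (\<forall>u'. qvi_solution \<sigma> \<Omega> A f (\<lambda>w x. \<phi> x * \<Gamma> w) u' \<longrightarrow>
                   (AE x in lebesgue. u' x = u x))"
proof -
  interpret elliptic_problem \<sigma> \<Omega> A a_low a_up \<phi> \<nu>
    using \<sigma> \<Omega>(1,4) A \<phi> by unfold_locales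
  define F where "F = Lp_norm (two_sharp CARD('n) \<sigma> q) (lebesgue_on \<Omega>) f"
  have "two_sharp CARD('n) \<sigma> q \<noteq> \<infinity>" by (simp add: two_sharp_def)
  then have F0: "0 \<le> F" unfolding F_def Lp_norm_def by simp
  have load: "integrable (lebesgue_on \<Omega>) (\<lambda>x. f x * v x)" "\<bar>LINT x|lebesgue_on \<Omega>. f x * v x\<bar> \<le> C_star * F * norm (grad v)"
    if v: "v \<in> Hs0 \<sigma> \<Omega>" for v
  proof -
    have vs: "v \<in> Lp (two_star CARD('n) \<sigma> q) (lebesgue_on \<Omega>)"
      "Lp_norm (two_star CARD('n) \<sigma> q) (lebesgue_on \<Omega>) v \<le> C_star * norm (grad v)"
      using C_star v Hs0_norm_grad[OF v] unfolding sobolev_const_def by auto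
    note H = Holder_sobolev[OF \<sigma>(1) q f vs(1), folded F_def]
    show "integrable (lebesgue_on \<Omega>) (\<lambda>x. f x * v x)" using H by blast
    have "F * Lp_norm (two_star CARD('n) \<sigma> q) (lebesgue_on \<Omega>) v \<le> F * (C_star * norm (grad v))"
      by (rule mult_left_mono[OF vs(2) F0])
    then show "\<bar>LINT x|lebesgue_on \<Omega>. f x * v x\<bar> \<le> C_star * F * norm (grad v)" using H by (simp add: mult_ac)
  qed
  \<comment> \<open>The load and \<Gamma> are transported to gradients through a chosen preimage, which is
    unique up to null sets.\<close>
  define rep where "rep G = (SOME u. u \<in> Hs0 \<sigma> \<Omega> \<and> grad u = G)" for G
  define ell where "ell G = (LINT x|lebesgue_on \<Omega>. f x * rep G x)" for G
  define g where "g G = \<Gamma> (rep G)" for G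
  have rep: "rep (grad u) \<in> Hs0 \<sigma> \<Omega>" "grad (rep (grad u)) = grad u" if "u \<in> Hs0 \<sigma> \<Omega>" for u
    using someI[where P="\<lambda>w. w \<in> Hs0 \<sigma> \<Omega> \<and> grad w = grad u" and x=u] that by (auto simp: rep_def)
  have ell: "ell (grad u) = (LINT x|lebesgue_on \<Omega>. f x * u x)" if u: "u \<in> Hs0 \<sigma> \<Omega>" for u
    unfolding ell_def
  proof (rule integral_cong_AE)
    have "AE x in lebesgue. x \<in> \<Omega> \<longrightarrow> f x * rep (grad u) x = f x * u x"
      using grad_eq_iff[OF rep(1)[OF u] u rep(2)[OF u]] by eventually_elim simp
    then show "AE x in lebesgue_on \<Omega>. f x * rep (grad u) x = f x * u x"
      by (subst AE_restrict_space_iff) (auto simp: domain_measurable)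
  qed (use load(1)[OF u] load(1)[OF rep(1)[OF u]] in auto)
  have ball: "u \<in> Hs0_ball \<sigma> \<Omega> R \<longleftrightarrow> norm (grad u) \<le> R" if "u \<in> Hs0 \<sigma> \<Omega>" for u R
    using that Hs0_norm_grad[OF that] by (simp add: Hs0_ball_def)
  have \<Gamma>_diff: "\<bar>\<Gamma> u - \<Gamma> v\<bar> \<le> \<gamma> R * norm (grad u - grad v)"
    if "u \<in> Hs0 \<sigma> \<Omega>" "v \<in> Hs0 \<sigma> \<Omega>" "R0 \<le> R" "norm (grad u) \<le> R" "norm (grad v) \<le> R" for u v R
    using \<Gamma>_lipschitz[OF that(3), of u v] that ball Hs0_norm_grad[OF Hs0_diff[OF that(1,2) \<sigma>]] grad_diff[OF that(1,2)] by simp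
  have g: "g (grad u) = \<Gamma> u" if u: "u \<in> Hs0 \<sigma> \<Omega>" for u
    using \<Gamma>_diff[OF rep(1)[OF u] u, of "max R0 (norm (grad u))"] by (simp add: g_def rep(2)[OF u])
  \<comment> \<open>A negative C_star is possible if the space is trivial; the maximum keeps the bound
    nonnegative.\<close>
  define C where "C = max 0 (C_star * F)"
  interpret VI: scaled_constraint "grad ` Hs0 \<sigma> \<Omega>" unit_constraint ell apply_A a_low a_up C
  proof
    fix G H assume "G \<in> grad ` Hs0 \<sigma> \<Omega>" "H \<in> grad ` Hs0 \<sigma> \<Omega>"
    then obtain u v where uv: "u \<in> Hs0 \<sigma> \<Omega>" "v \<in> Hs0 \<sigma> \<Omega>" "G = grad u" "H = grad v" by blast
    show "ell (G + H) = ell G + ell H"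
      unfolding uv(3,4) grad_add[OF uv(1,2), symmetric] ell[OF uv(1)] ell[OF uv(2)] ell[OF Hs0_add[OF uv(1,2) \<sigma>]]
      using load(1)[OF uv(1)] load(1)[OF uv(2)] by (simp add: distrib_left)
  next
    fix c G assume "G \<in> grad ` Hs0 \<sigma> \<Omega>"
    then obtain u where u: "u \<in> Hs0 \<sigma> \<Omega>" "G = grad u" by blast
    show "ell (c *\<^sub>R G) = c * ell G"
      unfolding u(2) grad_cmult[OF u(1), symmetric] ell[OF u(1)] ell[OF Hs0_cmult[OF u(1) \<sigma>]]
      by (simp add: mult.left_commute)
  next
    fix G assume "G \<in> grad ` Hs0 \<sigma> \<Omega>"
    then obtain u where u: "u \<in> Hs0 \<sigma> \<Omega>" "G = grad u" by blast
    have "C_star * F * norm (grad u) \<le> C * norm (grad u)" unfolding C_def by (intro mult_right_mono) auto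
    then show "\<bar>ell G\<bar> \<le> C * norm G" unfolding u(2) ell[OF u(1)] using load(2)[OF u(1)] by linarith
  next
    show "unit_constraint \<subseteq> grad ` Hs0 \<sigma> \<Omega>" by (auto simp: unit_constraint_def)
  qed (auto simp: C_def a b linear_add[OF apply_A_linear] linear_scale[OF apply_A_linear] grad_subspace unit_constraint_closed unit_constraint_convex unit_constraint_zero
        apply_A_coercive apply_A_bound)
  have qvi: "qvi_solution \<sigma> \<Omega> A f (\<lambda>w x. \<phi> x * \<Gamma> w) u \<longleftrightarrow> VI.solves (g (grad u)) (grad u)" if u: "u \<in> Hs0 \<sigma> \<Omega>" for u
  proof -
    have var: "(LINT x|lebesgue. (A x *v frac_grad \<sigma> u x) \<bullet> frac_grad \<sigma> (\<lambda>y. v y - u y) x) \<ge> (LINT x|lebesgue_on \<Omega>. f x * (v x - u x))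
        \<longleftrightarrow> apply_A (grad u) \<bullet> (grad v - grad u) \<ge> ell (grad v - grad u)" if v: "v \<in> Hs0 \<sigma> \<Omega>" for v
      unfolding grad_diff[OF v u, symmetric] ell[OF Hs0_diff[OF v u \<sigma>]] apply_A_grad[OF u Hs0_diff[OF v u \<sigma>]] ..
    have sub: "v \<in> Hs0 \<sigma> \<Omega>" if "v \<in> constraint_set \<sigma> \<Omega> (\<lambda>x. \<phi> x * \<Gamma> u)" for v
      using that by (simp add: constraint_set_def)
    note iff = scaled_constraint_iff[OF _ \<Gamma>_pos[OF u]]
    have img: "(*\<^sub>R) (\<Gamma> u) ` unit_constraint = grad ` constraint_set \<sigma> \<Omega> (\<lambda>x. \<phi> x * \<Gamma> u)"
    proof (intro equalityI subsetI)
      fix G assume G: "G \<in> (*\<^sub>R) (\<Gamma> u) ` unit_constraint"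
      then have "G \<in> grad ` Hs0 \<sigma> \<Omega>" using VI.scaled_K_subset by blast
      then obtain v where v: "v \<in> Hs0 \<sigma> \<Omega>" "G = grad v" by blast
      then show "G \<in> grad ` constraint_set \<sigma> \<Omega> (\<lambda>x. \<phi> x * \<Gamma> u)" using G iff[OF v(1)] by blast
    qed (use sub iff in blast)
    have "(\<forall>G\<in>(*\<^sub>R) (\<Gamma> u) ` unit_constraint. apply_A (grad u) \<bullet> (G - grad u) \<ge> ell (G - grad u)) \<longleftrightarrow>
        (\<forall>v\<in>constraint_set \<sigma> \<Omega> (\<lambda>x. \<phi> x * \<Gamma> u).
          (LINT x|lebesgue. (A x *v frac_grad \<sigma> u x) \<bullet> frac_grad \<sigma> (\<lambda>y. v y - u y) x) \<ge> (LINT x|lebesgue_on \<Omega>. f x * (v x - u x)))"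
      unfolding img using var sub by simp
    then show ?thesis unfolding qvi_solution_def VI.solves_def g[OF u] iff[OF u] by blast
  qed
  have "\<exists>!G. VI.solves (g G) G"
  proof (cases "0 < R_f")
    case True
    have CR: "C / a_low = R_f"
    proof -
      have "R_f = C_star * F / a_low" by (simp add: R_f C_sharp F_def)
      moreover from this True have "0 < C_star * F" using a by (simp add: zero_less_divide_iff)
      ultimately show ?thesis by (simp add: C_def)
    qed
    show ?thesis
    proof (rule VI.unique_quasi_solution[where m="\<eta> R_f" and M="E R_f" and c="\<gamma> R_f"], unfold CR)
      show "0 < \<eta> R_f" "0 \<le> \<gamma> R_f" using bounds_pos[OF True] by auto
      show "2 * R_f / \<eta> R_f * \<gamma> R_f < 1" using small by (simp add: R_f F_def mult_ac)
      fix G assume "G \<in> grad ` Hs0 \<sigma> \<Omega>" "norm G \<le> R_f"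
      then show "\<eta> R_f \<le> g G \<and> g G \<le> E R_f" using \<Gamma>_bounds[OF R0(2)[OF True]] g ball by auto
    next
      fix G H assume "G \<in> grad ` Hs0 \<sigma> \<Omega>" "H \<in> grad ` Hs0 \<sigma> \<Omega>" "norm G \<le> R_f" "norm H \<le> R_f"
      then show "\<bar>g G - g H\<bar> \<le> \<gamma> R_f * norm (G - H)" using \<Gamma>_diff R0(2)[OF True] g by auto
    qed
  next
    case False
    have "C_star * F = R_f * a_low" using a by (simp add: R_f C_sharp F_def)
    also have "\<dots> \<le> 0" using False a by (simp add: mult_nonpos_nonneg)
    finally have C0: "C / a_low = 0" by (simp add: C_def)
    have "0 < g (grad (\<lambda>_. 0))" using g[OF Hs0_zero[OF \<sigma>]] \<Gamma>_pos[OF Hs0_zero[OF \<sigma>]] by simp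
    then show ?thesis unfolding grad_zero
      by (intro VI.unique_quasi_solution[where m="g 0" and M="g 0" and c=0]) (auto simp: C0)
  qed
  then obtain G where G: "VI.solves (g G) G" and uniq: "\<And>H. VI.solves (g H) H \<Longrightarrow> H = G" by blast
  have "G \<in> grad ` Hs0 \<sigma> \<Omega>" using G VI.scaled_K_subset unfolding VI.solves_def by blast
  then obtain u where u: "u \<in> Hs0 \<sigma> \<Omega>" "G = grad u" by blast
  show ?thesis
  proof (intro exI[of _ u] conjI allI impI)
    show "qvi_solution \<sigma> \<Omega> A f (\<lambda>w x. \<phi> x * \<Gamma> w) u" using qvi[OF u(1)] G u(2) by simp
    fix u' assume u': "qvi_solution \<sigma> \<Omega> A f (\<lambda>w x. \<phi> x * \<Gamma> w) u'"
    then have u'H: "u' \<in> Hs0 \<sigma> \<Omega>" by (simp add: qvi_solution_def constraint_set_def)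
    then have "grad u' = grad u" using uniq[of "grad u'"] qvi[OF u'H] u' u(2) by simp
    then show "AE x in lebesgue. u' x = u x" by (rule grad_eq_iff[OF u'H u(1)])
  qed
qed

end
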